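(* Let $\mathscr{W} : \mathcal{P}(\mathbb{R}^d) \to [0,+\infty]$ be an energy functional which is translation invariant, $\sigma$-finite, lower semicontinuous, satisfies growth control with some index $\ell \geq 1$, and is subhomogeneous and chaos compatible (all six properties being defined in the context). If $\ell > 1$, then for all $p \in [1,\ell)$, the sequence of probability measures $\widetilde{\mathbb{P}}_n$, $n \geq 2$, satisfies a large deviation principle (with speed $n$) on $\widetilde{\mathcal{P}}_p(\mathbb{R}^d)$ with good rate function \[ \widetilde{\mathscr{I}}[\widetilde{\mu}] := \mathscr{F}[\widetilde{\mu}] - \mathscr{F}_\star, \qquad \widetilde\mu \in \widetilde{\mathcal{P}}_p(\mathbb{R}^d). \]
   Context: Throughout, $d \geq 1$ is an integer and $\sigma^2>0$ is fixed. Spaces. $\mathcal{P}(\mathbb{R}^d)$ is the set of Borel probability measures on $\mathbb{R}^d$ with the topology of weak convergence. For $p \geq 1$, $\mathcal{P}_p(\mathbb{R}^d)$ is the set of those with finite $p$-th moment, with the Wasserstein topology of order $p$, and $\widetilde{\mathcal{P}}_p(\mathbb{R}^d) \subset \mathcal{P}_p(\mathbb{R}^d)$ is the subset of centered measures ($\int x\,\mathrm{d}\mu(x)=0$), with the induced topology. For $y \in \mathbb{R}^d$, $\tau_y\mu$ is the pushforward of $\mu$ by $x \mapsto x+y$. Energy. For $n \geq 2$ and $\mathbf{x}=(x_1,\ldots,x_n) \in (\mathbb{R}^d)^n$, $\pi_n(\mathbf{x}) := \frac1n\sum_{i=1}^n \delta_{x_i}$ and $W_n(\mathbf{x}) :=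 \mathscr{W}[\pi_n(\mathbf{x})]$. The properties of $\mathscr{W}$ are: - translation invariant: $\mathscr{W}[\tau_y\mu]=\mathscr{W}[\mu]$ for all $y \in \mathbb{R}^d$, $\mu \in \mathcal{P}(\mathbb{R}^d)$; - $\sigma$-finite: $\mathscr{W}[\mu]<+\infty$ if $\mu$ has compact support; - lower semicontinuous: $\mathscr{W}$ is lower semicontinuous on $\mathcal{P}(\mathbb{R}^d)$; - growth control with index $\ell \geq 1$: there is $\kappa_\ell>0$ such that $\mathscr{W}[\mu]=+\infty$ if $\mu \notin \mathcal{P}_\ell(\mathbb{R}^d)$, and $\mathscr{W}[\widetilde\mu] \geq \kappa_\ell \int |x|^\ell \,\mathrm{d}\widetilde\mu(x)$ for all $\widetilde\mu \in \widetilde{\mathcal{P}}_\ell(\mathbb{R}^d)$; - subhomogeneous: for all $\epsilon\in(0,1)$, all $n\ge 2$ and all $\mathbf{x}\in(\mathbb{R}^d)^n$, $(1-\epsilon)W_n(\mathbf{x}) \geq W_n((1-\epsilon)\mathbf{x})$; - chaos compatible: for all $\mu \in \mathcal{P}(\mathbb{R}^d)$, if $(Y_n)_{n\ge1}$ are i.i.d. with law $\mu$, then $\lim_{n\to\infty} \mathbf{E}[W_n(Y_1,\ldots,Y_n)] = \mathscr{W}[\mu]$. Gibbs measure. $M_{d,n} := \{\widetilde{\mathbf{x}} \in (\mathbb{R}^d)^n : \widetilde x_1+\cdots+\widetilde x_n=0\}$, with Lebesgue measure $\mathrm{d}\widetilde{\mathbf{x}}$. $\widetilde{P}_n$ is the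 probability measure on $(\mathbb{R}^d)^n$, concentrated on $M_{d,n}$, with density $\widetilde{Z}_n^{-1}\exp(-\frac{2n}{\sigma^2}W_n(\widetilde{\mathbf{x}}))$ with respect to $\mathrm{d}\widetilde{\mathbf{x}}$, where $\widetilde Z_n := \int_{M_{d,n}} \exp(-\frac{2n}{\sigma^2}W_n(\widetilde{\mathbf{x}}))\,\mathrm{d}\widetilde{\mathbf{x}} \in (0,+\infty)$. Then $\widetilde{\mathbb{P}}_n := \widetilde{P}_n \circ \pi_n^{-1}$, regarded as a probability measure on the Borel $\sigma$-field of $\widetilde{\mathcal{P}}_p(\mathbb{R}^d)$. Free energy. The entropy is $\mathscr{S}[\mu] := \int p\log p\,\mathrm{d}x \in (-\infty,+\infty]$ if $\mu \in \mathcal{P}_1(\mathbb{R}^d)$ has Lebesgue density $p$, and $\mathscr{S}[\mu]:=+\infty$ otherwise. $\mathscr{F}[\mu] := \mathscr{S}[\mu]+\frac{2}{\sigma^2}\mathscr{W}[\mu]$ and $\mathscr{F}_\star := \inf_{\mu\in\mathcal{P}(\mathbb{R}^d)}\mathscr{F}[\mu]$, which is finite. A good rate function on a metric space is a proper function with compact level sets. *)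

theory Defs
  imports "HOL-Probability.Probability"
begin

section \<open>Probability measures on a Euclidean space\<close>

definition prob_measures :: "'a::euclidean_space measure set" where
  "prob_measures = {\<mu>. sets \<mu> = sets borel \<and> prob_space \<mu>}"

definition prob_measures_moment :: "real \<Rightarrow> 'a::euclidean_space measure set" where
  "prob_measures_moment p =
     {\<mu> \<in> prob_measures. (\<integral>\<^sup>+ x. ennreal (norm x powr p) \<partial>\<mu>) < \<infinity>}"

definition centered_prob_measures :: "real \<Rightarrow> 'a::euclidean_space measure set" where
  "centered_prob_measures p = {\<mu> \<in> prob_measures_moment p. (\<integral>x. x \<partial>\<mu>) = 0}"

definition translate_measure :: "'a::euclidean_space \<Rightarrow> 'a measure \<Rightarrow> 'a measure" where
  "translate_measure y \<mu> = distr \<mu> borel (\<lambda>x. x + y)"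

definition measure_support :: "'a::euclidean_space measure \<Rightarrow> 'a set" where
  "measure_support \<mu> = {x. \<forall>U. open U \<longrightarrow> x \<in> U \<longrightarrow> emeasure \<mu> U > 0}"

text \<open>The topology of weak convergence: the coarsest topology making integration against every
  bounded continuous function continuous.\<close>

definition weak_topology :: "'a::euclidean_space measure topology" where
  "weak_topology = topology_generated_by
     {{\<mu> \<in> prob_measures. (\<integral>x. f x \<partial>\<mu>) \<in> U} | (f :: 'a \<Rightarrow> real) U.
        continuous_on UNIV f \<and> bounded (range f) \<and> open U}"

definition couplings ::
  "'a::euclidean_space measure \<Rightarrow> 'a measure \<Rightarrow> ('a \<times> 'a) measure set" where
  "couplings \<mu> \<nu> = {\<gamma>. sets \<gamma> = sets (borel \<Otimes>\<^sub>M borel) \<and> prob_space \<gamma> \<and>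
     distr \<gamma> borel fst = \<mu> \<and> distr \<gamma> borel snd = \<nu>}"

definition wasserstein_dist ::
  "real \<Rightarrow> 'a::euclidean_space measure \<Rightarrow> 'a measure \<Rightarrow> real" where
  "wasserstein_dist p \<mu> \<nu> =
     enn2real (INF \<gamma>\<in>couplings \<mu> \<nu>. \<integral>\<^sup>+ (x, y). ennreal (norm (x - y) powr p) \<partial>\<gamma>) powr (1 / p)"

text \<open>The library constant is applied to the distance without first proving the metric axioms;
  its open sets are the sets containing a ball around each of their points.\<close>

definition wasserstein_topology :: "real \<Rightarrow> 'a::euclidean_space measure topology" where
  "wasserstein_topology p = Metric_space.mtopology (prob_measures_moment p) (wasserstein_dist p)"

definition centered_wasserstein_topology :: "real \<Rightarrow> 'a::euclidean_space measure topology" where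
  "centered_wasserstein_topology p =
     subtopology (wasserstein_topology p) (centered_prob_measures p)"


section \<open>The energy functional\<close>

text \<open>A point of the \<open>n\<close>-th power of the space is a function on \<open>{1..n}\<close>. The empirical measure
  \<open>(1/n) \<Sum>\<^sub>i \<delta>\<^bsub>x i\<^esub>\<close> is the image of the uniform distribution on \<open>{1..n}\<close> under it.\<close>

definition empirical_measure :: "nat \<Rightarrow> (nat \<Rightarrow> 'a::euclidean_space) \<Rightarrow> 'a measure" where
  "empirical_measure n x = distr (uniform_count_measure {1..n}) borel x"

definition energy_n ::
  "('a::euclidean_space measure \<Rightarrow> ennreal) \<Rightarrow> nat \<Rightarrow> (nat \<Rightarrow> 'a) \<Rightarrow> ennreal" where
  "energy_n W n x = W (empirical_measure n x)"

definition translation_invariant :: "('a::euclidean_space measure \<Rightarrow> ennreal) \<Rightarrow> bool" where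
  "translation_invariant W \<longleftrightarrow> (\<forall>\<mu>\<in>prob_measures. \<forall>y. W (translate_measure y \<mu>) = W \<mu>)"

definition sigma_finite_energy :: "('a::euclidean_space measure \<Rightarrow> ennreal) \<Rightarrow> bool" where
  "sigma_finite_energy W \<longleftrightarrow> (\<forall>\<mu>\<in>prob_measures. compact (measure_support \<mu>) \<longrightarrow> W \<mu> < \<infinity>)"

definition lower_semicontinuous_energy :: "('a::euclidean_space measure \<Rightarrow> ennreal) \<Rightarrow> bool" where
  "lower_semicontinuous_energy W \<longleftrightarrow>
     (\<forall>a. closedin weak_topology {\<mu> \<in> prob_measures. W \<mu> \<le> a})"

definition growth_control :: "('a::euclidean_space measure \<Rightarrow> ennreal) \<Rightarrow> real \<Rightarrow> bool" where
  "growth_control W l \<longleftrightarrow> (\<exists>\<kappa>>0.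
     (\<forall>\<mu>\<in>prob_measures. \<mu> \<notin> prob_measures_moment l \<longrightarrow> W \<mu> = \<infinity>) \<and>
     (\<forall>\<mu>\<in>centered_prob_measures l.
        W \<mu> \<ge> ennreal \<kappa> * (\<integral>\<^sup>+ x. ennreal (norm x powr l) \<partial>\<mu>)))"

definition subhomogeneous :: "('a::euclidean_space measure \<Rightarrow> ennreal) \<Rightarrow> bool" where
  "subhomogeneous W \<longleftrightarrow> (\<forall>\<epsilon>\<in>{0<..<1::real}. \<forall>n\<ge>2. \<forall>x.
     ennreal (1 - \<epsilon>) * energy_n W n x \<ge> energy_n W n (\<lambda>i. (1 - \<epsilon>) *\<^sub>R x i))"

text \<open>The i.i.d. sequence lives on a probability space over the type of sequences. The expectations
  depend on the law of the sequence only, and every law is realised on that type (by the coordinate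
  process of the infinite product measure), so fixing the type is no restriction.\<close>

definition chaos_compatible :: "('a::euclidean_space measure \<Rightarrow> ennreal) \<Rightarrow> bool" where
  "chaos_compatible W \<longleftrightarrow> (\<forall>\<mu>\<in>prob_measures.
     \<forall>(M :: (nat \<Rightarrow> 'a) measure) Y.
       prob_space M \<and> prob_space.indep_vars M (\<lambda>_. borel) Y {1..} \<and>
       (\<forall>n\<ge>1. distr M borel (Y n) = \<mu>) \<longrightarrow>
       (\<lambda>n. \<integral>\<^sup>+ \<omega>. energy_n W n (\<lambda>i. Y i \<omega>) \<partial>M) \<longlonglongrightarrow> W \<mu>)"


section \<open>The Gibbs measure on centered configurations\<close>

definition centered_configs :: "nat \<Rightarrow> (nat \<Rightarrow> 'a::euclidean_space) set" where
  "centered_configs n = {x \<in> {1..n} \<rightarrow>\<^sub>E UNIV. (\<Sum>i=1..n. x i) = 0}"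

text \<open>Lebesgue measure on the linear subspace of centered configurations: the image of Lebesgue
  measure under \<open>(x\<^sub>1, \<dots>, x\<^bsub>n-1\<^esub>) \<mapsto> (x\<^sub>1, \<dots>, x\<^bsub>n-1\<^esub>, - x\<^sub>1 - \<dots> - x\<^bsub>n-1\<^esub>)\<close>, times the Jacobian
  factor \<open>n\<^bsup>d/2\<^esup>\<close> of this linear map (its Gram matrix consists, in each of the \<open>d\<close> coordinates, of
  a block identity plus all-ones matrix of size \<open>n - 1\<close>, with determinant \<open>n\<close>).\<close>

definition lebesgue_centered :: "nat \<Rightarrow> (nat \<Rightarrow> 'a::euclidean_space) measure" where
  "lebesgue_centered n = scale_measure (ennreal (sqrt (real n) ^ DIM('a)))
     (distr (Pi\<^sub>M {1..<n} (\<lambda>_. lborel)) (restrict_space (Pi\<^sub>M {1..n} (\<lambda>_. borel)) (centered_configs n))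
        (\<lambda>x. \<lambda>i\<in>{1..n}. if i = n then - (\<Sum>j=1..<n. x j) else x i))"

definition gibbs_weight ::
  "('a::euclidean_space measure \<Rightarrow> ennreal) \<Rightarrow> real \<Rightarrow> nat \<Rightarrow> (nat \<Rightarrow> 'a) \<Rightarrow> ennreal" where
  "gibbs_weight W \<sigma> n x = (if energy_n W n x = \<infinity> then 0
     else ennreal (exp (- (2 * real n / \<sigma>\<^sup>2) * enn2real (energy_n W n x))))"

definition partition_function ::
  "('a::euclidean_space measure \<Rightarrow> ennreal) \<Rightarrow> real \<Rightarrow> nat \<Rightarrow> ennreal" where
  "partition_function W \<sigma> n = (\<integral>\<^sup>+ x. gibbs_weight W \<sigma> n x \<partial>lebesgue_centered n)"

definition gibbs_measure ::
  "('a::euclidean_space measure \<Rightarrow> ennreal) \<Rightarrow> real \<Rightarrow> nat \<Rightarrow> (nat \<Rightarrow> 'a) measure" where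
  "gibbs_measure W \<sigma> n =
     density (lebesgue_centered n) (\<lambda>x. gibbs_weight W \<sigma> n x / partition_function W \<sigma> n)"

definition borel_of :: "'b topology \<Rightarrow> 'b measure" where
  "borel_of X = sigma (topspace X) {U. openin X U}"

definition gibbs_empirical_law ::
  "('a::euclidean_space measure \<Rightarrow> ennreal) \<Rightarrow> real \<Rightarrow> real \<Rightarrow> nat \<Rightarrow> 'a measure measure" where
  "gibbs_empirical_law W \<sigma> p n =
     distr (gibbs_measure W \<sigma> n) (borel_of (centered_wasserstein_topology p)) (empirical_measure n)"


section \<open>Free energy\<close>

text \<open>For a measure with density and finite first moment the integral of the negative part of
  \<open>p log p\<close> is finite, so the difference below is never \<open>\<infinity> - \<infinity>\<close>.\<close>

definition entropy_functional :: "'a::euclidean_space measure \<Rightarrow> ereal" where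
  "entropy_functional \<mu> =
     (if \<mu> \<in> prob_measures_moment 1 \<and> (\<exists>f\<in>borel_measurable lborel. \<mu> = density lborel f)
      then let f = (\<lambda>x. enn2real (RN_deriv lborel \<mu> x)) in
        enn2ereal (\<integral>\<^sup>+ x. ennreal (f x * ln (f x)) \<partial>lborel)
          - enn2ereal (\<integral>\<^sup>+ x. ennreal (- (f x * ln (f x))) \<partial>lborel)
      else \<infinity>)"

definition free_energy ::
  "('a::euclidean_space measure \<Rightarrow> ennreal) \<Rightarrow> real \<Rightarrow> 'a measure \<Rightarrow> ereal" where
  "free_energy W \<sigma> \<mu> = entropy_functional \<mu> + ereal (2 / \<sigma>\<^sup>2) * enn2ereal (W \<mu>)"

definition min_free_energy :: "('a::euclidean_space measure \<Rightarrow> ennreal) \<Rightarrow> real \<Rightarrow> ereal" where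
  "min_free_energy W \<sigma> = (INF \<mu>\<in>prob_measures. free_energy W \<sigma> \<mu>)"


section \<open>Large deviation principles\<close>

definition ereal_log :: "real \<Rightarrow> ereal" where
  "ereal_log t = (if t = 0 then - \<infinity> else ereal (ln t))"

definition good_rate_function :: "'b topology \<Rightarrow> ('b \<Rightarrow> ereal) \<Rightarrow> bool" where
  "good_rate_function X I \<longleftrightarrow>
     (\<forall>x\<in>topspace X. 0 \<le> I x) \<and> (\<exists>x\<in>topspace X. I x < \<infinity>) \<and>
     (\<forall>a::real. compactin X {x \<in> topspace X. I x \<le> ereal a})"

text \<open>The large deviation principle with speed \<open>n\<close> for a sequence \<open>P n\<close>, \<open>n \<ge> m\<close>, of probability
  measures on the Borel \<open>\<sigma>\<close>-field of \<open>X\<close>.\<close>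

definition large_deviation_principle ::
  "'b topology \<Rightarrow> nat \<Rightarrow> (nat \<Rightarrow> 'b measure) \<Rightarrow> ('b \<Rightarrow> ereal) \<Rightarrow> bool" where
  "large_deviation_principle X m P I \<longleftrightarrow>
     (\<forall>n\<ge>m. prob_space (P n) \<and> sets (P n) = sets (borel_of X)) \<and>
     (\<forall>B\<in>sets (borel_of X).
        - (INF x\<in>X interior_of B. I x)
          \<le> liminf (\<lambda>n. ereal (1 / real n) * ereal_log (measure (P n) B)) \<and>
        limsup (\<lambda>n. ereal (1 / real n) * ereal_log (measure (P n) B))
          \<le> - (INF x\<in>X closure_of B. I x))"

end

theory Submission
  imports Defs
begin

text \<open>Everything is reduced to estimates of the unnormalized Gibbs mass of sets of empirical measures;
  the normalization is the mass of the whole space, so its growth rate comes out as a by-product.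

  Upper bound: near a given measure the energy is bounded below by semicontinuity, and the entropy by
  its Donsker--Varadhan dual formula, which makes the reference mass decay exponentially. A small part
  of the energy is set aside to dominate, through growth control, the unbounded Lebesgue measure; the
  same estimate gives exponential tightness, since a ball for the moment of order \<open>l\<close> is compact in the
  Wasserstein topology of smaller order.

  Lower bound: Lebesgue measure is tilted to i.i.d. samples of a measure with finite free energy.
  Recentering the samples costs only a polynomial factor, because energy and Lebesgue measure are
  translation invariant. On the likely event that the empirical measure is close to its limit,
  \<open>exp (- Z) \<ge> exp (- c) * (1 + c - Z)\<close> turns the expectation of the energy, which chaos compatibility
  controls, into a bound of the mass.\<close>

section \<open>Couplings and the Wasserstein metric\<close>

text \<open>Chaos compatibility controls only the expectation of the energy. Since the energy is
  nonnegative, restricting this expectation to an event costs nothing; for the log-density, which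
  has no sign, integrability under the sampled law compensates. This is why the lower bound uses a
  linear minorant of the exponential and no law of large numbers for the energy.

  The infimum in \<open>min_free_energy\<close> ranges over all probability measures, while the laws
  live on centered ones. The lower bound is therefore proved for an arbitrary measure of finite free
  energy and applied to neighbourhoods of its centered translate.

  Topological facts are reduced to sequences: bounded first moments give a subsequence realized by
  pointwise convergent random variables, after which weak convergence, Wasserstein convergence and
  compactness become matters of dominated convergence, Fatou's lemma and truncation. Closedness of
  the sublevel sets of the free energy comes from confronting the two local mass bounds.\<close>

lemma prob_measuresD:
  assumes "\<mu> \<in> prob_measures"
  shows "prob_space \<mu>" "sets \<mu> = sets borel" "space \<mu> = UNIV"
  using assms sets_eq_imp_space_eq[of \<mu> borel] by (auto simp: prob_measures_def)

lemma prob_measures_momentD: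
  assumes "\<mu> \<in> prob_measures_moment p"
  shows "\<mu> \<in> prob_measures" "prob_space \<mu>" "sets \<mu> = sets borel" "space \<mu> = UNIV"
    "(\<integral>\<^sup>+ x. ennreal (norm x powr p) \<partial>\<mu>) < \<infinity>"
proof -
  show *: "\<mu> \<in> prob_measures" and "(\<integral>\<^sup>+ x. ennreal (norm x powr p) \<partial>\<mu>) < \<infinity>"
    using assms unfolding prob_measures_moment_def by auto
  show "prob_space \<mu>" "sets \<mu> = sets borel" "space \<mu> = UNIV"
    using prob_measuresD[OF *] by auto
qed

lemma distr_in_prob_measures:
  fixes X :: "'b \<Rightarrow> 'a::euclidean_space"
  assumes "prob_space \<Omega>" "X \<in> borel_measurable \<Omega>"
  shows "distr \<Omega> borel X \<in> prob_measures"
  using prob_space.prob_space_distr[OF assms] unfolding prob_measures_def by simp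

lemma couplingsD:
  assumes "\<gamma> \<in> couplings \<mu> \<nu>"
  shows "prob_space \<gamma>" "sets \<gamma> = sets (borel \<Otimes>\<^sub>M borel)" "space \<gamma> = UNIV"
    "distr \<gamma> borel fst = \<mu>" "distr \<gamma> borel snd = \<nu>"
    "fst \<in> borel_measurable \<gamma>" "snd \<in> borel_measurable \<gamma>"
proof -
  show *: "sets \<gamma> = sets (borel \<Otimes>\<^sub>M borel)"
    using assms by (auto simp: couplings_def)
  show "prob_space \<gamma>" "distr \<gamma> borel fst = \<mu>" "distr \<gamma> borel snd = \<nu>"
    using assms by (auto simp: couplings_def)
  show "space \<gamma> = UNIV"
    using sets_eq_imp_space_eq[OF *] by (simp add: space_pair_measure)
  show "fst \<in> borel_measurable \<gamma>" "snd \<in> borel_measurable \<gamma>"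
    unfolding measurable_cong_sets[OF * refl] by (rule measurable_fst, rule measurable_snd)
qed

text \<open>Every coupling exhibited later, apart from the product, is the joint law of two random
  variables on one space. This turns its transport cost into an expectation.\<close>

lemma coupling_of_random_variables:
  fixes X Y :: "'b \<Rightarrow> 'a::euclidean_space"
  assumes "prob_space \<Omega>" and [measurable]: "X \<in> borel_measurable \<Omega>" "Y \<in> borel_measurable \<Omega>"
  defines "\<gamma> \<equiv> distr \<Omega> (borel \<Otimes>\<^sub>M borel) (\<lambda>\<omega>. (X \<omega>, Y \<omega>))"
  shows "\<gamma> \<in> couplings (distr \<Omega> borel X) (distr \<Omega> borel Y)"
    and "(\<integral>\<^sup>+ (x, y). ennreal (norm (x - y) powr p) \<partial>\<gamma>)
      = (\<integral>\<^sup>+ \<omega>. ennreal (norm (X \<omega> - Y \<omega>) powr p) \<partial>\<Omega>)"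
proof -
  interpret prob_space \<Omega> by fact
  show "\<gamma> \<in> couplings (distr \<Omega> borel X) (distr \<Omega> borel Y)"
    unfolding couplings_def \<gamma>_def
    by (auto intro!: prob_space_distr simp: distr_distr comp_def)
  show "(\<integral>\<^sup>+ (x, y). ennreal (norm (x - y) powr p) \<partial>\<gamma>)
      = (\<integral>\<^sup>+ \<omega>. ennreal (norm (X \<omega> - Y \<omega>) powr p) \<partial>\<Omega>)"
    unfolding \<gamma>_def by (subst nn_integral_distr) (auto simp: case_prod_beta)
qed

section \<open>Finiteness of the transport cost\<close>

lemma powr_add_le_mult:
  fixes a b p :: real
  assumes "0 \<le> a" "0 \<le> b" "0 \<le> p"
  shows "(a + b) powr p \<le> 2 powr p * (a powr p + b powr p)"
proof -
  have "(a + b) powr p \<le> (2 * max a b) powr p"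
    using assms by (intro powr_mono2) auto
  also have "\<dots> = 2 powr p * max a b powr p"
    using assms by (simp add: powr_mult)
  also have "\<dots> \<le> 2 powr p * (a powr p + b powr p)"
    by (intro mult_left_mono) (auto simp: max_def)
  finally show ?thesis .
qed

lemma norm_add_powr_le:
  fixes x y :: "'a::real_normed_vector"
  assumes "0 \<le> p"
  shows "norm (x + y) powr p \<le> 2 powr p * (norm x powr p + norm y powr p)"
  using powr_mono2[OF assms norm_ge_zero norm_triangle_ineq[of x y]]
    powr_add_le_mult[OF norm_ge_zero norm_ge_zero assms, of x y] by linarith

lemma norm_diff_powr_le:
  fixes x y :: "'a::real_normed_vector"
  assumes "0 \<le> p"
  shows "norm (x - y) powr p \<le> 2 powr p * (norm x powr p + norm y powr p)"
  using norm_add_powr_le[OF assms, of x "- y"] by simp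

lemma transport_cost_finite:
  fixes \<mu> \<nu> :: "'a::euclidean_space measure"
  assumes "0 \<le> p" "\<mu> \<in> prob_measures_moment p" "\<nu> \<in> prob_measures_moment p" "\<gamma> \<in> couplings \<mu> \<nu>"
  shows "(\<integral>\<^sup>+ (x, y). ennreal (norm (x - y) powr p) \<partial>\<gamma>) < \<infinity>"
proof -
  note \<gamma> = couplingsD[OF assms(4)]
  note [measurable] = \<gamma>(6,7)
  have 1: "(\<integral>\<^sup>+ x. ennreal (norm x powr p) \<partial>\<mu>) = (\<integral>\<^sup>+ w. ennreal (norm (fst w) powr p) \<partial>\<gamma>)"
    by (subst \<gamma>(4)[symmetric], subst nn_integral_distr) auto
  have 2: "(\<integral>\<^sup>+ x. ennreal (norm x powr p) \<partial>\<nu>) = (\<integral>\<^sup>+ w. ennreal (norm (snd w) powr p) \<partial>\<gamma>)"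
    by (subst \<gamma>(5)[symmetric], subst nn_integral_distr) auto
  have "(\<integral>\<^sup>+ (x, y). ennreal (norm (x - y) powr p) \<partial>\<gamma>)
      \<le> (\<integral>\<^sup>+ w. ennreal (2 powr p) * (ennreal (norm (fst w) powr p) + ennreal (norm (snd w) powr p)) \<partial>\<gamma>)"
    using norm_diff_powr_le[OF assms(1)]
    by (intro nn_integral_mono) (auto simp flip: ennreal_plus ennreal_mult intro!: ennreal_leI)
  also have "\<dots> = ennreal (2 powr p) * ((\<integral>\<^sup>+ x. ennreal (norm x powr p) \<partial>\<mu>) + (\<integral>\<^sup>+ x. ennreal (norm x powr p) \<partial>\<nu>))"
    by (simp add: nn_integral_cmult nn_integral_add 1 2)
  also have "\<dots> < \<infinity>"
    using prob_measures_momentD(5)[OF assms(2)] prob_measures_momentD(5)[OF assms(3)]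
    by (simp add: ennreal_mult_less_top)
  finally show ?thesis .
qed

text \<open>Provides at least one coupling, so the infimum in \<open>wasserstein_dist\<close> is
  finite for measures with finite moments. An infimum over no coupling would be infinite and
  \<open>enn2real\<close> would turn it into distance 0.\<close>

lemma product_coupling:
  fixes \<mu> \<nu> :: "'a::euclidean_space measure"
  assumes "\<mu> \<in> prob_measures" "\<nu> \<in> prob_measures"
  shows "\<mu> \<Otimes>\<^sub>M \<nu> \<in> couplings \<mu> \<nu>"
proof -
  note m = prob_measuresD[OF assms(1)] and n = prob_measuresD[OF assms(2)]
  interpret m: prob_space \<mu> by fact
  interpret n: prob_space \<nu> by fact
  interpret pair_prob_space \<mu> \<nu> ..
  have s: "sets (\<mu> \<Otimes>\<^sub>M \<nu>) = sets (borel \<Otimes>\<^sub>M borel)"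
    by (rule sets_pair_measure_cong) fact+
  have f: "distr (\<mu> \<Otimes>\<^sub>M \<nu>) borel fst = distr (\<mu> \<Otimes>\<^sub>M \<nu>) \<mu> fst"
    by (rule distr_cong) (auto simp: m)
  have g: "distr (\<mu> \<Otimes>\<^sub>M \<nu>) borel snd = distr (\<mu> \<Otimes>\<^sub>M \<nu>) \<nu> snd"
    by (rule distr_cong) (auto simp: n)
  have "distr (\<mu> \<Otimes>\<^sub>M \<nu>) \<nu> snd = \<nu>"
  proof (rule measure_eqI)
    fix A assume "A \<in> sets (distr (\<mu> \<Otimes>\<^sub>M \<nu>) \<nu> snd)"
    then have A: "A \<in> sets \<nu>" by simp
    have "snd -` A \<inter> space (\<mu> \<Otimes>\<^sub>M \<nu>) = space \<mu> \<times> A"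
      using sets.sets_into_space[OF A] by (auto simp: space_pair_measure)
    then show "emeasure (distr (\<mu> \<Otimes>\<^sub>M \<nu>) \<nu> snd) A = emeasure \<nu> A"
      using A by (simp add: emeasure_distr n.emeasure_pair_measure_Times m.emeasure_space_1)
  qed simp
  moreover have "prob_space (\<mu> \<Otimes>\<^sub>M \<nu>)" by (rule prob_space_axioms)
  ultimately show ?thesis
    unfolding couplings_def using n.distr_pair_fst[of \<mu>] f g s m.emeasure_space_1 by auto
qed

lemma wasserstein_dist_le:
  assumes "0 < p" "\<gamma> \<in> couplings \<mu> \<nu>" "0 \<le> a"
    "(\<integral>\<^sup>+ (x, y). ennreal (norm (x - y) powr p) \<partial>\<gamma>) \<le> ennreal (a powr p)"
  shows "wasserstein_dist p \<mu> \<nu> \<le> a"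
proof -
  let ?I = "INF \<gamma>\<in>couplings \<mu> \<nu>. \<integral>\<^sup>+ (x, y). ennreal (norm (x - y) powr p) \<partial>\<gamma>"
  have "?I \<le> ennreal (a powr p)"
    using assms by (intro INF_lower2[OF assms(2)]) auto
  then have "enn2real ?I \<le> a powr p"
    by (metis enn2real_leI powr_ge_zero)
  then have "enn2real ?I powr (1/p) \<le> (a powr p) powr (1/p)"
    using assms by (intro powr_mono2) auto
  then show ?thesis
    unfolding wasserstein_dist_def using assms by (simp add: powr_powr)
qed

lemma wasserstein_dist_lessE:
  fixes \<mu> \<nu> :: "'a::euclidean_space measure"
  assumes "0 < p" "\<mu> \<in> prob_measures_moment p" "\<nu> \<in> prob_measures_moment p"
    "wasserstein_dist p \<mu> \<nu> < a"
  obtains \<gamma> where "\<gamma> \<in> couplings \<mu> \<nu>"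
    "(\<integral>\<^sup>+ (x, y). ennreal (norm (x - y) powr p) \<partial>\<gamma>) < ennreal (a powr p)"
proof -
  let ?I = "INF \<gamma>\<in>couplings \<mu> \<nu>. \<integral>\<^sup>+ (x, y). ennreal (norm (x - y) powr p) \<partial>\<gamma>"
  have pc: "\<mu> \<Otimes>\<^sub>M \<nu> \<in> couplings \<mu> \<nu>"
    using assms prob_measures_momentD(1) by (intro product_coupling)
  \<comment> \<open>Needed before passing back from \<open>enn2real\<close>, which sends an infinite
    cost to 0.\<close>
  have "?I < \<infinity>"
    using transport_cost_finite[OF _ assms(2,3) pc] assms(1) by (intro INF_less_iff[THEN iffD2] bexI[OF _ pc]) auto
  have a: "enn2real ?I powr (1/p) < a"
    using assms(4) unfolding wasserstein_dist_def .
  then have "(enn2real ?I powr (1/p)) powr p < a powr p"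
    using assms(1) by (intro powr_less_mono2) auto
  then have "enn2real ?I < a powr p"
    using assms(1) by (simp add: powr_powr)
  then have "ennreal (enn2real ?I) < ennreal (a powr p)"
    using le_less_trans[OF enn2real_nonneg] by (intro ennreal_lessI) blast+
  then have "?I < ennreal (a powr p)"
    using \<open>?I < \<infinity>\<close> by (simp add: less_top)
  then show thesis
    using that by (auto simp: INF_less_iff)
qed

text \<open>The class of a point is the index of the first member of a countable dense sequence
  within \<open>e\<close> of it; points of one class share that member.\<close>

lemma small_countable_partition:
  assumes "0 < e"
  obtains c :: "'a::euclidean_space \<Rightarrow> nat" where "c \<in> borel \<rightarrow>\<^sub>M count_space UNIV"
    "\<And>x y. c x = c y \<Longrightarrow> dist x y < 2 * e"
proof -
  obtain D :: "'a set" where D: "countable D" "\<And>X. open X \<Longrightarrow> X \<noteq> {} \<Longrightarrow> \<exists>d\<in>D. d \<in> X"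
    using countable_dense_setE by blast
  define q where "q = from_nat_into D"
  define c where "c x = (LEAST i. dist (q i) x < e)" for x
  have "D \<noteq> {}" using D(2)[of UNIV] by auto
  have ex: "\<exists>i. dist (q i) x < e" for x
  proof -
    obtain d where "d \<in> D" "d \<in> ball x e" using D(2)[of "ball x e"] assms by auto
    then show ?thesis
      using from_nat_into_surj[OF D(1) \<open>d \<in> D\<close>] unfolding q_def by (metis dist_commute mem_ball)
  qed
  have *: "dist (q (c x)) x < e" for x
    unfolding c_def by (rule LeastI_ex[OF ex])
  have "c \<in> borel \<rightarrow>\<^sub>M count_space UNIV"
    unfolding c_def by measurable
  moreover have "dist x y < 2 * e" if "c x = c y" for x y
    using *[of x] *[of y] that dist_triangle2[of x y "q (c x)"] by (simp add: dist_commute)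
  ultimately show thesis by (rule that)
qed

text \<open>Two couplings sharing a marginal are glued without disintegrating them: inside each cell of a
  fine countable partition, the two copies of the middle variable are made independent.\<close>

lemma approximate_gluing:
  fixes \<mu> \<nu> \<rho> :: "'a::euclidean_space measure"
  assumes \<gamma>: "\<gamma> \<in> couplings \<mu> \<nu>" and \<delta>: "\<delta> \<in> couplings \<nu> \<rho>" and e: "0 < e"
  obtains \<Omega> :: "(('a \<times> 'a) \<times> ('a \<times> 'a)) measure" where "prob_space \<Omega>"
    "sets \<Omega> = sets (\<gamma> \<Otimes>\<^sub>M \<delta>)" "distr \<Omega> \<gamma> fst = \<gamma>" "distr \<Omega> \<delta> snd = \<delta>"
    "AE w in \<Omega>. dist (snd (fst w)) (fst (snd w)) < 2 * e"
proof -
  note g = couplingsD[OF \<gamma>] and d = couplingsD[OF \<delta>]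
  interpret g: prob_space \<gamma> by fact
  interpret d: prob_space \<delta> by fact
  interpret pair_prob_space \<gamma> \<delta> ..
  note [measurable] = g(6,7) d(6,7)
  obtain c :: "'a \<Rightarrow> nat" where c[measurable]: "c \<in> borel \<rightarrow>\<^sub>M count_space UNIV"
    and c_dist: "\<And>x y. c x = c y \<Longrightarrow> dist x y < 2 * e"
    using small_countable_partition[OF e] by blast
  define N where "N i = emeasure \<nu> {y. c y = i}" for i
  have Gs[measurable]: "{u. c (snd u) = i} \<in> sets \<gamma>" for i
    using measurable_sets[OF measurable_compose[OF g(7) c], of "{i}"] by (simp add: g(3) vimage_def)
  have Ds[measurable]: "{u. c (fst u) = i} \<in> sets \<delta>" for i
    using measurable_sets[OF measurable_compose[OF d(6) c], of "{i}"] by (simp add: d(3) vimage_def)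
  have Ng: "N i = emeasure \<gamma> {u. c (snd u) = i}" for i
    unfolding N_def by (subst g(5)[symmetric], subst emeasure_distr) (auto simp: g(3) vimage_def)
  have Nd: "N i = emeasure \<delta> {u. c (fst u) = i}" for i
    unfolding N_def by (subst d(4)[symmetric], subst emeasure_distr) (auto simp: d(3) vimage_def)
  have Nfin: "N i \<noteq> \<infinity>" for i unfolding Ng by simp
  have one: "inverse (N i) * N i = 1" if "N i \<noteq> 0" for i
    using ennreal_divide_self[of "N i"] that Nfin[of i] by (simp add: divide_ennreal_def mult.commute less_top)
  \<comment> \<open>Density relative to the product of the two couplings: given the cell of the
    middle coordinate, the two couplings are independent, and dividing by the mass of the cell
    restores both marginals.\<close>
  define h where "h w = (if c (snd (fst w)) = c (fst (snd w)) then inverse (N (c (snd (fst w)))) else 0)"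
    for w :: "('a \<times> 'a) \<times> ('a \<times> 'a)"
  have h[measurable]: "h \<in> borel_measurable (\<gamma> \<Otimes>\<^sub>M \<delta>)"
  proof -
    have [measurable]: "(\<lambda>w. c (snd (fst w))) \<in> \<gamma> \<Otimes>\<^sub>M \<delta> \<rightarrow>\<^sub>M count_space UNIV"
      by (rule measurable_compose[OF measurable_compose[OF measurable_fst g(7)] c])
    have [measurable]: "(\<lambda>w. c (fst (snd w))) \<in> \<gamma> \<Otimes>\<^sub>M \<delta> \<rightarrow>\<^sub>M count_space UNIV"
      by (rule measurable_compose[OF measurable_compose[OF measurable_snd d(6)] c])
    show ?thesis unfolding h_def
      by (rule measurable_compose_countable'[where f="\<lambda>i w. (\<lambda>i j. if i = j then inverse (N i) else 0) i (c (fst (snd w)))" and I=UNIV])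
        (auto intro!: measurable_compose[of "\<lambda>w. c (fst (snd w))" _ "count_space UNIV"])
  qed
  \<comment> \<open>On a cell of mass 0 the product \<open>inverse (N i) * N i\<close> is 0 instead
    of 1; such cells are negligible for both couplings.\<close>
  have AEg: "AE u in \<gamma>. N (c (snd u)) \<noteq> 0"
  proof -
    have "AE u in \<gamma>. N i = 0 \<longrightarrow> c (snd u) \<noteq> i" for i
    proof (cases "N i = 0")
      case True
      have "{u \<in> space \<gamma>. c (snd u) = i} \<in> null_sets \<gamma>"
        using True Ng[of i] by (intro null_setsI) (auto simp: g(3) Gs)
      then show ?thesis by (rule AE_I') auto
    qed simp
    then have "AE u in \<gamma>. \<forall>i. N i = 0 \<longrightarrow> c (snd u) \<noteq> i" by (simp add: AE_all_countable)
    then show ?thesis by eventually_elim auto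
  qed
  have AEd: "AE u in \<delta>. N (c (fst u)) \<noteq> 0"
  proof -
    have "AE u in \<delta>. N i = 0 \<longrightarrow> c (fst u) \<noteq> i" for i
    proof (cases "N i = 0")
      case True
      have "{u \<in> space \<delta>. c (fst u) = i} \<in> null_sets \<delta>"
        using True Nd[of i] by (intro null_setsI) (auto simp: d(3) Ds)
      then show ?thesis by (rule AE_I') auto
    qed simp
    then have "AE u in \<delta>. \<forall>i. N i = 0 \<longrightarrow> c (fst u) \<noteq> i" by (simp add: AE_all_countable)
    then show ?thesis by eventually_elim auto
  qed
  have intd: "(\<integral>\<^sup>+ v. h (u, v) \<partial>\<delta>) = inverse (N (c (snd u))) * N (c (snd u))" for u
  proof -
    have "(\<integral>\<^sup>+ v. h (u, v) \<partial>\<delta>) = (\<integral>\<^sup>+ v. inverse (N (c (snd u))) * indicator {v. c (fst v) = c (snd u)} v \<partial>\<delta>)"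
      by (intro nn_integral_cong) (auto simp: h_def split: split_indicator)
    also have "\<dots> = inverse (N (c (snd u))) * N (c (snd u))"
      unfolding Nd by (subst nn_integral_cmult_indicator) (auto simp: Ds)
    finally show ?thesis .
  qed
  have intg: "(\<integral>\<^sup>+ u. h (u, v) \<partial>\<gamma>) = inverse (N (c (fst v))) * N (c (fst v))" for v
  proof -
    have "(\<integral>\<^sup>+ u. h (u, v) \<partial>\<gamma>) = (\<integral>\<^sup>+ u. inverse (N (c (fst v))) * indicator {u. c (snd u) = c (fst v)} u \<partial>\<gamma>)"
      by (intro nn_integral_cong) (auto simp: h_def split: split_indicator)
    also have "\<dots> = inverse (N (c (fst v))) * N (c (fst v))"
      unfolding Ng by (subst nn_integral_cmult_indicator) (auto simp: Gs)
    finally show ?thesis .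
  qed
  define \<Omega> where "\<Omega> = density (\<gamma> \<Otimes>\<^sub>M \<delta>) h"
  have d1: "distr \<Omega> \<gamma> fst = \<gamma>"
  proof (rule measure_eqI)
    fix A assume "A \<in> sets (distr \<Omega> \<gamma> fst)"
    then have A[measurable]: "A \<in> sets \<gamma>" by simp
    have "emeasure (distr \<Omega> \<gamma> fst) A = (\<integral>\<^sup>+ w. h w * indicator A (fst w) \<partial>(\<gamma> \<Otimes>\<^sub>M \<delta>))"
      unfolding \<Omega>_def by (subst emeasure_distr, simp, simp, subst emeasure_density)
        (auto intro!: nn_integral_cong split: split_indicator)
    also have "\<dots> = (\<integral>\<^sup>+ u. (\<integral>\<^sup>+ v. h (u, v) \<partial>\<delta>) * indicator A u \<partial>\<gamma>)"
      by (subst d.nn_integral_fst[symmetric]) (auto simp: nn_integral_multc intro!: nn_integral_cong)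
    also have "\<dots> = (\<integral>\<^sup>+ u. indicator A u \<partial>\<gamma>)"
      using AEg by (intro nn_integral_cong_AE) (auto simp: intd one elim!: eventually_mono)
    finally show "emeasure (distr \<Omega> \<gamma> fst) A = emeasure \<gamma> A" by simp
  qed simp
  have d2: "distr \<Omega> \<delta> snd = \<delta>"
  proof (rule measure_eqI)
    fix A assume "A \<in> sets (distr \<Omega> \<delta> snd)"
    then have A[measurable]: "A \<in> sets \<delta>" by simp
    have "emeasure (distr \<Omega> \<delta> snd) A = (\<integral>\<^sup>+ w. h w * indicator A (snd w) \<partial>(\<gamma> \<Otimes>\<^sub>M \<delta>))"
      unfolding \<Omega>_def by (subst emeasure_distr, simp, simp, subst emeasure_density)
        (auto intro!: nn_integral_cong split: split_indicator)
    also have "\<dots> = (\<integral>\<^sup>+ v. (\<integral>\<^sup>+ u. h (u, v) \<partial>\<gamma>) * indicator A v \<partial>\<delta>)"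
      by (subst nn_integral_snd[symmetric]) (auto simp: nn_integral_multc intro!: nn_integral_cong)
    also have "\<dots> = (\<integral>\<^sup>+ u. indicator A u \<partial>\<delta>)"
      using AEd by (intro nn_integral_cong_AE) (auto simp: intg one elim!: eventually_mono)
    finally show "emeasure (distr \<Omega> \<delta> snd) A = emeasure \<delta> A" by simp
  qed simp
  have "prob_space (distr \<Omega> \<gamma> fst)" using g(1) d1 by simp
  then have ps: "prob_space \<Omega>"
    by (rule prob_space_distrD[rotated]) (simp add: \<Omega>_def)
  have "AE w in \<Omega>. dist (snd (fst w)) (fst (snd w)) < 2 * e"
    unfolding \<Omega>_def by (subst AE_density[OF h]) (auto simp: h_def intro!: c_dist AE_I2)
  with ps d1 d2 show thesis
    by (intro that[of \<Omega>]) (auto simp: \<Omega>_def)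
qed

section \<open>Minkowski's inequality and the triangle inequality\<close>

lemma convex_on_powr_nonneg:
  assumes "1 \<le> p"
  shows "convex_on {0..} (\<lambda>x::real. x powr p)"
proof (rule convex_onI)
  fix t x y :: real assume t: "0 < t" "t < 1" and xy: "x \<in> {0..}" "y \<in> {0..}"
  \<comment> \<open>The endpoint 0, which convexity on the open half-line does not reach: there the
    claim reduces to this inequality for one scaled point.\<close>
  have *: "(r * z) powr p \<le> r * z powr p" if "0 < r" "r < 1" "0 \<le> z" for r z :: real
  proof -
    have "r powr p \<le> r powr 1" using that assms by (intro powr_mono') auto
    then show ?thesis using that by (simp add: powr_mult mult_right_mono)
  qed
  show "((1 - t) *\<^sub>R x + t *\<^sub>R y) powr p \<le> (1 - t) * x powr p + t * y powr p"
  proof (cases "x = 0 \<or> y = 0")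
    case True
    then show ?thesis using *[of t y] *[of "1 - t" x] t xy assms by auto
  next
    case False
    then show ?thesis using convex_onD[OF powr_convex[OF assms], of t x y] t xy by auto
  qed
qed (rule convex_real_interval)

text \<open>Jensen's inequality with weights \<open>a / s\<close>, \<open>b / s\<close>,
  \<open>e / s\<close> at the points \<open>u / a\<close>, \<open>v / b\<close>,
  \<open>w / e\<close>. When the p-th moments of u, v, w are at most the p-th powers of a, b, e,
  integrating the right side gives at most \<open>s powr p\<close>, which is Minkowski's
  inequality.\<close>

lemma powr_sum3_le:
  fixes u v w a b e p :: real
  assumes "0 \<le> u" "0 \<le> v" "0 \<le> w" "0 < a" "0 < b" "0 < e" "1 \<le> p"
  defines "s \<equiv> a + b + e"
  shows "(u + v + w) powr p \<le> s powr (p - 1) * (a powr (1 - p) * u powr p + b powr (1 - p) * v powr p + e powr (1 - p) * w powr p)"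
proof -
  have s: "s > 0" using assms by simp
  define r where "r i = (if i = 0 then u / a else if i = Suc 0 then v / b else w / e)" for i :: nat
  define t where "t i = (if i = 0 then a / s else if i = Suc 0 then b / s else e / s)" for i :: nat
  have cv: "convex_on {0..} (\<lambda>x. x powr p)"
    using assms by (intro convex_on_powr_nonneg)
  have "(\<Sum>i\<in>{0,1,2}. t i *\<^sub>R r i) powr p \<le> (\<Sum>i\<in>{0,1,2}. t i * r i powr p)"
    using assms s by (intro convex_on_sum[OF _ _ cv]) (auto simp: t_def r_def s_def add_divide_distrib[symmetric])
  moreover have "(\<Sum>i\<in>{0,1,2}. t i *\<^sub>R r i) = (u + v + w) / s"
    using assms by (simp add: t_def r_def add_divide_distrib)
  ultimately have "((u + v + w) / s) powr p \<le> a / s * (u / a) powr p + b / s * (v / b) powr p + e / s * (w / e) powr p"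
    by (simp add: t_def r_def)
  moreover have "((u + v + w) / s) powr p = (u + v + w) powr p / s powr p"
    using assms s by (simp add: powr_divide)
  moreover have aux: "c / s * (x / c) powr p = c powr (1 - p) * x powr p / s" if "c > 0" "x \<ge> 0" for c x
    using that s by (simp add: powr_divide powr_diff field_simps)
  ultimately have "(u + v + w) powr p / s powr p \<le> (a powr (1 - p) * u powr p + b powr (1 - p) * v powr p + e powr (1 - p) * w powr p) / s"
    using assms by (simp add: aux add_divide_distrib)
  then have "(u + v + w) powr p \<le> s powr p * ((a powr (1 - p) * u powr p + b powr (1 - p) * v powr p + e powr (1 - p) * w powr p) / s)"
    using s by (simp add: divide_le_eq mult.commute)
  then show ?thesis
    using s by (simp add: powr_diff)
qed

text \<open>The way from the first to the last variable passes through two copies of the middle one.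
  The third summand \<open>e\<close> pays for the gap between the copies, and Minkowski's inequality
  adds the three lengths.\<close>

lemma wasserstein_dist_triangle_aux:
  fixes \<mu> \<nu> \<rho> :: "'a::euclidean_space measure"
  assumes p: "1 \<le> p" and \<gamma>: "\<gamma> \<in> couplings \<mu> \<nu>" and \<delta>: "\<delta> \<in> couplings \<nu> \<rho>"
    and "0 < a" "0 < b" "0 < e"
    and ca: "(\<integral>\<^sup>+ (x, y). ennreal (norm (x - y) powr p) \<partial>\<gamma>) \<le> ennreal (a powr p)"
    and cb: "(\<integral>\<^sup>+ (x, y). ennreal (norm (x - y) powr p) \<partial>\<delta>) \<le> ennreal (b powr p)"
  shows "wasserstein_dist p \<mu> \<rho> \<le> a + b + e"
proof -
  note g = couplingsD[OF \<gamma>] and d = couplingsD[OF \<delta>]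
  note [measurable] = g(6,7) d(6,7)
  obtain \<Omega> :: "(('a \<times> 'a) \<times> ('a \<times> 'a)) measure" where O: "prob_space \<Omega>"
    "sets \<Omega> = sets (\<gamma> \<Otimes>\<^sub>M \<delta>)" "distr \<Omega> \<gamma> fst = \<gamma>" "distr \<Omega> \<delta> snd = \<delta>"
    "AE w in \<Omega>. dist (snd (fst w)) (fst (snd w)) < 2 * (e/2)"
    by (rule approximate_gluing[OF \<gamma> \<delta> half_gt_zero[OF \<open>0 < e\<close>]])
  interpret prob_space \<Omega> by fact
  have [measurable]: "fst \<in> \<Omega> \<rightarrow>\<^sub>M \<gamma>" "snd \<in> \<Omega> \<rightarrow>\<^sub>M \<delta>"
    unfolding measurable_cong_sets[OF O(2) refl] by (rule measurable_fst, rule measurable_snd)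
  let ?x = "\<lambda>w::('a \<times> 'a) \<times> ('a \<times> 'a). fst (fst w)" and ?y = "\<lambda>w::('a \<times> 'a) \<times> ('a \<times> 'a). snd (fst w)"
  let ?y' = "\<lambda>w::('a \<times> 'a) \<times> ('a \<times> 'a). fst (snd w)" and ?z = "\<lambda>w::('a \<times> 'a) \<times> ('a \<times> 'a). snd (snd w)"
  have dx: "distr \<Omega> borel ?x = \<mu>"
    using distr_distr[of fst \<gamma> borel fst \<Omega>] by (simp add: O g comp_def)
  have dz: "distr \<Omega> borel ?z = \<rho>"
    using distr_distr[of snd \<delta> borel snd \<Omega>] by (simp add: O d comp_def)
  have c1: "(\<integral>\<^sup>+ w. ennreal (norm (?x w - ?y w) powr p) \<partial>\<Omega>) \<le> ennreal (a powr p)"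
    using ca by (subst (asm) O(3)[symmetric], subst (asm) nn_integral_distr) (auto simp: case_prod_beta)
  have c2: "(\<integral>\<^sup>+ w. ennreal (norm (?y' w - ?z w) powr p) \<partial>\<Omega>) \<le> ennreal (b powr p)"
    using cb by (subst (asm) O(4)[symmetric], subst (asm) nn_integral_distr) (auto simp: case_prod_beta)
  define s where "s = a + b + e"
  have s: "s > 0" using assms by (simp add: s_def)
  have "(\<integral>\<^sup>+ w. ennreal (norm (?x w - ?z w) powr p) \<partial>\<Omega>)
      \<le> (\<integral>\<^sup>+ w. ennreal (s powr (p - 1)) * (ennreal (a powr (1 - p)) * ennreal (norm (?x w - ?y w) powr p)
          + ennreal (b powr (1 - p)) * ennreal (norm (?y' w - ?z w) powr p) + ennreal e) \<partial>\<Omega>)"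
  proof (intro nn_integral_mono_AE)
    show "AE w in \<Omega>. ennreal (norm (?x w - ?z w) powr p)
      \<le> ennreal (s powr (p - 1)) * (ennreal (a powr (1 - p)) * ennreal (norm (?x w - ?y w) powr p)
          + ennreal (b powr (1 - p)) * ennreal (norm (?y' w - ?z w) powr p) + ennreal e)"
      using O(5)
    proof eventually_elim
      case (elim w)
      have "norm (?x w - ?z w) \<le> norm (?x w - ?y w) + norm (?y' w - ?z w) + dist (?y w) (?y' w)"
        by norm
      then have "norm (?x w - ?z w) \<le> norm (?x w - ?y w) + norm (?y' w - ?z w) + e"
        using elim by simp
      then have "norm (?x w - ?z w) powr p \<le> (norm (?x w - ?y w) + norm (?y' w - ?z w) + e) powr p"
        using p by (intro powr_mono2) auto
      also have "\<dots> \<le> s powr (p - 1) * (a powr (1 - p) * norm (?x w - ?y w) powr p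
          + b powr (1 - p) * norm (?y' w - ?z w) powr p + e powr (1 - p) * e powr p)"
        unfolding s_def using assms by (intro powr_sum3_le) auto
      also have "e powr (1 - p) * e powr p = e"
        using assms by (simp flip: powr_add)
      finally show ?case
        using \<open>0 < e\<close> by (simp flip: ennreal_plus ennreal_mult)
    qed
  qed
  also have "\<dots> = ennreal (s powr (p - 1)) * (ennreal (a powr (1 - p)) * (\<integral>\<^sup>+ w. ennreal (norm (?x w - ?y w) powr p) \<partial>\<Omega>)
          + ennreal (b powr (1 - p)) * (\<integral>\<^sup>+ w. ennreal (norm (?y' w - ?z w) powr p) \<partial>\<Omega>) + ennreal e)"
    by (simp add: nn_integral_cmult nn_integral_add emeasure_space_1)
  also have "\<dots> \<le> ennreal (s powr (p - 1)) * (ennreal (a powr (1 - p)) * ennreal (a powr p)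
          + ennreal (b powr (1 - p)) * ennreal (b powr p) + ennreal e)"
    by (intro mult_left_mono add_mono c1 c2) auto
  also have "\<dots> = ennreal (s powr (p - 1) * (a powr (1 - p) * a powr p + b powr (1 - p) * b powr p + e))"
    using assms by (simp flip: ennreal_plus ennreal_mult)
  also have "s powr (p - 1) * (a powr (1 - p) * a powr p + b powr (1 - p) * b powr p + e) = s powr p"
    using assms s by (simp add: powr_add[symmetric] s_def[symmetric]) (simp add: powr_diff)
  finally have c: "(\<integral>\<^sup>+ w. ennreal (norm (?x w - ?z w) powr p) \<partial>\<Omega>) \<le> ennreal (s powr p)" .
  have "distr \<Omega> (borel \<Otimes>\<^sub>M borel) (\<lambda>w. (?x w, ?z w)) \<in> couplings \<mu> \<rho>"
    using coupling_of_random_variables(1)[OF O(1), of ?x ?z] by (simp add: dx dz)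
  then show ?thesis
    unfolding s_def[symmetric] using c s p
    by (intro wasserstein_dist_le) (auto simp: coupling_of_random_variables(2)[OF O(1)])
qed

lemma wasserstein_dist_nonneg: "0 \<le> wasserstein_dist p \<mu> \<nu>"
  by (simp add: wasserstein_dist_def)

lemma wasserstein_dist_triangle:
  fixes \<mu> \<nu> \<rho> :: "'a::euclidean_space measure"
  assumes p: "1 \<le> p" and "\<mu> \<in> prob_measures_moment p" "\<nu> \<in> prob_measures_moment p" "\<rho> \<in> prob_measures_moment p"
  shows "wasserstein_dist p \<mu> \<rho> \<le> wasserstein_dist p \<mu> \<nu> + wasserstein_dist p \<nu> \<rho>"
proof (rule field_le_epsilon)
  fix e :: real assume e: "0 < e"
  have p0: "0 < p" using p by simp
  obtain \<gamma> where \<gamma>: "\<gamma> \<in> couplings \<mu> \<nu>"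
    "(\<integral>\<^sup>+ (x, y). ennreal (norm (x - y) powr p) \<partial>\<gamma>) < ennreal ((wasserstein_dist p \<mu> \<nu> + e / 3) powr p)"
    using wasserstein_dist_lessE[OF p0 assms(2,3), of "wasserstein_dist p \<mu> \<nu> + e / 3"] e by auto
  obtain \<delta> where \<delta>: "\<delta> \<in> couplings \<nu> \<rho>"
    "(\<integral>\<^sup>+ (x, y). ennreal (norm (x - y) powr p) \<partial>\<delta>) < ennreal ((wasserstein_dist p \<nu> \<rho> + e / 3) powr p)"
    using wasserstein_dist_lessE[OF p0 assms(3,4), of "wasserstein_dist p \<nu> \<rho> + e / 3"] e by auto
  have "wasserstein_dist p \<mu> \<rho> \<le> (wasserstein_dist p \<mu> \<nu> + e / 3) + (wasserstein_dist p \<nu> \<rho> + e / 3) + e / 3"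
    using \<gamma> \<delta> e wasserstein_dist_nonneg[of p \<mu> \<nu>] wasserstein_dist_nonneg[of p \<nu> \<rho>]
    by (intro wasserstein_dist_triangle_aux[OF p \<gamma>(1) \<delta>(1)]) auto
  then show "wasserstein_dist p \<mu> \<rho> \<le> wasserstein_dist p \<mu> \<nu> + wasserstein_dist p \<nu> \<rho> + e"
    by simp
qed

lemma wasserstein_dist_commute: "wasserstein_dist p \<mu> \<nu> = wasserstein_dist p \<nu> \<mu>"
proof -
  have *: "(INF \<gamma>\<in>couplings \<nu> \<mu>. \<integral>\<^sup>+ (x, y). ennreal (norm (x - y) powr p) \<partial>\<gamma>)
    \<le> (INF \<gamma>\<in>couplings \<mu> \<nu>. \<integral>\<^sup>+ (x, y). ennreal (norm (x - y) powr p) \<partial>\<gamma>)" for \<mu> \<nu> :: "'a measure"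
  proof (rule INF_mono)
    fix \<gamma> assume \<gamma>: "\<gamma> \<in> couplings \<mu> \<nu>"
    note g = couplingsD[OF this]
    have "distr \<gamma> (borel \<Otimes>\<^sub>M borel) (\<lambda>w. (snd w, fst w)) \<in> couplings \<nu> \<mu>"
      using coupling_of_random_variables(1)[OF g(1,7,6)] by (simp add: g)
    moreover have "(\<integral>\<^sup>+ (x, y). ennreal (norm (x - y) powr p) \<partial>distr \<gamma> (borel \<Otimes>\<^sub>M borel) (\<lambda>w. (snd w, fst w)))
      \<le> (\<integral>\<^sup>+ (x, y). ennreal (norm (x - y) powr p) \<partial>\<gamma>)"
      unfolding coupling_of_random_variables(2)[OF g(1,7,6)]
      by (intro nn_integral_mono) (auto simp: norm_minus_commute)
    ultimately show "\<exists>\<gamma>'\<in>couplings \<nu> \<mu>. (\<integral>\<^sup>+ (x, y). ennreal (norm (x - y) powr p) \<partial>\<gamma>')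
      \<le> (\<integral>\<^sup>+ (x, y). ennreal (norm (x - y) powr p) \<partial>\<gamma>)" by blast
  qed
  show ?thesis unfolding wasserstein_dist_def using antisym[OF *[of \<mu> \<nu>] *[of \<nu> \<mu>]] by simp
qed

lemma wasserstein_dist_refl:
  assumes "0 < p" "\<mu> \<in> prob_measures"
  shows "wasserstein_dist p \<mu> \<mu> = 0"
proof -
  note m = prob_measuresD[OF assms(2)]
  have [measurable]: "(\<lambda>x. x) \<in> borel_measurable \<mu>"
    unfolding measurable_cong_sets[OF m(2) refl] by simp
  have "distr \<mu> borel (\<lambda>x. x) = \<mu>"
    by (rule distr_id2) (simp add: m)
  then have "distr \<mu> (borel \<Otimes>\<^sub>M borel) (\<lambda>x. (x, x)) \<in> couplings \<mu> \<mu>"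
    using coupling_of_random_variables(1)[OF m(1), of "\<lambda>x. x" "\<lambda>x. x"] by simp
  then have "wasserstein_dist p \<mu> \<mu> \<le> 0"
    using coupling_of_random_variables(2)[OF m(1), of "\<lambda>x. x" "\<lambda>x. x" p]
    by (intro wasserstein_dist_le[OF assms(1)]) auto
  then show ?thesis using wasserstein_dist_nonneg[of p \<mu> \<mu>] by simp
qed

text \<open>Taken over finite intersections of a countable base, these bounded Lipschitz functions
  form a countable family that determines a probability measure. The Lipschitz property makes their
  integrals continuous for the Wasserstein distance by a direct estimate.\<close>

definition open_bump :: "'a::metric_space set \<Rightarrow> nat \<Rightarrow> 'a \<Rightarrow> real" where
  "open_bump U m x = min 1 (real m * infdist x (- U))"

lemma open_bump_bounds: "0 \<le> open_bump U m x" "open_bump U m x \<le> 1"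
  by (auto simp: open_bump_def infdist_nonneg)

lemma open_bump_lipschitz: "\<bar>open_bump U m x - open_bump U m y\<bar> \<le> real m * dist x y"
proof -
  have "\<bar>infdist x (- U) - infdist y (- U)\<bar> \<le> dist x y"
    using infdist_triangle_abs by blast
  then have "real m * \<bar>infdist x (- U) - infdist y (- U)\<bar> \<le> real m * dist x y"
    by (intro mult_left_mono) auto
  moreover have "real m * \<bar>infdist x (- U) - infdist y (- U)\<bar> = \<bar>real m * infdist x (- U) - real m * infdist y (- U)\<bar>"
    by (simp add: abs_mult right_diff_distrib[symmetric])
  ultimately show ?thesis unfolding open_bump_def by linarith
qed

lemma open_bump_continuous: "continuous_on A (open_bump U m)"
  unfolding open_bump_def by (intro continuous_intros)

lemma open_bump_measurable[measurable]: "open_bump (U :: 'a::euclidean_space set) m \<in> borel_measurable borel"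
  by (intro borel_measurable_continuous_onI open_bump_continuous)

lemma open_bump_tendsto:
  assumes "open U" "U \<noteq> UNIV"
  shows "(\<lambda>m. open_bump U m x) \<longlonglongrightarrow> indicator U x"
proof (cases "x \<in> U")
  case True
  have "infdist x (- U) > 0"
    using assms True in_closed_iff_infdist_zero[of "- U" x] infdist_nonneg[of x "- U"] by force
  then obtain N where "real N * infdist x (- U) \<ge> 1"
    by (metis less_imp_le reals_Archimedean3)
  then have "open_bump U m x = 1" if "m \<ge> N" for m
    using that \<open>infdist x (- U) > 0\<close> unfolding open_bump_def
    by (smt (verit, best) mult_right_mono of_nat_mono)
  then have "\<forall>\<^sub>F m in sequentially. open_bump U m x = 1"
    by (auto intro: eventually_sequentiallyI)
  then show ?thesis using True by (simp add: tendsto_eventually)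
next
  case False
  then show ?thesis by (simp add: open_bump_def)
qed

text \<open>The generator omits \<^term>\<open>UNIV\<close>, for which the distance to the complement is a junk value.\<close>

lemma prob_measures_eqI_bump:
  fixes \<mu> \<nu> :: "'a::euclidean_space measure"
  assumes "\<mu> \<in> prob_measures" "\<nu> \<in> prob_measures" "countable B" "topological_basis B"
    and eq: "\<And>F m. F \<subseteq> B \<Longrightarrow> finite F \<Longrightarrow> F \<noteq> {} \<Longrightarrow> (\<integral>x. open_bump (\<Inter>F) m x \<partial>\<mu>) = (\<integral>x. open_bump (\<Inter>F) m x \<partial>\<nu>)"
  shows "\<mu> = \<nu>"
proof -
  note m = prob_measuresD[OF assms(1)] and n = prob_measuresD[OF assms(2)]
  interpret m: prob_space \<mu> by fact
  interpret n: prob_space \<nu> by fact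
  define E where "E = {\<Inter>F | F. F \<subseteq> B \<and> finite F \<and> F \<noteq> {}}"
  have "emeasure \<mu> V = emeasure \<nu> V" if V: "V \<in> E" for V
  proof -
    obtain F where F: "V = \<Inter>F" "F \<subseteq> B" "finite F" "F \<noteq> {}" using V unfolding E_def by blast
    have "open V" using F topological_basis_open[OF assms(4)] by (auto intro!: open_Inter)
    show ?thesis
    proof (cases "V = UNIV")
      case True
      then show ?thesis using m.emeasure_space_1 n.emeasure_space_1 m n by simp
    next
      case False
      have lim: "(\<lambda>k. \<integral>x. open_bump V k x \<partial>\<rho>) \<longlonglongrightarrow> measure \<rho> V"
        if r: "prob_space \<rho>" "sets \<rho> = sets borel" for \<rho> :: "'a measure"
      proof -
        interpret r: prob_space \<rho> by fact
        have [measurable]: "open_bump V k \<in> borel_measurable \<rho>" for k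
          using open_bump_measurable measurable_cong_sets[OF r(2) refl] by blast
        have [measurable]: "V \<in> sets \<rho>" using r \<open>open V\<close> by simp
        have "(\<lambda>k. \<integral>x. open_bump V k x \<partial>\<rho>) \<longlonglongrightarrow> (\<integral>x. indicator V x \<partial>\<rho>)"
          using open_bump_tendsto[OF \<open>open V\<close> False] open_bump_bounds[of V]
          by (intro integral_dominated_convergence[where w="\<lambda>_. 1"]) (auto intro!: AE_I2)
        then show ?thesis by simp
      qed
      have "(\<lambda>k. \<integral>x. open_bump V k x \<partial>\<mu>) = (\<lambda>k. \<integral>x. open_bump V k x \<partial>\<nu>)"
        using eq[OF F(2-4)] F(1) by simp
      then have "measure \<mu> V = measure \<nu> V"
        using lim[OF m(1,2)] lim[OF n(1,2)] LIMSEQ_unique by metis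
      then show ?thesis by (simp add: m.emeasure_eq_measure n.emeasure_eq_measure)
    qed
  qed
  moreover have "Int_stable E"
  proof (rule Int_stableI)
    fix V W assume "V \<in> E" "W \<in> E"
    then obtain F G where "V = \<Inter>F" "F \<subseteq> B" "finite F" "F \<noteq> {}" "W = \<Inter>G" "G \<subseteq> B" "finite G" "G \<noteq> {}"
      unfolding E_def by blast
    then have "V \<inter> W = \<Inter>(F \<union> G) \<and> F \<union> G \<subseteq> B \<and> finite (F \<union> G) \<and> F \<union> G \<noteq> {}" by auto
    then show "V \<inter> W \<in> E" unfolding E_def by blast
  qed
  moreover have "sets borel = sigma_sets UNIV E"
  proof -
    have sB: "sets borel = sigma_sets UNIV B"
      by (subst borel_eq_countable_basis[OF assms(3,4)]) (simp add: sets_measure_of)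
    have "B \<subseteq> E" unfolding E_def by (auto intro!: exI[of _ "{_}"])
    moreover have "E \<subseteq> sigma_sets UNIV B"
      unfolding sB[symmetric] E_def using topological_basis_open[OF assms(4)] by (auto intro!: borel_open open_Inter)
    ultimately show ?thesis
      unfolding sB by (rule antisym[OF sigma_sets_mono' sigma_sets_mono])
  qed
  moreover obtain A where A: "A \<subseteq> B" "\<Union>A = UNIV"
    using topological_basisE[OF assms(4)] assms(4) unfolding topological_basis_def by (metis open_UNIV)
  have BE: "B \<subseteq> E" unfolding E_def by (auto intro!: exI[of _ "{_}"])
  define Ai where "Ai = from_nat_into A"
  have "A \<noteq> {}" using A by auto
  have rA: "range Ai = A"
    unfolding Ai_def using A(1) assms(3) countable_subset \<open>A \<noteq> {}\<close> by (metis range_from_nat_into)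
  ultimately show ?thesis
    using A BE rA by (intro measure_eqI_generator_eq[of E UNIV \<mu> \<nu> Ai]) (auto simp: m n)
qed

text \<open>Coupled points within \<open>\<eta>\<close> of each other contribute the Lipschitz
  bound. The remaining ones contribute at most the oscillation \<open>2 * B\<close> times their
  probability, which Markov's inequality bounds by \<open>\<eta> powr (- p) * c\<close>.\<close>

lemma coupling_lipschitz_diff:
  fixes \<mu> \<nu> :: "'a::euclidean_space measure" and f :: "'a \<Rightarrow> real"
  assumes p: "1 \<le> p" and \<gamma>: "\<gamma> \<in> couplings \<mu> \<nu>" and f[measurable]: "f \<in> borel_measurable borel"
    and fb: "\<And>x. \<bar>f x\<bar> \<le> B" and fL: "\<And>x y. \<bar>f x - f y\<bar> \<le> L * dist x y" and "0 < \<eta>" "0 \<le> L" "0 \<le> c"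
    and ca: "(\<integral>\<^sup>+ (x, y). ennreal (norm (x - y) powr p) \<partial>\<gamma>) \<le> ennreal c"
  shows "\<bar>(\<integral>x. f x \<partial>\<mu>) - (\<integral>x. f x \<partial>\<nu>)\<bar> \<le> L * \<eta> + 2 * B * \<eta> powr (- p) * c"
proof -
  note g = couplingsD[OF \<gamma>]
  interpret prob_space \<gamma> by fact
  note [measurable] = g(6,7)
  have B: "B \<ge> 0" using fb[of 0] by simp
  have i1: "(\<integral>x. f x \<partial>\<mu>) = (\<integral>w. f (fst w) \<partial>\<gamma>)"
    by (subst g(4)[symmetric], subst integral_distr) auto
  have i2: "(\<integral>x. f x \<partial>\<nu>) = (\<integral>w. f (snd w) \<partial>\<gamma>)"
    by (subst g(5)[symmetric], subst integral_distr) auto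
  have I[simp]: "integrable \<gamma> (\<lambda>w. f (fst w))" "integrable \<gamma> (\<lambda>w. f (snd w))"
    using fb by (auto intro!: integrable_const_bound[where B=B])
  have ci: "integrable \<gamma> (\<lambda>w. norm (fst w - snd w) powr p)"
    using le_less_trans[OF ca ennreal_less_top] by (intro integrableI_bounded) (auto simp: case_prod_unfold)
  have cv: "(\<integral>w. norm (fst w - snd w) powr p \<partial>\<gamma>) \<le> c"
    using ca \<open>0 \<le> c\<close> by (intro integral_real_bounded) (auto simp: case_prod_unfold)
  have "\<bar>(\<integral>x. f x \<partial>\<mu>) - (\<integral>x. f x \<partial>\<nu>)\<bar> = \<bar>\<integral>w. f (fst w) - f (snd w) \<partial>\<gamma>\<bar>"
    unfolding i1 i2 by simp
  also have "\<dots> \<le> (\<integral>w. \<bar>f (fst w) - f (snd w)\<bar> \<partial>\<gamma>)"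
    by (rule integral_abs_bound)
  also have "\<dots> \<le> (\<integral>w. L * \<eta> + 2 * B * \<eta> powr (- p) * norm (fst w - snd w) powr p \<partial>\<gamma>)"
  proof (rule integral_mono)
    fix w :: "'a \<times> 'a"
    show "\<bar>f (fst w) - f (snd w)\<bar> \<le> L * \<eta> + 2 * B * \<eta> powr (- p) * norm (fst w - snd w) powr p"
    proof (cases "dist (fst w) (snd w) \<le> \<eta>")
      case True
      have "\<bar>f (fst w) - f (snd w)\<bar> \<le> L * \<eta>"
        using fL[of "fst w" "snd w"] mult_left_mono[OF True \<open>0 \<le> L\<close>] by linarith
      moreover have "0 \<le> 2 * B * \<eta> powr (- p) * norm (fst w - snd w) powr p" using B by auto
      ultimately show ?thesis by linarith
    next
      case False
      then have "\<eta> powr p \<le> norm (fst w - snd w) powr p"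
        using \<open>0 < \<eta>\<close> p by (intro powr_mono2) (auto simp: dist_norm)
      then have "\<eta> powr (-p) * \<eta> powr p \<le> \<eta> powr (-p) * norm (fst w - snd w) powr p"
        by (intro mult_left_mono) auto
      then have "1 \<le> \<eta> powr (-p) * norm (fst w - snd w) powr p"
        using \<open>0 < \<eta>\<close> by (simp flip: powr_add)
      then have "2 * B * 1 \<le> 2 * B * (\<eta> powr (-p) * norm (fst w - snd w) powr p)"
        using B by (intro mult_left_mono) auto
      moreover have "\<bar>f (fst w) - f (snd w)\<bar> \<le> 2 * B" using fb[of "fst w"] fb[of "snd w"] by linarith
      moreover have "0 \<le> L * \<eta>" using assms by simp
      ultimately show ?thesis by (simp add: mult.assoc)
    qed
  qed (use ci in auto)
  also have "\<dots> = L * \<eta> + 2 * B * \<eta> powr (- p) * (\<integral>w. norm (fst w - snd w) powr p \<partial>\<gamma>)"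
    using ci by (simp add: prob_space)
  also have "\<dots> \<le> L * \<eta> + 2 * B * \<eta> powr (- p) * c"
    using cv B by (intro add_left_mono mult_left_mono) auto
  finally show ?thesis .
qed

lemma wasserstein_lipschitz_tendsto:
  fixes \<mu> :: "'a::euclidean_space measure" and f :: "'a \<Rightarrow> real"
  assumes p: "1 \<le> p" and mu: "\<mu> \<in> prob_measures_moment p" and nu: "\<And>k. \<nu> k \<in> prob_measures_moment p"
    and f[measurable]: "f \<in> borel_measurable borel"
    and fb: "\<And>x. \<bar>f x\<bar> \<le> B" and fL: "\<And>x y. \<bar>f x - f y\<bar> \<le> L * dist x y" and "0 \<le> L"
    and lim: "(\<lambda>k. wasserstein_dist p \<mu> (\<nu> k)) \<longlonglongrightarrow> 0"
  shows "(\<lambda>k. \<integral>x. f x \<partial>\<nu> k) \<longlonglongrightarrow> (\<integral>x. f x \<partial>\<mu>)"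
proof (rule metric_LIMSEQ_I)
  fix e :: real assume e: "0 < e"
  have B: "B \<ge> 0" using fb[of 0] by simp
  \<comment> \<open>First \<open>\<eta>\<close> makes the Lipschitz term at most
    \<open>e / 2\<close>, then \<open>c\<close>, depending on \<open>\<eta>\<close>, makes the
    Markov term less than \<open>e / 2\<close>, and \<open>a\<close> is the distance whose p-th
    power is \<open>c\<close>.\<close>
  define \<eta> where "\<eta> = e / (2 * (L + 1))"
  have \<eta>: "0 < \<eta>" "L * \<eta> < e / 2 + 0 \<or> L * \<eta> \<le> e / 2"
    using e \<open>0 \<le> L\<close> by (auto simp: \<eta>_def field_simps)
  then have L\<eta>: "L * \<eta> \<le> e / 2" by auto
  define c where "c = e / (4 * (2 * B * \<eta> powr (-p) + 1))"
  have D: "0 \<le> 2 * B * \<eta> powr (-p)" using B by simp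
  have c: "0 < c" "2 * B * \<eta> powr (-p) * c < e / 2"
  proof -
    show "0 < c" unfolding c_def using D e by (intro divide_pos_pos) auto
    have "(2 * B * \<eta> powr (-p) + 1) * c = e / 4" unfolding c_def using D by (simp add: field_simps)
    then show "2 * B * \<eta> powr (-p) * c < e / 2" using \<open>0 < c\<close> e by (simp add: distrib_right)
  qed
  define a where "a = c powr (1/p)"
  have a: "0 < a" "a powr p = c" using c p by (auto simp: a_def powr_powr)
  have "\<forall>\<^sub>F k in sequentially. wasserstein_dist p \<mu> (\<nu> k) < a"
    using lim a by (simp add: order_tendstoD)
  then obtain N where N: "\<And>k. k \<ge> N \<Longrightarrow> wasserstein_dist p \<mu> (\<nu> k) < a"
    by (auto simp: eventually_sequentially)
  show "\<exists>N. \<forall>k\<ge>N. dist (\<integral>x. f x \<partial>\<nu> k) (\<integral>x. f x \<partial>\<mu>) < e"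
  proof (intro exI allI impI)
    fix k assume "k \<ge> N"
    then obtain \<gamma> where "\<gamma> \<in> couplings \<mu> (\<nu> k)"
      "(\<integral>\<^sup>+ (x, y). ennreal (norm (x - y) powr p) \<partial>\<gamma>) < ennreal (a powr p)"
      using wasserstein_dist_lessE[OF _ mu nu N[OF \<open>k \<ge> N\<close>]] p by auto
    then have "\<bar>(\<integral>x. f x \<partial>\<mu>) - (\<integral>x. f x \<partial>\<nu> k)\<bar> \<le> L * \<eta> + 2 * B * \<eta> powr (- p) * c"
      using a c \<eta> \<open>0 \<le> L\<close> by (intro coupling_lipschitz_diff[OF p _ f fb fL]) (auto simp: less_imp_le)
    then show "dist (\<integral>x. f x \<partial>\<nu> k) (\<integral>x. f x \<partial>\<mu>) < e"
      using L\<eta> c by (simp add: dist_real_def)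
  qed
qed

lemma Metric_space_wasserstein:
  assumes p: "1 \<le> p"
  shows "Metric_space (prob_measures_moment p :: 'a::euclidean_space measure set) (wasserstein_dist p)"
proof
  fix \<mu> \<nu> \<rho> :: "'a measure"
  show "0 \<le> wasserstein_dist p \<mu> \<nu>" by (rule wasserstein_dist_nonneg)
  show "wasserstein_dist p \<mu> \<nu> = wasserstein_dist p \<nu> \<mu>" by (rule wasserstein_dist_commute)
  show "(wasserstein_dist p \<mu> \<nu> = 0) = (\<mu> = \<nu>)"
    if "\<mu> \<in> prob_measures_moment p" "\<nu> \<in> prob_measures_moment p"
  proof
    assume "\<mu> = \<nu>"
    then show "wasserstein_dist p \<mu> \<nu> = 0"
      using wasserstein_dist_refl[OF _ prob_measures_momentD(1)[OF that(1)]] p by simp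
  next
    assume 0: "wasserstein_dist p \<mu> \<nu> = 0"
    obtain B :: "'a set set" where B: "countable B" "topological_basis B"
      using ex_countable_basis by blast
    show "\<mu> = \<nu>"
    proof (rule prob_measures_eqI_bump[OF _ _ B])
      fix F m
      \<comment> \<open>Distance 0 says that the constant sequence \<open>\<nu>\<close> converges to
        \<open>\<mu>\<close>, so a constant sequence of integrals has the other integral as its
        limit.\<close>
      have "(\<lambda>k::nat. \<integral>x. open_bump (\<Inter>F) m x \<partial>\<nu>) \<longlonglongrightarrow> (\<integral>x. open_bump (\<Inter>F) m x \<partial>\<mu>)"
        using that 0 by (intro wasserstein_lipschitz_tendsto[OF p, where B=1 and L="real m"])
          (simp_all add: open_bump_lipschitz open_bump_bounds)
      then show "(\<integral>x. open_bump (\<Inter>F) m x \<partial>\<mu>) = (\<integral>x. open_bump (\<Inter>F) m x \<partial>\<nu>)"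
        by (simp add: LIMSEQ_const_iff)
    qed (use prob_measures_momentD(1)[OF that(1)] prob_measures_momentD(1)[OF that(2)] in simp_all)
  qed
  show "wasserstein_dist p \<mu> \<rho> \<le> wasserstein_dist p \<mu> \<nu> + wasserstein_dist p \<nu> \<rho>"
    if "\<mu> \<in> prob_measures_moment p" "\<nu> \<in> prob_measures_moment p" "\<rho> \<in> prob_measures_moment p"
    using wasserstein_dist_triangle[OF p that] .
qed

section \<open>A space-filling curve with a Borel section\<close>

text \<open>Schoenberg's curve: a triangular wave of period 2, truncated to \<^term>\<open>{0..1::real}\<close>, reads off
  the ternary digits 0 and 2 of its argument.\<close>

definition tri_wave :: "real \<Rightarrow> real" where
  "tri_wave t = arccos (cos (pi * t)) / pi"

text \<open>It is 0 where \<open>tri_wave\<close> is at most 1/3 and 1 where it is at least 2/3. A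
  number in the unit interval with leading ternary digit 0 or 2 lies in one of these two thirds, so
  continuity costs no information about the digit.\<close>

definition digit_wave :: "real \<Rightarrow> real" where
  "digit_wave t = max 0 (min 1 (3 * tri_wave t - 1))"

lemma tri_wave_periodic: "tri_wave (2 * real m + u) = tri_wave u"
proof -
  have "cos (pi * (2 * real m + u)) = cos (pi * u)"
    using cos.plus_of_nat[of "pi * u" m] by (simp add: algebra_simps)
  then show ?thesis by (simp add: tri_wave_def)
qed

lemma tri_wave_id: "0 \<le> u \<Longrightarrow> u \<le> 1 \<Longrightarrow> tri_wave u = u"
  unfolding tri_wave_def by (subst arccos_cos) (auto simp: mult_le_cancel_left1)

lemma tri_wave_continuous: "continuous_on A tri_wave"
  unfolding tri_wave_def by (intro continuous_intros) auto

lemma digit_wave_continuous: "continuous_on A digit_wave"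
  unfolding digit_wave_def by (intro continuous_intros tri_wave_continuous)

lemma digit_wave_bounds: "0 \<le> digit_wave t" "digit_wave t \<le> 1"
  by (auto simp: digit_wave_def)

text \<open>The point of the Cantor set whose ternary digits are twice the given binary
  ones.\<close>

definition ternary :: "(nat \<Rightarrow> nat) \<Rightarrow> real" where
  "ternary a = (\<Sum>j. 2 * real (a j) / 3 ^ Suc j)"

lemma ternary_summable:
  assumes "\<And>j. a j \<le> 1"
  shows "summable (\<lambda>j. 2 * real (a j) / 3 ^ Suc j)"
proof (rule summable_comparison_test')
  show "summable (\<lambda>j. 2 / 3 * (1 / 3 :: real) ^ j)"
    by (intro summable_mult summable_geometric) simp
  fix j :: nat
  show "norm (2 * real (a j) / 3 ^ Suc j) \<le> 2 / 3 * (1 / 3) ^ j"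
    using assms[of j] by (simp add: power_divide divide_simps)
qed

lemma ternary_bounds:
  assumes "\<And>j. a j \<le> 1"
  shows "0 \<le> ternary a" "ternary a \<le> 1"
proof -
  show "0 \<le> ternary a"
    unfolding ternary_def by (intro suminf_nonneg ternary_summable assms) auto
  have s: "(\<lambda>j. 2 / 3 * (1 / 3 :: real) ^ j) sums (2 / 3 * (1 / (1 - 1 / 3)))"
    by (intro sums_mult geometric_sums) simp
  have "ternary a \<le> (\<Sum>j. 2 / 3 * (1 / 3 :: real) ^ j)"
    unfolding ternary_def
  proof (intro suminf_le ternary_summable assms sums_summable[OF s])
    fix j
    show "2 * real (a j) / 3 ^ Suc j \<le> 2 / 3 * (1 / 3) ^ j"
      using assms[of j] by (simp add: power_divide divide_simps)
  qed
  also have "\<dots> = 1" using sums_unique[OF s] by simp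
  finally show "ternary a \<le> 1" .
qed

lemma ternary_shift:
  assumes "\<And>j. a j \<le> 1"
  shows "3 * ternary a = 2 * real (a 0) + ternary (\<lambda>j. a (Suc j))"
proof -
  have "ternary a = (\<Sum>j. 2 * real (a (Suc j)) / 3 ^ Suc (Suc j)) + 2 * real (a 0) / 3"
    unfolding ternary_def using suminf_split_head[OF ternary_summable, of a] assms by simp
  also have "(\<Sum>j. 2 * real (a (Suc j)) / 3 ^ Suc (Suc j)) = (\<Sum>j. 1/3 * (2 * real (a (Suc j)) / 3 ^ Suc j))"
    by (intro suminf_cong) simp
  also have "\<dots> = 1/3 * ternary (\<lambda>j. a (Suc j))"
    unfolding ternary_def by (intro suminf_mult ternary_summable assms)
  finally show ?thesis by simp
qed

text \<open>Multiplying by 3 shifts the digits by one place. The integer part that appears is always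
  even, because the digits are 0 or 2 and the initial integer is even, so the period 2 of the wave
  removes it.\<close>

lemma digit_wave_ternary:
  assumes "\<And>j. a j \<le> 1"
  shows "digit_wave (3 ^ k * (2 * real m + ternary a)) = real (a k)"
proof -
  have "\<exists>N::nat. 3 ^ k * (2 * real m + ternary a) = 2 * real N + ternary (\<lambda>j. a (j + k))"
  proof (induction k)
    case (Suc k)
    then obtain N :: nat where N: "3 ^ k * (2 * real m + ternary a) = 2 * real N + ternary (\<lambda>j. a (j + k))"
      by blast
    have "3 ^ Suc k * (2 * real m + ternary a) = 3 * (3 ^ k * (2 * real m + ternary a))"
      by simp
    also have "\<dots> = 6 * real N + 3 * ternary (\<lambda>j. a (j + k))" unfolding N by simp
    also have "\<dots> = 2 * real (3 * N + a k) + ternary (\<lambda>j. a (j + Suc k))"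
      using ternary_shift[of "\<lambda>j. a (j + k)"] assms by simp
    finally show ?case by blast
  qed auto
  then obtain N :: nat where N: "3 ^ k * (2 * real m + ternary a) = 2 * real N + ternary (\<lambda>j. a (j + k))"
    by blast
  define u where "u = ternary (\<lambda>j. a (j + k))"
  have u: "0 \<le> u" "u \<le> 1" unfolding u_def using ternary_bounds[of "\<lambda>j. a (j + k)"] assms by auto
  define v where "v = ternary (\<lambda>j. a (Suc j + k))"
  have v: "0 \<le> v" "v \<le> 1" unfolding v_def using ternary_bounds[of "\<lambda>j. a (Suc j + k)"] assms by auto
  have uv: "3 * u = 2 * real (a k) + v"
    unfolding u_def v_def using ternary_shift[of "\<lambda>j. a (j + k)"] assms by simp
  have "digit_wave (3 ^ k * (2 * real m + ternary a)) = max 0 (min 1 (3 * u - 1))"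
    unfolding N digit_wave_def u_def[symmetric] tri_wave_periodic tri_wave_id[OF u] ..
  also have "\<dots> = real (a k)"
    using assms[of k] uv u v by (cases "a k = 0") auto
  finally show ?thesis .
qed

section \<open>Binary expansion of the coordinates and the curve\<close>

definition binary_digit :: "nat \<Rightarrow> real \<Rightarrow> nat" where
  "binary_digit j z = nat (\<lfloor>2 ^ Suc j * z\<rfloor> mod 2)"

lemma binary_digit_le: "binary_digit j z \<le> 1"
  unfolding binary_digit_def by simp

text \<open>The N-th partial sum telescopes to the dyadic truncation of \<open>z\<close>, which is
  within \<open>(1/2) ^ N\<close> of \<open>z\<close>.\<close>

lemma binary_digit_sums:
  assumes "0 \<le> z" "z < 1"
  shows "(\<lambda>j. real (binary_digit j z) / 2 ^ Suc j) sums z"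
proof -
  have part: "(\<Sum>j<N. real (binary_digit j z) / 2 ^ Suc j) = of_int \<lfloor>2 ^ N * z\<rfloor> / 2 ^ N" for N
  proof (induction N)
    case 0
    have "\<lfloor>z\<rfloor> = 0" using assms by (simp add: floor_eq_iff)
    then show ?case by simp
  next
    case (Suc N)
    have "\<lfloor>2 ^ N * z\<rfloor> = \<lfloor>2 ^ Suc N * z / real_of_int 2\<rfloor>" by simp
    also have "\<dots> = \<lfloor>2 ^ Suc N * z\<rfloor> div 2"
      by (rule floor_divide_real_eq_div) simp
    finally have "\<lfloor>2 ^ Suc N * z\<rfloor> = 2 * \<lfloor>2 ^ N * z\<rfloor> + \<lfloor>2 ^ Suc N * z\<rfloor> mod 2"
      by (metis mult_div_mod_eq)
    then have "real_of_int \<lfloor>2 ^ Suc N * z\<rfloor> = 2 * real_of_int \<lfloor>2 ^ N * z\<rfloor> + real_of_int (\<lfloor>2 ^ Suc N * z\<rfloor> mod 2)"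
      by linarith
    moreover have "real (binary_digit N z) = real_of_int (\<lfloor>2 ^ Suc N * z\<rfloor> mod 2)"
      unfolding binary_digit_def by simp
    ultimately have "real_of_int \<lfloor>2 ^ Suc N * z\<rfloor> = 2 * real_of_int \<lfloor>2 ^ N * z\<rfloor> + real (binary_digit N z)" by simp
    then show ?case using Suc by (simp add: field_simps)
  qed
  have "(\<lambda>N. of_int \<lfloor>2 ^ N * z\<rfloor> / 2 ^ N) \<longlonglongrightarrow> z"
  proof (rule tendsto_sandwich[of "\<lambda>N. z - (1/2) ^ N" _ _ "\<lambda>_. z"])
    show "\<forall>\<^sub>F N in sequentially. z - (1/2) ^ N \<le> of_int \<lfloor>2 ^ N * z\<rfloor> / 2 ^ N"
    proof (intro always_eventually allI)
      fix N :: nat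
      have "2 ^ N * z - 1 \<le> of_int \<lfloor>2 ^ N * z\<rfloor>" by linarith
      then have "(2 ^ N * z - 1) / 2 ^ N \<le> of_int \<lfloor>2 ^ N * z\<rfloor> / 2 ^ N" by (intro divide_right_mono) auto
      then show "z - (1/2) ^ N \<le> of_int \<lfloor>2 ^ N * z\<rfloor> / 2 ^ N" by (simp add: diff_divide_distrib power_divide)
    qed
    show "\<forall>\<^sub>F N in sequentially. of_int \<lfloor>2 ^ N * z\<rfloor> / 2 ^ N \<le> z"
    proof (intro always_eventually allI)
      fix N :: nat
      have "of_int \<lfloor>2 ^ N * z\<rfloor> \<le> 2 ^ N * z" by linarith
      then show "of_int \<lfloor>2 ^ N * z\<rfloor> / 2 ^ N \<le> z" by (simp add: divide_le_eq mult.commute)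
    qed
    have "(\<lambda>N. z - (1/2) ^ N) \<longlonglongrightarrow> z - 0"
      by (intro tendsto_intros LIMSEQ_power_zero) simp
    then show "(\<lambda>N. z - (1/2) ^ N) \<longlonglongrightarrow> z" by simp
  qed simp
  then show ?thesis unfolding sums_def part .
qed

text \<open>The section \<open>s\<close> codes the size of a point in an even integer and its
  direction in a Cantor point. The linear bound on \<open>s\<close> is what carries tightness over
  to the real line.\<close>

lemma space_filling_curve:
  obtains \<phi> :: "real \<Rightarrow> 'a::euclidean_space" and s :: "'a \<Rightarrow> real"
  where "continuous_on UNIV \<phi>" "s \<in> borel_measurable borel" "\<And>y. \<phi> (s y) = y"
    "\<And>y. 0 \<le> s y" "\<And>y. s y \<le> 2 * norm y + 1"
proof -
  define d where "d = DIM('a)"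
  have d: "0 < d" by (simp add: d_def)
  obtain b :: "nat \<Rightarrow> 'a" where b: "bij_betw b {..<d} Basis"
    using ex_bij_betw_nat_finite[OF finite_Basis] by (auto simp: d_def atLeast0LessThan)
  \<comment> \<open>Coordinate \<open>i\<close> is the binary number formed by the digits at the
    positions congruent to \<open>i\<close> modulo \<open>d\<close>.\<close>
  define x where "x i t = (\<Sum>j. digit_wave (3 ^ (j * d + i) * t) / 2 ^ Suc j)" for i t
  \<comment> \<open>Equal to \<open>m + 1\<close> on the whole interval from \<open>2 * m\<close> to
    \<open>2 * m + 1\<close>, where the curve therefore fills the cube of half-width
    \<open>m + 1\<close>; in between it interpolates continuously.\<close>
  define R where "R t = 1 + (t - tri_wave t) / 2" for t
  define \<phi> where "\<phi> t = (\<Sum>i<d. (R t * (2 * x i t - 1)) *\<^sub>R b i)" for t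
  define m where "m y = nat \<lfloor>norm y\<rfloor>" for y :: 'a
  define z where "z i y = ((y \<bullet> b i) / (real (m y) + 1) + 1) / 2" for i y
  define a where "a y n = binary_digit (n div d) (z (n mod d) y)" for y n
  \<comment> \<open>The integer \<open>m y\<close> selects a cube strictly containing
    \<open>y\<close>, so the rescaled coordinates \<open>z i y\<close> lie in [0,1); their binary
    digits are interleaved into \<open>a y\<close>.\<close>
  define s where "s y = 2 * real (m y) + ternary (a y)" for y
  have a1: "a y n \<le> 1" for y n unfolding a_def by (rule binary_digit_le)
  have xc: "continuous_on UNIV (x i)" for i
    unfolding x_def
  proof (rule uniform_limit_theorem[OF _ Weierstrass_m_test])
    show "\<forall>\<^sub>F n in sequentially. continuous_on UNIV (\<lambda>t. \<Sum>j<n. digit_wave (3 ^ (j * d + i) * t) / 2 ^ Suc j)"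
      by (intro always_eventually allI continuous_intros continuous_on_compose2[OF digit_wave_continuous[of UNIV]]) auto
    show "norm (digit_wave (3 ^ (j * d + i) * t) / 2 ^ Suc j) \<le> (1 / 2) ^ Suc j" for j t
      using digit_wave_bounds[of "3 ^ (j * d + i) * t"] by (simp add: power_divide divide_simps)
    show "summable (\<lambda>j. (1 / 2 :: real) ^ Suc j)"
      by (subst summable_Suc_iff) (simp add: summable_geometric)
  qed simp
  have "continuous_on UNIV \<phi>"
    unfolding \<phi>_def R_def by (intro continuous_intros xc tri_wave_continuous) auto
  moreover have mm[measurable]: "m \<in> borel \<rightarrow>\<^sub>M count_space UNIV"
    unfolding m_def by measurable
  have "s \<in> borel_measurable borel"
    unfolding s_def ternary_def a_def binary_digit_def z_def by measurable
  moreover have mb: "real (m y) \<le> norm y" "norm y < real (m y) + 1" for y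
    unfolding m_def by (auto simp: of_nat_nat)
  have "0 \<le> s y" "s y \<le> 2 * norm y + 1" for y
    using ternary_bounds[of "a y", OF a1] mb[of y] by (auto simp: s_def)
  moreover have "\<phi> (s y) = y" for y
  proof -
    have R: "R (s y) = real (m y) + 1"
      using tri_wave_periodic[of "m y" "ternary (a y)"] tri_wave_id[OF ternary_bounds[OF a1]]
      by (simp add: R_def s_def)
    have x: "x i (s y) = z i y" if i: "i < d" for i
    proof -
      have "\<bar>y \<bullet> b i\<bar> \<le> norm y"
        using b i by (intro Basis_le_norm) (auto simp: bij_betw_def)
      then have "\<bar>y \<bullet> b i\<bar> < real (m y) + 1" using mb[of y] by linarith
      then have "\<bar>(y \<bullet> b i) / (real (m y) + 1)\<bar> < 1" by simp
      moreover have "0 \<le> (q + 1) / 2 \<and> (q + 1) / 2 < 1" if "\<bar>q\<bar> < 1" for q :: real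
        using that by (auto simp: abs_less_iff)
      ultimately have z: "0 \<le> z i y" "z i y < 1" unfolding z_def by blast+
      have "digit_wave (3 ^ (j * d + i) * s y) = real (binary_digit j (z i y))" for j
        unfolding s_def digit_wave_ternary[OF a1] using i by (simp add: a_def)
      then show ?thesis
        unfolding x_def using sums_unique[OF binary_digit_sums[OF z]] by simp
    qed
    have "\<phi> (s y) = (\<Sum>i<d. (y \<bullet> b i) *\<^sub>R b i)"
      unfolding \<phi>_def
    proof (intro sum.cong refl)
      fix i assume "i \<in> {..<d}"
      then show "(R (s y) * (2 * x i (s y) - 1)) *\<^sub>R b i = (y \<bullet> b i) *\<^sub>R b i"
        using x[of i] mb[of y] unfolding R by (simp add: z_def field_simps)
    qed
    also have "\<dots> = (\<Sum>e\<in>Basis. (y \<bullet> e) *\<^sub>R e)"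
      by (rule sum.reindex_bij_betw[OF b])
    finally show ?thesis by (simp add: euclidean_representation)
  qed
  ultimately show thesis by (intro that[of \<phi> s])
qed

section \<open>Subsequential almost sure representation\<close>

text \<open>The theorems of Helly and Skorohod on the real line are transported along the curve: a Borel
  section need not be continuous, but only the continuity of the curve is used.\<close>

definition pointwise_representation ::
  "(nat \<Rightarrow> 'a::euclidean_space measure) \<Rightarrow> (nat \<Rightarrow> nat) \<Rightarrow> real measure \<Rightarrow> (nat \<Rightarrow> real \<Rightarrow> 'a) \<Rightarrow> (real \<Rightarrow> 'a) \<Rightarrow> bool"
  where "pointwise_representation \<nu> r \<Omega> Xs X \<longleftrightarrow> strict_mono r \<and> prob_space \<Omega>
    \<and> (\<forall>k. Xs k \<in> borel_measurable \<Omega>) \<and> (\<forall>k. distr \<Omega> borel (Xs k) = \<nu> (r k))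
    \<and> X \<in> borel_measurable \<Omega> \<and> (\<forall>\<omega>\<in>space \<Omega>. (\<lambda>k. Xs k \<omega>) \<longlonglongrightarrow> X \<omega>)"

lemma pointwise_representationD:
  assumes "pointwise_representation \<nu> r \<Omega> Xs X"
  shows "strict_mono r" "prob_space \<Omega>" "Xs k \<in> borel_measurable \<Omega>" "distr \<Omega> borel (Xs k) = \<nu> (r k)"
    "X \<in> borel_measurable \<Omega>" "\<omega> \<in> space \<Omega> \<Longrightarrow> (\<lambda>k. Xs k \<omega>) \<longlonglongrightarrow> X \<omega>"
  using assms unfolding pointwise_representation_def by auto

text \<open>Markov's inequality makes the images of the measures under \<open>s\<close> tight on the
  line. Composing Skorohod's variables with \<open>\<phi>\<close> restores the laws, because
  \<open>\<phi>\<close> inverts \<open>s\<close>. The limit law on the line need not be carried by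
  the range of \<open>s\<close>; it is only pushed forward by \<open>\<phi>\<close>, and its
  identification is left to the applications.\<close>

lemma tight_subsequence_representation:
  fixes \<mu> :: "nat \<Rightarrow> 'a::euclidean_space measure"
  assumes \<mu>: "\<And>k. \<mu> k \<in> prob_measures" and C: "\<And>k. (\<integral>\<^sup>+ x. ennreal (norm x) \<partial>\<mu> k) \<le> ennreal C"
  shows "\<exists>r \<Omega> Xs X. pointwise_representation \<mu> r \<Omega> Xs X"
proof -
  obtain \<phi> :: "real \<Rightarrow> 'a" and s where cv: "continuous_on UNIV \<phi>" and s: "s \<in> borel_measurable borel"
    and \<phi>s: "\<And>y. \<phi> (s y) = y" and s0: "\<And>y. 0 \<le> s y" and s1: "\<And>y. s y \<le> 2 * norm y + 1"
    using space_filling_curve by blast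
  have \<phi>[measurable]: "\<phi> \<in> borel_measurable borel" by (rule borel_measurable_continuous_onI[OF cv])
  have sm: "s \<in> borel_measurable (\<mu> k)" for k
    unfolding measurable_cong_sets[OF prob_measuresD(2)[OF \<mu>] refl] by (rule s)
  define L where "L k = distr (\<mu> k) borel s" for k
  have rd: "real_distribution (L k)" for k
  proof -
    interpret prob_space "\<mu> k" by (rule prob_measuresD(1)[OF \<mu>])
    show ?thesis unfolding L_def by (rule real_distribution_distr[OF sm])
  qed
  have "tight L"
    unfolding tight_def
  proof (intro conjI allI impI rd)
    fix \<epsilon> :: real assume e: "0 < \<epsilon>"
    define C' where "C' = max C 1"
    have C': "1 \<le> C'" "C \<le> C'" by (auto simp: C'_def)
    \<comment> \<open>Markov's inequality then bounds the mass outside radius \<open>K\<close> by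
      \<open>\<epsilon> / 2\<close>. Replacing \<open>C\<close> by a constant at least 1 keeps
      \<open>K\<close> positive.\<close>
    define K where "K = 2 * C' / \<epsilon>"
    have K: "0 < K" "C' / K < \<epsilon>" using e C' by (auto simp: K_def field_simps)
    have "1 - \<epsilon> < measure (L k) {-1 <.. 2 * K + 1}" for k
    proof -
      note m = prob_measuresD[OF \<mu>, of k]
      interpret prob_space "\<mu> k" by (rule m)
      have [measurable]: "(\<lambda>x. norm x) \<in> borel_measurable (\<mu> k)"
        unfolding measurable_cong_sets[OF m(2) refl] by simp
      have ss: "{x. K \<le> norm x} \<in> sets (\<mu> k)" unfolding m by (intro borel_closed closed_Collect_le continuous_intros)
      have "emeasure (\<mu> k) {x. K \<le> norm x} = (\<integral>\<^sup>+ x. indicator {x. K \<le> norm x} x \<partial>\<mu> k)" using ss by simp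
      also have "\<dots> \<le> (\<integral>\<^sup>+ x. ennreal (1 / K) * ennreal (norm x) \<partial>\<mu> k)"
        using K by (intro nn_integral_mono) (auto split: split_indicator simp flip: ennreal_mult)
      also have "\<dots> = ennreal (1 / K) * (\<integral>\<^sup>+ x. ennreal (norm x) \<partial>\<mu> k)"
        by (simp add: nn_integral_cmult)
      also have "\<dots> \<le> ennreal (1 / K) * ennreal C'"
        using order_trans[OF C ennreal_leI[OF C'(2)]] by (intro mult_left_mono) auto
      also have "\<dots> = ennreal (C' / K)" using K C' by (simp flip: ennreal_mult)
      finally have "prob {x. K \<le> norm x} \<le> C' / K"
        using K C' by (simp add: emeasure_eq_measure)
      then have "1 - \<epsilon> < 1 - prob {x. K \<le> norm x}" using K by simp
      also have "\<dots> = prob (space (\<mu> k) - {x. K \<le> norm x})" using prob_compl[OF ss] by simp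
      also have "\<dots> \<le> prob (s -` {-1 <.. 2 * K + 1} \<inter> space (\<mu> k))"
      proof (rule finite_measure_mono)
        show "space (\<mu> k) - {x. K \<le> norm x} \<subseteq> s -` {-1 <.. 2 * K + 1} \<inter> space (\<mu> k)"
        proof
          fix y assume "y \<in> space (\<mu> k) - {x. K \<le> norm x}"
          then show "y \<in> s -` {-1 <.. 2 * K + 1} \<inter> space (\<mu> k)" using s0[of y] s1[of y] by auto
        qed
        show "s -` {-1 <.. 2 * K + 1} \<inter> space (\<mu> k) \<in> events" by (rule measurable_sets[OF sm]) simp
      qed
      also have "\<dots> = measure (L k) {-1 <.. 2 * K + 1}"
        unfolding L_def by (rule measure_distr[OF sm, symmetric]) simp
      finally show ?thesis .
    qed
    moreover have "-1 < 2 * K + 1" using K by simp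
    ultimately show "\<exists>a b. a < b \<and> (\<forall>k. 1 - \<epsilon> < measure (L k) {a<..b})" by blast
  qed
  then obtain r M where r: "strict_mono r" and M: "real_distribution M" "weak_conv_m (L \<circ> id \<circ> r) M"
    using tight_imp_convergent_subsubsequence[of L id] by (auto simp: strict_mono_def)
  have rd': "real_distribution ((L \<circ> id \<circ> r) k)" for k using rd by simp
  obtain \<Omega> :: "real measure" and Ys Y where O: "prob_space \<Omega>" "\<forall>n. Ys n \<in> measurable \<Omega> borel"
    "\<forall>n. distr \<Omega> borel (Ys n) = (L \<circ> id \<circ> r) n" "Y \<in> measurable \<Omega> lborel"
    "\<forall>x \<in> space \<Omega>. (\<lambda>n. Ys n x) \<longlonglongrightarrow> Y x"
    using Skorohod[OF rd' M] by blast
  have "pointwise_representation \<mu> r \<Omega> (\<lambda>k \<omega>. \<phi> (Ys k \<omega>)) (\<lambda>\<omega>. \<phi> (Y \<omega>))"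
    unfolding pointwise_representation_def
  proof (intro conjI allI ballI)
    show "(\<lambda>\<omega>. \<phi> (Ys k \<omega>)) \<in> borel_measurable \<Omega>" for k
      using O(2) by (intro measurable_compose[OF _ \<phi>]) auto
    show "(\<lambda>\<omega>. \<phi> (Y \<omega>)) \<in> borel_measurable \<Omega>"
      using O(4) by (intro measurable_compose[OF _ \<phi>]) auto
    show "(\<lambda>k. \<phi> (Ys k \<omega>)) \<longlonglongrightarrow> \<phi> (Y \<omega>)" if "\<omega> \<in> space \<Omega>" for \<omega>
      using O(5) that continuous_on_tendsto_compose[OF cv] by auto
    show "distr \<Omega> borel (\<lambda>\<omega>. \<phi> (Ys k \<omega>)) = \<mu> (r k)" for k
    proof -
      have "distr \<Omega> borel (\<lambda>\<omega>. \<phi> (Ys k \<omega>)) = distr (distr \<Omega> borel (Ys k)) borel \<phi>"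
        using O(2) by (subst distr_distr) (auto simp: comp_def)
      also have "\<dots> = distr (distr (\<mu> (r k)) borel s) borel \<phi>"
        using O(3) by (simp add: L_def)
      also have "\<dots> = distr (\<mu> (r k)) borel (\<lambda>y. y)"
        using sm by (subst distr_distr) (auto simp: comp_def \<phi>s)
      also have "\<dots> = \<mu> (r k)"
        by (rule distr_id2) (simp add: prob_measuresD[OF \<mu>])
      finally show ?thesis .
    qed
  qed (fact r, fact O)
  then show ?thesis by blast
qed

section \<open>Convergence in the Wasserstein metric\<close>

lemma measurable_prob_measures:
  assumes "\<mu> \<in> prob_measures"
  shows "measurable \<mu> N = measurable borel N"
  by (rule measurable_cong_sets[OF prob_measuresD(2)[OF assms] refl])

lemma le_one_plus_powr:
  fixes x :: real
  assumes "0 \<le> x" "0 < p" "p \<le> q"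
  shows "x powr p \<le> 1 + x powr q"
proof (cases "x \<le> 1")
  case True
  then have "x powr p \<le> 1" using powr_mono2[of p x 1] assms by auto
  then show ?thesis using powr_ge_zero[of x q] by linarith
next
  case False
  then have "x powr p \<le> x powr q" using assms by (intro powr_mono) auto
  then show ?thesis by linarith
qed

lemma nn_integral_moment_mono:
  assumes "\<mu> \<in> prob_measures" "0 < p" "p \<le> q" and "(\<integral>\<^sup>+ x. ennreal (norm x powr q) \<partial>\<mu>) \<le> ennreal C" "0 \<le> C"
  shows "(\<integral>\<^sup>+ x. ennreal (norm x powr p) \<partial>\<mu>) \<le> ennreal (1 + C)"
proof -
  interpret prob_space \<mu> by (rule prob_measuresD[OF assms(1)])
  have [measurable]: "(\<lambda>x. norm x powr q) \<in> borel_measurable \<mu>"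
    unfolding measurable_prob_measures[OF assms(1)] by measurable
  have "(\<integral>\<^sup>+ x. ennreal (norm x powr p) \<partial>\<mu>) \<le> (\<integral>\<^sup>+ x. 1 + ennreal (norm x powr q) \<partial>\<mu>)"
    using le_one_plus_powr[OF norm_ge_zero assms(2,3)]
    by (intro nn_integral_mono) (auto simp flip: ennreal_1 ennreal_plus simp del: ennreal_1 intro!: ennreal_leI)
  also have "\<dots> = 1 + (\<integral>\<^sup>+ x. ennreal (norm x powr q) \<partial>\<mu>)"
    by (subst nn_integral_add) (auto simp: emeasure_space_1)
  also have "\<dots> \<le> 1 + ennreal C" by (intro add_left_mono assms)
  finally show ?thesis using assms by simp
qed

lemma prob_measures_moment_mono:
  assumes "\<mu> \<in> prob_measures_moment q" "0 < p" "p \<le> q"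
  shows "\<mu> \<in> prob_measures_moment p"
proof -
  note m = prob_measures_momentD[OF assms(1)]
  obtain C where C: "0 \<le> C" "(\<integral>\<^sup>+ x. ennreal (norm x powr q) \<partial>\<mu>) = ennreal C"
    using m(5) by (metis ennreal_cases infinity_ennreal_def less_irrefl)
  have "(\<integral>\<^sup>+ x. ennreal (norm x powr p) \<partial>\<mu>) \<le> ennreal (1 + C)"
    by (intro nn_integral_moment_mono[OF m(1) assms(2,3)]) (simp_all add: C)
  then have "(\<integral>\<^sup>+ x. ennreal (norm x powr p) \<partial>\<mu>) < \<infinity>"
    using le_less_trans ennreal_less_top by fastforce
  then show ?thesis using m(1) by (simp add: prob_measures_moment_def)
qed

lemma moment_integrable:
  assumes "\<mu> \<in> prob_measures_moment p"
  shows "integrable \<mu> (\<lambda>x. norm x powr p)"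
proof -
  note m = prob_measures_momentD[OF assms]
  have [measurable]: "(\<lambda>x. norm x powr p) \<in> borel_measurable \<mu>"
    unfolding measurable_prob_measures[OF m(1)] by measurable
  show ?thesis using m(5) by (intro integrableI_bounded) auto
qed

lemma first_moment_integrable:
  assumes "\<mu> \<in> prob_measures_moment p" "1 \<le> p"
  shows "integrable \<mu> (\<lambda>x. x)"
proof -
  have m: "\<mu> \<in> prob_measures_moment 1" by (rule prob_measures_moment_mono[OF assms(1)]) (use assms in auto)
  have [measurable]: "(\<lambda>x. x) \<in> borel_measurable \<mu>"
    unfolding measurable_prob_measures[OF prob_measures_momentD(1)[OF m]] by measurable
  show ?thesis using prob_measures_momentD(5)[OF m] by (intro integrableI_bounded) auto
qed

lemma wasserstein_tendsto_random_variables: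
  fixes X :: "'b \<Rightarrow> 'a::euclidean_space"
  assumes p: "1 \<le> p" and "prob_space \<Omega>" "X \<in> borel_measurable \<Omega>" "\<And>k. Xs k \<in> borel_measurable \<Omega>"
    and lim: "(\<lambda>k. \<integral>\<^sup>+ \<omega>. ennreal (norm (X \<omega> - Xs k \<omega>) powr p) \<partial>\<Omega>) \<longlonglongrightarrow> 0"
  shows "(\<lambda>k. wasserstein_dist p (distr \<Omega> borel X) (distr \<Omega> borel (Xs k))) \<longlonglongrightarrow> 0"
proof (rule LIMSEQ_I)
  fix e :: real assume e: "0 < e"
  have "\<forall>\<^sub>F k in sequentially. (\<integral>\<^sup>+ \<omega>. ennreal (norm (X \<omega> - Xs k \<omega>) powr p) \<partial>\<Omega>) < ennreal ((e/2) powr p)"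
    using lim e by (intro order_tendstoD(2)[OF lim]) auto
  then obtain N where N: "\<And>k. k \<ge> N \<Longrightarrow> (\<integral>\<^sup>+ \<omega>. ennreal (norm (X \<omega> - Xs k \<omega>) powr p) \<partial>\<Omega>) < ennreal ((e/2) powr p)"
    by (auto simp: eventually_sequentially)
  have "wasserstein_dist p (distr \<Omega> borel X) (distr \<Omega> borel (Xs k)) \<le> e/2" if "k \<ge> N" for k
    using N[OF that] e p
    by (intro wasserstein_dist_le[OF _ coupling_of_random_variables(1)[OF assms(2-4)]])
      (auto simp: coupling_of_random_variables(2)[OF assms(2-4)])
  then show "\<exists>N. \<forall>k\<ge>N. norm (wasserstein_dist p (distr \<Omega> borel X) (distr \<Omega> borel (Xs k)) - 0) < e"
    using e by (intro exI[of _ N]) (fastforce simp: abs_of_nonneg[OF wasserstein_dist_nonneg])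
qed

text \<open>The Riesz-Scheffe argument. Fatou's lemma is applied to the nonnegative functions
  \<open>g k\<close>; since the moments converge, the integrals of their first parts tend to the
  integral of the limit, which leaves nothing for the subtracted p-th power of the
  difference.\<close>

lemma Lp_convergence_of_moments:
  fixes X :: "'b \<Rightarrow> 'a::euclidean_space"
  assumes p: "0 < p" and "prob_space \<Omega>"
    and Xm[measurable]: "X \<in> borel_measurable \<Omega>" "\<And>k. Xs k \<in> borel_measurable \<Omega>"
    and lim: "\<And>\<omega>. \<omega> \<in> space \<Omega> \<Longrightarrow> (\<lambda>k. Xs k \<omega>) \<longlonglongrightarrow> X \<omega>"
    and int: "integrable \<Omega> (\<lambda>\<omega>. norm (X \<omega>) powr p)" "\<And>k. integrable \<Omega> (\<lambda>\<omega>. norm (Xs k \<omega>) powr p)"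
    and mom: "(\<lambda>k. \<integral>\<omega>. norm (Xs k \<omega>) powr p \<partial>\<Omega>) \<longlonglongrightarrow> (\<integral>\<omega>. norm (X \<omega>) powr p \<partial>\<Omega>)"
  shows "(\<lambda>k. \<integral>\<^sup>+ \<omega>. ennreal (norm (X \<omega> - Xs k \<omega>) powr p) \<partial>\<Omega>) \<longlonglongrightarrow> 0"
proof -
  interpret prob_space \<Omega> by fact
  define g where "g k \<omega> = 2 powr p * (norm (X \<omega>) powr p + norm (Xs k \<omega>) powr p) - norm (X \<omega> - Xs k \<omega>) powr p" for k \<omega>
  have g0: "0 \<le> g k \<omega>" for k \<omega>
    unfolding g_def using norm_diff_powr_le[of p "X \<omega>" "Xs k \<omega>"] p by simp
  define A where "A = (\<integral>\<omega>. norm (X \<omega>) powr p \<partial>\<Omega>)"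
  define B where "B k = (\<integral>\<omega>. norm (Xs k \<omega>) powr p \<partial>\<Omega>)" for k
  define D where "D k = (\<integral>\<omega>. norm (X \<omega> - Xs k \<omega>) powr p \<partial>\<Omega>)" for k
  have Di: "integrable \<Omega> (\<lambda>\<omega>. norm (X \<omega> - Xs k \<omega>) powr p)" for k
  proof (rule Bochner_Integration.integrable_bound)
    show "integrable \<Omega> (\<lambda>\<omega>. 2 powr p * (norm (X \<omega>) powr p + norm (Xs k \<omega>) powr p))" using int by auto
    show "AE \<omega> in \<Omega>. norm (norm (X \<omega> - Xs k \<omega>) powr p) \<le> norm (2 powr p * (norm (X \<omega>) powr p + norm (Xs k \<omega>) powr p))"
      using norm_diff_powr_le[of p] p by (intro AE_I2) (simp add: order_less_imp_le)
  qed simp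
  have gi: "(\<integral>\<^sup>+ \<omega>. ennreal (g k \<omega>) \<partial>\<Omega>) = ennreal (2 powr p * (A + B k) - D k)" for k
  proof -
    have "(\<integral>\<^sup>+ \<omega>. ennreal (g k \<omega>) \<partial>\<Omega>) = ennreal (\<integral>\<omega>. g k \<omega> \<partial>\<Omega>)"
      using int Di g0 by (intro nn_integral_eq_integral) (auto simp: g_def[abs_def])
    also have "(\<integral>\<omega>. g k \<omega> \<partial>\<Omega>) = 2 powr p * (A + B k) - D k"
      unfolding g_def A_def B_def D_def using int Di by simp
    finally show ?thesis .
  qed
  have gl: "(\<lambda>k. ennreal (g k \<omega>)) \<longlonglongrightarrow> ennreal (2 powr p * (2 * norm (X \<omega>) powr p))" if "\<omega> \<in> space \<Omega>" for \<omega>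
  proof -
    have "(\<lambda>k. norm (X \<omega> - Xs k \<omega>) powr p) \<longlonglongrightarrow> norm (X \<omega> - X \<omega>) powr p"
      using p by (intro tendsto_powr2 tendsto_intros lim that) auto
    moreover have "(\<lambda>k. norm (Xs k \<omega>) powr p) \<longlonglongrightarrow> norm (X \<omega>) powr p"
      using p by (intro tendsto_powr2 tendsto_intros lim that) auto
    ultimately have "(\<lambda>k. g k \<omega>) \<longlonglongrightarrow> 2 powr p * (norm (X \<omega>) powr p + norm (X \<omega>) powr p) - norm (X \<omega> - X \<omega>) powr p"
      unfolding g_def by (intro tendsto_diff tendsto_mult tendsto_add tendsto_const)
    then show ?thesis using p by (intro tendsto_ennrealI) simp
  qed
  have "ennreal (2 powr p * (2 * A)) = (\<integral>\<^sup>+ \<omega>. ennreal (2 powr p * (2 * norm (X \<omega>) powr p)) \<partial>\<Omega>)"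
    using int(1) by (subst nn_integral_eq_integral) (auto simp: A_def)
  also have "\<dots> = (\<integral>\<^sup>+ \<omega>. liminf (\<lambda>k. ennreal (g k \<omega>)) \<partial>\<Omega>)"
    by (intro nn_integral_cong) (metis gl lim_imp_Liminf sequentially_bot)
  also have "\<dots> \<le> liminf (\<lambda>k. \<integral>\<^sup>+ \<omega>. ennreal (g k \<omega>) \<partial>\<Omega>)"
    unfolding g_def by (intro nn_integral_liminf) measurable
  finally have fatou: "ennreal (2 powr p * (2 * A)) \<le> liminf (\<lambda>k. ennreal (2 powr p * (A + B k) - D k))"
    unfolding gi .
  have A0: "0 \<le> A" unfolding A_def by simp
  have "D \<longlonglongrightarrow> 0"
  proof (rule LIMSEQ_I)
    fix e :: real assume e: "0 < e"
    have D0: "0 \<le> D k" for k unfolding D_def by simp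
    have "\<forall>\<^sub>F k in sequentially. 2 powr p * (2 * A) - e/2 < 2 powr p * (A + B k) - D k"
    \<comment> \<open>\<open>ennreal\<close> truncates negative numbers, so a negative left side is
      treated separately, using that the integral of \<open>g k\<close> is nonnegative.\<close>
    proof (cases "2 powr p * (2 * A) - e/2 < 0")
      case True
      have "0 \<le> 2 powr p * (A + B k) - D k" for k
      proof -
        have "0 \<le> (\<integral>\<omega>. g k \<omega> \<partial>\<Omega>)" using g0 by (intro integral_nonneg_AE) auto
        also have "(\<integral>\<omega>. g k \<omega> \<partial>\<Omega>) = 2 powr p * (A + B k) - D k"
          unfolding g_def A_def B_def D_def using int Di by simp
        finally show ?thesis .
      qed
      then show ?thesis using True by (intro always_eventually allI) (rule less_le_trans)
    next
      case False
      have "ennreal (2 powr p * (2 * A) - e/2) < ennreal (2 powr p * (2 * A))"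
        using e False by (subst ennreal_less_iff) auto
      then have "ennreal (2 powr p * (2 * A) - e/2) < liminf (\<lambda>k. ennreal (2 powr p * (A + B k) - D k))"
        using fatou by (rule less_le_trans)
      then have "\<forall>\<^sub>F k in sequentially. ennreal (2 powr p * (2 * A) - e/2) < ennreal (2 powr p * (A + B k) - D k)"
        by (rule less_LiminfD)
      then show ?thesis using False by (auto simp: ennreal_less_iff elim: eventually_mono)
    qed
    moreover have "\<forall>\<^sub>F k in sequentially. 2 powr p * (A + B k) < 2 powr p * (2 * A) + e/2"
    proof (rule order_tendstoD(2))
      show "(\<lambda>k. 2 powr p * (A + B k)) \<longlonglongrightarrow> 2 powr p * (A + A)"
        using mom unfolding A_def[symmetric] B_def[symmetric] by (intro tendsto_intros)
      show "2 powr p * (A + A) < 2 powr p * (2 * A) + e/2" using e by simp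
    qed
    ultimately have "\<forall>\<^sub>F k in sequentially. norm (D k - 0) < e"
      by eventually_elim (use D0 in auto)
    then show "\<exists>N. \<forall>k\<ge>N. norm (D k - 0) < e" by (simp add: eventually_sequentially)
  qed
  then have "(\<lambda>k. ennreal (D k)) \<longlonglongrightarrow> ennreal 0" by (rule tendsto_ennrealI)
  moreover have "(\<integral>\<^sup>+ \<omega>. ennreal (norm (X \<omega> - Xs k \<omega>) powr p) \<partial>\<Omega>) = ennreal (D k)" for k
    unfolding D_def using Di by (intro nn_integral_eq_integral) auto
  ultimately show ?thesis by simp
qed

text \<open>The moment of order \<open>l\<close> gives uniform integrability of order
  \<open>p\<close>: below a level \<open>N\<close> the distance is handled by dominated convergence,
  above it its p-th power is at most \<open>N powr (p - l)\<close> times its l-th power. Fatou's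
  lemma gives the moment bound of the limit.\<close>

lemma Lp_convergence_bounded_moment:
  fixes X :: "'b \<Rightarrow> 'a::euclidean_space"
  assumes p: "0 < p" "p < l" and "prob_space \<Omega>"
    and Xm[measurable]: "X \<in> borel_measurable \<Omega>" "\<And>k. Xs k \<in> borel_measurable \<Omega>"
    and lim: "\<And>\<omega>. \<omega> \<in> space \<Omega> \<Longrightarrow> (\<lambda>k. Xs k \<omega>) \<longlonglongrightarrow> X \<omega>"
    and C: "\<And>k. (\<integral>\<^sup>+ \<omega>. ennreal (norm (Xs k \<omega>) powr l) \<partial>\<Omega>) \<le> ennreal C" "0 \<le> C"
  shows "(\<integral>\<^sup>+ \<omega>. ennreal (norm (X \<omega>) powr l) \<partial>\<Omega>) \<le> ennreal C"
    and "(\<lambda>k. \<integral>\<^sup>+ \<omega>. ennreal (norm (X \<omega> - Xs k \<omega>) powr p) \<partial>\<Omega>) \<longlonglongrightarrow> 0"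
proof -
  interpret prob_space \<Omega> by fact
  have "(\<integral>\<^sup>+ \<omega>. ennreal (norm (X \<omega>) powr l) \<partial>\<Omega>) = (\<integral>\<^sup>+ \<omega>. liminf (\<lambda>k. ennreal (norm (Xs k \<omega>) powr l)) \<partial>\<Omega>)"
  proof (rule nn_integral_cong)
    fix \<omega> assume "\<omega> \<in> space \<Omega>"
    then have "(\<lambda>k. ennreal (norm (Xs k \<omega>) powr l)) \<longlonglongrightarrow> ennreal (norm (X \<omega>) powr l)"
      using p by (intro tendsto_ennrealI tendsto_powr2 tendsto_intros lim) auto
    then show "ennreal (norm (X \<omega>) powr l) = liminf (\<lambda>k. ennreal (norm (Xs k \<omega>) powr l))"
      by (metis lim_imp_Liminf sequentially_bot)
  qed
  also have "\<dots> \<le> liminf (\<lambda>k. \<integral>\<^sup>+ \<omega>. ennreal (norm (Xs k \<omega>) powr l) \<partial>\<Omega>)"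
    by (intro nn_integral_liminf) measurable
  also have "\<dots> \<le> ennreal C"
    using C by (intro Liminf_le) (auto intro!: always_eventually)
  finally show 1: "(\<integral>\<^sup>+ \<omega>. ennreal (norm (X \<omega>) powr l) \<partial>\<Omega>) \<le> ennreal C" .
  define D where "D k \<omega> = norm (X \<omega> - Xs k \<omega>)" for k \<omega>
  have D0: "0 \<le> D k \<omega>" for k \<omega> by (simp add: D_def)
  have [measurable]: "D k \<in> borel_measurable \<Omega>" for k unfolding D_def by measurable
  define C' where "C' = 2 powr l * (C + C) + 1"
  have C': "0 < C'" using C(2) unfolding C'_def by (intro add_nonneg_pos) auto
  have Dl: "(\<integral>\<^sup>+ \<omega>. ennreal (D k \<omega> powr l) \<partial>\<Omega>) \<le> ennreal C'" for k
  proof -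
    have "(\<integral>\<^sup>+ \<omega>. ennreal (D k \<omega> powr l) \<partial>\<Omega>)
        \<le> (\<integral>\<^sup>+ \<omega>. ennreal (2 powr l) * (ennreal (norm (X \<omega>) powr l) + ennreal (norm (Xs k \<omega>) powr l)) \<partial>\<Omega>)"
      unfolding D_def using norm_diff_powr_le[of l] p
      by (intro nn_integral_mono) (auto simp flip: ennreal_plus ennreal_mult intro!: ennreal_leI)
    also have "\<dots> = ennreal (2 powr l) * ((\<integral>\<^sup>+ \<omega>. ennreal (norm (X \<omega>) powr l) \<partial>\<Omega>) + (\<integral>\<^sup>+ \<omega>. ennreal (norm (Xs k \<omega>) powr l) \<partial>\<Omega>))"
      by (simp add: nn_integral_cmult nn_integral_add)
    also have "\<dots> \<le> ennreal (2 powr l) * (ennreal C + ennreal C)"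
      by (intro mult_left_mono add_mono 1 C) auto
    also have "\<dots> = ennreal (2 powr l * (C + C))" using C(2) by (simp flip: ennreal_plus ennreal_mult)
    also have "\<dots> \<le> ennreal C'" unfolding C'_def by (intro ennreal_leI) simp
    finally show ?thesis .
  qed
  show "(\<lambda>k. \<integral>\<^sup>+ \<omega>. ennreal (norm (X \<omega> - Xs k \<omega>) powr p) \<partial>\<Omega>) \<longlonglongrightarrow> 0"
    unfolding D_def[symmetric]
  proof (rule order_tendstoI)
    fix a :: ennreal assume a: "0 < a"
    then obtain e where e: "0 < e" "ennreal e < a"
      by (metis ennreal_0 ennreal_less_zero_iff ennreal_cases dense less_top_ennreal order_less_trans linorder_not_less top.not_eq_extremum)
    \<comment> \<open>Solves \<open>N powr (p - l) * C' = e / 2\<close>, so the part above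
      \<open>N\<close> takes half of the error.\<close>
    define N where "N = (2 * C' / e) powr (1 / (l - p))"
    have N: "0 < N" "N powr (p - l) * C' = e / 2"
    proof -
      show "0 < N" unfolding N_def using C' e by simp
      have "N powr (p - l) = (2 * C' / e) powr (- 1)"
      proof -
        have "(p - l) / (l - p) = - 1" using p by (simp add: field_simps)
        then show ?thesis unfolding N_def powr_powr by simp
      qed
      also have "\<dots> = e / (2 * C')" using C' e by (simp add: powr_minus_divide)
      finally show "N powr (p - l) * C' = e / 2" using C' by simp
    qed
    have split: "D k \<omega> powr p \<le> min (D k \<omega>) N powr p + N powr (p - l) * D k \<omega> powr l" for k \<omega>
    proof (cases "D k \<omega> \<le> N")
      case True
      then show ?thesis by simp
    next
      case False
      then have "D k \<omega> powr p = D k \<omega> powr (p - l) * D k \<omega> powr l" using N by (simp flip: powr_add)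
      also have "\<dots> \<le> N powr (p - l) * D k \<omega> powr l"
        using False N p by (intro mult_right_mono powr_mono2') auto
      finally show ?thesis using powr_ge_zero[of "min (D k \<omega>) N" p] by linarith
    qed
    have "(\<lambda>k. \<integral>\<omega>. min (D k \<omega>) N powr p \<partial>\<Omega>) \<longlonglongrightarrow> (\<integral>\<omega>. 0 \<partial>\<Omega>)"
    proof (rule integral_dominated_convergence[where w="\<lambda>_. N powr p"])
      show "AE \<omega> in \<Omega>. (\<lambda>k. min (D k \<omega>) N powr p) \<longlonglongrightarrow> 0"
      proof (rule AE_I2)
        fix \<omega> assume "\<omega> \<in> space \<Omega>"
        then have "(\<lambda>k. min (D k \<omega>) N powr p) \<longlonglongrightarrow> min (norm (X \<omega> - X \<omega>)) N powr p"
          unfolding D_def using p N by (intro tendsto_powr2 tendsto_intros lim) (auto simp: min_def)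
        then show "(\<lambda>k. min (D k \<omega>) N powr p) \<longlonglongrightarrow> 0" using N by simp
      qed
      show "AE \<omega> in \<Omega>. norm (min (D k \<omega>) N powr p) \<le> N powr p" for k
        using p N D0 by (intro AE_I2) (auto intro!: powr_mono2)
    qed auto
    then have "\<forall>\<^sub>F k in sequentially. (\<integral>\<omega>. min (D k \<omega>) N powr p \<partial>\<Omega>) < e / 2"
      using e by (intro order_tendstoD(2)) auto
    then show "\<forall>\<^sub>F k in sequentially. (\<integral>\<^sup>+ \<omega>. ennreal (D k \<omega> powr p) \<partial>\<Omega>) < a"
    proof eventually_elim
      case (elim k)
      have i: "integrable \<Omega> (\<lambda>\<omega>. min (D k \<omega>) N powr p)"
        using p N D0 by (intro integrable_const_bound[where B="N powr p"]) (auto intro!: AE_I2 powr_mono2)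
      have "(\<integral>\<^sup>+ \<omega>. ennreal (D k \<omega> powr p) \<partial>\<Omega>)
          \<le> (\<integral>\<^sup>+ \<omega>. ennreal (min (D k \<omega>) N powr p) + ennreal (N powr (p - l)) * ennreal (D k \<omega> powr l) \<partial>\<Omega>)"
        using split by (intro nn_integral_mono) (auto simp flip: ennreal_plus ennreal_mult intro!: ennreal_leI)
      also have "\<dots> = (\<integral>\<^sup>+ \<omega>. ennreal (min (D k \<omega>) N powr p) \<partial>\<Omega>) + ennreal (N powr (p - l)) * (\<integral>\<^sup>+ \<omega>. ennreal (D k \<omega> powr l) \<partial>\<Omega>)"
        by (simp add: nn_integral_add nn_integral_cmult)
      also have "\<dots> \<le> ennreal (e / 2) + ennreal (N powr (p - l)) * ennreal C'"
        using elim i by (intro add_mono mult_left_mono Dl) (auto simp: nn_integral_eq_integral intro!: ennreal_leI)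
      also have "\<dots> = ennreal e" using N C' e by (simp flip: ennreal_plus ennreal_mult)
      finally show ?case using e(2) by (rule le_less_trans)
    qed
  qed simp
qed

section \<open>Weak limits along the Wasserstein metric\<close>

lemma frequently_subseq:
  assumes "\<exists>\<^sub>F n in sequentially. P n"
  shows "\<exists>r :: nat \<Rightarrow> nat. strict_mono r \<and> (\<forall>n. P (r n))"
proof -
  have "infinite {n. P n}"
    using assms by (simp add: INFM_iff_infinite[symmetric] cofinite_eq_sequentially)
  then show ?thesis using infinite_enumerate[of "{n. P n}"] by auto
qed

text \<open>The pointwise limit of a represented subsequence has some law; the bump integrals, which
  converge to those of \<open>\<mu>\<close> by assumption and to those of the limit variable by
  dominated convergence, identify it.\<close>

lemma weak_limit_representation:
  fixes \<mu> :: "'a::euclidean_space measure"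
  assumes mu: "\<mu> \<in> prob_measures" and nu: "\<And>k. \<nu> k \<in> prob_measures"
    and C: "\<And>k. (\<integral>\<^sup>+ x. ennreal (norm x) \<partial>\<nu> k) \<le> ennreal C"
    and B: "countable B" "topological_basis B"
    and lim: "\<And>F m. F \<subseteq> B \<Longrightarrow> finite F \<Longrightarrow> F \<noteq> {} \<Longrightarrow>
      (\<lambda>k. \<integral>x. open_bump (\<Inter>F) m x \<partial>\<nu> k) \<longlonglongrightarrow> (\<integral>x. open_bump (\<Inter>F) m x \<partial>\<mu>)"
  shows "\<exists>r \<Omega> Xs X. pointwise_representation \<nu> r \<Omega> Xs X \<and> distr \<Omega> borel X = \<mu>"
proof -
  obtain r \<Omega> Xs X where rep: "pointwise_representation \<nu> r \<Omega> Xs X"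
    using tight_subsequence_representation[of \<nu>, OF nu C] by blast
  note O = pointwise_representationD(2)[OF rep] and Xs[measurable] = pointwise_representationD(3)[OF rep]
    and X[measurable] = pointwise_representationD(5)[OF rep] and r = pointwise_representationD(1)[OF rep]
    and d = pointwise_representationD(4)[OF rep] and c = pointwise_representationD(6)[OF rep]
  interpret prob_space \<Omega> by fact
  have "distr \<Omega> borel X = \<mu>"
  proof (rule prob_measures_eqI_bump[OF distr_in_prob_measures[OF O X] mu B])
    fix F m assume F: "F \<subseteq> B" "finite F" "F \<noteq> {}"
    have "(\<lambda>k. \<integral>\<omega>. open_bump (\<Inter>F) m (Xs k \<omega>) \<partial>\<Omega>) \<longlonglongrightarrow> (\<integral>\<omega>. open_bump (\<Inter>F) m (X \<omega>) \<partial>\<Omega>)"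
    proof (rule integral_dominated_convergence[where w="\<lambda>_. 1"])
      show "AE \<omega> in \<Omega>. (\<lambda>k. open_bump (\<Inter>F) m (Xs k \<omega>)) \<longlonglongrightarrow> open_bump (\<Inter>F) m (X \<omega>)"
        by (intro AE_I2 continuous_on_tendsto_compose[OF open_bump_continuous[of UNIV] c]) auto
    qed (auto simp: open_bump_bounds)
    moreover have "(\<integral>\<omega>. open_bump (\<Inter>F) m (Xs k \<omega>) \<partial>\<Omega>) = (\<integral>x. open_bump (\<Inter>F) m x \<partial>\<nu> (r k))" for k
      unfolding d[symmetric] by (subst integral_distr) auto
    ultimately have "(\<lambda>k. \<integral>x. open_bump (\<Inter>F) m x \<partial>\<nu> (r k)) \<longlonglongrightarrow> (\<integral>\<omega>. open_bump (\<Inter>F) m (X \<omega>) \<partial>\<Omega>)"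
      by simp
    moreover have "(\<lambda>k. \<integral>x. open_bump (\<Inter>F) m x \<partial>\<nu> (r k)) \<longlonglongrightarrow> (\<integral>x. open_bump (\<Inter>F) m x \<partial>\<mu>)"
      using LIMSEQ_subseq_LIMSEQ[OF lim[OF F] r] by (simp add: comp_def)
    ultimately have "(\<integral>\<omega>. open_bump (\<Inter>F) m (X \<omega>) \<partial>\<Omega>) = (\<integral>x. open_bump (\<Inter>F) m x \<partial>\<mu>)"
      by (rule LIMSEQ_unique)
    then show "(\<integral>x. open_bump (\<Inter>F) m x \<partial>distr \<Omega> borel X) = (\<integral>x. open_bump (\<Inter>F) m x \<partial>\<mu>)"
      by (subst integral_distr) auto
  qed
  with rep show ?thesis by blast
qed

text \<open>Bounds the first moments along a convergent sequence, which gives its tightness. Of the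
  added 2, one unit comes from estimating a length by 1 plus its p-th power, the other from a
  transport cost below 1.\<close>

lemma wasserstein_first_moment_le:
  fixes \<mu> \<nu> :: "'a::euclidean_space measure"
  assumes p: "1 \<le> p" and "\<mu> \<in> prob_measures_moment p" "\<nu> \<in> prob_measures_moment p" "wasserstein_dist p \<mu> \<nu> < 1"
  shows "(\<integral>\<^sup>+ x. ennreal (norm x) \<partial>\<nu>) \<le> (\<integral>\<^sup>+ x. ennreal (norm x) \<partial>\<mu>) + 2"
proof -
  obtain \<gamma> where \<gamma>: "\<gamma> \<in> couplings \<mu> \<nu>" "(\<integral>\<^sup>+ (x, y). ennreal (norm (x - y) powr p) \<partial>\<gamma>) < ennreal (1 powr p)"
    using wasserstein_dist_lessE[OF _ assms(2-4)] p by auto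
  note g = couplingsD[OF \<gamma>(1)]
  interpret prob_space \<gamma> by fact
  note [measurable] = g(6,7)
  have "(\<integral>\<^sup>+ x. ennreal (norm x) \<partial>\<nu>) = (\<integral>\<^sup>+ w. ennreal (norm (snd w)) \<partial>\<gamma>)"
    by (subst g(5)[symmetric], subst nn_integral_distr) auto
  also have "\<dots> \<le> (\<integral>\<^sup>+ w. ennreal (norm (fst w)) + (1 + ennreal (norm (fst w - snd w) powr p)) \<partial>\<gamma>)"
  proof (rule nn_integral_mono)
    fix w :: "'a \<times> 'a"
    have "norm (snd w) \<le> norm (fst w) + norm (fst w - snd w)" by norm
    also have "norm (fst w - snd w) \<le> 1 + norm (fst w - snd w) powr p"
      using le_one_plus_powr[of "norm (fst w - snd w)" 1 p] p by simp
    finally show "ennreal (norm (snd w)) \<le> ennreal (norm (fst w)) + (1 + ennreal (norm (fst w - snd w) powr p))"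
      by (simp flip: ennreal_1 ennreal_plus del: ennreal_1 add: ennreal_leI)
  qed
  also have "\<dots> = (\<integral>\<^sup>+ w. ennreal (norm (fst w)) \<partial>\<gamma>) + (1 + (\<integral>\<^sup>+ (x, y). ennreal (norm (x - y) powr p) \<partial>\<gamma>))"
    by (simp add: nn_integral_add emeasure_space_1 case_prod_unfold)
  also have "\<dots> \<le> (\<integral>\<^sup>+ w. ennreal (norm (fst w)) \<partial>\<gamma>) + (1 + 1)"
    using \<gamma>(2) by (intro add_left_mono) auto
  also have "(\<integral>\<^sup>+ w. ennreal (norm (fst w)) \<partial>\<gamma>) = (\<integral>\<^sup>+ x. ennreal (norm x) \<partial>\<mu>)"
    by (subst g(4)[symmetric], subst nn_integral_distr) auto
  finally show ?thesis by simp
qed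

text \<open>For a test function that is merely continuous no Lipschitz estimate is available. If the
  integrals stayed away from the limit along a subsequence, a further subsequence would have a
  pointwise representation, and dominated convergence would contradict this.\<close>

lemma wasserstein_imp_weak_convergence:
  fixes \<mu> :: "'a::euclidean_space measure" and f :: "'a \<Rightarrow> real"
  assumes p: "1 \<le> p" and mu: "\<mu> \<in> prob_measures_moment p" and nu: "\<And>k. \<nu> k \<in> prob_measures_moment p"
    and lim: "(\<lambda>k. wasserstein_dist p \<mu> (\<nu> k)) \<longlonglongrightarrow> 0"
    and f: "continuous_on UNIV f" and fb: "\<And>x. \<bar>f x\<bar> \<le> b"
  shows "(\<lambda>k. \<integral>x. f x \<partial>\<nu> k) \<longlonglongrightarrow> (\<integral>x. f x \<partial>\<mu>)"
proof (rule ccontr)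
  assume "\<not> ?thesis"
  then obtain e where e: "0 < e" "\<not> (\<forall>\<^sub>F k in sequentially. dist (\<integral>x. f x \<partial>\<nu> k) (\<integral>x. f x \<partial>\<mu>) < e)"
    by (auto simp: tendsto_iff)
  have fm[measurable]: "f \<in> borel_measurable borel" by (rule borel_measurable_continuous_onI[OF f])
  have ev1: "\<forall>\<^sub>F k in sequentially. wasserstein_dist p \<mu> (\<nu> k) < 1"
    using lim by (rule order_tendstoD) simp
  have fr: "\<exists>\<^sub>F k in sequentially. \<not> dist (\<integral>x. f x \<partial>\<nu> k) (\<integral>x. f x \<partial>\<mu>) < e"
    using e(2) by (simp add: not_eventually)
  from frequently_subseq[OF frequently_eventually_frequently[OF fr ev1]]
  obtain q :: "nat \<Rightarrow> nat" where q: "strict_mono q"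
    and qP: "\<And>k. \<not> dist (\<integral>x. f x \<partial>\<nu> (q k)) (\<integral>x. f x \<partial>\<mu>) < e \<and> wasserstein_dist p \<mu> (\<nu> (q k)) < 1"
    by blast
  have lim': "(\<lambda>k. wasserstein_dist p \<mu> (\<nu> (q k))) \<longlonglongrightarrow> 0"
    using LIMSEQ_subseq_LIMSEQ[OF lim q] by (simp add: comp_def)
  have mu1: "\<mu> \<in> prob_measures_moment 1" by (rule prob_measures_moment_mono[OF mu]) (use p in auto)
  obtain A where A: "0 \<le> A" "(\<integral>\<^sup>+ x. ennreal (norm x) \<partial>\<mu>) = ennreal A"
    using prob_measures_momentD(5)[OF mu1] by (simp add: less_top) (metis ennreal_cases top.not_eq_extremum)
  have Cb: "(\<integral>\<^sup>+ x. ennreal (norm x) \<partial>\<nu> (q k)) \<le> ennreal (A + 2)" for k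
    using wasserstein_first_moment_le[OF p mu nu, of "q k"] qP[of k] A by simp
  obtain B :: "'a set set" where B: "countable B" "topological_basis B"
    using ex_countable_basis by blast
  have bl: "(\<lambda>k. \<integral>x. open_bump (\<Inter>F) m x \<partial>\<nu> (q k)) \<longlonglongrightarrow> (\<integral>x. open_bump (\<Inter>F) m x \<partial>\<mu>)" for F m
    by (rule wasserstein_lipschitz_tendsto[OF p mu nu _ _ _ _ lim', where B=1 and L="real m"])
      (simp_all add: open_bump_lipschitz open_bump_bounds)
  obtain r \<Omega> Xs X where rep: "pointwise_representation (\<lambda>k. \<nu> (q k)) r \<Omega> Xs X" and dX: "distr \<Omega> borel X = \<mu>"
    using weak_limit_representation[OF prob_measures_momentD(1)[OF mu] prob_measures_momentD(1)[OF nu] Cb B bl] by blast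
  note O = pointwise_representationD(2)[OF rep] and Xs[measurable] = pointwise_representationD(3)[OF rep]
    and X[measurable] = pointwise_representationD(5)[OF rep]
    and d = pointwise_representationD(4)[OF rep] and c = pointwise_representationD(6)[OF rep]
  interpret prob_space \<Omega> by fact
  have "(\<lambda>k. \<integral>\<omega>. f (Xs k \<omega>) \<partial>\<Omega>) \<longlonglongrightarrow> (\<integral>\<omega>. f (X \<omega>) \<partial>\<Omega>)"
  proof (rule integral_dominated_convergence[where w="\<lambda>_. b"])
    show "AE \<omega> in \<Omega>. (\<lambda>k. f (Xs k \<omega>)) \<longlonglongrightarrow> f (X \<omega>)"
      by (intro AE_I2 continuous_on_tendsto_compose[OF f c]) auto
  qed (auto simp: fb)
  moreover have "(\<integral>\<omega>. f (Xs k \<omega>) \<partial>\<Omega>) = (\<integral>x. f x \<partial>\<nu> (q (r k)))" for k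
    unfolding d[symmetric] by (subst integral_distr) auto
  moreover have "(\<integral>\<omega>. f (X \<omega>) \<partial>\<Omega>) = (\<integral>x. f x \<partial>\<mu>)"
    unfolding dX[symmetric] by (subst integral_distr) auto
  ultimately have "(\<lambda>k. \<integral>x. f x \<partial>\<nu> (q (r k))) \<longlonglongrightarrow> (\<integral>x. f x \<partial>\<mu>)" by simp
  then have "\<forall>\<^sub>F k in sequentially. dist (\<integral>x. f x \<partial>\<nu> (q (r k))) (\<integral>x. f x \<partial>\<mu>) < e"
    using e(1) by (rule tendstoD)
  then show False using qP by (auto simp: eventually_sequentially)
qed

section \<open>The Wasserstein topology on centered measures\<close>

lemma centered_prob_measuresD:
  assumes "\<mu> \<in> centered_prob_measures p"
  shows "\<mu> \<in> prob_measures_moment p" "(\<integral>x. x \<partial>\<mu>) = 0"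
  using assms by (auto simp: centered_prob_measures_def)

lemma centered_subset_prob_measures: "centered_prob_measures p \<subseteq> prob_measures"
  using prob_measures_momentD(1) centered_prob_measuresD(1) by blast

lemma topspace_centered_wasserstein:
  assumes "1 \<le> p"
  shows "topspace (centered_wasserstein_topology p :: 'a::euclidean_space measure topology) = centered_prob_measures p"
proof -
  interpret Metric_space "prob_measures_moment p :: 'a measure set" "wasserstein_dist p"
    by (rule Metric_space_wasserstein[OF assms])
  show ?thesis
    unfolding centered_wasserstein_topology_def wasserstein_topology_def
    by (auto simp: centered_prob_measures_def)
qed

lemma openin_centered_wassersteinD:
  fixes U :: "'a::euclidean_space measure set"
  assumes "1 \<le> p" "openin (centered_wasserstein_topology p) U" "\<mu> \<in> U"
  shows "\<exists>r>0. \<forall>\<nu>\<in>centered_prob_measures p. wasserstein_dist p \<mu> \<nu> < r \<longrightarrow> \<nu> \<in> U"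
proof -
  interpret Metric_space "prob_measures_moment p :: 'a measure set" "wasserstein_dist p"
    by (rule Metric_space_wasserstein[OF assms(1)])
  obtain T where T: "openin mtopology T" "U = T \<inter> centered_prob_measures p"
    using assms(2) unfolding centered_wasserstein_topology_def wasserstein_topology_def openin_subtopology
    by auto
  then obtain r where "r > 0" "mball \<mu> r \<subseteq> T"
    using assms(3) by (auto simp: openin_mtopology)
  moreover have "\<mu> \<in> prob_measures_moment p" using T assms(3) by (auto dest: centered_prob_measuresD)
  ultimately have "\<nu> \<in> U" if "\<nu> \<in> centered_prob_measures p" "wasserstein_dist p \<mu> \<nu> < r" for \<nu>
    using T(2) that centered_prob_measuresD(1)[OF that(1)] by (auto simp: subset_iff)
  then show ?thesis using \<open>r > 0\<close> by blast
qed

text \<open>If no ball around a point of \<open>U\<close> met the centered measures inside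
  \<open>U\<close> only, choosing an outside point in each ball of radius \<open>1 / (k + 1)\<close>
  would give a sequence that \<open>seq\<close> forbids.\<close>

lemma openin_centered_wasserstein_sequentially:
  fixes U :: "'a::euclidean_space measure set"
  assumes p: "1 \<le> p" and U: "U \<subseteq> centered_prob_measures p"
    and seq: "\<And>\<mu> \<nu>. \<mu> \<in> U \<Longrightarrow> (\<And>k. \<nu> k \<in> centered_prob_measures p) \<Longrightarrow>
      (\<lambda>k. wasserstein_dist p \<mu> (\<nu> k)) \<longlonglongrightarrow> 0 \<Longrightarrow> \<exists>k. \<nu> k \<in> U"
  shows "openin (centered_wasserstein_topology p) U"
proof -
  interpret Metric_space "prob_measures_moment p :: 'a measure set" "wasserstein_dist p"
    by (rule Metric_space_wasserstein[OF p])
  have ex: "\<exists>r>0. \<forall>\<nu>\<in>centered_prob_measures p. wasserstein_dist p \<mu> \<nu> < r \<longrightarrow> \<nu> \<in> U" if "\<mu> \<in> U" for \<mu>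
  proof (rule ccontr)
    assume neg: "\<not> ?thesis"
    have "\<exists>\<nu>\<in>centered_prob_measures p. wasserstein_dist p \<mu> \<nu> < 1 / real (Suc k) \<and> \<nu> \<notin> U" for k
      using neg by (metis of_nat_0_less_iff zero_less_Suc zero_less_divide_1_iff)
    then obtain \<nu> where \<nu>: "\<And>k. \<nu> k \<in> centered_prob_measures p"
      "\<And>k. wasserstein_dist p \<mu> (\<nu> k) < 1 / real (Suc k)" "\<And>k. \<nu> k \<notin> U" by metis
    have "(\<lambda>k. wasserstein_dist p \<mu> (\<nu> k)) \<longlonglongrightarrow> 0"
    proof (rule tendsto_sandwich[of "\<lambda>_. 0" _ _ "\<lambda>k. 1 / real (Suc k)"])
      show "(\<lambda>k. 1 / real (Suc k)) \<longlonglongrightarrow> 0" using LIMSEQ_inverse_real_of_nat by (simp add: inverse_eq_divide)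
    qed (use \<nu>(2) wasserstein_dist_nonneg in \<open>auto intro!: always_eventually less_imp_le\<close>)
    then show False using seq[of \<mu> \<nu>, OF that \<nu>(1)] \<nu>(3) by blast
  qed
  then obtain r where r: "\<And>\<mu>. \<mu> \<in> U \<Longrightarrow> r \<mu> > 0"
    "\<And>\<mu> \<nu>. \<mu> \<in> U \<Longrightarrow> \<nu> \<in> centered_prob_measures p \<Longrightarrow> wasserstein_dist p \<mu> \<nu> < r \<mu> \<Longrightarrow> \<nu> \<in> U" by metis
  define T where "T = (\<Union>\<mu>\<in>U. mball \<mu> (r \<mu>))"
  have "openin mtopology T" unfolding T_def by auto
  moreover have "U = T \<inter> centered_prob_measures p"
    using U r by (auto simp: T_def dest: centered_prob_measuresD)
  ultimately show ?thesis
    unfolding centered_wasserstein_topology_def wasserstein_topology_def openin_subtopology by blast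
qed

section \<open>Comparison with the weak topology\<close>

lemma bounded_range_real_abs:
  fixes f :: "'a \<Rightarrow> real"
  assumes "bounded (range f)"
  obtains b where "\<And>x. \<bar>f x\<bar> \<le> b"
  using assms unfolding bounded_iff by auto

text \<open>The property carried through the generation of the weak topology is that a sequence
  converging to a point of the set is eventually in the set; unlike openness itself it can be tested
  for one fixed sequence.\<close>

lemma openin_weak_imp_openin_centered:
  fixes V :: "'a::euclidean_space measure set"
  assumes p: "1 \<le> p" and V: "openin weak_topology V"
  shows "openin (centered_wasserstein_topology p) (V \<inter> centered_prob_measures p)"
proof (rule openin_centered_wasserstein_sequentially[OF p])
  fix \<mu> \<nu> assume mu: "\<mu> \<in> V \<inter> centered_prob_measures p" and nu: "\<And>k. \<nu> k \<in> centered_prob_measures p"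
    and lim: "(\<lambda>k. wasserstein_dist p \<mu> (\<nu> k)) \<longlonglongrightarrow> 0"
  have mu': "\<mu> \<in> prob_measures_moment p" using mu by (auto dest: centered_prob_measuresD)
  have nu': "\<nu> k \<in> prob_measures_moment p" for k using nu by (auto dest: centered_prob_measuresD)
  have "generate_topology_on {{\<mu> \<in> prob_measures. (\<integral>x. f x \<partial>\<mu>) \<in> U} | (f :: 'a \<Rightarrow> real) U.
        continuous_on UNIV f \<and> bounded (range f) \<and> open U} V"
    using V unfolding weak_topology_def openin_topology_generated_by_iff .
  then have "\<mu> \<in> V \<longrightarrow> (\<forall>\<^sub>F k in sequentially. \<nu> k \<in> V)"
  proof induction
    case (Int a b)
    then show ?case by (auto simp: eventually_conj_iff)
  next
    case (UN K)
    show ?case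
    proof
      assume "\<mu> \<in> \<Union>K"
      then obtain k where "k \<in> K" "\<mu> \<in> k" by blast
      then have "\<forall>\<^sub>F j in sequentially. \<nu> j \<in> k" using UN by blast
      then show "\<forall>\<^sub>F j in sequentially. \<nu> j \<in> \<Union>K"
        by eventually_elim (use \<open>k \<in> K\<close> in blast)
    qed
  next
    case (Basis s)
    then obtain f :: "'a \<Rightarrow> real" and U where s: "s = {\<mu> \<in> prob_measures. (\<integral>x. f x \<partial>\<mu>) \<in> U}"
      "continuous_on UNIV f" "bounded (range f)" "open U" by blast
    obtain b where b: "\<And>x. \<bar>f x\<bar> \<le> b" using bounded_range_real_abs[OF s(3)] by blast
    have "(\<lambda>k. \<integral>x. f x \<partial>\<nu> k) \<longlonglongrightarrow> (\<integral>x. f x \<partial>\<mu>)"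
      by (rule wasserstein_imp_weak_convergence[OF p mu' nu' lim s(2) b])
    then show ?case
      using topological_tendstoD[of _ _ _ U] s prob_measures_momentD(1)[OF nu'] by auto
  qed simp
  then have "\<forall>\<^sub>F k in sequentially. \<nu> k \<in> V" using mu by simp
  then show "\<exists>k. \<nu> k \<in> V \<inter> centered_prob_measures p"
    using nu by (auto simp: eventually_sequentially)
qed auto

lemma openin_energy_superlevel:
  assumes "1 \<le> p" "lower_semicontinuous_energy W"
  shows "openin (centered_wasserstein_topology p) {\<mu> \<in> centered_prob_measures p. w < W \<mu>}"
proof -
  have c: "closedin weak_topology {\<mu> \<in> prob_measures. W \<mu> \<le> w}"
    using assms(2) unfolding lower_semicontinuous_energy_def by blast
  have t: "topspace weak_topology \<subseteq> (prob_measures :: 'a measure set)"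
    unfolding weak_topology_def topology_generated_by_topspace by auto
  have t': "(prob_measures :: 'a measure set) \<subseteq> topspace weak_topology"
  proof -
    have "openin weak_topology {\<mu> \<in> prob_measures. (\<integral>x. (0::real) \<partial>\<mu>) \<in> UNIV}"
      unfolding weak_topology_def by (intro topology_generated_by_Basis) (auto intro!: exI[of _ "\<lambda>_. 0"] exI[of _ UNIV])
    then show ?thesis using openin_subset by fastforce
  qed
  have "openin (centered_wasserstein_topology p)
      ((topspace weak_topology - {\<mu> \<in> prob_measures. W \<mu> \<le> w}) \<inter> centered_prob_measures p)"
    by (rule openin_weak_imp_openin_centered[OF assms(1) openin_diff[OF openin_topspace c]])
  moreover have "(topspace weak_topology - {\<mu> \<in> prob_measures. W \<mu> \<le> w}) \<inter> centered_prob_measures p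
      = {\<mu> \<in> centered_prob_measures p. w < W \<mu>}"
    using t t' centered_subset_prob_measures[of p] by (auto simp: not_le)
  ultimately show ?thesis by simp
qed

lemma openin_integral_superlevel:
  fixes f :: "'a::euclidean_space \<Rightarrow> real"
  assumes "1 \<le> p" "continuous_on UNIV f" "bounded (range f)"
  shows "openin (centered_wasserstein_topology p) {\<mu> \<in> centered_prob_measures p. c < (\<integral>x. f x \<partial>\<mu>)}"
proof -
  have "openin weak_topology {\<mu> \<in> prob_measures. (\<integral>x. f x \<partial>\<mu>) \<in> {c<..}}"
    unfolding weak_topology_def using assms by (intro topology_generated_by_Basis CollectI exI[of _ f] exI[of _ "{c<..}"]) auto
  moreover have "{\<mu> \<in> prob_measures. (\<integral>x. f x \<partial>\<mu>) \<in> {c<..}} \<inter> centered_prob_measures p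
        = {\<mu> \<in> centered_prob_measures p. c < (\<integral>x. f x \<partial>\<mu>)}"
    using centered_subset_prob_measures[of p] by auto
  ultimately show ?thesis
    using openin_weak_imp_openin_centered[OF assms(1)] by (metis (no_types, lifting))
qed

text \<open>Sequential compactness: a represented subsequence converges in order \<open>p\<close>
  because a higher moment is bounded. The limit keeps the moment bound by Fatou's lemma and the zero
  mean by convergence of order 1.\<close>

lemma compactin_moment_ball:
  fixes K :: "'a::euclidean_space measure set"
  assumes p: "1 \<le> p" "p < l" and R: "0 \<le> R"
  defines "K \<equiv> {\<mu> \<in> centered_prob_measures p. (\<integral>\<^sup>+ x. ennreal (norm x powr l) \<partial>\<mu>) \<le> ennreal R}"
  shows "compactin (centered_wasserstein_topology p) K" "closedin (centered_wasserstein_topology p) K"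
proof -
  interpret Metric_space "prob_measures_moment p :: 'a measure set" "wasserstein_dist p"
    by (rule Metric_space_wasserstein[OF p(1)])
  have "\<exists>\<mu> r. \<mu> \<in> K \<and> strict_mono r \<and> limitin mtopology (\<sigma> \<circ> r) \<mu> sequentially" if \<sigma>: "range \<sigma> \<subseteq> K" for \<sigma> :: "nat \<Rightarrow> 'a measure"
  proof -
    have s1: "\<sigma> k \<in> centered_prob_measures p" and s2: "(\<integral>\<^sup>+ x. ennreal (norm x powr l) \<partial>\<sigma> k) \<le> ennreal R" for k
      using \<sigma> by (auto simp: K_def)
    note s3 = centered_prob_measuresD[OF s1]
    note s4 = prob_measures_momentD[OF s3(1)]
    have "(\<integral>\<^sup>+ x. ennreal (norm x powr 1) \<partial>\<sigma> k) \<le> ennreal (1 + R)" for k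
      by (rule nn_integral_moment_mono[OF s4(1) _ _ s2 R]) (use p in auto)
    then have C: "(\<integral>\<^sup>+ x. ennreal (norm x) \<partial>\<sigma> k) \<le> ennreal (1 + R)" for k by simp
    obtain r \<Omega> Xs X where rep: "pointwise_representation \<sigma> r \<Omega> Xs X"
      using tight_subsequence_representation[of \<sigma>, OF s4(1) C] by blast
    note O = pointwise_representationD(2)[OF rep] and Xs[measurable] = pointwise_representationD(3)[OF rep]
      and X[measurable] = pointwise_representationD(5)[OF rep]
      and d = pointwise_representationD(4)[OF rep] and c = pointwise_representationD(6)[OF rep]
    interpret prob_space \<Omega> by fact
    have mom: "(\<integral>\<^sup>+ \<omega>. ennreal (norm (Xs k \<omega>) powr l) \<partial>\<Omega>) \<le> ennreal R" for k
      using s2[of "r k"] unfolding d[symmetric] by (subst (asm) nn_integral_distr) auto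
    have Lp: "(\<integral>\<^sup>+ \<omega>. ennreal (norm (X \<omega>) powr l) \<partial>\<Omega>) \<le> ennreal R"
      "(\<lambda>k. \<integral>\<^sup>+ \<omega>. ennreal (norm (X \<omega> - Xs k \<omega>) powr q) \<partial>\<Omega>) \<longlonglongrightarrow> 0" if "0 < q" "q < l" for q
      using Lp_convergence_bounded_moment[OF that O X Xs c mom R] by auto
    define \<mu> where "\<mu> = distr \<Omega> borel X"
    have m1: "\<mu> \<in> prob_measures" unfolding \<mu>_def by (rule distr_in_prob_measures[OF O X])
    have m2: "(\<integral>\<^sup>+ x. ennreal (norm x powr l) \<partial>\<mu>) \<le> ennreal R"
      unfolding \<mu>_def by (subst nn_integral_distr) (use Lp(1)[of p] p in auto)
    then have "\<mu> \<in> prob_measures_moment l"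
      using m1 le_less_trans[OF m2 ennreal_less_top] by (simp add: prob_measures_moment_def)
    then have m3: "\<mu> \<in> prob_measures_moment p"
      by (rule prob_measures_moment_mono) (use p in auto)
    have iX: "integrable \<Omega> X"
      using first_moment_integrable[OF m3 p(1)] unfolding \<mu>_def by (subst (asm) integrable_distr_eq) auto
    have iXs: "integrable \<Omega> (Xs k)" for k
      using first_moment_integrable[OF s3(1) p(1), of "r k"] unfolding d[symmetric] by (subst (asm) integrable_distr_eq) auto
    \<comment> \<open>Here the convergence is used with exponent 1, which is below \<open>l\<close>
      because \<open>p\<close> is at least 1.\<close>
    have "norm (\<integral>\<omega>. X \<omega> \<partial>\<Omega>) \<le> 0"
    proof (rule LIMSEQ_le_const)
      show "(\<lambda>k. enn2real (\<integral>\<^sup>+ \<omega>. ennreal (norm (X \<omega> - Xs k \<omega>) powr 1) \<partial>\<Omega>)) \<longlonglongrightarrow> 0"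
        using tendsto_enn2real[of _ "0::real" sequentially] Lp(2)[of 1] p by auto
      have "norm (\<integral>\<omega>. X \<omega> \<partial>\<Omega>) \<le> enn2real (\<integral>\<^sup>+ \<omega>. ennreal (norm (X \<omega> - Xs k \<omega>) powr 1) \<partial>\<Omega>)" for k
      proof -
        have "(\<integral>\<omega>. Xs k \<omega> \<partial>\<Omega>) = (\<integral>x. x \<partial>\<sigma> (r k))"
          unfolding d[symmetric] by (subst integral_distr) auto
        then have "(\<integral>\<omega>. X \<omega> \<partial>\<Omega>) = (\<integral>\<omega>. X \<omega> - Xs k \<omega> \<partial>\<Omega>)"
          using iX iXs s3(2) by simp
        then have "norm (\<integral>\<omega>. X \<omega> \<partial>\<Omega>) \<le> (\<integral>\<omega>. norm (X \<omega> - Xs k \<omega>) \<partial>\<Omega>)"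
          using integral_norm_bound[of \<Omega> "\<lambda>\<omega>. X \<omega> - Xs k \<omega>"] by simp
        also have "\<dots> = enn2real (\<integral>\<^sup>+ \<omega>. ennreal (norm (X \<omega> - Xs k \<omega>) powr 1) \<partial>\<Omega>)"
          by (simp add: integral_eq_nn_integral)
        finally show ?thesis .
      qed
      then show "\<exists>N. \<forall>k\<ge>N. norm (\<integral>\<omega>. X \<omega> \<partial>\<Omega>) \<le> enn2real (\<integral>\<^sup>+ \<omega>. ennreal (norm (X \<omega> - Xs k \<omega>) powr 1) \<partial>\<Omega>)"
        by blast
    qed
    then have "(\<integral>x. x \<partial>\<mu>) = 0" unfolding \<mu>_def by (subst integral_distr) auto
    then have muK: "\<mu> \<in> K" using m3 m2 by (simp add: K_def centered_prob_measures_def)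
    have "(\<lambda>k. wasserstein_dist p \<mu> (\<sigma> (r k))) \<longlonglongrightarrow> 0"
      using wasserstein_tendsto_random_variables[OF p(1) O X Xs Lp(2)] p unfolding d \<mu>_def by auto
    then have "limitin mtopology (\<sigma> \<circ> r) \<mu> sequentially"
      unfolding limitin_metric_dist_null using m3 s3(1) by (simp add: wasserstein_dist_commute)
    then show ?thesis using muK pointwise_representationD(1)[OF rep] by blast
  qed
  moreover have "K \<subseteq> prob_measures_moment p" by (auto simp: K_def dest: centered_prob_measuresD)
  ultimately have c: "compactin mtopology K" unfolding compactin_sequentially by blast
  then show 1: "compactin (centered_wasserstein_topology p) K"
    unfolding centered_wasserstein_topology_def wasserstein_topology_def
    by (simp add: compactin_subtopology K_def)
  have "closedin mtopology K" by (rule compactin_imp_closedin[OF Hausdorff_space_mtopology c])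
  then show "closedin (centered_wasserstein_topology p) K"
    unfolding centered_wasserstein_topology_def wasserstein_topology_def closedin_subtopology
    by (intro exI[of _ K]) (auto simp: K_def)
qed

section \<open>Wasserstein closeness from finitely many averages\<close>

lemma distr_shift_eq_translate:
  fixes X :: "'b \<Rightarrow> 'a::euclidean_space"
  assumes [measurable]: "X \<in> borel_measurable \<Omega>"
  shows "distr \<Omega> borel (\<lambda>\<omega>. X \<omega> + y) = translate_measure y (distr \<Omega> borel X)"
  unfolding translate_measure_def by (subst distr_distr) (auto simp: comp_def)

text \<open>Reduces Wasserstein closeness to finitely many averages, to which the law of large
  numbers applies; the shifts \<open>y\<close> and \<open>z\<close> later are minus the empirical
  and the true mean. If no \<open>N\<close> and \<open>\<delta>\<close> sufficed, measures failing
  the claim for \<open>N = k\<close> and \<open>\<delta> = 1 / (k + 1)\<close> would converge weakly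
  together with their p-th moments, hence in the Wasserstein metric.\<close>

lemma wasserstein_test_functions:
  fixes \<mu> :: "'a::euclidean_space measure"
  assumes p: "1 \<le> p" and mu: "\<mu> \<in> prob_measures_moment p" and \<rho>: "0 < \<rho>"
  shows "\<exists>(f :: nat \<Rightarrow> 'a \<Rightarrow> real) N \<delta>. 0 < \<delta> \<and> (\<forall>j. f j \<in> borel_measurable borel) \<and> (\<forall>j x. \<bar>f j x\<bar> \<le> 1) \<and>
    (\<forall>\<nu>\<in>prob_measures_moment p. \<forall>y. (\<forall>j<N. \<bar>(\<integral>x. f j x \<partial>\<nu>) - (\<integral>x. f j x \<partial>\<mu>)\<bar> < \<delta>) \<longrightarrow>
      \<bar>(\<integral>x. norm x powr p \<partial>\<nu>) - (\<integral>x. norm x powr p \<partial>\<mu>)\<bar> < \<delta> \<longrightarrow> norm (y - z) < \<delta> \<longrightarrow>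
      wasserstein_dist p (translate_measure z \<mu>) (translate_measure y \<nu>) < \<rho>)"
proof -
  obtain B :: "'a set set" where B: "countable B" "topological_basis B"
    using ex_countable_basis by blast
  define I where "I = {F. F \<subseteq> B \<and> finite F} \<times> (UNIV :: nat set)"
  have I: "countable I" "I \<noteq> {}"
    unfolding I_def using countable_Collect_finite_subset[OF B(1)] by (auto simp: conj_commute)
  define f where "f j = (case from_nat_into I j of (F, m) \<Rightarrow> open_bump (\<Inter>F) m)" for j
  have fm: "f j \<in> borel_measurable borel" for j by (simp add: f_def split: prod.split)
  have fb: "\<bar>f j x\<bar> \<le> 1" for j x by (simp add: f_def open_bump_bounds split: prod.split)
  let ?P = "\<lambda>N \<delta> \<nu> y. (\<forall>j<N. \<bar>(\<integral>x. f j x \<partial>\<nu>) - (\<integral>x. f j x \<partial>\<mu>)\<bar> < \<delta>) \<and>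
      \<bar>(\<integral>x. norm x powr p \<partial>\<nu>) - (\<integral>x. norm x powr p \<partial>\<mu>)\<bar> < \<delta> \<and> norm (y - z) < \<delta>"
  have "\<exists>N \<delta>. 0 < \<delta> \<and> (\<forall>\<nu>\<in>prob_measures_moment p. \<forall>y. ?P N \<delta> \<nu> y \<longrightarrow>
      wasserstein_dist p (translate_measure z \<mu>) (translate_measure y \<nu>) < \<rho>)"
  proof (rule ccontr)
    assume neg: "\<not> ?thesis"
    have "\<exists>\<nu> y. \<nu> \<in> prob_measures_moment p \<and> ?P k (1 / real (Suc k)) \<nu> y \<and>
      \<not> wasserstein_dist p (translate_measure z \<mu>) (translate_measure y \<nu>) < \<rho>" for k
    proof -
      have "0 < 1 / real (Suc k)" by simp
      then show ?thesis using neg by blast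
    qed
    then obtain \<nu> y where nu: "\<And>k. \<nu> k \<in> prob_measures_moment p"
      and P: "\<And>k. ?P k (1 / real (Suc k)) (\<nu> k) (y k)"
      and far: "\<And>k. \<not> wasserstein_dist p (translate_measure z \<mu>) (translate_measure (y k) (\<nu> k)) < \<rho>"
      by metis
    have inv0: "(\<lambda>k. 1 / real (Suc k)) \<longlonglongrightarrow> 0"
      using LIMSEQ_inverse_real_of_nat by (simp add: inverse_eq_divide)
    define A where "A = (\<integral>x. norm x powr p \<partial>\<mu>)"
    have A0: "0 \<le> A" by (simp add: A_def)
    have momb: "(\<integral>\<^sup>+ x. ennreal (norm x powr p) \<partial>\<nu> k) \<le> ennreal (A + 1)" for k
    proof -
      have "(\<integral>\<^sup>+ x. ennreal (norm x powr p) \<partial>\<nu> k) = ennreal (\<integral>x. norm x powr p \<partial>\<nu> k)"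
        by (intro nn_integral_eq_integral moment_integrable nu) auto
      moreover have "(\<integral>x. norm x powr p \<partial>\<nu> k) \<le> A + 1"
      proof -
        have "\<bar>(\<integral>x. norm x powr p \<partial>\<nu> k) - A\<bar> < 1 / real (Suc k)" using P by (simp add: A_def)
        also have "\<dots> \<le> 1" by simp
        finally show ?thesis by linarith
      qed
      ultimately show ?thesis by (simp add: ennreal_leI)
    qed
    have "(\<integral>\<^sup>+ x. ennreal (norm x powr 1) \<partial>\<nu> k) \<le> ennreal (1 + (A + 1))" for k
      by (rule nn_integral_moment_mono[OF prob_measures_momentD(1)[OF nu] _ _ momb]) (use p A0 in auto)
    then have C: "(\<integral>\<^sup>+ x. ennreal (norm x) \<partial>\<nu> k) \<le> ennreal (1 + (A + 1))" for k by simp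
    have bl: "(\<lambda>k. \<integral>x. open_bump (\<Inter>F) m x \<partial>\<nu> k) \<longlonglongrightarrow> (\<integral>x. open_bump (\<Inter>F) m x \<partial>\<mu>)"
      if "F \<subseteq> B" "finite F" for F m
    proof -
      have "(F, m) \<in> I" using that by (simp add: I_def)
      then obtain j where j: "from_nat_into I j = (F, m)" using from_nat_into_surj[OF I(1)] by blast
      then have fj: "f j = open_bump (\<Inter>F) m" by (simp add: f_def)
      have "(\<lambda>k. (\<integral>x. f j x \<partial>\<nu> k) - (\<integral>x. f j x \<partial>\<mu>)) \<longlonglongrightarrow> 0"
      proof (rule Lim_null_comparison[OF _ inv0])
        show "\<forall>\<^sub>F k in sequentially. norm ((\<integral>x. f j x \<partial>\<nu> k) - (\<integral>x. f j x \<partial>\<mu>)) \<le> 1 / real (Suc k)"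
          using eventually_gt_at_top[of j]
        proof eventually_elim
          case (elim k)
          then have "\<bar>(\<integral>x. f j x \<partial>\<nu> k) - (\<integral>x. f j x \<partial>\<mu>)\<bar> < 1 / real (Suc k)" using P[of k] by blast
          then show ?case by simp
        qed
      qed
      then show ?thesis unfolding fj by (rule LIM_zero_cancel)
    qed
    obtain r \<Omega> Xs X where rep: "pointwise_representation \<nu> r \<Omega> Xs X" and dX: "distr \<Omega> borel X = \<mu>"
      using weak_limit_representation[OF prob_measures_momentD(1)[OF mu] prob_measures_momentD(1)[OF nu] C B bl] by blast
    note O = pointwise_representationD(2)[OF rep] and Xs[measurable] = pointwise_representationD(3)[OF rep]
      and X[measurable] = pointwise_representationD(5)[OF rep] and r = pointwise_representationD(1)[OF rep]
      and d = pointwise_representationD(4)[OF rep] and c = pointwise_representationD(6)[OF rep]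
    interpret prob_space \<Omega> by fact
    have i1: "integrable \<Omega> (\<lambda>\<omega>. norm (X \<omega>) powr p)"
      using moment_integrable[OF mu] unfolding dX[symmetric] by (subst (asm) integrable_distr_eq) auto
    have i2: "integrable \<Omega> (\<lambda>\<omega>. norm (Xs k \<omega>) powr p)" for k
      using moment_integrable[OF nu, of "r k"] unfolding d[symmetric] by (subst (asm) integrable_distr_eq) auto
    have e1: "(\<integral>\<omega>. norm (X \<omega>) powr p \<partial>\<Omega>) = A"
      unfolding A_def dX[symmetric] by (subst integral_distr) auto
    have e2: "(\<integral>\<omega>. norm (Xs k \<omega>) powr p \<partial>\<Omega>) = (\<integral>x. norm x powr p \<partial>\<nu> (r k))" for k
      unfolding d[symmetric] by (subst integral_distr) auto
    have "(\<lambda>k. (\<integral>x. norm x powr p \<partial>\<nu> k) - A) \<longlonglongrightarrow> 0"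
      using P by (intro Lim_null_comparison[OF _ inv0]) (auto simp: A_def intro!: always_eventually less_imp_le)
    then have "(\<lambda>k. \<integral>x. norm x powr p \<partial>\<nu> k) \<longlonglongrightarrow> A" by (rule LIM_zero_cancel)
    from LIMSEQ_subseq_LIMSEQ[OF this r]
    have "(\<lambda>k. \<integral>\<omega>. norm (Xs k \<omega>) powr p \<partial>\<Omega>) \<longlonglongrightarrow> (\<integral>\<omega>. norm (X \<omega>) powr p \<partial>\<Omega>)"
      unfolding e1 e2 by (simp add: comp_def)
    then have L: "(\<lambda>k. \<integral>\<^sup>+ \<omega>. ennreal (norm (X \<omega> - Xs k \<omega>) powr p) \<partial>\<Omega>) \<longlonglongrightarrow> 0"
      using p by (intro Lp_convergence_of_moments[OF _ O X Xs c i1 i2]) auto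
    have "(\<lambda>k. y k - z) \<longlonglongrightarrow> 0"
      using P by (intro Lim_null_comparison[OF _ inv0]) (auto intro!: always_eventually less_imp_le)
    from LIMSEQ_subseq_LIMSEQ[OF this r] have yz: "(\<lambda>k. y (r k) - z) \<longlonglongrightarrow> 0" by (simp add: comp_def)
    have yp: "(\<lambda>k. norm (y (r k) - z) powr p) \<longlonglongrightarrow> 0"
      using tendsto_powr2[OF tendsto_norm[OF yz] tendsto_const[of p]] p by simp
    have "(\<lambda>k. ennreal (2 powr p) * ((\<integral>\<^sup>+ \<omega>. ennreal (norm (X \<omega> - Xs k \<omega>) powr p) \<partial>\<Omega>) + ennreal (norm (y (r k) - z) powr p)))
        \<longlonglongrightarrow> ennreal (2 powr p) * (0 + ennreal 0)"
      by (intro ennreal_tendsto_cmult tendsto_add L tendsto_ennrealI yp) auto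
    then have up: "(\<lambda>k. ennreal (2 powr p) * ((\<integral>\<^sup>+ \<omega>. ennreal (norm (X \<omega> - Xs k \<omega>) powr p) \<partial>\<Omega>) + ennreal (norm (y (r k) - z) powr p)))
        \<longlonglongrightarrow> 0" by simp
    have "(\<lambda>k. \<integral>\<^sup>+ \<omega>. ennreal (norm ((X \<omega> + z) - (Xs k \<omega> + y (r k))) powr p) \<partial>\<Omega>) \<longlonglongrightarrow> 0"
    proof (rule tendsto_sandwich[OF _ _ tendsto_const up])
      show "\<forall>\<^sub>F k in sequentially. (\<integral>\<^sup>+ \<omega>. ennreal (norm ((X \<omega> + z) - (Xs k \<omega> + y (r k))) powr p) \<partial>\<Omega>)
        \<le> ennreal (2 powr p) * ((\<integral>\<^sup>+ \<omega>. ennreal (norm (X \<omega> - Xs k \<omega>) powr p) \<partial>\<Omega>) + ennreal (norm (y (r k) - z) powr p))"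
      proof (intro always_eventually allI)
        fix k
        have "(\<integral>\<^sup>+ \<omega>. ennreal (norm ((X \<omega> + z) - (Xs k \<omega> + y (r k))) powr p) \<partial>\<Omega>)
          \<le> (\<integral>\<^sup>+ \<omega>. ennreal (2 powr p) * (ennreal (norm (X \<omega> - Xs k \<omega>) powr p) + ennreal (norm (y (r k) - z) powr p)) \<partial>\<Omega>)"
        proof (rule nn_integral_mono)
          fix \<omega>
          have "(X \<omega> + z) - (Xs k \<omega> + y (r k)) = (X \<omega> - Xs k \<omega>) - (y (r k) - z)" by simp
          then have "norm ((X \<omega> + z) - (Xs k \<omega> + y (r k))) powr p
            \<le> 2 powr p * (norm (X \<omega> - Xs k \<omega>) powr p + norm (y (r k) - z) powr p)"
            using norm_diff_powr_le[of p "X \<omega> - Xs k \<omega>" "y (r k) - z"] p by (simp only:)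
          then show "ennreal (norm ((X \<omega> + z) - (Xs k \<omega> + y (r k))) powr p)
            \<le> ennreal (2 powr p) * (ennreal (norm (X \<omega> - Xs k \<omega>) powr p) + ennreal (norm (y (r k) - z) powr p))"
            by (simp flip: ennreal_plus ennreal_mult add: ennreal_leI)
        qed
        also have "\<dots> = ennreal (2 powr p) * ((\<integral>\<^sup>+ \<omega>. ennreal (norm (X \<omega> - Xs k \<omega>) powr p) \<partial>\<Omega>) + ennreal (norm (y (r k) - z) powr p))"
          by (simp add: nn_integral_cmult nn_integral_add emeasure_space_1)
        finally show "(\<integral>\<^sup>+ \<omega>. ennreal (norm ((X \<omega> + z) - (Xs k \<omega> + y (r k))) powr p) \<partial>\<Omega>)
          \<le> ennreal (2 powr p) * ((\<integral>\<^sup>+ \<omega>. ennreal (norm (X \<omega> - Xs k \<omega>) powr p) \<partial>\<Omega>) + ennreal (norm (y (r k) - z) powr p))" .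
      qed
    qed simp
    then have "(\<lambda>k. wasserstein_dist p (distr \<Omega> borel (\<lambda>\<omega>. X \<omega> + z)) (distr \<Omega> borel (\<lambda>\<omega>. Xs k \<omega> + y (r k)))) \<longlonglongrightarrow> 0"
      by (intro wasserstein_tendsto_random_variables[OF p O]) auto
    then have "(\<lambda>k. wasserstein_dist p (translate_measure z \<mu>) (translate_measure (y (r k)) (\<nu> (r k)))) \<longlonglongrightarrow> 0"
      by (simp add: distr_shift_eq_translate dX d)
    then have "\<forall>\<^sub>F k in sequentially. wasserstein_dist p (translate_measure z \<mu>) (translate_measure (y (r k)) (\<nu> (r k))) < \<rho>"
      using \<rho> by (rule order_tendstoD)
    then show False using far by (auto simp: eventually_sequentially)
  qed
  then show ?thesis using fm fb by (intro exI[of _ f]) blast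
qed

section \<open>Integrability of exponential weights\<close>

lemma power_le_exp:
  fixes y :: real
  assumes "0 \<le> y"
  shows "y ^ d \<le> real d ^ d * exp y"
proof (cases "d = 0")
  case False
  have "(1 + y / real d) ^ d \<le> exp y"
    using False assms by (intro exp_ge_one_plus_x_over_n_power_n) auto
  moreover have "(y / real d) ^ d \<le> (1 + y / real d) ^ d"
    using assms by (intro power_mono) auto
  ultimately have "(y / real d) ^ d \<le> exp y" by linarith
  then show ?thesis using False by (simp add: power_divide field_simps)
qed (use assms in simp)

text \<open>Points of norm between \<open>k\<close> and \<open>k + 1\<close> lie in a ball of volume
  \<open>V * (k + 1) ^ d\<close> and carry weight at most \<open>exp (- c * k)\<close>. Half of the
  exponent absorbs the polynomial volume, the other half leaves a geometric series.\<close>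

lemma nn_integral_exp_norm_finite:
  assumes c: "0 < c"
  shows "(\<integral>\<^sup>+ x. ennreal (exp (- c * norm (x::'a::euclidean_space))) \<partial>lborel) < \<infinity>"
proof -
  define d where "d = DIM('a)"
  define V where "V = unit_ball_vol (real d)"
  have V: "0 \<le> V" by (simp add: V_def)
  define g where "g k = exp (- c * real k) * (V * (real k + 1) ^ d)" for k
  have g0: "0 \<le> g k" for k using V by (simp add: g_def)
  have "summable g"
  proof (rule summable_comparison_test')
    define D where "D = V * ((2 / c) ^ d * real d ^ d) * exp (c / 2)"
    show "summable (\<lambda>k. D * exp (- c / 2) ^ k)"
      using c by (intro summable_mult summable_geometric) simp
    fix k :: nat
    define y where "y = c / 2 * (real k + 1)"
    have "y ^ d \<le> real d ^ d * exp y" using c by (intro power_le_exp) (simp add: y_def)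
    then have "(2 / c) ^ d * y ^ d \<le> (2 / c) ^ d * (real d ^ d * exp y)"
      using c by (intro mult_left_mono) auto
    moreover have "(2 / c) ^ d * y ^ d = (real k + 1) ^ d"
    proof -
      have "2 / c * y = real k + 1" using c by (simp add: y_def field_simps)
      then show ?thesis by (simp add: power_mult_distrib[symmetric])
    qed
    ultimately have "V * (real k + 1) ^ d \<le> V * ((2 / c) ^ d * (real d ^ d * exp y))"
      using V by (intro mult_left_mono) auto
    then have "g k \<le> exp (- c * real k) * (V * ((2 / c) ^ d * (real d ^ d * exp y)))"
      unfolding g_def by (rule mult_left_mono) simp
    also have "\<dots> = V * ((2 / c) ^ d * real d ^ d) * (exp (- c * real k) * exp y)" by simp
    also have "exp (- c * real k) * exp y = exp (c / 2) * exp (- c / 2) ^ k"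
      by (simp add: y_def exp_of_nat_mult[symmetric] exp_add[symmetric] field_simps)
    finally show "norm (g k) \<le> D * exp (- c / 2) ^ k" using g0 by (simp add: D_def mult_ac)
  qed
  have "(\<integral>\<^sup>+ x. ennreal (exp (- c * norm (x::'a))) \<partial>lborel)
      \<le> (\<integral>\<^sup>+ x. (\<Sum>k. ennreal (exp (- c * real k)) * indicator (cball 0 (real k + 1)) x) \<partial>(lborel::'a measure))"
  proof (rule nn_integral_mono)
    fix x :: 'a
    define k where "k = nat \<lfloor>norm x\<rfloor>"
    have k: "real k \<le> norm x" "norm x \<le> real k + 1" unfolding k_def by auto
    have "ennreal (exp (- c * norm x)) \<le> ennreal (exp (- c * real k)) * indicator (cball 0 (real k + 1)) x"
      using k c by (auto intro!: ennreal_leI)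
    also have "\<dots> \<le> (\<Sum>k. ennreal (exp (- c * real k)) * indicator (cball 0 (real k + 1)) x)"
    proof -
      define h :: "nat \<Rightarrow> ennreal" where "h j = ennreal (exp (- c * real j)) * indicator (cball 0 (real j + 1)) x" for j
      have "sum h {k} \<le> suminf h" by (rule sum_le_suminf) auto
      then have "h k \<le> suminf h" by simp
      then show ?thesis unfolding h_def .
    qed
    finally show "ennreal (exp (- c * norm x)) \<le> (\<Sum>k. ennreal (exp (- c * real k)) * indicator (cball 0 (real k + 1)) x)" .
  qed
  also have "\<dots> = (\<Sum>k. \<integral>\<^sup>+ x. ennreal (exp (- c * real k)) * indicator (cball 0 (real k + 1)) x \<partial>(lborel::'a measure))"
  proof (intro nn_integral_suminf)
    fix k :: nat
    have [measurable]: "cball (0::'a) (real k + 1) \<in> sets borel" by simp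
    show "(\<lambda>x. ennreal (exp (- c * real k)) * indicator (cball (0::'a) (real k + 1)) x) \<in> borel_measurable lborel"
      by measurable
  qed
  also have "\<dots> = (\<Sum>k. ennreal (g k))"
  proof (intro suminf_cong)
    fix k
    have "(\<integral>\<^sup>+ x. ennreal (exp (- c * real k)) * indicator (cball 0 (real k + 1)) x \<partial>(lborel::'a measure))
      = ennreal (exp (- c * real k)) * ennreal (V * (real k + 1) ^ d)"
      by (subst nn_integral_cmult_indicator) (auto simp: emeasure_cball V_def d_def)
    then show "(\<integral>\<^sup>+ x. ennreal (exp (- c * real k)) * indicator (cball 0 (real k + 1)) x \<partial>(lborel::'a measure)) = ennreal (g k)"
      using V by (simp add: g_def ennreal_mult)
  qed
  also have "\<dots> < \<infinity>"
    using \<open>summable g\<close> g0 by (simp add: suminf_ennreal2 less_top[symmetric])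
  finally show ?thesis .
qed

lemma nn_integral_exp_norm_powr_finite:
  assumes c: "0 < c" and l: "1 \<le> l"
  shows "(\<integral>\<^sup>+ x. ennreal (exp (- c * norm (x::'a::euclidean_space) powr l)) \<partial>lborel) < \<infinity>"
proof -
  have "(\<integral>\<^sup>+ x. ennreal (exp (- c * norm (x::'a) powr l)) \<partial>lborel)
      \<le> (\<integral>\<^sup>+ x. ennreal (exp c) * ennreal (exp (- c * norm (x::'a))) \<partial>lborel)"
  proof (rule nn_integral_mono)
    fix x :: 'a
    have "norm x \<le> 1 + norm x powr l" using le_one_plus_powr[of "norm x" 1 l] l by simp
    then have "c * norm x \<le> c * (1 + norm x powr l)" using c by (intro mult_left_mono) auto
    then have "exp (- c * norm x powr l) \<le> exp (c + - c * norm x)" by (simp add: algebra_simps)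
    then show "ennreal (exp (- c * norm x powr l)) \<le> ennreal (exp c) * ennreal (exp (- c * norm x))"
      by (simp add: exp_add flip: ennreal_mult) (simp add: ennreal_leI mult_exp_exp)
  qed
  also have "\<dots> = ennreal (exp c) * (\<integral>\<^sup>+ x. ennreal (exp (- c * norm (x::'a))) \<partial>lborel)"
    by (intro nn_integral_cmult) auto
  also have "\<dots> < \<infinity>" using nn_integral_exp_norm_finite[OF c, where 'a='a] by (simp add: ennreal_mult_less_top)
  finally show ?thesis .
qed

lemma integrable_exp_norm_powr:
  assumes c: "0 < c" and l: "1 \<le> l"
  shows "integrable lborel (\<lambda>x. exp (- c * norm (x::'a::euclidean_space) powr l))"
  using nn_integral_exp_norm_powr_finite[OF assms, where 'a='a] by (intro integrableI_bounded) auto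

section \<open>Entropy\<close>

text \<open>If \<open>q\<close> is at least \<open>exp (- r)\<close>, then \<open>- ln q\<close> is
  at most \<open>r\<close>. Otherwise, with t the square root of \<open>q\<close>, the left side is
  \<open>2 * t * (t * - ln t)\<close>, where the last factor is at most 1 and t is at most
  \<open>exp (- r / 2)\<close>. With \<open>r = norm x\<close> both terms on the right are
  integrable as soon as the first moment is finite.\<close>

lemma neg_xlnx_le:
  fixes q r :: real
  assumes "0 \<le> q" "0 \<le> r"
  shows "- (q * ln q) \<le> q * r + 2 * exp (- r / 2)"
proof (cases "q \<ge> exp (- r)")
  case True
  then have "- r \<le> ln q" using ln_ge_iff[of q "- r"] exp_gt_zero[of "- r"] by linarith
  then have "q * - r \<le> q * ln q" using assms by (intro mult_left_mono) auto
  then show ?thesis using exp_ge_zero[of "- r / 2"] by linarith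
next
  case False
  show ?thesis
  proof (cases "q = 0")
    case True
    then show ?thesis by simp
  next
    case q: False
    define t where "t = sqrt q"
    have t: "0 < t" "t * t = q" using assms q by (auto simp: t_def)
    have "t \<le> exp (- r / 2)"
    proof -
      have "t * t \<le> exp (- r / 2) * exp (- r / 2)" using False t by (simp add: mult_exp_exp)
      then show ?thesis using t(1) by (metis exp_ge_zero linorder_not_le mult_strict_mono')
    qed
    moreover have "- (q * ln q) = 2 * t * (t * - ln t)"
    proof -
      have "ln q = 2 * ln t" using ln_mult_pos[OF t(1) t(1)] t(2) by simp
      then have "q * ln q = t * t * (2 * ln t)" unfolding t(2) by simp
      then show ?thesis by simp
    qed
    moreover have "t * - ln t \<le> 1"
    proof -
      have "ln (1 / t) \<le> 1 / t - 1" using t by (intro ln_le_minus_one) auto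
      then have "- ln t \<le> 1 / t" using t by (simp add: ln_div)
      then have "t * - ln t \<le> t * (1 / t)" using t by (intro mult_left_mono) auto
      then show ?thesis using t by simp
    qed
    ultimately have "- (q * ln q) \<le> 2 * exp (- r / 2)"
      using t by (smt (verit, best) mult_left_le)
    then show ?thesis using assms by (smt (verit) mult_nonneg_nonneg)
  qed
qed

lemma entropy_negative_part_finite:
  fixes q :: "'a::euclidean_space \<Rightarrow> real"
  assumes q[measurable]: "q \<in> borel_measurable borel" "\<And>x. 0 \<le> q x"
    and mu: "density lborel (\<lambda>x. ennreal (q x)) \<in> prob_measures_moment 1"
  shows "(\<integral>\<^sup>+ x. ennreal (- (q x * ln (q x))) \<partial>lborel) < \<infinity>"
proof -
  have "(\<integral>\<^sup>+ x. ennreal (- (q x * ln (q x))) \<partial>lborel)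
      \<le> (\<integral>\<^sup>+ x. ennreal (q x) * ennreal (norm x) + ennreal 2 * ennreal (exp (- (1/2) * norm x)) \<partial>lborel)"
  proof (rule nn_integral_mono)
    fix x :: 'a
    have "- (q x * ln (q x)) \<le> q x * norm x + 2 * exp (- norm x / 2)"
      by (rule neg_xlnx_le) (use q in auto)
    then show "ennreal (- (q x * ln (q x))) \<le> ennreal (q x) * ennreal (norm x) + ennreal 2 * ennreal (exp (- (1/2) * norm x))"
      using q(2)[of x] by (simp flip: ennreal_mult ennreal_plus del: ennreal_numeral add: ennreal_leI)
  qed
  also have "\<dots> = (\<integral>\<^sup>+ x. ennreal (q x) * ennreal (norm x) \<partial>lborel)
      + ennreal 2 * (\<integral>\<^sup>+ x. ennreal (exp (- (1/2) * norm x)) \<partial>(lborel :: 'a measure))"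
    by (subst nn_integral_add) (auto simp: nn_integral_cmult simp del: ennreal_numeral)
  also have "(\<integral>\<^sup>+ x. ennreal (q x) * ennreal (norm x) \<partial>lborel)
      = (\<integral>\<^sup>+ x. ennreal (norm x powr 1) \<partial>density lborel (\<lambda>x. ennreal (q x)))"
    by (subst nn_integral_density) auto
  also have "\<dots> + ennreal 2 * (\<integral>\<^sup>+ x. ennreal (exp (- (1/2) * norm x)) \<partial>(lborel :: 'a measure)) < \<infinity>"
    using prob_measures_momentD(5)[OF mu] nn_integral_exp_norm_finite[of "1/2", where 'a='a]
    by (simp add: less_top[symmetric] ennreal_mult_eq_top_iff)
  finally show ?thesis .
qed

text \<open>The Radon-Nikodym derivative is extended-valued, but total mass 1 makes it finite almost
  everywhere, so its real version is still a density.\<close>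

lemma prob_density_real:
  fixes \<mu> :: "'a::euclidean_space measure"
  assumes "\<mu> \<in> prob_measures" "f \<in> borel_measurable lborel" "\<mu> = density lborel f"
  defines "q \<equiv> \<lambda>x. enn2real (RN_deriv lborel \<mu> x)"
  shows "q \<in> borel_measurable borel" "\<mu> = density lborel (\<lambda>x. ennreal (q x))"
proof -
  interpret prob_space \<mu> by (rule prob_measuresD[OF assms(1)])
  have d: "density lborel (RN_deriv lborel \<mu>) = \<mu>"
    using assms by (intro RN_derivI) auto
  have m: "RN_deriv lborel \<mu> \<in> borel_measurable lborel" by simp
  then show "q \<in> borel_measurable borel" unfolding q_def by simp
  have "(\<integral>\<^sup>+ x. RN_deriv lborel \<mu> x \<partial>lborel) = emeasure (density lborel (RN_deriv lborel \<mu>)) UNIV"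
    by (subst emeasure_density) auto
  also have "\<dots> = 1" unfolding d using emeasure_space_1 prob_measuresD(3)[OF assms(1)] by simp
  finally have "AE x in lborel. RN_deriv lborel \<mu> x \<noteq> \<infinity>"
    by (intro nn_integral_PInf_AE m) auto
  then have "density lborel (RN_deriv lborel \<mu>) = density lborel (\<lambda>x. ennreal (q x))"
    by (intro density_cong m) (auto simp: q_def less_top elim!: eventually_mono)
  then show "\<mu> = density lborel (\<lambda>x. ennreal (q x))" using d by simp
qed

text \<open>The singular case records what the dual formula exploits: some Lebesgue-null set is
  charged by the measure. In the density case the finite negative part excludes a difference of
  infinities.\<close>

lemma entropy_functional_cases:
  fixes \<mu> :: "'a::euclidean_space measure"
  assumes "\<mu> \<in> prob_measures_moment 1"
  obtains (singular) "\<not> absolutely_continuous lborel \<mu>" "entropy_functional \<mu> = \<infinity>"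
  | (density) q where "q \<in> borel_measurable borel" "\<And>x. 0 \<le> q x" "\<mu> = density lborel (\<lambda>x. ennreal (q x))"
    "(\<integral>\<^sup>+ x. ennreal (- (q x * ln (q x))) \<partial>lborel) < \<infinity>"
    "entropy_functional \<mu> = enn2ereal (\<integral>\<^sup>+ x. ennreal (q x * ln (q x)) \<partial>lborel)
          - enn2ereal (\<integral>\<^sup>+ x. ennreal (- (q x * ln (q x))) \<partial>lborel)"
proof (cases "\<exists>f\<in>borel_measurable lborel. \<mu> = density lborel f")
  case True
  then obtain f where f: "f \<in> borel_measurable lborel" "\<mu> = density lborel f" by blast
  note m = prob_measures_momentD(1)[OF assms]
  define q where "q = (\<lambda>x. enn2real (RN_deriv lborel \<mu> x))"
  have q: "q \<in> borel_measurable borel" "\<mu> = density lborel (\<lambda>x. ennreal (q x))"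
    using prob_density_real[OF m f] unfolding q_def by auto
  have q0: "0 \<le> q x" for x by (simp add: q_def)
  have fin: "(\<integral>\<^sup>+ x. ennreal (- (q x * ln (q x))) \<partial>lborel) < \<infinity>"
    using entropy_negative_part_finite[OF q(1) q0] assms q(2) by simp
  have "entropy_functional \<mu> = enn2ereal (\<integral>\<^sup>+ x. ennreal (q x * ln (q x)) \<partial>lborel)
          - enn2ereal (\<integral>\<^sup>+ x. ennreal (- (q x * ln (q x))) \<partial>lborel)"
    unfolding entropy_functional_def Let_def q_def using True assms by simp
  then show thesis using density[of q] q q0 fin by blast
next
  case False
  have "\<not> absolutely_continuous lborel \<mu>"
  proof
    assume ac: "absolutely_continuous lborel \<mu>"
    have "density lborel (RN_deriv lborel \<mu>) = \<mu>"
      using ac prob_measures_momentD(3)[OF assms]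
      by (intro sigma_finite_measure.density_RN_deriv[OF sigma_finite_lborel]) auto
    then have "\<exists>f\<in>borel_measurable lborel. \<mu> = density lborel f"
      by (intro bexI[of _ "RN_deriv lborel \<mu>"]) auto
    then show False using False by blast
  qed
  moreover have "entropy_functional \<mu> = \<infinity>"
    unfolding entropy_functional_def using False by auto
  ultimately show thesis by (rule singular)
qed

text \<open>Writes the entropy as the mean of \<open>ln q\<close> under the measure itself, the form
  in which it arises from the log-density of independent samples.\<close>

lemma finite_entropy_log_density:
  fixes \<mu> :: "'a::euclidean_space measure"
  assumes "entropy_functional \<mu> < \<infinity>"
  shows "\<exists>q. q \<in> borel_measurable borel \<and> (\<forall>x. 0 \<le> q x) \<and> \<mu> = density lborel (\<lambda>x. ennreal (q x))
    \<and> integrable \<mu> (\<lambda>x. ln (q x)) \<and> entropy_functional \<mu> = ereal (\<integral>x. ln (q x) \<partial>\<mu>)"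
proof -
  have m: "\<mu> \<in> prob_measures_moment 1"
    using assms unfolding entropy_functional_def by (auto split: if_splits)
  show ?thesis
  proof (cases rule: entropy_functional_cases[OF m])
    case 1
    then show ?thesis using assms by simp
  next
    case (2 q)
    note [measurable] = 2(1)
    define P where "P = (\<integral>\<^sup>+ x. ennreal (q x * ln (q x)) \<partial>lborel)"
    define N where "N = (\<integral>\<^sup>+ x. ennreal (- (q x * ln (q x))) \<partial>lborel)"
    have N: "N < \<infinity>" using 2(4) by (simp add: N_def)
    have S: "entropy_functional \<mu> = enn2ereal P - enn2ereal N" using 2(5) by (simp add: P_def N_def)
    have P: "P < \<infinity>"
    proof (rule ccontr)
      assume "\<not> P < \<infinity>"
      then have "P = \<infinity>" by (simp add: less_top[symmetric])
      then have "entropy_functional \<mu> = \<infinity>" unfolding S using N by (cases N) auto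
      then show False using assms by simp
    qed
    have int: "integrable lborel (\<lambda>x. q x * ln (q x))"
      using P N unfolding P_def N_def by (subst real_integrable_def) (auto simp: less_top)
    have val: "(\<integral>x. q x * ln (q x) \<partial>lborel) = enn2real P - enn2real N"
      unfolding P_def N_def by (rule real_lebesgue_integral_def[OF int])
    have "entropy_functional \<mu> = ereal (enn2real P - enn2real N)"
      unfolding S using P N by (cases P; cases N) auto
    moreover have "integrable \<mu> (\<lambda>x. ln (q x))"
      unfolding 2(3) using int 2(2) by (subst integrable_real_density) (auto simp: mult.commute)
    moreover have "(\<integral>x. ln (q x) \<partial>\<mu>) = (\<integral>x. q x * ln (q x) \<partial>lborel)"
      unfolding 2(3) using 2(2) by (subst integral_real_density) auto
    ultimately show ?thesis using 2 val by (intro exI[of _ q]) auto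
  qed
qed

section \<open>The Donsker--Varadhan lower bound\<close>

lemma bounded_borel_ae_limit_of_continuous:
  fixes f :: "'a::euclidean_space \<Rightarrow> real"
  assumes f: "f \<in> borel_measurable borel" and fb: "\<And>x. \<bar>f x\<bar> \<le> M"
  shows "\<exists>g. (\<forall>n::nat. continuous_on UNIV (g n) \<and> (\<forall>x. \<bar>g n x\<bar> \<le> M)) \<and>
    (AE x in lborel. (\<lambda>n. g n x) \<longlonglongrightarrow> f x)"
proof -
  have "f \<in> borel_measurable (lebesgue_on UNIV)"
    using f by (simp add: borel_measurable_if_D measurable_completion)
  then have "f measurable_on UNIV"
    by (intro lebesgue_measurable_imp_measurable_on) auto
  then obtain N g where N: "negligible N" and g: "\<And>n::nat. continuous_on UNIV (g n)"
    and lim: "\<And>x. x \<notin> N \<Longrightarrow> (\<lambda>n. g n x) \<longlonglongrightarrow> f x"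
    unfolding measurable_on_def by auto
  \<comment> \<open>Clipping supplies the uniform bound for dominated convergence and leaves the
    limit unchanged, since \<open>f\<close> already takes values between \<open>- M\<close> and
    \<open>M\<close>.\<close>
  define h where "h n x = max (- M) (min M (g n x))" for n x
  have M: "0 \<le> M" using fb[of 0] by simp
  have "AE x in lebesgue. (\<lambda>n. h n x) \<longlonglongrightarrow> f x"
  proof (rule AE_I')
    show "N \<in> null_sets lebesgue" using N by (simp add: negligible_iff_null_sets)
    show "{x \<in> space lebesgue. \<not> (\<lambda>n. h n x) \<longlonglongrightarrow> f x} \<subseteq> N"
    proof (clarsimp, rule ccontr)
      fix x assume n: "\<not> (\<lambda>n. h n x) \<longlonglongrightarrow> f x" and "x \<notin> N"
      then have "(\<lambda>n. h n x) \<longlonglongrightarrow> max (- M) (min M (f x))"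
        unfolding h_def by (intro tendsto_intros lim)
      moreover have "max (- M) (min M (f x)) = f x" using fb[of x] by auto
      ultimately show False using n by simp
    qed
  qed
  then have "AE x in lborel. (\<lambda>n. h n x) \<longlonglongrightarrow> f x"
    by (simp add: AE_completion_iff)
  moreover have "continuous_on UNIV (h n)" "\<bar>h n x\<bar> \<le> M" for n x
    unfolding h_def using g M by (auto intro!: continuous_intros)
  ultimately show ?thesis by blast
qed

text \<open>Replaces a bounded Borel test function by a continuous one: a strict inequality survives
  the limit, with \<open>exp M\<close> times the exponential weight as dominating function. The
  disjunction serves two uses: in the singular case the means of \<open>g n\<close> lie above
  \<open>b\<close>, in the density case they converge to \<open>b\<close>.\<close>

lemma donsker_varadhan_approximation:
  fixes \<mu> :: "'a::euclidean_space measure" and g :: "nat \<Rightarrow> 'a \<Rightarrow> real"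
  assumes mu: "\<mu> \<in> prob_measures_moment 1" and c: "0 < c" and l: "1 \<le> l"
    and g: "\<And>n. continuous_on UNIV (g n)" "\<And>n x. \<bar>g n x\<bar> \<le> M" and glim: "AE x in lborel. (\<lambda>n. g n x) \<longlonglongrightarrow> f x"
    and gmu: "(\<forall>n. b \<le> (\<integral>x. g n x \<partial>\<mu>)) \<or> (\<lambda>n. \<integral>x. g n x \<partial>\<mu>) \<longlonglongrightarrow> b"
    and fm: "f \<in> borel_measurable borel" "\<And>x. \<bar>f x\<bar> \<le> M"
    and lt: "(\<integral>x. exp (f x) * exp (- c * norm x powr l) \<partial>lborel) < exp (b - a)"
  shows "\<exists>f. continuous_on UNIV f \<and> bounded (range f) \<and>
    (\<integral>\<^sup>+ x. ennreal (exp (f x - c * norm x powr l)) \<partial>lborel) < ennreal (exp ((\<integral>x. f x \<partial>\<mu>) - a))"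
proof -
  note m = prob_measures_momentD[OF mu]
  define E where "E x = exp (- c * norm x powr l)" for x :: 'a
  have E0: "0 < E x" for x by (simp add: E_def)
  have Ei: "integrable lborel E" unfolding E_def by (rule integrable_exp_norm_powr[OF c l])
  have Em[measurable]: "E \<in> borel_measurable borel" using Ei by auto
  note lt = lt[folded E_def]
  have gm[measurable]: "g n \<in> borel_measurable borel" for n by (rule borel_measurable_continuous_onI[OF g(1)])
  note fm(1)[measurable]
  have gi: "integrable lborel (\<lambda>x. exp (g n x) * E x)" for n
  proof (rule Bochner_Integration.integrable_bound[of _ "\<lambda>x. exp M * E x"])
    show "AE x in lborel. norm (exp (g n x) * E x) \<le> norm (exp M * E x)"
      using g(2) E0 by (intro AE_I2) (auto simp: abs_mult abs_le_iff less_imp_le intro!: mult_right_mono)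
  qed (use Ei in auto)
  have "(\<lambda>n. \<integral>x. exp (g n x) * E x \<partial>lborel) \<longlonglongrightarrow> (\<integral>x. exp (f x) * E x \<partial>lborel)"
  proof (rule integral_dominated_convergence[where w="\<lambda>x. exp M * E x"])
    show "AE x in lborel. (\<lambda>n. exp (g n x) * E x) \<longlonglongrightarrow> exp (f x) * E x"
      using glim by eventually_elim (intro tendsto_intros)
    show "AE x in lborel. norm (exp (g n x) * E x) \<le> exp M * E x" for n
      using g(2) E0 by (intro AE_I2) (auto simp: abs_mult abs_le_iff less_imp_le intro!: mult_right_mono)
  qed (use Ei in auto)
  \<comment> \<open>Lowering \<open>b\<close> a little keeps the strict inequality and leaves room
    for means that only converge to \<open>b\<close>.\<close>
  moreover obtain b' where b': "b' < b" "(\<integral>x. exp (f x) * E x \<partial>lborel) < exp (b' - a)"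
  proof -
    have "((\<lambda>b'. exp (b' - a)) \<longlongrightarrow> exp (b - a)) (at_left b)" by (intro tendsto_intros)
    then have "\<forall>\<^sub>F b' in at_left b. (\<integral>x. exp (f x) * E x \<partial>lborel) < exp (b' - a)"
      using lt by (rule order_tendstoD)
    moreover have "\<forall>\<^sub>F b' in at_left b. b' < b" by (simp add: eventually_at_filter)
    ultimately have "\<forall>\<^sub>F b' in at_left b. b' < b \<and> (\<integral>x. exp (f x) * E x \<partial>lborel) < exp (b' - a)"
      by eventually_elim simp
    then show thesis using that eventually_happens'[OF trivial_limit_at_left_real] by blast
  qed
  ultimately have "\<forall>\<^sub>F n in sequentially. (\<integral>x. exp (g n x) * E x \<partial>lborel) < exp (b' - a)"
    by (intro order_tendstoD)
  moreover have "\<forall>\<^sub>F n in sequentially. b' < (\<integral>x. g n x \<partial>\<mu>)"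
  proof (cases "(\<lambda>n. \<integral>x. g n x \<partial>\<mu>) \<longlonglongrightarrow> b")
    case True
    then show ?thesis using b'(1) by (rule order_tendstoD)
  next
    case False
    then show ?thesis using gmu b'(1) by (intro always_eventually) (auto intro: less_le_trans)
  qed
  ultimately have "\<forall>\<^sub>F n in sequentially. (\<integral>x. exp (g n x) * E x \<partial>lborel) < exp ((\<integral>x. g n x \<partial>\<mu>) - a)"
    by eventually_elim (erule less_trans, simp)
  then obtain n where n: "(\<integral>x. exp (g n x) * E x \<partial>lborel) < exp ((\<integral>x. g n x \<partial>\<mu>) - a)"
    by (auto simp: eventually_sequentially)
  have "(\<integral>\<^sup>+ x. ennreal (exp (g n x - c * norm x powr l)) \<partial>lborel) = (\<integral>\<^sup>+ x. ennreal (exp (g n x) * E x) \<partial>lborel)"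
    by (intro nn_integral_cong) (simp add: E_def mult_exp_exp)
  also have "\<dots> = ennreal (\<integral>x. exp (g n x) * E x \<partial>lborel)"
    using E0 by (intro nn_integral_eq_integral gi) (auto intro!: AE_I2 mult_nonneg_nonneg less_imp_le)
  also have "\<dots> < ennreal (exp ((\<integral>x. g n x \<partial>\<mu>) - a))"
    using n by (intro ennreal_lessI) auto
  finally show ?thesis
    using g by (intro exI[of _ "g n"]) (auto simp: bounded_iff intro!: exI[of _ M])
qed

text \<open>The ideal test function is \<open>ln q + c * norm x powr l\<close>, the log-density
  relative to the exponential weight: its exponential integrates to 1 against the weight, and its
  mean is at least the entropy because the power only adds. It is truncated to become bounded. In
  the singular case a large multiple of the indicator of a compact null set charged by the measure
  takes its place.\<close>

lemma donsker_varadhan_lower: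
  fixes \<mu> :: "'a::euclidean_space measure"
  assumes mu: "\<mu> \<in> prob_measures_moment 1" and c: "0 < c" and l: "1 \<le> l"
    and a: "ereal a < entropy_functional \<mu>"
  shows "\<exists>f. continuous_on UNIV f \<and> bounded (range f) \<and>
    (\<integral>\<^sup>+ x. ennreal (exp (f x - c * norm x powr l)) \<partial>lborel) < ennreal (exp ((\<integral>x. f x \<partial>\<mu>) - a))"
proof -
  note m = prob_measures_momentD[OF mu]
  interpret prob_space \<mu> by (rule m)
  define E where "E x = exp (- c * norm x powr l)" for x :: 'a
  have E0: "0 < E x" for x by (simp add: E_def)
  have Ei: "integrable lborel E" unfolding E_def by (rule integrable_exp_norm_powr[OF c l])
  have Em[measurable]: "E \<in> borel_measurable borel" using Ei by auto
  define Z where "Z = (\<integral>x. E x \<partial>lborel)"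
  have Z0: "0 \<le> Z" unfolding Z_def using E0 by (intro integral_nonneg_AE) (auto intro: less_imp_le)
  show ?thesis
  proof (cases rule: entropy_functional_cases[OF mu])
    case 1
    then obtain A where A: "A \<in> null_sets lborel" "A \<notin> null_sets \<mu>"
      unfolding absolutely_continuous_def by blast
    have Ab: "A \<in> sets borel" using A(1) by auto
    then have "0 < emeasure \<mu> A" using A(2) m(3) by (auto simp: null_sets_def zero_less_iff_neq_zero)
    also have "emeasure \<mu> A = (SUP K\<in>{K. K \<subseteq> A \<and> compact K}. emeasure \<mu> K)"
      using Ab m by (intro inner_regular) auto
    finally obtain K where K: "K \<subseteq> A" "compact K" "0 < emeasure \<mu> K"
      by (auto simp: less_SUP_iff)
    have Ks[measurable]: "K \<in> sets borel" using K(2) by (simp add: compact_imp_closed)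
    have Kmu: "K \<in> sets \<mu>" using Ks m by simp
    have K0: "K \<noteq> {}" using K(3) by auto
    define w where "w = measure \<mu> K"
    have w: "0 < w" using K(3) by (simp add: w_def emeasure_eq_measure)
    have Knull: "K \<in> null_sets lborel" using null_sets_subset[OF A(1)] K(1) Ks by auto
    \<comment> \<open>Large enough that \<open>exp (t * w - a)\<close> is at least
      \<open>Z + 1\<close>; the Lebesgue integral stays equal to \<open>Z\<close> because
      \<open>K\<close> is a null set.\<close>
    define t where "t = max 0 ((a + ln (Z + 1)) / w)"
    have t: "0 \<le> t" "a + ln (Z + 1) \<le> t * w"
      using w by (auto simp: t_def max_def field_simps)
    define g where "g n x = t * max 0 (1 - real n * infdist x K)" for n :: nat and x
    show ?thesis
    proof (rule donsker_varadhan_approximation[where g=g and f="\<lambda>x. t * indicator K x" and M=t and b="t * w", OF mu c l])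
      show "continuous_on UNIV (g n)" for n
        unfolding g_def by (intro continuous_intros)
      show gb: "\<bar>g n x\<bar> \<le> t" for n x
      proof -
        have "0 \<le> real n * infdist x K" by (simp add: infdist_nonneg)
        then have "0 \<le> max 0 (1 - real n * infdist x K)" "max 0 (1 - real n * infdist x K) \<le> 1" by auto
        then show ?thesis unfolding g_def using t mult_left_le[of "max 0 (1 - real n * infdist x K)" t] by (simp add: abs_mult)
      qed
      show "AE x in lborel. (\<lambda>n. g n x) \<longlonglongrightarrow> t * indicator K x"
      proof (rule AE_I2)
        fix x
        show "(\<lambda>n. g n x) \<longlonglongrightarrow> t * indicator K x"
        proof (cases "x \<in> K")
          case True
          then show ?thesis by (simp add: g_def)
        next
          case False
          have pos: "0 < infdist x K"
            using False K0 K(2) in_closed_iff_infdist_zero[of K x] infdist_nonneg[of x K]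
            by (simp add: compact_imp_closed less_le)
          then obtain n0 where n0: "1 < real n0 * infdist x K" using reals_Archimedean3 by blast
          have "g n x = 0" if "n \<ge> n0" for n
          proof -
            have "real n0 * infdist x K \<le> real n * infdist x K" using that pos by (intro mult_right_mono) auto
            then show ?thesis using n0 by (simp add: g_def)
          qed
          then show ?thesis using False by (auto intro!: tendsto_eventually eventually_sequentiallyI)
        qed
      qed
      have "t * w \<le> (\<integral>x. g n x \<partial>\<mu>)" for n
      proof -
        have gm: "g n \<in> borel_measurable \<mu>"
          unfolding measurable_prob_measures[OF m(1)] g_def
          by (intro borel_measurable_continuous_onI continuous_intros)
        have "t * w = (\<integral>x. t * indicator K x \<partial>\<mu>)" using Kmu by (simp add: w_def)
        also have "\<dots> \<le> (\<integral>x. g n x \<partial>\<mu>)"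
        proof (rule integral_mono)
          show "integrable \<mu> (\<lambda>x. t * indicator K x)" using Kmu by (simp add: emeasure_eq_measure)
          show "integrable \<mu> (g n)" using gb gm by (intro integrable_const_bound[where B=t]) auto
          show "t * indicator K x \<le> g n x" for x
            using t K0 by (auto simp: g_def indicator_def intro!: mult_nonneg_nonneg)
        qed
        finally show ?thesis .
      qed
      then show "(\<forall>n. t * w \<le> (\<integral>x. g n x \<partial>\<mu>)) \<or> (\<lambda>n. \<integral>x. g n x \<partial>\<mu>) \<longlonglongrightarrow> t * w" by blast
      have "(\<integral>x. exp (t * indicator K x) * E x \<partial>lborel) = Z"
        unfolding Z_def
      proof (rule integral_cong_AE)
        show "AE x in lborel. exp (t * indicator K x) * E x = E x"
          using AE_not_in[OF Knull] by eventually_elim simp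
      qed auto
      also have "Z < Z + 1" by simp
      also have "Z + 1 = exp (ln (Z + 1))" using Z0 by simp
      also have "\<dots> \<le> exp (t * w - a)" using t by simp
      finally show "(\<integral>x. exp (t * indicator K x) * exp (- c * norm x powr l) \<partial>lborel) < exp (t * w - a)"
        unfolding E_def .
    qed (use t in \<open>auto simp: indicator_def\<close>)
  next
    case (2 q)
    note q[measurable] = 2(1)
    define P where "P = (\<integral>\<^sup>+ x. ennreal (q x * ln (q x)) \<partial>lborel)"
    define N where "N = (\<integral>\<^sup>+ x. ennreal (- (q x * ln (q x))) \<partial>lborel)"
    obtain N' where N': "0 \<le> N'" "N = ennreal N'" using 2(4) unfolding N_def by (metis ennreal_cases infinity_ennreal_def less_irrefl)
    have "ereal a < enn2ereal P - ereal N'" using a 2(5) N' by (simp add: P_def[symmetric] N_def[symmetric])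
    then have "ereal (a + N') < enn2ereal P" by (simp add: ereal_less_minus_iff)
    \<comment> \<open>The margin between \<open>a + N'\<close> and \<open>a'\<close> later absorbs
      the term \<open>exp (- real k) * Z\<close> caused by the truncation from below.\<close>
    then obtain a' where a': "a + N' < a'" "ereal a' < enn2ereal P"
      using ereal_dense2 by (metis ereal_less(2) ereal_less_eq(3) less_ereal.simps(1))
    define pm where "pm k x = q x * min (real k) (max 0 (ln (q x)))" for k x
    have pm[measurable]: "pm k \<in> borel_measurable borel" for k unfolding pm_def by measurable
    have q0: "0 \<le> q x" for x by (rule 2(2))
    have pm0: "0 \<le> pm k x" for k x unfolding pm_def using q0 by simp
    have qi: "(\<integral>\<^sup>+ x. ennreal (q x) \<partial>lborel) = 1"
    proof -
      have "(\<integral>\<^sup>+ x. ennreal (q x) \<partial>lborel) = emeasure \<mu> UNIV" unfolding 2(3) by (subst emeasure_density) auto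
      then show ?thesis using emeasure_space_1 m(4) by simp
    qed
    have qint: "integrable lborel q" using qi q0 by (intro integrableI_bounded) auto
    have qint1: "(\<integral>x. q x \<partial>lborel) = 1" using qi q0 by (simp add: integral_eq_nn_integral)
    have Pk: "(\<lambda>k. \<integral>\<^sup>+ x. ennreal (pm k x) \<partial>lborel) \<longlonglongrightarrow> P"
    proof -
      have "P = (\<integral>\<^sup>+ x. ennreal (q x * max 0 (ln (q x))) \<partial>lborel)"
        unfolding P_def using q0 by (intro nn_integral_cong) (auto simp: max_def ennreal_neg mult_nonneg_nonpos)
      also have "\<dots> = (\<integral>\<^sup>+ x. (SUP k. ennreal (pm k x)) \<partial>lborel)"
      proof (rule nn_integral_cong)
        fix x
        have "incseq (\<lambda>k. ennreal (pm k x))"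
          unfolding pm_def using q0 by (intro monoI ennreal_leI mult_left_mono) auto
        moreover have "(\<lambda>k. ennreal (pm k x)) \<longlonglongrightarrow> ennreal (q x * max 0 (ln (q x)))"
        proof (rule tendsto_eventually, rule eventually_sequentiallyI[of "nat \<lceil>max 0 (ln (q x))\<rceil>"])
          fix k assume "nat \<lceil>max 0 (ln (q x))\<rceil> \<le> k"
          then have "max 0 (ln (q x)) \<le> real k" by linarith
          then show "ennreal (pm k x) = ennreal (q x * max 0 (ln (q x)))" by (simp add: pm_def)
        qed
        ultimately show "ennreal (q x * max 0 (ln (q x))) = (SUP k. ennreal (pm k x))"
          using LIMSEQ_SUP LIMSEQ_unique by blast
      qed
      also have "\<dots> = (SUP k. \<integral>\<^sup>+ x. ennreal (pm k x) \<partial>lborel)"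
        using q0 by (intro nn_integral_monotone_convergence_SUP)
          (auto simp: incseq_def le_fun_def pm_def intro!: ennreal_leI mult_left_mono)
      finally have Pe: "P = (SUP k. \<integral>\<^sup>+ x. ennreal (pm k x) \<partial>lborel)" .
      have "incseq (\<lambda>k. \<integral>\<^sup>+ x. ennreal (pm k x) \<partial>lborel)"
        using q0 by (intro monoI nn_integral_mono) (auto simp: pm_def intro!: ennreal_leI mult_left_mono)
      then show ?thesis unfolding Pe by (rule LIMSEQ_SUP)
    qed
    have "\<forall>\<^sub>F k in sequentially. ennreal a' < (\<integral>\<^sup>+ x. ennreal (pm k x) \<partial>lborel) \<or> a' < 0"
    \<comment> \<open>For negative \<open>a'\<close> the comparison in \<open>ennreal\<close>
      carries no information; nonnegativity of the integral then does the same work.\<close>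
    proof (cases "a' < 0")
      case False
      have "ennreal a' < P" using a'(2) False
        by (metis enn2ereal_ennreal less_ennreal.rep_eq linorder_not_less)
      then show ?thesis using order_tendstoD(1)[OF Pk] by (auto elim: eventually_mono)
    qed simp
    moreover have "\<forall>\<^sub>F k in sequentially. 1 + exp (- real k) * Z < exp (a' - N' - a)"
    proof (rule order_tendstoD(2))
      have "(\<lambda>k. exp (- real k)) \<longlonglongrightarrow> 0"
        by (intro filterlim_compose[OF exp_at_bot] filterlim_compose[OF filterlim_uminus_at_bot_at_top] filterlim_real_sequentially)
      then have "(\<lambda>k. 1 + exp (- real k) * Z) \<longlonglongrightarrow> 1 + 0 * Z" by (intro tendsto_intros)
      then show "(\<lambda>k. 1 + exp (- real k) * Z) \<longlonglongrightarrow> 1" by simp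
      show "1 < exp (a' - N' - a)" using a'(1) by simp
    qed
    ultimately obtain k where k: "ennreal a' < (\<integral>\<^sup>+ x. ennreal (pm k x) \<partial>lborel) \<or> a' < 0"
      "1 + exp (- real k) * Z < exp (a' - N' - a)"
      using eventually_happens'[OF sequentially_bot eventually_conj] by blast
    \<comment> \<open>Where \<open>q\<close> vanishes the value is prescribed, since
      \<open>ln 0 = 0\<close> would make \<open>f\<close> nonnegative there and the exponential
      integral too large.\<close>
    define f where "f x = (if q x = 0 then - real k else max (- real k) (min (real k) (ln (q x) + c * norm x powr l)))" for x
    have fm[measurable]: "f \<in> borel_measurable borel" unfolding f_def by measurable
    have fb: "\<bar>f x\<bar> \<le> real k" for x by (auto simp: f_def)
    have ef: "exp (f x) * E x \<le> q x + exp (- real k) * E x" for x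
    proof (cases "q x = 0")
      case False
      then have qp: "0 < q x" using q0[of x] by simp
      have "f x \<le> - real k \<or> f x \<le> ln (q x) + c * norm x powr l" using False by (auto simp: f_def)
      then show ?thesis
      proof
        assume "f x \<le> - real k"
        then have "exp (f x) * E x \<le> exp (- real k) * E x" using E0[of x] by (intro mult_right_mono) auto
        then show ?thesis using q0[of x] by linarith
      next
        assume "f x \<le> ln (q x) + c * norm x powr l"
        then have "exp (f x) * E x \<le> exp (ln (q x) + c * norm x powr l) * E x" using E0[of x] by (intro mult_right_mono) auto
        also have "\<dots> = q x" using qp by (simp add: E_def mult_exp_exp)
        finally show ?thesis using E0[of x] by (smt (verit) exp_gt_zero mult_pos_pos)
      qed
    qed (simp add: f_def)
    have efi: "integrable lborel (\<lambda>x. exp (f x) * E x)"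
    proof (rule Bochner_Integration.integrable_bound[of _ "\<lambda>x. q x + exp (- real k) * E x"])
      show "AE x in lborel. norm (exp (f x) * E x) \<le> norm (q x + exp (- real k) * E x)"
        using ef E0 q0 by (intro AE_I2) (auto simp: abs_mult less_imp_le intro!: order_trans[OF ef])
    qed (use Ei qint in auto)
    have "(\<integral>x. exp (f x) * E x \<partial>lborel) \<le> (\<integral>x. q x + exp (- real k) * E x \<partial>lborel)"
      using ef efi Ei qint by (intro integral_mono) auto
    also have "\<dots> = 1 + exp (- real k) * Z" using Ei qint qint1 by (simp add: Z_def)
    finally have ub: "(\<integral>x. exp (f x) * E x \<partial>lborel) < exp (a' - N' - a)" using k(2) by simp
    have pmi: "integrable lborel (pm k)"
    proof (rule Bochner_Integration.integrable_bound[of _ "\<lambda>x. real k * q x"])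
      have "pm k x \<le> q x * real k" for x unfolding pm_def using q0 by (intro mult_left_mono) auto
      then show "AE x in lborel. norm (pm k x) \<le> norm (real k * q x)"
        using q0 pm0 by (intro AE_I2) (simp add: mult.commute)
    qed (use qint in auto)
    define neg where "neg x = max 0 (- (q x * ln (q x)))" for x
    have negm[measurable]: "neg \<in> borel_measurable borel" unfolding neg_def by measurable
    have negN: "(\<integral>\<^sup>+ x. ennreal (neg x) \<partial>lborel) = ennreal N'"
      unfolding N'(2)[symmetric] N_def neg_def by (intro nn_integral_cong) (auto simp: max_def ennreal_neg)
    have negi: "integrable lborel neg"
      using negN by (intro integrableI_bounded) (auto simp: neg_def)
    have neg1: "(\<integral>x. neg x \<partial>lborel) = N'"
      using negN N'(1) by (subst integral_eq_nn_integral) (auto simp: neg_def)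
    have pm1: "a' \<le> (\<integral>x. pm k x \<partial>lborel)"
    proof -
      have e: "(\<integral>\<^sup>+ x. ennreal (pm k x) \<partial>lborel) = ennreal (\<integral>x. pm k x \<partial>lborel)"
        using pm0 by (intro nn_integral_eq_integral pmi) auto
      have "0 \<le> (\<integral>x. pm k x \<partial>lborel)" using pm0 by (intro integral_nonneg_AE) auto
      then show ?thesis using k(1) unfolding e by (smt (verit) ennreal_leI linorder_not_less)
    qed
    \<comment> \<open>The truncation loses only part of the positive logarithm. The full negative
      part survives, because truncating from below at \<open>- real k\<close> only raises the
      value.\<close>
    have fq: "pm k x - neg x \<le> q x * f x" for x
    proof (cases "q x = 0")
      case False
      then have qp: "0 < q x" using q0[of x] by simp
      have cn: "0 \<le> c * norm x powr l" using c by simp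
      show ?thesis
      proof (cases "ln (q x) \<ge> 0")
        case True
        then have "min (real k) (max 0 (ln (q x))) \<le> f x" using False cn by (auto simp: f_def)
        then have "pm k x \<le> q x * f x" unfolding pm_def using qp by (intro mult_left_mono) auto
        then show ?thesis by (simp add: neg_def)
      next
        case ln: False
        then have "ln (q x) \<le> f x" using False cn by (auto simp: f_def)
        then have "q x * ln (q x) \<le> q x * f x" using qp by (intro mult_left_mono) auto
        moreover have "pm k x = 0" using ln by (simp add: pm_def max_def)
        moreover have "neg x \<ge> - (q x * ln (q x))" by (simp add: neg_def)
        ultimately show ?thesis by linarith
      qed
    qed (simp add: pm_def neg_def)
    have fi: "integrable lborel (\<lambda>x. q x * f x)"
    proof (rule Bochner_Integration.integrable_bound[of _ "\<lambda>x. real k * q x"])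
      have "q x * \<bar>f x\<bar> \<le> q x * real k" for x by (rule mult_left_mono[OF fb q0])
      then show "AE x in lborel. norm (q x * f x) \<le> norm (real k * q x)"
        using q0 by (intro AE_I2) (simp add: abs_mult mult.commute)
    qed (use qint in auto)
    define b where "b = (\<integral>x. f x \<partial>\<mu>)"
    have "a' - N' \<le> (\<integral>x. pm k x - neg x \<partial>lborel)" using pm1 pmi negi neg1 by simp
    also have "\<dots> \<le> (\<integral>x. q x * f x \<partial>lborel)" using fq pmi negi fi by (intro integral_mono) auto
    also have "\<dots> = b" unfolding b_def 2(3) using q0 by (subst integral_real_density) auto
    finally have "exp (a' - N' - a) \<le> exp (b - a)" by simp
    then have ub': "(\<integral>x. exp (f x) * E x \<partial>lborel) < exp (b - a)" using ub by linarith
    obtain g where g: "\<And>n::nat. continuous_on UNIV (g n)" "\<And>n x. \<bar>g n x\<bar> \<le> real k"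
      "AE x in lborel. (\<lambda>n. g n x) \<longlonglongrightarrow> f x"
      using bounded_borel_ae_limit_of_continuous[OF fm fb] by blast
    have gm: "g n \<in> borel_measurable borel" for n by (rule borel_measurable_continuous_onI[OF g(1)])
    have "(\<lambda>n. \<integral>x. g n x \<partial>\<mu>) \<longlonglongrightarrow> b"
      unfolding b_def
    proof (rule integral_dominated_convergence[where w="\<lambda>_. real k"])
      show "AE x in \<mu>. (\<lambda>n. g n x) \<longlonglongrightarrow> f x"
        unfolding 2(3) using g(3) by (subst AE_density) (auto elim!: eventually_mono)
    qed (use gm g(2) in \<open>auto simp: measurable_prob_measures[OF m(1)]\<close>)
    then show ?thesis
      by (intro donsker_varadhan_approximation[where g=g and f=f and M="real k" and b=b, OF mu c l] g fm fb ub'[unfolded E_def]) simp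
  qed
qed

section \<open>Empirical measures\<close>

lemma empirical_measure_prob:
  assumes "1 \<le> n"
  shows "empirical_measure n x \<in> prob_measures"
  unfolding empirical_measure_def
  using assms by (intro distr_in_prob_measures prob_space_uniform_count_measure) (auto simp: measurable_def sets_uniform_count_measure space_uniform_count_measure)

lemma measurable_uniform_count[measurable, simp]: "f \<in> measurable (uniform_count_measure A) borel"
  by (auto simp: measurable_def sets_uniform_count_measure space_uniform_count_measure)

lemma integral_uniform_count_measure':
  fixes f :: "'b \<Rightarrow> 'c::{banach, second_countable_topology}"
  assumes "finite A"
  shows "integral\<^sup>L (uniform_count_measure A) f = (\<Sum>x\<in>A. f x /\<^sub>R real (card A))"
  unfolding uniform_count_measure_def
  using assms by (subst lebesgue_integral_point_measure_finite) (auto simp: divide_inverse)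

lemma integral_empirical_measure:
  fixes f :: "'a::euclidean_space \<Rightarrow> 'b::{banach, second_countable_topology}"
  assumes "f \<in> borel_measurable borel"
  shows "(\<integral>y. f y \<partial>empirical_measure n x) = (\<Sum>i=1..n. f (x i)) /\<^sub>R real n"
  unfolding empirical_measure_def using assms
  by (subst integral_distr) (auto simp: integral_uniform_count_measure' scaleR_sum_right)

lemma nn_integral_empirical_measure:
  fixes f :: "'a::euclidean_space \<Rightarrow> real"
  assumes "f \<in> borel_measurable borel" "\<And>y. 0 \<le> f y" "1 \<le> n"
  shows "(\<integral>\<^sup>+ y. ennreal (f y) \<partial>empirical_measure n x) = ennreal ((\<Sum>i=1..n. f (x i)) / real n)"
proof -
  have "(\<integral>\<^sup>+ y. ennreal (f y) \<partial>empirical_measure n x) = (\<integral>\<^sup>+ i. ennreal (f (x i)) \<partial>uniform_count_measure {1..n})"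
    unfolding empirical_measure_def using assms by (subst nn_integral_distr) auto
  also have "\<dots> = (\<Sum>i=1..n. ennreal (f (x i) / real n))"
    unfolding uniform_count_measure_def using assms
    by (subst nn_integral_point_measure_finite) (auto simp flip: ennreal_mult intro!: sum.cong)
  also have "\<dots> = ennreal ((\<Sum>i=1..n. f (x i)) / real n)"
    using assms by (subst sum_ennreal) (auto simp: sum_divide_distrib)
  finally show ?thesis .
qed

lemma empirical_measure_moment:
  assumes "1 \<le> n"
  shows "empirical_measure n x \<in> prob_measures_moment p"
  using empirical_measure_prob[OF assms, of x]
    nn_integral_empirical_measure[of "\<lambda>y. norm y powr p" n x] assms
  by (simp add: prob_measures_moment_def)

lemma empirical_measure_centered:
  assumes "1 \<le> n" "(\<Sum>i=1..n. x i) = 0"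
  shows "empirical_measure n x \<in> centered_prob_measures p"
  using empirical_measure_moment[OF assms(1)] integral_empirical_measure[of "\<lambda>y. y" n x] assms(2)
  by (simp add: centered_prob_measures_def)

lemma empirical_measure_support_compact:
  assumes "1 \<le> n"
  shows "compact (measure_support (empirical_measure n x))"
proof -
  have "measure_support (empirical_measure n x) \<subseteq> x ` {1..n}"
  proof
    fix y assume y: "y \<in> measure_support (empirical_measure n x)"
    show "y \<in> x ` {1..n}"
    proof (rule ccontr)
      assume "y \<notin> x ` {1..n}"
      moreover have o: "open (- (x ` {1..n}))" by (intro open_Compl finite_imp_closed) simp
      ultimately have "emeasure (empirical_measure n x) (- (x ` {1..n})) > 0"
        using y unfolding measure_support_def by blast
      moreover have "emeasure (empirical_measure n x) (- (x ` {1..n})) = 0"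
      proof -
        have "x -` (- (x ` {1..n})) \<inter> space (uniform_count_measure {1..n}) = {}"
          by (auto simp: space_uniform_count_measure)
        then show ?thesis unfolding empirical_measure_def using o by (subst emeasure_distr) auto
      qed
      ultimately show False by simp
    qed
  qed
  then have "finite (measure_support (empirical_measure n x))" by (rule finite_subset) simp
  then show ?thesis by (rule finite_imp_compact)
qed

text \<open>A finite support is compact. Hence the Gibbs weight is positive at every
  configuration.\<close>

lemma energy_empirical_finite:
  assumes "sigma_finite_energy W" "1 \<le> n"
  shows "energy_n W n x < \<infinity>"
  using assms empirical_measure_prob[OF assms(2)] empirical_measure_support_compact[OF assms(2)]
  unfolding sigma_finite_energy_def energy_n_def by blast

section \<open>Measurability of the energy of a configuration\<close>

lemma topspace_weak: "topspace weak_topology = (prob_measures :: 'a::euclidean_space measure set)"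
proof
  show "topspace weak_topology \<subseteq> (prob_measures :: 'a measure set)"
    unfolding weak_topology_def topology_generated_by_topspace by auto
  have "openin weak_topology {\<mu> \<in> (prob_measures :: 'a measure set). (\<integral>x. (0::real) \<partial>\<mu>) \<in> UNIV}"
    unfolding weak_topology_def by (intro topology_generated_by_Basis) (auto intro!: exI[of _ "\<lambda>_. 0"] exI[of _ UNIV])
  then show "(prob_measures :: 'a measure set) \<subseteq> topspace weak_topology" using openin_subset by fastforce
qed

text \<open>By induction over the generation of the weak topology; a subbasic set pulls back along
  an average of finitely many continuous coordinate functions.\<close>

lemma open_vimage_empirical_measure:
  fixes V :: "'a::euclidean_space measure set"
  assumes n: "1 \<le> n" and V: "openin weak_topology V"
  shows "open {x. empirical_measure n x \<in> V}"
proof -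
  have "generate_topology_on {{\<mu> \<in> prob_measures. (\<integral>x. f x \<partial>\<mu>) \<in> U} | (f :: 'a \<Rightarrow> real) U.
        continuous_on UNIV f \<and> bounded (range f) \<and> open U} V"
    using V unfolding weak_topology_def openin_topology_generated_by_iff .
  then show ?thesis
  proof induction
    case (Int a b)
    then show ?case by (simp add: Collect_conj_eq open_Int)
  next
    case (UN K)
    have "{x. empirical_measure n x \<in> \<Union>K} = (\<Union>k\<in>K. {x. empirical_measure n x \<in> k})" by auto
    then show ?case using UN by (metis (no_types, lifting) open_UN)
  next
    case (Basis s)
    then obtain f :: "'a \<Rightarrow> real" and U where s: "s = {\<mu> \<in> prob_measures. (\<integral>x. f x \<partial>\<mu>) \<in> U}"
      "continuous_on UNIV f" "bounded (range f)" "open U" by blast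
    have "{x. empirical_measure n x \<in> s} = (\<lambda>x. (\<Sum>i=1..n. f (x i)) /\<^sub>R real n) -` U"
      using s empirical_measure_prob[OF n] by (auto simp: integral_empirical_measure borel_measurable_continuous_onI)
    moreover have "open ((\<lambda>x. (\<Sum>i=1..n. f (x i)) /\<^sub>R real n) -` U)"
      by (intro open_vimage s continuous_intros continuous_on_compose2[OF s(2)] continuous_on_product_coordinates) auto
    ultimately show ?case by simp
  qed simp
qed

text \<open>Relates the product over \<open>{1..n}\<close> to the Borel sets of the full function
  space. Outside \<open>{1..n}\<close> an extensional function has the constant value
  \<open>undefined\<close>.\<close>

lemma measurable_PiM_embed:
  "(\<lambda>x. x) \<in> Pi\<^sub>M {1..n::nat} (\<lambda>_. borel :: 'a::euclidean_space measure) \<rightarrow>\<^sub>M (borel :: (nat \<Rightarrow> 'a) measure)"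
proof -
  have "(\<lambda>x. x) \<in> Pi\<^sub>M {1..n::nat} (\<lambda>_. borel :: 'a measure) \<rightarrow>\<^sub>M Pi\<^sub>M UNIV (\<lambda>_. borel)"
  proof (rule measurable_PiM_single')
    fix i :: nat
    show "(\<lambda>x. x i) \<in> Pi\<^sub>M {1..n::nat} (\<lambda>_. borel :: 'a measure) \<rightarrow>\<^sub>M borel"
    proof (cases "i \<in> {1..n}")
      case False
      have "(\<lambda>x. x i) \<in> Pi\<^sub>M {1..n::nat} (\<lambda>_. borel :: 'a measure) \<rightarrow>\<^sub>M borel
        \<longleftrightarrow> (\<lambda>x. undefined :: 'a) \<in> Pi\<^sub>M {1..n::nat} (\<lambda>_. borel :: 'a measure) \<rightarrow>\<^sub>M borel"
        by (rule measurable_cong) (use False in \<open>auto simp: space_PiM PiE_def extensional_def\<close>)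
      then show ?thesis by simp
    qed simp
  qed (auto simp: space_PiM)
  then show ?thesis using measurable_cong_sets[OF refl sets_PiM_equal_borel] by blast
qed

lemma energy_n_borel:
  assumes "lower_semicontinuous_energy W" "1 \<le> n"
  shows "energy_n W n \<in> borel_measurable borel"
proof (rule borel_measurableI_le)
  fix w
  have c: "closedin weak_topology {\<mu> \<in> prob_measures. W \<mu> \<le> w}"
    using assms(1) unfolding lower_semicontinuous_energy_def by blast
  have "open {x. empirical_measure n x \<in> prob_measures - {\<mu> \<in> prob_measures. W \<mu> \<le> w}}"
    using c by (intro open_vimage_empirical_measure assms) (auto simp: closedin_def topspace_weak)
  then have c: "closed (- {x. empirical_measure n x \<in> prob_measures - {\<mu> \<in> prob_measures. W \<mu> \<le> w}})"
    by (rule closed_Compl)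
  have eq: "- {x. empirical_measure n x \<in> prob_measures - {\<mu> \<in> prob_measures. W \<mu> \<le> w}} = {x. energy_n W n x \<le> w}"
    using empirical_measure_prob[OF assms(2)] by (auto simp: energy_n_def)
  have "{x. energy_n W n x \<le> w} \<in> sets borel"
    using c unfolding eq by (rule borel_closed)
  then show "{x \<in> space borel. energy_n W n x \<le> w} \<in> sets borel" by (simp only: space_borel UNIV_I simp_thms)
qed

lemma energy_n_PiM_measurable:
  assumes "lower_semicontinuous_energy W" "1 \<le> n"
  shows "energy_n W n \<in> borel_measurable (Pi\<^sub>M {1..n} (\<lambda>_. borel))"
  using measurable_compose[OF measurable_PiM_embed energy_n_borel[OF assms]] by simp

section \<open>The Gibbs measure\<close>

text \<open>The chart of \<open>lebesgue_centered\<close>: \<open>n - 1\<close> free points and a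
  last one that restores the zero sum.\<close>

definition center_extend :: "nat \<Rightarrow> (nat \<Rightarrow> 'a::euclidean_space) \<Rightarrow> nat \<Rightarrow> 'a" where
  "center_extend n x = (\<lambda>i\<in>{1..n}. if i = n then - (\<Sum>j=1..<n. x j) else x i)"

lemma sum_split_last: "1 \<le> n \<Longrightarrow> (\<Sum>i=1..n::nat. f i) = (\<Sum>i=1..<n. f i) + (f n :: 'a::comm_monoid_add)"
  by (metis sum.last_plus add.commute)

lemma center_extend_centered: "1 \<le> n \<Longrightarrow> center_extend n x \<in> centered_configs n"
proof -
  assume n: "1 \<le> n"
  have "(\<Sum>i=1..n. center_extend n x i) = (\<Sum>i=1..<n. x i) + - (\<Sum>i=1..<n. x i)"
    unfolding sum_split_last[OF n]
    by (intro arg_cong2[of _ _ _ _ "(+)"] sum.cong) (use n in \<open>auto simp: center_extend_def\<close>)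
  then show ?thesis by (simp add: centered_configs_def) (simp add: center_extend_def)
qed

lemma center_extend_measurable[measurable]:
  "center_extend n \<in> Pi\<^sub>M {1..<n} (\<lambda>_. lborel) \<rightarrow>\<^sub>M Pi\<^sub>M {1..n} (\<lambda>_. borel :: 'a::euclidean_space measure)"
  unfolding center_extend_def
proof (rule measurable_restrict)
  fix i assume i: "i \<in> {1..n}"
  show "(\<lambda>x. if i = n then - (\<Sum>j=1..<n. x j) else x i) \<in> Pi\<^sub>M {1..<n} (\<lambda>_. lborel) \<rightarrow>\<^sub>M (borel :: 'a measure)"
  proof (cases "i = n")
    case False
    then have "i \<in> {1..<n}" using i by auto
    then have "(\<lambda>x. x i) \<in> Pi\<^sub>M {1..<n} (\<lambda>_. lborel) \<rightarrow>\<^sub>M (lborel :: 'a measure)" by measurable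
    then show ?thesis using False by simp
  next
    case True
    have "(\<lambda>x. x j) \<in> Pi\<^sub>M {1..<n} (\<lambda>_. lborel) \<rightarrow>\<^sub>M (borel :: 'a measure)" if "j \<in> {1..<n}" for j
    proof -
      have "(\<lambda>x. x j) \<in> Pi\<^sub>M {1..<n} (\<lambda>_. lborel) \<rightarrow>\<^sub>M (lborel :: 'a measure)" using that by measurable
      then show ?thesis by simp
    qed
    then show ?thesis using True by simp
  qed
qed

lemma sets_lebesgue_centered:
  "sets (lebesgue_centered n :: (nat \<Rightarrow> 'a::euclidean_space) measure) = sets (restrict_space (Pi\<^sub>M {1..n} (\<lambda>_. borel)) (centered_configs n))"
  by (simp add: lebesgue_centered_def)

lemma space_lebesgue_centered:
  "space (lebesgue_centered n :: (nat \<Rightarrow> 'a::euclidean_space) measure) = centered_configs n"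
  using sets_eq_imp_space_eq[OF sets_lebesgue_centered, of n]
  by (auto simp: space_restrict_space space_PiM centered_configs_def)

lemma measurable_lebesgue_centered:
  fixes G :: "(nat \<Rightarrow> 'a::euclidean_space) \<Rightarrow> 'b"
  assumes "G \<in> Pi\<^sub>M {1..n} (\<lambda>_. borel) \<rightarrow>\<^sub>M N"
  shows "G \<in> lebesgue_centered n \<rightarrow>\<^sub>M N"
  using measurable_restrict_space1[OF assms] measurable_cong_sets[OF sets_lebesgue_centered refl] by blast

lemma nn_integral_lebesgue_centered:
  fixes G :: "(nat \<Rightarrow> 'a::euclidean_space) \<Rightarrow> ennreal"
  assumes n: "1 \<le> n" and G: "G \<in> borel_measurable (lebesgue_centered n)"
  shows "(\<integral>\<^sup>+ x. G x \<partial>lebesgue_centered n)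
    = ennreal (sqrt (real n) ^ DIM('a)) * (\<integral>\<^sup>+ z. G (center_extend n z) \<partial>Pi\<^sub>M {1..<n} (\<lambda>_. lborel))"
proof -
  let ?R = "restrict_space (Pi\<^sub>M {1..n} (\<lambda>_. borel)) (centered_configs n) :: (nat \<Rightarrow> 'a) measure"
  have c: "center_extend n \<in> Pi\<^sub>M {1..<n} (\<lambda>_. lborel) \<rightarrow>\<^sub>M ?R"
    by (rule measurable_restrict_space2[OF _ center_extend_measurable]) (use center_extend_centered[OF n] in auto)
  have G': "G \<in> borel_measurable ?R"
    using G measurable_cong_sets[OF sets_lebesgue_centered refl] by blast
  have "lebesgue_centered n = scale_measure (ennreal (sqrt (real n) ^ DIM('a)))
     (distr (Pi\<^sub>M {1..<n} (\<lambda>_. lborel)) ?R (center_extend n))"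
    unfolding lebesgue_centered_def center_extend_def ..
  then show ?thesis
    using c G' by (simp add: nn_integral_scale_measure nn_integral_distr)
qed

text \<open>The last factor depends on all free points and is replaced by its bound; the other
  \<open>n - 1\<close> factors integrate independently.\<close>

lemma product_upper_bound:
  fixes u :: "'a::euclidean_space \<Rightarrow> ennreal"
  assumes n: "1 \<le> n" and u[measurable]: "u \<in> borel_measurable borel" and b: "\<And>x. u x \<le> b"
  shows "(\<integral>\<^sup>+ z. (\<Prod>i=1..n. u (center_extend n z i)) \<partial>Pi\<^sub>M {1..<n} (\<lambda>_. lborel)) \<le> b * (\<integral>\<^sup>+ x. u x \<partial>lborel) ^ (n - 1)"
proof -
  interpret product_sigma_finite "\<lambda>_::nat. lborel :: 'a measure" by standard
  have split: "{1..n} = insert n {1..<n}" using n by auto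
  have [measurable]: "(\<lambda>z. \<Prod>i\<in>{1..<n}. u (z i)) \<in> borel_measurable (Pi\<^sub>M {1..<n} (\<lambda>_. lborel))"
  proof (rule borel_measurable_prod_ennreal)
    fix i assume i: "i \<in> {1..<n}"
    have "u \<in> borel_measurable lborel" by simp
    from measurable_compose[OF measurable_component_singleton[OF i] this]
    show "(\<lambda>z. u (z i)) \<in> borel_measurable (Pi\<^sub>M {1..<n} (\<lambda>_. lborel))" .
  qed
  have "(\<integral>\<^sup>+ z. (\<Prod>i=1..n. u (center_extend n z i)) \<partial>Pi\<^sub>M {1..<n} (\<lambda>_. lborel))
      \<le> (\<integral>\<^sup>+ z. b * (\<Prod>i\<in>{1..<n}. u (z i)) \<partial>Pi\<^sub>M {1..<n} (\<lambda>_. lborel))"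
  proof (rule nn_integral_mono)
    fix z :: "nat \<Rightarrow> 'a"
    have "(\<Prod>i=1..n. u (center_extend n z i)) = u (center_extend n z n) * (\<Prod>i\<in>{1..<n}. u (center_extend n z i))"
      unfolding split by simp
    also have "(\<Prod>i\<in>{1..<n}. u (center_extend n z i)) = (\<Prod>i\<in>{1..<n}. u (z i))"
      by (intro prod.cong) (auto simp: center_extend_def)
    also have "u (center_extend n z n) * \<dots> \<le> b * \<dots>" by (intro mult_right_mono b) auto
    finally show "(\<Prod>i=1..n. u (center_extend n z i)) \<le> b * (\<Prod>i\<in>{1..<n}. u (z i))" .
  qed
  also have "\<dots> = b * (\<integral>\<^sup>+ z. (\<Prod>i\<in>{1..<n}. u (z i)) \<partial>Pi\<^sub>M {1..<n} (\<lambda>_. lborel))"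
    by (intro nn_integral_cmult) measurable
  also have "(\<integral>\<^sup>+ z. (\<Prod>i\<in>{1..<n}. u (z i)) \<partial>Pi\<^sub>M {1..<n} (\<lambda>_. lborel)) = (\<Prod>i\<in>{1..<n}. \<integral>\<^sup>+ x. u x \<partial>lborel)"
    by (intro product_nn_integral_prod) auto
  finally show ?thesis by simp
qed

section \<open>Measurability of the weight and of the empirical measure\<close>

lemma gibbs_weight_measurable:
  assumes "lower_semicontinuous_energy W" "1 \<le> n"
  shows "gibbs_weight W \<sigma> n \<in> borel_measurable (Pi\<^sub>M {1..n} (\<lambda>_. borel))"
proof -
  note [measurable] = energy_n_PiM_measurable[OF assms]
  show ?thesis unfolding gibbs_weight_def by measurable
qed

text \<open>Pairing equal indices couples two empirical measures. If corresponding points are within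
  \<open>r / 2\<close>, so are the measures in Wasserstein distance, whatever the order.\<close>

lemma open_vimage_centered:
  fixes U :: "'a::euclidean_space measure set"
  assumes p: "1 \<le> p" and n: "1 \<le> n" and U: "openin (centered_wasserstein_topology p) U"
  shows "\<exists>V. open V \<and> {x. (\<Sum>i=1..n. x i) = 0 \<and> empirical_measure n x \<in> U} = {x. (\<Sum>i=1..n. x i) = 0} \<inter> V"
proof -
  let ?S = "{x. (\<Sum>i=1..n. x i) = 0 \<and> empirical_measure n x \<in> U}"
  have ex: "\<exists>r>0. \<forall>\<nu>\<in>centered_prob_measures p. wasserstein_dist p (empirical_measure n x) \<nu> < r \<longrightarrow> \<nu> \<in> U"
    if "x \<in> ?S" for x
    using openin_centered_wassersteinD[OF p U] that by blast
  define r where "r x = (SOME r. r > 0 \<and> (\<forall>\<nu>\<in>centered_prob_measures p. wasserstein_dist p (empirical_measure n x) \<nu> < r \<longrightarrow> \<nu> \<in> U))" for x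
  have rP: "r x > 0 \<and> (\<forall>\<nu>\<in>centered_prob_measures p. wasserstein_dist p (empirical_measure n x) \<nu> < r x \<longrightarrow> \<nu> \<in> U)"
    if "x \<in> ?S" for x
    unfolding r_def by (rule someI_ex) (rule ex[OF that])
  have r: "0 < r x" "\<And>\<nu>. \<nu> \<in> centered_prob_measures p \<Longrightarrow> wasserstein_dist p (empirical_measure n x) \<nu> < r x \<Longrightarrow> \<nu> \<in> U"
    if "x \<in> ?S" for x
    using rP[OF that] by blast+
  define B where "B x = (\<Inter>i\<in>{1..n}. {y. norm (x i - y i) < r x / 2})" for x :: "nat \<Rightarrow> 'a"
  have "open (\<Union>x\<in>?S. B x)"
    unfolding B_def
    by (intro open_UN ballI open_INT finite_atLeastAtMost open_Collect_less continuous_intros continuous_on_product_coordinates)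
  moreover have "?S = {x. (\<Sum>i=1..n. x i) = 0} \<inter> (\<Union>x\<in>?S. B x)"
  proof (intro equalityI subsetI)
    fix x assume "x \<in> ?S"
    then show "x \<in> {x. (\<Sum>i=1..n. x i) = 0} \<inter> (\<Union>x\<in>?S. B x)"
      using r(1)[of x] by (auto simp: B_def intro!: bexI[of _ x])
  next
    fix y assume y: "y \<in> {x. (\<Sum>i=1..n. x i) = 0} \<inter> (\<Union>x\<in>?S. B x)"
    then obtain x where x: "x \<in> ?S" "y \<in> B x" by blast
    have ps: "prob_space (uniform_count_measure {1..n})"
      using n by (intro prob_space_uniform_count_measure) auto
    interpret prob_space "uniform_count_measure {1..n}" by (rule ps)
    note cp = coupling_of_random_variables[OF ps measurable_uniform_count measurable_uniform_count, of x y]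
    have "wasserstein_dist p (empirical_measure n x) (empirical_measure n y) \<le> r x / 2"
      unfolding empirical_measure_def
    proof (rule wasserstein_dist_le[OF _ cp(1)])
      have "(\<integral>\<^sup>+ i. ennreal (norm (x i - y i) powr p) \<partial>uniform_count_measure {1..n})
        \<le> (\<integral>\<^sup>+ i. ennreal ((r x / 2) powr p) \<partial>uniform_count_measure {1..n})"
      proof (rule nn_integral_mono)
        fix i assume "i \<in> space (uniform_count_measure {1..n})"
        then have "norm (x i - y i) < r x / 2" using x(2) by (auto simp: B_def space_uniform_count_measure)
        then show "ennreal (norm (x i - y i) powr p) \<le> ennreal ((r x / 2) powr p)"
          using p by (intro ennreal_leI powr_mono2) auto
      qed
      also have "\<dots> = ennreal ((r x / 2) powr p)"
        unfolding nn_integral_const emeasure_space_1 by simp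
      finally show "(\<integral>\<^sup>+ (xa, ya). ennreal (norm (xa - ya) powr p)
        \<partial>distr (uniform_count_measure {1..n}) (borel \<Otimes>\<^sub>M borel) (\<lambda>\<omega>. (x \<omega>, y \<omega>))) \<le> ennreal ((r x / 2) powr p)"
        unfolding cp(2) .
    qed (use p r(1)[OF x(1)] in auto)
    then have "wasserstein_dist p (empirical_measure n x) (empirical_measure n y) < r x"
      using r(1)[OF x(1)] by linarith
    then show "y \<in> ?S" using r(2)[OF x(1)] empirical_measure_centered[OF n, of y p] y by auto
  qed
  ultimately show ?thesis by blast
qed

lemma empirical_measure_measurable:
  fixes p :: real
  assumes p: "1 \<le> p" and n: "1 \<le> n"
  shows "empirical_measure n \<in> lebesgue_centered n \<rightarrow>\<^sub>M borel_of (centered_wasserstein_topology p :: 'a::euclidean_space measure topology)"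
  unfolding borel_of_def
proof (rule measurable_measure_of)
  show "{U. openin (centered_wasserstein_topology p) U} \<subseteq> Pow (topspace (centered_wasserstein_topology p :: 'a measure topology))"
    using openin_subset by auto
  show "empirical_measure n \<in> space (lebesgue_centered n) \<rightarrow> topspace (centered_wasserstein_topology p :: 'a measure topology)"
    using empirical_measure_centered[OF n] by (auto simp: space_lebesgue_centered topspace_centered_wasserstein[OF p] centered_configs_def)
  fix U :: "'a measure set" assume "U \<in> {U. openin (centered_wasserstein_topology p) U}"
  then obtain V where V: "open V"
    "{x. (\<Sum>i=1..n. x i) = 0 \<and> empirical_measure n x \<in> U} = {x. (\<Sum>i=1..n. x i) = 0} \<inter> V"
    using open_vimage_centered[OF p n] by blast
  have "V \<in> sets borel" using V(1) by simp
  then have "(\<lambda>x. x) -` V \<inter> space (Pi\<^sub>M {1..n} (\<lambda>_. borel :: 'a measure)) \<in> sets (Pi\<^sub>M {1..n} (\<lambda>_. borel))"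
    by (rule measurable_sets[OF measurable_PiM_embed])
  then have "centered_configs n \<inter> ((\<lambda>x. x) -` V \<inter> space (Pi\<^sub>M {1..n} (\<lambda>_. borel :: 'a measure))) \<in> sets (lebesgue_centered n)"
    unfolding sets_lebesgue_centered by (auto simp: sets_restrict_space)
  also have "centered_configs n \<inter> ((\<lambda>x. x) -` V \<inter> space (Pi\<^sub>M {1..n} (\<lambda>_. borel :: 'a measure)))
      = empirical_measure n -` U \<inter> space (lebesgue_centered n)"
    using V(2) by (auto simp: space_lebesgue_centered centered_configs_def space_PiM set_eq_iff)
  finally show "empirical_measure n -` U \<inter> space (lebesgue_centered n) \<in> sets (lebesgue_centered n)" .
qed

definition gibbs_mass ::
  "('a::euclidean_space measure \<Rightarrow> ennreal) \<Rightarrow> real \<Rightarrow> nat \<Rightarrow> 'a measure set \<Rightarrow> ennreal" where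
  "gibbs_mass W \<sigma> n B = (\<integral>\<^sup>+ x. gibbs_weight W \<sigma> n x * indicator B (empirical_measure n x) \<partial>lebesgue_centered n)"

lemma growth_controlE:
  assumes "growth_control W l"
  obtains \<kappa> where "\<kappa> > 0"
    "\<And>\<mu>. \<mu> \<in> prob_measures \<Longrightarrow> \<mu> \<notin> prob_measures_moment l \<Longrightarrow> W \<mu> = \<infinity>"
    "\<And>\<mu>. \<mu> \<in> centered_prob_measures l \<Longrightarrow> ennreal \<kappa> * (\<integral>\<^sup>+ x. ennreal (norm x powr l) \<partial>\<mu>) \<le> W \<mu>"
  using assms unfolding growth_control_def by blast

text \<open>The energy is split convexly: a fraction \<open>\<epsilon>\<close> is bounded below by
  growth control and becomes an integrable product weight, the rest by \<open>w\<close>. The value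
  \<open>\<epsilon> = 1\<close> gives the pure moment bound behind tightness.\<close>

lemma gibbs_weight_le:
  fixes W :: "'a::euclidean_space measure \<Rightarrow> ennreal"
  assumes sf: "sigma_finite_energy W" and n: "1 \<le> n" and \<kappa>: "0 < \<kappa>"
    and gc: "\<And>\<mu>. \<mu> \<in> centered_prob_measures l \<Longrightarrow> ennreal \<kappa> * (\<integral>\<^sup>+ x. ennreal (norm x powr l) \<partial>\<mu>) \<le> W \<mu>"
    and x: "x \<in> centered_configs n" and \<epsilon>: "0 \<le> \<epsilon>" "\<epsilon> \<le> 1" and w: "0 \<le> w" "ennreal w \<le> energy_n W n x"
  shows "gibbs_weight W \<sigma> n x \<le> ennreal (exp (- (real n * (2 / \<sigma>\<^sup>2 * ((1 - \<epsilon>) * w)))) *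
    exp (- (\<epsilon> * (2 / \<sigma>\<^sup>2 * \<kappa>) * (\<Sum>i=1..n. norm (x i) powr l))))"
proof -
  define E where "E = enn2real (energy_n W n x)"
  have fin: "energy_n W n x < \<infinity>" by (rule energy_empirical_finite[OF sf n])
  have E: "energy_n W n x = ennreal E" unfolding E_def using fin by (simp add: less_top)
  have E0: "0 \<le> E" by (simp add: E_def)
  have wE: "w \<le> E" using w E E0 by simp
  define s where "s = (\<Sum>i=1..n. norm (x i) powr l)"
  have s0: "0 \<le> s" unfolding s_def by (intro sum_nonneg) auto
  have "(\<Sum>i=1..n. x i) = 0" using x by (simp add: centered_configs_def)
  from gc[OF empirical_measure_centered[OF n this]]
  have "ennreal \<kappa> * ennreal (s / real n) \<le> ennreal E"
    using E nn_integral_empirical_measure[of "\<lambda>y. norm y powr l" n x] n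
    by (simp add: energy_n_def s_def)
  then have "ennreal (\<kappa> * (s / real n)) \<le> ennreal E"
    using \<kappa> s0 by (subst ennreal_mult) auto
  then have sE: "\<kappa> * (s / real n) \<le> E" using E0 by simp
  have "\<epsilon> * (\<kappa> * (s / real n)) + (1 - \<epsilon>) * w \<le> \<epsilon> * E + (1 - \<epsilon>) * E"
    using \<epsilon> by (intro add_mono mult_left_mono sE wE) auto
  then have "\<epsilon> * (\<kappa> * (s / real n)) + (1 - \<epsilon>) * w \<le> E" by (simp add: algebra_simps)
  then have "real n * (2 / \<sigma>\<^sup>2) * (\<epsilon> * (\<kappa> * (s / real n)) + (1 - \<epsilon>) * w) \<le> real n * (2 / \<sigma>\<^sup>2) * E"
    by (intro mult_left_mono) auto
  moreover have "real n * b * (\<epsilon> * (\<kappa> * (s / real n)) + (1 - \<epsilon>) * w) = real n * (b * ((1 - \<epsilon>) * w)) + \<epsilon> * (b * \<kappa>) * s" for b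
    using n by (simp add: field_simps)
  ultimately have "real n * (2 / \<sigma>\<^sup>2 * ((1 - \<epsilon>) * w)) + \<epsilon> * (2 / \<sigma>\<^sup>2 * \<kappa>) * s \<le> real n * (2 / \<sigma>\<^sup>2) * E"
    by (simp only:)
  moreover have "real n * (2 / \<sigma>\<^sup>2) * E = (2 * real n / \<sigma>\<^sup>2) * E" by simp
  ultimately have "- (2 * real n / \<sigma>\<^sup>2) * E \<le> - (real n * (2 / \<sigma>\<^sup>2 * ((1 - \<epsilon>) * w))) + - (\<epsilon> * (2 / \<sigma>\<^sup>2 * \<kappa>) * s)"
    by linarith
  then have "exp (- (2 * real n / \<sigma>\<^sup>2) * E) \<le> exp (- (real n * (2 / \<sigma>\<^sup>2 * ((1 - \<epsilon>) * w))) + - (\<epsilon> * (2 / \<sigma>\<^sup>2 * \<kappa>) * s))"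
    by simp
  moreover have "gibbs_weight W \<sigma> n x = ennreal (exp (- (2 * real n / \<sigma>\<^sup>2) * E))"
    unfolding gibbs_weight_def E_def using fin by simp
  ultimately show ?thesis
    unfolding s_def[symmetric] exp_add[symmetric] by (simp only: ennreal_leI)
qed

lemma gibbs_mass_le:
  fixes W :: "'a::euclidean_space measure \<Rightarrow> ennreal" and u :: "'a \<Rightarrow> real"
  assumes n: "1 \<le> n" and u[measurable]: "u \<in> borel_measurable borel" and u0: "\<And>y. 0 \<le> u y" "\<And>y. u y \<le> b"
    and A: "(\<integral>\<^sup>+ y. ennreal (u y) \<partial>lborel) \<le> ennreal A" "0 \<le> A" and "0 \<le> C"
    and le: "\<And>x. x \<in> centered_configs n \<Longrightarrow> empirical_measure n x \<in> B \<Longrightarrow>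
      gibbs_weight W \<sigma> n x \<le> ennreal (C * (\<Prod>i=1..n. u (x i)))"
  shows "gibbs_mass W \<sigma> n B \<le> ennreal (sqrt (real n) ^ DIM('a) * (C * (b * A ^ (n - 1))))"
proof -
  have b: "0 \<le> b" using u0[of undefined] by linarith
  have "(\<lambda>x. \<Prod>i=1..n. u (x i)) \<in> borel_measurable (Pi\<^sub>M {1..n} (\<lambda>_. borel))" by measurable
  note pm[measurable] = measurable_lebesgue_centered[OF this]
  have "gibbs_mass W \<sigma> n B \<le> (\<integral>\<^sup>+ x. ennreal C * ennreal (\<Prod>i=1..n. u (x i)) \<partial>lebesgue_centered n)"
    unfolding gibbs_mass_def
  proof (rule nn_integral_mono)
    fix x :: "nat \<Rightarrow> 'a" assume "x \<in> space (lebesgue_centered n)"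
    then have x: "x \<in> centered_configs n" by (simp add: space_lebesgue_centered)
    have "ennreal (C * (\<Prod>i=1..n. u (x i))) = ennreal C * ennreal (\<Prod>i=1..n. u (x i))"
      using \<open>0 \<le> C\<close> u0 by (intro ennreal_mult prod_nonneg) auto
    then show "gibbs_weight W \<sigma> n x * indicator B (empirical_measure n x) \<le> ennreal C * ennreal (\<Prod>i=1..n. u (x i))"
      using le[OF x] by (auto simp: indicator_def)
  qed
  also have "\<dots> = ennreal (sqrt (real n) ^ DIM('a)) *
      (\<integral>\<^sup>+ z. ennreal C * ennreal (\<Prod>i=1..n. u (center_extend n z i)) \<partial>Pi\<^sub>M {1..<n} (\<lambda>_. lborel))"
    by (rule nn_integral_lebesgue_centered[OF n]) measurable
  also have "(\<integral>\<^sup>+ z. ennreal C * ennreal (\<Prod>i=1..n. u (center_extend n z i)) \<partial>Pi\<^sub>M {1..<n} (\<lambda>_. lborel))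
      = (\<integral>\<^sup>+ z. ennreal C * (\<Prod>i=1..n. ennreal (u (center_extend n z i))) \<partial>Pi\<^sub>M {1..<n} (\<lambda>_. lborel))"
    using u0 by (simp add: prod_ennreal)
  also have "\<dots> = ennreal C * (\<integral>\<^sup>+ z. (\<Prod>i=1..n. ennreal (u (center_extend n z i))) \<partial>Pi\<^sub>M {1..<n} (\<lambda>_. lborel))"
  proof (rule nn_integral_cmult)
    have "(\<lambda>x. \<Prod>i=1..n. ennreal (u (x i))) \<in> borel_measurable (Pi\<^sub>M {1..n} (\<lambda>_. borel))" by measurable
    from measurable_compose[OF center_extend_measurable this]
    show "(\<lambda>z. \<Prod>i=1..n. ennreal (u (center_extend n z i))) \<in> borel_measurable (Pi\<^sub>M {1..<n} (\<lambda>_. lborel))" .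
  qed
  also have "(\<integral>\<^sup>+ z. (\<Prod>i=1..n. ennreal (u (center_extend n z i))) \<partial>Pi\<^sub>M {1..<n} (\<lambda>_. lborel))
      \<le> ennreal b * (\<integral>\<^sup>+ y. ennreal (u y) \<partial>lborel) ^ (n - 1)"
    using u0 by (intro product_upper_bound[OF n]) (auto intro: ennreal_leI)
  also have "\<dots> \<le> ennreal b * ennreal A ^ (n - 1)"
    by (intro mult_left_mono power_mono A) auto
  also have "ennreal (sqrt (real n) ^ DIM('a)) * (ennreal C * (ennreal b * ennreal A ^ (n - 1)))
      = ennreal (sqrt (real n) ^ DIM('a) * (C * (b * A ^ (n - 1))))"
    using b \<open>0 \<le> A\<close> \<open>0 \<le> C\<close> by (simp add: ennreal_mult ennreal_power)
  finally show ?thesis by (simp add: mult_left_mono)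
qed

text \<open>Half of the gap between \<open>a\<close> and \<open>b\<close> absorbs the power of
  \<open>n\<close>, the other half the constant.\<close>

lemma eventually_poly_exp_le:
  fixes a b K :: real
  assumes "a < b"
  shows "\<forall>\<^sub>F n in sequentially. sqrt (real n) ^ d * (K * exp (- (real n * b))) \<le> exp (- (real n * a))"
proof -
  define \<delta> where "\<delta> = (b - a) / 2"
  have \<delta>: "0 < \<delta>" using assms by (simp add: \<delta>_def)
  define D where "D = (real d / \<delta>) ^ d * \<bar>K\<bar>"
  have D: "0 \<le> D" using \<delta> by (simp add: D_def)
  have "\<forall>\<^sub>F n in sequentially. D * exp (- (real n * \<delta>)) < 1"
  proof (rule order_tendstoD(2))
    have "(\<lambda>n. exp (- (real n * \<delta>))) = (\<lambda>n. exp (- \<delta>) ^ n)"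
      by (simp add: exp_of_nat_mult[symmetric])
    moreover have "(\<lambda>n. exp (- \<delta>) ^ n) \<longlonglongrightarrow> 0" using \<delta> by (intro LIMSEQ_power_zero) simp
    ultimately have "(\<lambda>n. exp (- (real n * \<delta>))) \<longlonglongrightarrow> 0" by simp
    then have "(\<lambda>n. D * exp (- (real n * \<delta>))) \<longlonglongrightarrow> D * 0" by (intro tendsto_intros)
    then show "(\<lambda>n. D * exp (- (real n * \<delta>))) \<longlonglongrightarrow> 0" by simp
  qed simp
  then show ?thesis
    using eventually_ge_at_top[of 1]
  proof eventually_elim
    case (elim n)
    have "sqrt (real n) \<le> real n"
    proof -
      have "sqrt (real n) * 1 \<le> sqrt (real n) * sqrt (real n)" using elim by (intro mult_left_mono) auto
      then show ?thesis by simp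
    qed
    then have "sqrt (real n) ^ d \<le> real n ^ d" by (intro power_mono) auto
    also have "real n ^ d = (1 / \<delta>) ^ d * (\<delta> * real n) ^ d" using \<delta> by (simp flip: power_mult_distrib)
    also have "\<dots> \<le> (1 / \<delta>) ^ d * (real d ^ d * exp (\<delta> * real n))"
      using \<delta> by (intro mult_left_mono power_le_exp) auto
    finally have s: "sqrt (real n) ^ d \<le> (real d / \<delta>) ^ d * exp (\<delta> * real n)"
      by (simp add: power_divide)
    have "sqrt (real n) ^ d * (K * exp (- (real n * b))) \<le> sqrt (real n) ^ d * (\<bar>K\<bar> * exp (- (real n * b)))"
      by (intro mult_left_mono mult_right_mono) auto
    also have "\<dots> \<le> ((real d / \<delta>) ^ d * exp (\<delta> * real n)) * (\<bar>K\<bar> * exp (- (real n * b)))"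
      by (intro mult_right_mono s) auto
    also have "\<dots> = D * (exp (\<delta> * real n) * exp (- (real n * b)))" by (simp add: D_def)
    also have "exp (\<delta> * real n) * exp (- (real n * b)) = exp (- (real n * \<delta>)) * exp (- (real n * a))"
      unfolding \<delta>_def by (simp add: mult_exp_exp field_simps)
    also have "D * \<dots> = D * exp (- (real n * \<delta>)) * exp (- (real n * a))" by simp
    also have "\<dots> \<le> 1 * exp (- (real n * a))"
      using elim by (intro mult_right_mono) auto
    finally show ?case by simp
  qed
qed

section \<open>Upper bounds for the Gibbs measure\<close>

lemma entropy_functional_not_MInf:
  "entropy_functional \<mu> \<noteq> - \<infinity>"
proof (cases "\<mu> \<in> prob_measures_moment 1")
  case True
  show ?thesis
  proof (cases rule: entropy_functional_cases[OF True])
    case 1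
    then show ?thesis by simp
  next
    case (2 q)
    define P where "P = (\<integral>\<^sup>+ x. ennreal (q x * ln (q x)) \<partial>lborel)"
    define N where "N = (\<integral>\<^sup>+ x. ennreal (- (q x * ln (q x))) \<partial>lborel)"
    have "N < \<infinity>" "entropy_functional \<mu> = enn2ereal P - enn2ereal N"
      using 2(4,5) by (auto simp: P_def N_def)
    then show ?thesis by (cases P; cases N) auto
  qed
qed (simp add: entropy_functional_def)

lemma free_energy_approx_below:
  assumes \<beta>: "0 < \<sigma>\<^sup>2" and a: "ereal a < free_energy W \<sigma> \<mu>"
  shows "\<exists>s w. ereal s < entropy_functional \<mu> \<and> 0 \<le> w \<and> (w = 0 \<or> ennreal w < W \<mu>) \<and> a < s + 2 / \<sigma>\<^sup>2 * w"
proof -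
  define b where "b = 2 / \<sigma>\<^sup>2"
  have b: "0 < b" using \<beta> by (simp add: b_def)
  have F: "ereal a < entropy_functional \<mu> + ereal b * enn2ereal (W \<mu>)"
    using a by (simp add: free_energy_def b_def)
  show ?thesis
    unfolding b_def[symmetric]
  proof (cases "entropy_functional \<mu>")
    case PInf
    then show "\<exists>s w. ereal s < entropy_functional \<mu> \<and> 0 \<le> w \<and> (w = 0 \<or> ennreal w < W \<mu>) \<and> a < s + b * w"
      by (intro exI[of _ "a + 1"] exI[of _ 0]) auto
  next
    case MInf
    then show "\<exists>s w. ereal s < entropy_functional \<mu> \<and> 0 \<le> w \<and> (w = 0 \<or> ennreal w < W \<mu>) \<and> a < s + b * w"
      using entropy_functional_not_MInf[of \<mu>] by simp
  next
    case (real S)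
    show "\<exists>s w. ereal s < entropy_functional \<mu> \<and> 0 \<le> w \<and> (w = 0 \<or> ennreal w < W \<mu>) \<and> a < s + b * w"
    proof (cases "W \<mu>")
      case top
      define w where "w = max 0 ((a - S + 1) / b + 1)"
      have "a - S + 1 < b * ((a - S + 1) / b + 1)" using b by (simp add: field_simps)
      also have "\<dots> \<le> b * w" unfolding w_def using b by (intro mult_left_mono) auto
      finally have "a < (S - 1) + b * w" by simp
      then show ?thesis using top real by (intro exI[of _ "S - 1"] exI[of _ w]) (auto simp: w_def)
    next
      case (real w')
      have "a < S + b * w'" using F real \<open>entropy_functional \<mu> = ereal S\<close> by (simp add: enn2ereal_ennreal)
      define \<delta> where "\<delta> = S + b * w' - a"
      have \<delta>: "0 < \<delta>" using \<open>a < S + b * w'\<close> by (simp add: \<delta>_def)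
      show ?thesis
      proof (cases "w' = 0")
        case True
        then show ?thesis using \<delta> \<open>entropy_functional \<mu> = ereal S\<close>
          by (rule_tac exI[of _ "S - \<delta> / 2"], rule_tac exI[of _ 0]) (auto simp: \<delta>_def field_simps)
      next
        case False
        then have w': "0 < w'" using real by simp
        \<comment> \<open>The first entry keeps \<open>w\<close> nonnegative, the second limits the
          loss in \<open>b * w\<close> to a third of \<open>\<delta>\<close>; the entropy gives up
          another third.\<close>
        define w where "w = max (w' / 2) (w' - \<delta> / (3 * b))"
        have w: "0 \<le> w" "w < w'" using w' \<delta> b by (auto simp: w_def)
        have "b * (w' - \<delta> / (3 * b)) \<le> b * w" unfolding w_def using b by (intro mult_left_mono) auto
        moreover have "b * (w' - \<delta> / (3 * b)) = b * w' - \<delta> / 3" using b by (simp add: field_simps)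
        ultimately have "a < (S - \<delta> / 3) + b * w" using \<delta> unfolding \<delta>_def by argo
        then show ?thesis using \<delta> w real \<open>entropy_functional \<mu> = ereal S\<close>
          by (intro exI[of _ "S - \<delta> / 3"] exI[of _ w]) (auto simp: ennreal_lessI)
      qed
    qed
  qed
qed

lemma gibbs_local_upper_bound:
  fixes W :: "'a::euclidean_space measure \<Rightarrow> ennreal"
  assumes \<sigma>: "0 < \<sigma>\<^sup>2" and sf: "sigma_finite_energy W" and lsc: "lower_semicontinuous_energy W"
    and gc: "growth_control W l" and p: "1 \<le> p" "p < l"
    and mu: "\<mu> \<in> centered_prob_measures p" and a: "ereal a < free_energy W \<sigma> \<mu>"
  shows "\<exists>U. openin (centered_wasserstein_topology p) U \<and> \<mu> \<in> U \<and>
    (\<forall>\<^sub>F n in sequentially. gibbs_mass W \<sigma> n U \<le> ennreal (exp (- (real n * a))))"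
proof -
  obtain \<kappa> where \<kappa>: "0 < \<kappa>"
    and gr: "\<And>\<mu>. \<mu> \<in> centered_prob_measures l \<Longrightarrow> ennreal \<kappa> * (\<integral>\<^sup>+ x. ennreal (norm x powr l) \<partial>\<mu>) \<le> W \<mu>"
    using growth_controlE[OF gc] by metis
  define b where "b = 2 / \<sigma>\<^sup>2"
  have b: "0 < b" using \<sigma> by (simp add: b_def)
  obtain s w where s: "ereal s < entropy_functional \<mu>" and w: "0 \<le> w" "w = 0 \<or> ennreal w < W \<mu>"
    and sw: "a < s + b * w"
    using free_energy_approx_below[OF \<sigma> a] unfolding b_def by blast
  define gap where "gap = s + b * w - a"
  have gap: "0 < gap" using sw by (simp add: gap_def)
  \<comment> \<open>Small enough that the energy set aside, \<open>\<epsilon> * (b * w)\<close>, is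
    less than the gap; adding 1 in the denominator allows \<open>w = 0\<close>.\<close>
  define \<epsilon> where "\<epsilon> = min (1/2) (gap / (2 * (b * w + 1)))"
  have bw: "0 \<le> b * w" using b w by simp
  have \<epsilon>: "0 < \<epsilon>" "\<epsilon> < 1" using gap bw by (auto simp: \<epsilon>_def)
  have "\<epsilon> * (b * w) \<le> gap / (2 * (b * w + 1)) * (b * w + 1)"
    using bw \<epsilon> gap by (intro mult_mono) (auto simp: \<epsilon>_def)
  also have "\<dots> = gap / 2" using bw by (simp add: field_simps)
  finally have "\<epsilon> * (b * w) < gap" using gap by linarith
  then have aw: "a < b * ((1 - \<epsilon>) * w) + s" unfolding gap_def by (simp add: algebra_simps)
  define c where "c = \<epsilon> * (b * \<kappa>)"
  have c: "0 < c" using \<epsilon> b \<kappa> by (simp add: c_def)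
  have mu1: "\<mu> \<in> prob_measures_moment 1"
    by (rule prob_measures_moment_mono[OF centered_prob_measuresD(1)[OF mu]]) (use p in auto)
  obtain f where f: "continuous_on UNIV f" "bounded (range f)"
    and fl: "(\<integral>\<^sup>+ x. ennreal (exp (f x - c * norm x powr l)) \<partial>lborel) < ennreal (exp ((\<integral>x. f x \<partial>\<mu>) - s))"
    using donsker_varadhan_lower[OF mu1 c _ s, of l] p by auto
  have fm[measurable]: "f \<in> borel_measurable borel" by (rule borel_measurable_continuous_onI[OF f(1)])
  obtain M where M: "\<And>x. \<bar>f x\<bar> \<le> M" using bounded_range_real_abs[OF f(2)] by blast
  obtain A where A: "0 \<le> A" "(\<integral>\<^sup>+ x. ennreal (exp (f x - c * norm x powr l)) \<partial>lborel) = ennreal A"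
  proof (cases "\<integral>\<^sup>+ x. ennreal (exp (f x - c * norm x powr l)) \<partial>lborel" rule: ennreal_cases)
    case top
    then show ?thesis using fl by simp
  qed (use that in blast)
  have "A < exp ((\<integral>x. f x \<partial>\<mu>) - s)" using fl A by (simp add: ennreal_less_iff)
  \<comment> \<open>A level strictly below the mean of \<open>f\<close>, so that exceeding it is an
    open condition met by \<open>\<mu>\<close>, yet high enough to bound the one-point integral
    \<open>A\<close>. For \<open>A = 0\<close> the logarithm gives no level, and any lower one
    serves.\<close>
  then obtain c1 where c1: "c1 < (\<integral>x. f x \<partial>\<mu>)" "A \<le> exp (c1 - s)"
  proof (cases "A = 0")
    case True
    then show ?thesis by (intro that[of "(\<integral>x. f x \<partial>\<mu>) - 1"]) auto
  next
    case False
    then have "0 < A" using A by simp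
    moreover have "ln A < (\<integral>x. f x \<partial>\<mu>) - s"
      using \<open>0 < A\<close> \<open>A < exp ((\<integral>x. f x \<partial>\<mu>) - s)\<close> by (metis exp_gt_zero ln_exp ln_less_cancel_iff)
    ultimately show ?thesis by (intro that[of "s + ln A"]) auto
  qed
  \<comment> \<open>For \<open>w = 0\<close> no energy condition is imposed, since the energy of
    \<open>\<mu>\<close> need not exceed 0.\<close>
  define U where "U = {\<mu> \<in> centered_prob_measures p. c1 < (\<integral>x. f x \<partial>\<mu>)} \<inter>
    (if w = 0 then centered_prob_measures p else {\<mu> \<in> centered_prob_measures p. ennreal w < W \<mu>})"
  have "openin (centered_wasserstein_topology p) (centered_prob_measures p :: 'a measure set)"
    using openin_topspace topspace_centered_wasserstein[OF p(1)] by metis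
  then have "openin (centered_wasserstein_topology p) U"
    unfolding U_def using openin_integral_superlevel[OF p(1) f] openin_energy_superlevel[OF p(1) lsc]
    by (auto intro!: openin_Int)
  moreover have "\<mu> \<in> U" using mu c1 w by (auto simp: U_def)
  moreover have "\<forall>\<^sub>F n in sequentially. gibbs_mass W \<sigma> n U \<le> ennreal (exp (- (real n * a)))"
  proof -
    define u where "u y = exp (f y - c * norm y powr l)" for y
    have um[measurable]: "u \<in> borel_measurable borel" unfolding u_def by measurable
    \<comment> \<open>Collects what does not grow with \<open>n\<close>: the bound
      \<open>exp M\<close> of the last, dependent factor and the one missing power of
      \<open>exp (c1 - s)\<close>.\<close>
    define K where "K = exp M * exp (- (c1 - s))"
    have "\<forall>\<^sub>F n in sequentially. sqrt (real n) ^ DIM('a) * (K * exp (- (real n * (b * ((1 - \<epsilon>) * w) + s)))) \<le> exp (- (real n * a))"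
      by (rule eventually_poly_exp_le[OF aw])
    then show ?thesis
      using eventually_ge_at_top[of 1]
    proof eventually_elim
      case (elim n)
      define C where "C = exp (- (real n * (b * ((1 - \<epsilon>) * w))) - real n * c1)"
      have "gibbs_mass W \<sigma> n U \<le> ennreal (sqrt (real n) ^ DIM('a) * (C * (exp M * exp (c1 - s) ^ (n - 1))))"
      proof (rule gibbs_mass_le[OF elim(2) um])
        show "0 \<le> u y" for y by (simp add: u_def)
        show "u y \<le> exp M" for y
        proof -
          have "0 \<le> c * norm y powr l" using c by simp
          moreover have "f y \<le> M" using M[of y] by simp
          ultimately show ?thesis unfolding u_def by simp
        qed
        show "(\<integral>\<^sup>+ y. ennreal (u y) \<partial>lborel) \<le> ennreal (exp (c1 - s))"
          unfolding u_def A(2) using c1(2) by (rule ennreal_leI)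
        fix x assume x: "x \<in> centered_configs n" and xU: "empirical_measure n x \<in> U"
        define S where "S = (\<Sum>i=1..n. norm (x i) powr l)"
        have "ennreal w \<le> energy_n W n x"
          using xU by (auto simp: U_def energy_n_def split: if_splits)
        then have g: "gibbs_weight W \<sigma> n x \<le> ennreal (exp (- (real n * (b * ((1 - \<epsilon>) * w)))) * exp (- (\<epsilon> * (b * \<kappa>) * S)))"
          using gibbs_weight_le[OF sf elim(2) \<kappa> gr x, of \<epsilon> w \<sigma>] \<epsilon> w unfolding S_def b_def by simp
        \<comment> \<open>Exponential Chebyshev inequality: on \<open>U\<close> the sum of
          \<open>f (x i)\<close> exceeds \<open>n * c1\<close>, so the exponential of the difference
          may be inserted as a factor. Afterwards \<open>c1\<close> cancels against the one-point
          integrals and leaves the rate \<open>s\<close>.\<close>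
        have "c1 < (\<integral>y. f y \<partial>empirical_measure n x)" using xU by (simp add: U_def)
        also have "\<dots> = (\<Sum>i=1..n. f (x i)) / real n"
          using integral_empirical_measure[OF fm, of n x] by (simp add: divide_inverse mult.commute)
        finally have "real n * c1 \<le> (\<Sum>i=1..n. f (x i))" using elim(2) by (simp add: field_simps)
        then have "- (real n * (b * ((1 - \<epsilon>) * w))) + - (\<epsilon> * (b * \<kappa>) * S)
            \<le> - (real n * (b * ((1 - \<epsilon>) * w))) - real n * c1 + ((\<Sum>i=1..n. f (x i)) - c * S)"
          unfolding c_def by linarith
        also have "(\<Sum>i=1..n. f (x i)) - c * S = (\<Sum>i=1..n. f (x i) - c * norm (x i) powr l)"
          unfolding S_def by (simp add: sum_subtractf sum_distrib_left)
        finally have "exp (- (real n * (b * ((1 - \<epsilon>) * w)))) * exp (- (\<epsilon> * (b * \<kappa>) * S)) \<le> C * (\<Prod>i=1..n. u (x i))"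
          unfolding C_def u_def by (simp add: exp_sum[symmetric] mult_exp_exp)
        then show "gibbs_weight W \<sigma> n x \<le> ennreal (C * (\<Prod>i=1..n. u (x i)))"
          using g ennreal_leI order_trans by blast
      qed (auto simp: C_def)
      also have "C * (exp M * exp (c1 - s) ^ (n - 1)) = K * exp (- (real n * (b * ((1 - \<epsilon>) * w) + s)))"
      proof -
        have "exp (c1 - s) ^ (n - 1) = exp (real (n - 1) * (c1 - s))" by (simp add: exp_of_nat_mult)
        also have "real (n - 1) = real n - 1" using elim(2) by simp
        finally show ?thesis unfolding C_def K_def by (simp add: mult_exp_exp algebra_simps)
      qed
      finally show ?case using elim(1) by (meson ennreal_leI order_trans)
    qed
  qed
  ultimately show ?thesis by blast
qed

text \<open>All of the energy is spent on the moment of order \<open>l\<close>: half of it keeps the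
  Lebesgue integral finite, the other half is at least \<open>c / 2 * R\<close> per particle on the
  set where the moment exceeds \<open>R\<close>.\<close>

lemma gibbs_exponential_tightness:
  fixes W :: "'a::euclidean_space measure \<Rightarrow> ennreal"
  assumes \<sigma>: "0 < \<sigma>\<^sup>2" and sf: "sigma_finite_energy W"
    and gc: "growth_control W l" and p: "1 \<le> p" "p < l"
  shows "\<exists>R\<ge>0. \<forall>\<^sub>F n in sequentially. gibbs_mass W \<sigma> n
    {\<mu>. \<not> (\<integral>\<^sup>+ x. ennreal (norm x powr l) \<partial>\<mu>) \<le> ennreal R} \<le> ennreal (exp (- (real n * a)))"
    and "\<exists>C. \<forall>n\<ge>1. gibbs_mass W \<sigma> n UNIV \<le> ennreal (sqrt (real n) ^ DIM('a) * exp (real n * C))"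
proof -
  obtain \<kappa> where \<kappa>: "0 < \<kappa>"
    and gr: "\<And>\<mu>. \<mu> \<in> centered_prob_measures l \<Longrightarrow> ennreal \<kappa> * (\<integral>\<^sup>+ x. ennreal (norm x powr l) \<partial>\<mu>) \<le> W \<mu>"
    using growth_controlE[OF gc] by metis
  define c where "c = 2 / \<sigma>\<^sup>2 * \<kappa>"
  have c: "0 < c" using \<sigma> \<kappa> by (simp add: c_def)
  have g: "gibbs_weight W \<sigma> n x \<le> ennreal (exp (- (c * (\<Sum>i=1..n. norm (x i) powr l))))"
    if "x \<in> centered_configs n" "1 \<le> n" for n x
    using gibbs_weight_le[OF sf that(2) \<kappa> gr that(1), of 1 0 \<sigma>] by (simp add: c_def)
  obtain A0 where A0: "0 \<le> A0" "(\<integral>\<^sup>+ x. ennreal (exp (- (c / 2) * norm (x::'a) powr l)) \<partial>lborel) = ennreal A0"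
  proof (cases "\<integral>\<^sup>+ x. ennreal (exp (- (c / 2) * norm (x::'a) powr l)) \<partial>lborel" rule: ennreal_cases)
    case top
    then show ?thesis using nn_integral_exp_norm_powr_finite[of "c/2" l, where 'a='a] c p by simp
  qed (use that in blast)
  \<comment> \<open>Raised above 1 so that its powers increase with the exponent and its logarithm
    is defined.\<close>
  define A where "A = A0 + 1"
  have A: "0 \<le> A0" "1 \<le> A" "(\<integral>\<^sup>+ x. ennreal (exp (- (c / 2) * norm (x::'a) powr l)) \<partial>lborel) \<le> ennreal A"
    using A0 by (auto simp: A_def ennreal_leI)
  define u where "u y = exp (- (c / 2) * norm (y::'a) powr l)" for y
  have um: "u \<in> borel_measurable borel" unfolding u_def by measurable
  have u1: "0 \<le> u y" "u y \<le> 1" for y unfolding u_def using c by auto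
  have pow: "A ^ (n - 1) \<le> exp (real n * ln A)" for n
  proof -
    have "A ^ (n - 1) \<le> A ^ n" using A by (intro power_increasing) auto
    also have "\<dots> = exp (real n * ln A)" using A by (simp add: exp_of_nat_mult)
    finally show ?thesis .
  qed
  have main: "gibbs_mass W \<sigma> n B \<le> ennreal (sqrt (real n) ^ DIM('a) * (exp (- (real n * (c / 2 * R))) * exp (real n * ln A)))"
    if n: "1 \<le> n" and B: "\<And>x. empirical_measure n x \<in> B \<Longrightarrow> R \<le> (\<Sum>i=1..n. norm (x i) powr l) / real n" for n B R
  proof -
    have "gibbs_mass W \<sigma> n B \<le> ennreal (sqrt (real n) ^ DIM('a) * (exp (- (real n * (c / 2 * R))) * (1 * A ^ (n - 1))))"
    proof (rule gibbs_mass_le[OF n um u1])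
      fix x assume x: "x \<in> centered_configs n" and xB: "empirical_measure n x \<in> B"
      define S where "S = (\<Sum>i=1..n. norm (x i) powr l)"
      have "real n * R \<le> S" using B[OF xB] n unfolding S_def by (simp add: field_simps)
      then have "c / 2 * (real n * R) \<le> c / 2 * S" using c by (intro mult_left_mono) auto
      then have "- (c * S) \<le> - (real n * (c / 2 * R)) + (- (c / 2) * S)" by (simp add: algebra_simps)
      also have "- (c / 2) * S = (\<Sum>i=1..n. - (c / 2) * norm (x i) powr l)"
        unfolding S_def by (simp only: sum_distrib_left)
      finally have "exp (- (c * S)) \<le> exp (- (real n * (c / 2 * R))) * (\<Prod>i=1..n. u (x i))"
        unfolding u_def exp_sum[OF finite_atLeastAtMost, symmetric] mult_exp_exp by simp
      then show "gibbs_weight W \<sigma> n x \<le> ennreal (exp (- (real n * (c / 2 * R))) * (\<Prod>i=1..n. u (x i)))"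
        using order_trans[OF g[OF x n] ennreal_leI] by (simp add: S_def)
    qed (use A in \<open>auto simp: u_def\<close>)
    also have "\<dots> \<le> ennreal (sqrt (real n) ^ DIM('a) * (exp (- (real n * (c / 2 * R))) * exp (real n * ln A)))"
      using pow by (intro ennreal_leI mult_left_mono) auto
    finally show ?thesis .
  qed
  show "\<exists>C. \<forall>n\<ge>1. gibbs_mass W \<sigma> n UNIV \<le> ennreal (sqrt (real n) ^ DIM('a) * exp (real n * C))"
  proof (intro exI allI impI)
    fix n :: nat assume n: "1 \<le> n"
    have "0 \<le> (\<Sum>i=1..n. norm (x i :: 'a) powr l) / real n" for x by (intro divide_nonneg_nonneg sum_nonneg) auto
    from main[OF n this] show "gibbs_mass W \<sigma> n UNIV \<le> ennreal (sqrt (real n) ^ DIM('a) * exp (real n * ln A))"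
      by simp
  qed
  \<comment> \<open>Makes the gain \<open>c / 2 * R\<close> pay for the rate \<open>a\<close>, for
    \<open>ln A\<close> per point, and for one more unit that beats the polynomial factor.\<close>
  define R where "R = max 0 (2 * (a + ln A + 1) / c)"
  have R: "0 \<le> R" "a + ln A + 1 \<le> c / 2 * R"
  proof -
    have "a + ln A + 1 = c / 2 * (2 * (a + ln A + 1) / c)" using c by simp
    also have "\<dots> \<le> c / 2 * R" unfolding R_def using c by (intro mult_left_mono) auto
    finally show "a + ln A + 1 \<le> c / 2 * R" .
  qed (simp add: R_def)
  have "\<forall>\<^sub>F n in sequentially. sqrt (real n) ^ DIM('a) * (1 * exp (- (real n * (a + 1)))) \<le> exp (- (real n * a))"
    by (rule eventually_poly_exp_le) simp
  then have "\<forall>\<^sub>F n in sequentially. gibbs_mass W \<sigma> n {\<mu>. \<not> (\<integral>\<^sup>+ x. ennreal (norm x powr l) \<partial>\<mu>) \<le> ennreal R} \<le> ennreal (exp (- (real n * a)))"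
    using eventually_ge_at_top[of 1]
  proof eventually_elim
    case (elim n)
    have B: "R \<le> (\<Sum>i=1..n. norm (x i :: 'a) powr l) / real n"
      if "empirical_measure n x \<in> {\<mu>. \<not> (\<integral>\<^sup>+ x. ennreal (norm x powr l) \<partial>\<mu>) \<le> ennreal R}" for x
      using that nn_integral_empirical_measure[of "\<lambda>y. norm y powr l" n x] elim(2) R(1)
      by (simp add: not_le ennreal_less_iff)
    have "exp (- (real n * (c / 2 * R))) * exp (real n * ln A) \<le> exp (- (real n * (a + 1)))"
    proof -
      have "real n * (a + ln A + 1) \<le> real n * (c / 2 * R)" using R by (intro mult_left_mono) auto
      then have "- (real n * (c / 2 * R)) + real n * ln A \<le> - (real n * (a + 1))" by (simp add: algebra_simps)
      then show ?thesis by (simp add: mult_exp_exp)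
    qed
    then have "sqrt (real n) ^ DIM('a) * (exp (- (real n * (c / 2 * R))) * exp (real n * ln A)) \<le> sqrt (real n) ^ DIM('a) * (1 * exp (- (real n * (a + 1))))"
      by (intro mult_left_mono) auto
    then show ?case using main[OF elim(2) B] elim(1) by (meson ennreal_leI order_trans)
  qed
  then show "\<exists>R\<ge>0. \<forall>\<^sub>F n in sequentially. gibbs_mass W \<sigma> n
    {\<mu>. \<not> (\<integral>\<^sup>+ x. ennreal (norm x powr l) \<partial>\<mu>) \<le> ennreal R} \<le> ennreal (exp (- (real n * a)))"
    using R(1) by blast
qed

section \<open>Normalization\<close>

lemma gibbs_weight_pos:
  assumes "sigma_finite_energy W" "1 \<le> n"
  shows "0 < gibbs_weight W \<sigma> n x"
  using energy_empirical_finite[OF assms, of x] by (auto simp: gibbs_weight_def)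

lemma partition_function_eq: "partition_function W \<sigma> n = gibbs_mass W \<sigma> n UNIV"
  by (simp add: partition_function_def gibbs_mass_def)

text \<open>A positive weight can have integral 0 only if the Lebesgue measure of the chart is 0.
  For \<open>n = 1\<close> that measure is a unit mass on a single point.\<close>

lemma partition_function_pos:
  fixes W :: "'a::euclidean_space measure \<Rightarrow> ennreal"
  assumes sf: "sigma_finite_energy W" and lsc: "lower_semicontinuous_energy W" and n: "1 \<le> n"
  shows "partition_function W \<sigma> n \<noteq> 0"
proof
  assume Z: "partition_function W \<sigma> n = 0"
  interpret product_sigma_finite "\<lambda>_::nat. lborel :: 'a measure" by standard
  note gm = gibbs_weight_measurable[OF lsc n, of \<sigma>]
  have "(\<integral>\<^sup>+ z. gibbs_weight W \<sigma> n (center_extend n z) \<partial>Pi\<^sub>M {1..<n} (\<lambda>_. lborel)) = 0"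
    using Z n unfolding partition_function_def nn_integral_lebesgue_centered[OF n measurable_lebesgue_centered[OF gm]]
    by simp
  then have "AE z in Pi\<^sub>M {1..<n} (\<lambda>_. lborel :: 'a measure). gibbs_weight W \<sigma> n (center_extend n z) = 0"
    using measurable_compose[OF center_extend_measurable gm] by (subst (asm) nn_integral_0_iff_AE) auto
  then have "AE z in Pi\<^sub>M {1..<n} (\<lambda>_. lborel :: 'a measure). False"
    by eventually_elim (use gibbs_weight_pos[OF sf n] in \<open>auto simp: less_le\<close>)
  then have "emeasure (Pi\<^sub>M {1..<n} (\<lambda>_. lborel :: 'a measure)) (space (Pi\<^sub>M {1..<n} (\<lambda>_. lborel))) = 0"
    by (subst (asm) AE_iff_measurable[of "space (Pi\<^sub>M {1..<n} (\<lambda>_. lborel :: 'a measure))"]) auto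
  moreover have "emeasure (Pi\<^sub>M {1..<n} (\<lambda>_. lborel :: 'a measure)) (Pi\<^sub>E {1..<n} (\<lambda>_. UNIV)) = (\<Prod>i\<in>{1..<n}. emeasure (lborel :: 'a measure) UNIV)"
    by (intro emeasure_PiM) auto
  ultimately show False by (simp add: space_PiM ennreal_top_eq_mult_iff split: if_splits)
qed

text \<open>The mass identity is stated with the normalization multiplied out, so estimates of
  \<open>gibbs_mass\<close> transfer before the growth of the partition function is known.\<close>

lemma gibbs_law_properties:
  fixes W :: "'a::euclidean_space measure \<Rightarrow> ennreal"
  assumes \<sigma>: "0 < \<sigma>\<^sup>2" and sf: "sigma_finite_energy W" and lsc: "lower_semicontinuous_energy W"
    and gc: "growth_control W l" and p: "1 \<le> p" "p < l" and n: "1 \<le> n"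
  shows "prob_space (gibbs_empirical_law W \<sigma> p n)"
    and "0 < enn2real (partition_function W \<sigma> n)"
    and "B \<in> sets (borel_of (centered_wasserstein_topology p)) \<Longrightarrow>
      enn2real (partition_function W \<sigma> n) * measure (gibbs_empirical_law W \<sigma> p n) B = enn2real (gibbs_mass W \<sigma> n B)"
proof -
  let ?Z = "partition_function W \<sigma> n" and ?P = "gibbs_empirical_law W \<sigma> p n"
  note gm = measurable_lebesgue_centered[OF gibbs_weight_measurable[OF lsc n, of \<sigma>]]
  note gm[measurable]
  note em = empirical_measure_measurable[OF p(1) n, where 'a='a]
  have Z0: "?Z \<noteq> 0" by (rule partition_function_pos[OF sf lsc n])
  obtain C where C: "\<And>n. 1 \<le> n \<Longrightarrow> gibbs_mass W \<sigma> n UNIV \<le> ennreal (sqrt (real n) ^ DIM('a) * exp (real n * C))"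
    using gibbs_exponential_tightness(2)[OF \<sigma> sf gc p] by blast
  have Z1: "?Z < \<infinity>"
    unfolding partition_function_eq using le_less_trans[OF C[OF n] ennreal_less_top] by simp
  have E: "emeasure ?P B = gibbs_mass W \<sigma> n B / ?Z" if B: "B \<in> sets (borel_of (centered_wasserstein_topology p))" for B
  proof -
    have em': "empirical_measure n \<in> gibbs_measure W \<sigma> n \<rightarrow>\<^sub>M borel_of (centered_wasserstein_topology p)"
      unfolding gibbs_measure_def using em by simp
    have s: "empirical_measure n -` B \<inter> space (lebesgue_centered n) \<in> sets (lebesgue_centered n)"
      by (rule measurable_sets[OF em B])
    have "emeasure ?P B = emeasure (gibbs_measure W \<sigma> n) (empirical_measure n -` B \<inter> space (lebesgue_centered n))"
      unfolding gibbs_empirical_law_def using em' B by (subst emeasure_distr) (auto simp: gibbs_measure_def)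
    also have "\<dots> = (\<integral>\<^sup>+ x. gibbs_weight W \<sigma> n x / ?Z * indicator (empirical_measure n -` B \<inter> space (lebesgue_centered n)) x \<partial>lebesgue_centered n)"
      unfolding gibbs_measure_def using s by (intro emeasure_density) auto
    also have "\<dots> = (\<integral>\<^sup>+ x. gibbs_weight W \<sigma> n x * indicator (empirical_measure n -` B \<inter> space (lebesgue_centered n)) x / ?Z \<partial>lebesgue_centered n)"
      by (intro nn_integral_cong) (auto simp: indicator_def)
    also have "\<dots> = (\<integral>\<^sup>+ x. gibbs_weight W \<sigma> n x * indicator (empirical_measure n -` B \<inter> space (lebesgue_centered n)) x \<partial>lebesgue_centered n) / ?Z"
      using s by (intro nn_integral_divide) auto
    also have "(\<integral>\<^sup>+ x. gibbs_weight W \<sigma> n x * indicator (empirical_measure n -` B \<inter> space (lebesgue_centered n)) x \<partial>lebesgue_centered n) = gibbs_mass W \<sigma> n B"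
      unfolding gibbs_mass_def by (intro nn_integral_cong) (auto simp: indicator_def)
    finally show ?thesis .
  qed
  have sp: "space ?P = topspace (centered_wasserstein_topology p)"
    unfolding gibbs_empirical_law_def borel_of_def space_distr
    by (rule space_measure_of) (auto dest: openin_subset)
  have "gibbs_mass W \<sigma> n (topspace (centered_wasserstein_topology p)) = ?Z"
    unfolding partition_function_def gibbs_mass_def
  proof (rule nn_integral_cong)
    fix x :: "nat \<Rightarrow> 'a" assume "x \<in> space (lebesgue_centered n)"
    then have "empirical_measure n x \<in> centered_prob_measures p"
      by (intro empirical_measure_centered[OF n]) (simp add: space_lebesgue_centered centered_configs_def)
    then show "gibbs_weight W \<sigma> n x * indicator (topspace (centered_wasserstein_topology p)) (empirical_measure n x) = gibbs_weight W \<sigma> n x"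
      by (simp add: topspace_centered_wasserstein[OF p(1)])
  qed
  moreover have "topspace (centered_wasserstein_topology p) \<in> sets (borel_of (centered_wasserstein_topology p :: 'a measure topology))"
    using sets.top[of ?P] unfolding sp by (simp add: gibbs_empirical_law_def)
  ultimately have "emeasure ?P (space ?P) = 1"
    using E Z0 Z1 by (simp add: sp)
  then show "prob_space ?P" by (rule prob_spaceI)
  show "0 < enn2real ?Z" using Z0 Z1 by (simp add: enn2real_positive_iff zero_less_iff_neq_zero)
  show "enn2real ?Z * measure ?P B = enn2real (gibbs_mass W \<sigma> n B)"
    if "B \<in> sets (borel_of (centered_wasserstein_topology p))"
  proof -
    have "?Z * emeasure ?P B = gibbs_mass W \<sigma> n B"
      using E[OF that] Z0 Z1 by (metis ennreal_mult_divide_eq infinity_ennreal_def mult.commute ennreal_times_divide less_irrefl)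
    then show ?thesis unfolding measure_def by (metis enn2real_mult)
  qed
qed

section \<open>Independent samples\<close>

text \<open>For an integrable \<open>g\<close> without further moments: \<open>g\<close> is
  truncated at level \<open>k\<close>, the average of the truncated part is controlled by
  Hoeffding's inequality, and the average of the remainder by Markov's inequality.\<close>

lemma (in prob_space) weak_law_of_large_numbers:
  fixes Y :: "nat \<Rightarrow> 'a \<Rightarrow> 'b::euclidean_space" and g :: "'b \<Rightarrow> real"
  assumes ind: "indep_vars (\<lambda>_. borel) Y {1..}" and d: "\<And>i. 1 \<le> i \<Longrightarrow> distr M borel (Y i) = \<mu>"
    and g[measurable]: "g \<in> borel_measurable borel" and gi: "integrable \<mu> g" and \<delta>: "0 < \<delta>"
  shows "(\<lambda>n. prob {\<omega>\<in>space M. \<delta> \<le> \<bar>(\<Sum>i=1..n. g (Y i \<omega>)) / real n - (\<integral>x. g x \<partial>\<mu>)\<bar>}) \<longlonglongrightarrow> 0"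
proof (rule order_tendstoI)
  have Y[measurable]: "Y i \<in> borel_measurable M" if "1 \<le> i" for i
    using ind that unfolding indep_vars_def by auto
  have sm: "sets \<mu> = sets borel" using d[of 1] by auto
  have gm: "g \<in> borel_measurable \<mu>" using g measurable_cong_sets[OF sm refl] by blast
  define m where "m = (\<integral>x. g x \<partial>\<mu>)"
  define h where "h k x = max (- real k) (min (real k) (g x))" for k :: nat and x
  have h[measurable]: "h k \<in> borel_measurable borel" for k unfolding h_def by measurable
  have hb: "- real k \<le> h k x" "h k x \<le> real k" for k x by (auto simp: h_def)
  have hm: "h k \<in> borel_measurable \<mu>" for k using h measurable_cong_sets[OF sm refl] by blast
  have hg: "\<bar>h k x\<bar> \<le> \<bar>g x\<bar>" for k x by (auto simp: h_def)
  have hi: "integrable \<mu> (h k)" for k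
    using hg by (intro Bochner_Integration.integrable_bound[OF gi hm]) auto
  define e where "e k = (\<integral>x. \<bar>g x - h k x\<bar> \<partial>\<mu>)" for k
  have "(\<lambda>k. \<integral>x. \<bar>g x - h k x\<bar> \<partial>\<mu>) \<longlonglongrightarrow> (\<integral>x. 0 \<partial>\<mu>)"
  proof (rule integral_dominated_convergence[where w="\<lambda>x. 2 * \<bar>g x\<bar>"])
    show "AE x in \<mu>. (\<lambda>k. \<bar>g x - h k x\<bar>) \<longlonglongrightarrow> 0"
    proof (rule AE_I2)
      fix x
      have "\<bar>g x - h k x\<bar> = 0" if "nat \<lceil>\<bar>g x\<bar>\<rceil> \<le> k" for k
      proof -
        have "\<bar>g x\<bar> \<le> real k" using that by linarith
        then show ?thesis by (auto simp: h_def)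
      qed
      then show "(\<lambda>k. \<bar>g x - h k x\<bar>) \<longlonglongrightarrow> 0"
        by (intro tendsto_eventually eventually_sequentiallyI)
    qed
    show "AE x in \<mu>. norm \<bar>g x - h k x\<bar> \<le> 2 * \<bar>g x\<bar>" for k
    proof (rule AE_I2)
      fix x show "norm \<bar>g x - h k x\<bar> \<le> 2 * \<bar>g x\<bar>" using hg[of k x] by simp
    qed
  qed (use gi gm hm in auto)
  then have e0: "e \<longlonglongrightarrow> 0" unfolding e_def by simp
  fix \<epsilon> :: real assume \<epsilon>: "0 < \<epsilon>"
  \<comment> \<open>The first bound limits the shift of the mean under truncation to
    \<open>\<delta> / 3\<close>; the second makes Markov's estimate of the remainder at level
    \<open>\<delta> / 3\<close> less than \<open>\<epsilon> / 2\<close>.\<close>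
  define \<eta> where "\<eta> = min (\<delta> / 3) (\<epsilon> * \<delta> / 6)"
  have \<eta>: "0 < \<eta>" using \<delta> \<epsilon> by (simp add: \<eta>_def)
  have "\<forall>\<^sub>F k in sequentially. e k < \<eta>" using e0 \<eta> by (rule order_tendstoD)
  then obtain k where k: "0 < k" "e k < \<eta>"
    using eventually_happens'[OF sequentially_bot eventually_conj[OF _ eventually_gt_at_top[of 0]]] by blast
  define mk where "mk = (\<integral>x. h k x \<partial>\<mu>)"
  have "\<bar>m - mk\<bar> \<le> e k"
  proof -
    have "m - mk = (\<integral>x. g x - h k x \<partial>\<mu>)" unfolding m_def mk_def using gi hi by simp
    then show ?thesis unfolding e_def using integral_abs_bound[of \<mu> "\<lambda>x. g x - h k x"] by simp
  qed
  then have mmk: "\<bar>m - mk\<bar> < \<delta> / 3" using k by (simp add: \<eta>_def)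
  \<comment> \<open>Hoeffding's bound for variables between \<open>- k\<close> and \<open>k\<close>,
    with the interval length left in the form the inequality produces.\<close>
  define Q where "Q n = 2 * exp (- 2 * real n * (\<delta> / 3)\<^sup>2 / (real k - - real k)\<^sup>2)" for n :: nat
  have "Q \<longlonglongrightarrow> 0"
  proof -
    define q where "q = 2 * (\<delta> / 3)\<^sup>2 / (real k - - real k)\<^sup>2"
    have q: "0 < q" using \<delta> k by (simp add: q_def)
    have "Q = (\<lambda>n. 2 * exp (- q) ^ n)"
      unfolding Q_def q_def by (simp add: exp_of_nat_mult[symmetric] mult.commute mult.left_commute)
    moreover have "(\<lambda>n. 2 * exp (- q) ^ n) \<longlonglongrightarrow> 2 * 0"
      using q by (intro tendsto_intros LIMSEQ_power_zero) simp
    ultimately show ?thesis by simp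
  qed
  then have "\<forall>\<^sub>F n in sequentially. Q n < \<epsilon> / 2" using \<epsilon> by (intro order_tendstoD) auto
  then show "\<forall>\<^sub>F n in sequentially. prob {\<omega>\<in>space M. \<delta> \<le> \<bar>(\<Sum>i=1..n. g (Y i \<omega>)) / real n - (\<integral>x. g x \<partial>\<mu>)\<bar>} < \<epsilon>"
    using eventually_ge_at_top[of 1]
  proof eventually_elim
    case (elim n)
    have E: "expectation (\<lambda>\<omega>. f (Y i \<omega>)) = (\<integral>x. f x \<partial>\<mu>)" if "1 \<le> i" "f \<in> borel_measurable borel" for f :: "'b \<Rightarrow> real" and i
      using that unfolding d[OF that(1), symmetric] by (subst integral_distr) auto
    interpret H: Hoeffding_ineq_iid M "{1..n}" "\<lambda>i \<omega>. h k (Y i \<omega>)" "\<lambda>\<omega>. h k (Y 1 \<omega>)" "- real k" "real k" "expectation (\<lambda>\<omega>. h k (Y 1 \<omega>))"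
    proof unfold_locales
      show "indep_vars (\<lambda>_. borel) (\<lambda>i \<omega>. h k (Y i \<omega>)) {1..n}"
        by (rule indep_vars_compose2[OF indep_vars_subset[OF ind]]) auto
      show "distr M borel (\<lambda>\<omega>. h k (Y i \<omega>)) = distr M borel (\<lambda>\<omega>. h k (Y 1 \<omega>))" if "i \<in> {1..n}" for i
      proof -
        have "distr M borel (\<lambda>\<omega>. h k (Y j \<omega>)) = distr \<mu> borel (h k)" if "1 \<le> j" for j
          using distr_distr[of "h k" borel borel "Y j" M] Y[OF that] by (simp add: d[OF that] comp_def)
        then show ?thesis using that by simp
      qed
    qed (use hb in auto)
    have mk1: "expectation (\<lambda>\<omega>. h k (Y 1 \<omega>)) = mk" unfolding mk_def by (rule E) auto
    have p1: "prob {\<omega>\<in>space M. \<delta> / 3 \<le> \<bar>(\<Sum>i=1..n. h k (Y i \<omega>)) / real n - mk\<bar>} \<le> Q n"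
      using H.Hoeffding_ineq_abs_ge'[of "\<delta> / 3"] \<delta> k elim(2) unfolding mk1 Q_def by simp
    define D where "D \<omega> = (\<Sum>i=1..n. \<bar>g (Y i \<omega>) - h k (Y i \<omega>)\<bar>) / real n" for \<omega>
    have Di: "integrable M (\<lambda>\<omega>. \<bar>g (Y i \<omega>) - h k (Y i \<omega>)\<bar>)" if "1 \<le> i" for i
    proof -
      have "integrable \<mu> (\<lambda>x. \<bar>g x - h k x\<bar>)" using gi hi by auto
      then show ?thesis unfolding d[OF that, symmetric] using Y[OF that] by (subst (asm) integrable_distr_eq) auto
    qed
    have D_int: "integrable M D" unfolding D_def using Di by (intro integrable_divide integrable_sum) auto
    have D_exp: "expectation D = e k"
    proof -
      have "expectation D = (\<Sum>i=1..n. expectation (\<lambda>\<omega>. \<bar>g (Y i \<omega>) - h k (Y i \<omega>)\<bar>)) / real n"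
        unfolding D_def using Di by simp
      also have "(\<Sum>i=1..n. expectation (\<lambda>\<omega>. \<bar>g (Y i \<omega>) - h k (Y i \<omega>)\<bar>)) = (\<Sum>i=1..n. e k)"
      proof (intro sum.cong refl)
        fix i assume "i \<in> {1..n}"
        then have i: "1 \<le> i" by simp
        show "expectation (\<lambda>\<omega>. \<bar>g (Y i \<omega>) - h k (Y i \<omega>)\<bar>) = e k"
          using E[OF i, of "\<lambda>x. \<bar>g x - h k x\<bar>"] by (simp add: e_def)
      qed
      finally show ?thesis using elim(2) by simp
    qed
    have p2: "prob {\<omega>\<in>space M. \<delta> / 3 \<le> D \<omega>} \<le> e k / (\<delta> / 3)"
    proof -
      have "AE \<omega> in M. 0 \<le> D \<omega>"
        unfolding D_def by (intro AE_I2 divide_nonneg_nonneg sum_nonneg) auto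
      then have "prob {\<omega>\<in>space M. \<delta> / 3 \<le> D \<omega>} \<le> expectation D / (\<delta> / 3)"
        using integral_Markov_inequality_measure[OF D_int sets.empty_sets, of "\<delta> / 3"] \<delta> by auto
      then show ?thesis unfolding D_exp .
    qed
    have "prob {\<omega>\<in>space M. \<delta> \<le> \<bar>(\<Sum>i=1..n. g (Y i \<omega>)) / real n - m\<bar>}
        \<le> prob ({\<omega>\<in>space M. \<delta> / 3 \<le> \<bar>(\<Sum>i=1..n. h k (Y i \<omega>)) / real n - mk\<bar>} \<union> {\<omega>\<in>space M. \<delta> / 3 \<le> D \<omega>})"
    proof (rule finite_measure_mono)
      show "{\<omega>\<in>space M. \<delta> / 3 \<le> \<bar>(\<Sum>i=1..n. h k (Y i \<omega>)) / real n - mk\<bar>} \<union> {\<omega>\<in>space M. \<delta> / 3 \<le> D \<omega>} \<in> events"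
        unfolding D_def by measurable
      show "{\<omega>\<in>space M. \<delta> \<le> \<bar>(\<Sum>i=1..n. g (Y i \<omega>)) / real n - m\<bar>}
        \<subseteq> {\<omega>\<in>space M. \<delta> / 3 \<le> \<bar>(\<Sum>i=1..n. h k (Y i \<omega>)) / real n - mk\<bar>} \<union> {\<omega>\<in>space M. \<delta> / 3 \<le> D \<omega>}"
      proof (rule subsetI, rule ccontr)
        fix \<omega> assume w: "\<omega> \<in> {\<omega>\<in>space M. \<delta> \<le> \<bar>(\<Sum>i=1..n. g (Y i \<omega>)) / real n - m\<bar>}"
          and n: "\<omega> \<notin> {\<omega>\<in>space M. \<delta> / 3 \<le> \<bar>(\<Sum>i=1..n. h k (Y i \<omega>)) / real n - mk\<bar>} \<union> {\<omega>\<in>space M. \<delta> / 3 \<le> D \<omega>}"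
        have "\<bar>(\<Sum>i=1..n. g (Y i \<omega>)) / real n - (\<Sum>i=1..n. h k (Y i \<omega>)) / real n\<bar> \<le> D \<omega>"
        proof -
          have "\<bar>(\<Sum>i=1..n. g (Y i \<omega>)) / real n - (\<Sum>i=1..n. h k (Y i \<omega>)) / real n\<bar>
              = \<bar>\<Sum>i=1..n. g (Y i \<omega>) - h k (Y i \<omega>)\<bar> / real n"
            by (simp add: sum_subtractf diff_divide_distrib[symmetric] abs_divide)
          also have "\<dots> \<le> D \<omega>" unfolding D_def by (intro divide_right_mono sum_abs) auto
          finally show ?thesis .
        qed
        moreover have "\<delta> \<le> \<bar>(\<Sum>i=1..n. g (Y i \<omega>)) / real n - m\<bar>" "\<omega> \<in> space M" using w by blast+
        moreover have "\<bar>(\<Sum>i=1..n. h k (Y i \<omega>)) / real n - mk\<bar> < \<delta> / 3" "D \<omega> < \<delta> / 3"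
          using n \<open>\<omega> \<in> space M\<close> by (auto simp only: Un_iff mem_Collect_eq not_le)
        ultimately show False using mmk by argo
      qed
    qed
    also have "\<dots> \<le> Q n + e k / (\<delta> / 3)"
      by (rule order_trans[OF measure_Un_le add_mono[OF p1 p2]]) (unfold D_def, measurable)
    also have "\<dots> < \<epsilon>"
    proof -
      have "e k < \<epsilon> * \<delta> / 6" using k by (simp add: \<eta>_def)
      then have "e k / (\<delta> / 3) < \<epsilon> / 2" using \<delta> by (simp add: field_simps)
      then show ?thesis using elim(1) by linarith
    qed
    finally show ?case unfolding m_def .
  qed
qed (auto intro!: always_eventually less_le_trans[OF _ measure_nonneg])

section \<open>The canonical independent sequence\<close>

definition iid_measure :: "'a::euclidean_space measure \<Rightarrow> (nat \<Rightarrow> 'a) measure" where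
  "iid_measure \<mu> = Pi\<^sub>M UNIV (\<lambda>_. \<mu>)"

context
  fixes \<mu> :: "'a::euclidean_space measure"
  assumes mu: "\<mu> \<in> prob_measures"
begin

lemma prob_space_iid: "prob_space (iid_measure \<mu>)"
  unfolding iid_measure_def by (intro prob_space_PiM prob_measuresD[OF mu])

lemma sets_iid: "sets (iid_measure \<mu>) = sets borel"
proof -
  have "sets (iid_measure \<mu>) = sets (Pi\<^sub>M UNIV (\<lambda>_::nat. borel :: 'a measure))"
    unfolding iid_measure_def by (intro sets_PiM_cong refl prob_measuresD(2)[OF mu])
  then show ?thesis using sets_PiM_equal_borel by blast
qed

lemma space_iid: "space (iid_measure \<mu>) = UNIV"
  using sets_eq_imp_space_eq[OF sets_iid] by simp

lemma iid_component_measurable[measurable]: "(\<lambda>\<omega>. \<omega> i) \<in> borel_measurable (iid_measure \<mu>)"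
proof -
  have "(\<lambda>\<omega>. \<omega> i) \<in> iid_measure \<mu> \<rightarrow>\<^sub>M \<mu>" unfolding iid_measure_def by (rule measurable_component_singleton) simp
  then show ?thesis using measurable_cong_sets[OF refl prob_measuresD(2)[OF mu]] by blast
qed

lemma distr_iid_component: "distr (iid_measure \<mu>) borel (\<lambda>\<omega>. \<omega> i) = \<mu>"
proof -
  have "distr (iid_measure \<mu>) borel (\<lambda>\<omega>. \<omega> i) = distr (iid_measure \<mu>) \<mu> (\<lambda>\<omega>. \<omega> i)"
    by (rule distr_cong) (auto simp: prob_measuresD[OF mu])
  also have "\<dots> = \<mu>"
    unfolding iid_measure_def by (rule distr_PiM_component) (auto intro: prob_measuresD[OF mu])
  finally show ?thesis .
qed

lemma distr_iid_restrict: "distr (iid_measure \<mu>) (Pi\<^sub>M I (\<lambda>_. \<mu>)) (\<lambda>\<omega>. \<lambda>i\<in>I. \<omega> i) = Pi\<^sub>M I (\<lambda>_. \<mu>)"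
  using distr_PiM_reindex[of UNIV "\<lambda>_::nat. \<mu>" "\<lambda>i. i" I] prob_measuresD(1)[OF mu]
  unfolding iid_measure_def by auto

lemma indep_iid: "prob_space.indep_vars (iid_measure \<mu>) (\<lambda>_. borel) (\<lambda>i \<omega>. \<omega> i) {1..}"
proof -
  interpret prob_space "iid_measure \<mu>" by (rule prob_space_iid)
  have "distr (iid_measure \<mu>) (Pi\<^sub>M {1..} (\<lambda>_. borel)) (\<lambda>\<omega>. \<lambda>i\<in>{1..}. \<omega> i) = distr (iid_measure \<mu>) (Pi\<^sub>M {1..} (\<lambda>_. \<mu>)) (\<lambda>\<omega>. \<lambda>i\<in>{1..}. \<omega> i)"
    by (intro distr_cong refl sets_PiM_cong) (auto simp: prob_measuresD[OF mu])
  also have "\<dots> = Pi\<^sub>M {1..} (\<lambda>i. distr (iid_measure \<mu>) borel (\<lambda>\<omega>. \<omega> i))"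
    unfolding distr_iid_restrict distr_iid_component ..
  finally show ?thesis by (subst indep_vars_iff_distr_eq_PiM) auto
qed

end

section \<open>Recentering as a change of variables\<close>

definition sample_mean :: "nat \<Rightarrow> (nat \<Rightarrow> 'a::euclidean_space) \<Rightarrow> 'a" where
  "sample_mean n y = (\<Sum>i=1..n. y i) /\<^sub>R real n"

definition recenter :: "nat \<Rightarrow> (nat \<Rightarrow> 'a::euclidean_space) \<Rightarrow> nat \<Rightarrow> 'a" where
  "recenter n y = (\<lambda>i\<in>{1..n}. y i - sample_mean n y)"

lemma sum_recenter: "1 \<le> n \<Longrightarrow> (\<Sum>i=1..n. recenter n y i) = 0"
  by (simp add: recenter_def sum_subtractf sample_mean_def sum_constant_scaleR)

lemma recenter_centered: "1 \<le> n \<Longrightarrow> recenter n y \<in> centered_configs n"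
  using sum_recenter[of n y] by (simp add: centered_configs_def) (simp add: recenter_def)

lemma PiM_lborel_translate:
  assumes "finite I"
  shows "distr (Pi\<^sub>M I (\<lambda>_. lborel :: 'a::euclidean_space measure)) (Pi\<^sub>M I (\<lambda>_. lborel)) (\<lambda>x. \<lambda>i\<in>I. x i - m) = Pi\<^sub>M I (\<lambda>_. lborel)"
proof -
  interpret product_sigma_finite "\<lambda>_. lborel :: 'a measure" by standard
  have mt: "(\<lambda>x. \<lambda>i\<in>I. x i - m) \<in> Pi\<^sub>M I (\<lambda>_. lborel) \<rightarrow>\<^sub>M Pi\<^sub>M I (\<lambda>_. lborel :: 'a measure)"
    by (rule measurable_restrict) measurable
  show ?thesis
  proof (rule PiM_eqI[OF assms])
    fix A assume A: "\<And>i. i \<in> I \<Longrightarrow> A i \<in> sets (lborel :: 'a measure)"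
    have "(\<lambda>x. \<lambda>i\<in>I. x i - m) -` Pi\<^sub>E I A \<inter> space (Pi\<^sub>M I (\<lambda>_. lborel)) = Pi\<^sub>E I (\<lambda>i. (\<lambda>x. x - m) -` A i)"
      by (auto simp: space_PiM PiE_def Pi_def extensional_def)
    moreover have "emeasure lborel ((\<lambda>x. x - m) -` A i) = emeasure lborel (A i)" if "i \<in> I" for i
    proof -
      have "emeasure lborel (A i) = emeasure (distr lborel borel ((+) (- m))) (A i)"
        by (simp add: lborel_distr_plus)
      also have "\<dots> = emeasure lborel ((+) (- m) -` A i)" using A[OF that] by (subst emeasure_distr) auto
      also have "(+) (- m) -` A i = (\<lambda>x. x - m) -` A i" by auto
      finally show ?thesis ..
    qed
    moreover have "(\<lambda>x. x - m) -` A i \<in> sets lborel" if "i \<in> I" for i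
      using measurable_sets[of "\<lambda>x. x - m" borel borel "A i"] A[OF that] by simp
    moreover have "Pi\<^sub>E I A \<in> sets (Pi\<^sub>M I (\<lambda>_. lborel))" using A assms by (intro sets_PiM_I_finite) auto
    ultimately show "emeasure (distr (Pi\<^sub>M I (\<lambda>_. lborel)) (Pi\<^sub>M I (\<lambda>_. lborel)) (\<lambda>x. \<lambda>i\<in>I. x i - m)) (Pi\<^sub>E I A) = (\<Prod>i\<in>I. emeasure lborel (A i))"
      using mt assms by (simp add: emeasure_distr emeasure_PiM)
  qed simp
qed

lemma nn_integral_lborel_affine:
  fixes h :: "'a::euclidean_space \<Rightarrow> ennreal"
  assumes [measurable]: "h \<in> borel_measurable borel" and "0 < c"
  shows "(\<integral>\<^sup>+ t. h t \<partial>lborel) = ennreal (c ^ DIM('a)) * (\<integral>\<^sup>+ m. h (t0 + c *\<^sub>R m) \<partial>lborel)"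
proof -
  have "(\<integral>\<^sup>+ t. h t \<partial>lborel) = (\<integral>\<^sup>+ t. h t \<partial>density (distr lborel borel (\<lambda>x. t0 + c *\<^sub>R x)) (\<lambda>_. ennreal (\<bar>c\<bar> ^ DIM('a))))"
    using lborel_affine[of c t0] assms(2) by simp
  also have "\<dots> = (\<integral>\<^sup>+ m. ennreal (c ^ DIM('a)) * h (t0 + c *\<^sub>R m) \<partial>lborel)"
    using assms(2) by (subst nn_integral_density) (auto simp: nn_integral_distr)
  also have "\<dots> = ennreal (c ^ DIM('a)) * (\<integral>\<^sup>+ m. h (t0 + c *\<^sub>R m) \<partial>lborel)"
    by (intro nn_integral_cmult) auto
  finally show ?thesis .
qed

lemma measurable_recenter:
  assumes "1 \<le> n"
  shows "recenter n \<in> Pi\<^sub>M {1..n} (\<lambda>_. lborel) \<rightarrow>\<^sub>M (lebesgue_centered n :: (nat \<Rightarrow> 'a::euclidean_space) measure)"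
proof -
  have "recenter n \<in> Pi\<^sub>M {1..n} (\<lambda>_. lborel) \<rightarrow>\<^sub>M Pi\<^sub>M {1..n} (\<lambda>_. borel :: 'a measure)"
    unfolding recenter_def sample_mean_def
  proof (rule measurable_restrict)
    fix i assume "i \<in> {1..n}"
    have c: "(\<lambda>x. x j) \<in> Pi\<^sub>M {1..n} (\<lambda>_. lborel) \<rightarrow>\<^sub>M (borel :: 'a measure)" if "j \<in> {1..n}" for j
      using measurable_component_singleton[OF that, of "\<lambda>_. lborel :: 'a measure"] by simp
    show "(\<lambda>y. y i - (\<Sum>i=1..n. y i) /\<^sub>R real n) \<in> Pi\<^sub>M {1..n} (\<lambda>_. lborel) \<rightarrow>\<^sub>M (borel :: 'a measure)"
      using c \<open>i \<in> {1..n}\<close> by (intro borel_measurable_diff borel_measurable_scaleR borel_measurable_sum borel_measurable_const)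
  qed
  then have "recenter n \<in> Pi\<^sub>M {1..n} (\<lambda>_. lborel) \<rightarrow>\<^sub>M restrict_space (Pi\<^sub>M {1..n} (\<lambda>_. borel :: 'a measure)) (centered_configs n)"
    by (intro measurable_restrict_space2) (use recenter_centered[OF assms] in auto)
  then show ?thesis using measurable_cong_sets[OF refl sets_lebesgue_centered] by blast
qed

lemma measurable_sample_mean:
  "sample_mean n \<in> Pi\<^sub>M {1..n} (\<lambda>_. lborel) \<rightarrow>\<^sub>M (borel :: 'a::euclidean_space measure)"
  unfolding sample_mean_def
proof (intro borel_measurable_scaleR borel_measurable_sum borel_measurable_const)
  fix j assume "j \<in> {1..n}"
  from measurable_component_singleton[OF this, of "\<lambda>_. lborel :: 'a measure"]
  show "(\<lambda>x. x j) \<in> Pi\<^sub>M {1..n} (\<lambda>_. lborel) \<rightarrow>\<^sub>M (borel :: 'a measure)" by simp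
qed

lemma sample_mean_update:
  assumes "1 \<le> n"
  shows "sample_mean n (x(n := - (\<Sum>i=1..<n. x i) + real n *\<^sub>R m)) = m"
proof -
  have "(\<Sum>i=1..n. (x(n := - (\<Sum>i=1..<n. x i) + real n *\<^sub>R m)) i) = (\<Sum>i=1..<n. x i) + (- (\<Sum>i=1..<n. x i) + real n *\<^sub>R m)"
    unfolding sum_split_last[OF assms] by simp
  then show ?thesis using assms by (simp add: sample_mean_def)
qed

text \<open>With the last point written as \<open>n * m\<close> minus the sum of the others,
  recentering is a translation by \<open>m\<close> in the first \<open>n - 1\<close> coordinates,
  and the last point is again determined by the zero sum.\<close>

lemma recenter_update:
  assumes "1 \<le> n"
  shows "recenter n (x(n := - (\<Sum>i=1..<n. x i) + real n *\<^sub>R m)) = center_extend n (\<lambda>i\<in>{1..<n}. x i - m)"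
proof
  fix i
  have s: "(\<Sum>j=1..<n. (\<lambda>i\<in>{1..<n}. x i - m) j) = (\<Sum>j=1..<n. x j) - (real n - 1) *\<^sub>R m"
    using assms by (simp add: sum_subtractf sum_constant_scaleR of_nat_diff)
  show "recenter n (x(n := - (\<Sum>i=1..<n. x i) + real n *\<^sub>R m)) i = center_extend n (\<lambda>i\<in>{1..<n}. x i - m) i"
    unfolding recenter_def sample_mean_update[OF assms] center_extend_def s
    by (auto simp: algebra_simps)
qed

text \<open>The last point is replaced by the sample mean as a variable, with Jacobian n to the
  power of the dimension. Recentering then only translates the other points, which Lebesgue measure
  ignores, so the integral factorizes into mean and shape.\<close>

lemma nn_integral_recenter:
  fixes G :: "(nat \<Rightarrow> 'a::euclidean_space) \<Rightarrow> ennreal" and K :: "'a \<Rightarrow> ennreal"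
  assumes n: "1 \<le> n" and G: "G \<in> borel_measurable (lebesgue_centered n)" and K[measurable]: "K \<in> borel_measurable borel"
  shows "(\<integral>\<^sup>+ y. G (recenter n y) * K (sample_mean n y) \<partial>Pi\<^sub>M {1..n} (\<lambda>_. lborel))
    = ennreal (real n ^ DIM('a)) * ((\<integral>\<^sup>+ m. K m \<partial>lborel) * (\<integral>\<^sup>+ z. G (center_extend n z) \<partial>Pi\<^sub>M {1..<n} (\<lambda>_. lborel)))"
proof -
  interpret product_sigma_finite "\<lambda>_::nat. lborel :: 'a measure" by standard
  let ?P = "Pi\<^sub>M {1..<n} (\<lambda>_. lborel :: 'a measure)"
  interpret P: sigma_finite_measure ?P by (rule sigma_finite) simp
  interpret PL: pair_sigma_finite ?P "lborel :: 'a measure" ..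
  have split: "{1..n} = insert n {1..<n}" using n by auto
  have f[measurable]: "(\<lambda>y. G (recenter n y) * K (sample_mean n y)) \<in> borel_measurable (Pi\<^sub>M {1..n} (\<lambda>_. lborel))"
    using measurable_compose[OF measurable_recenter[OF n] G] measurable_compose[OF measurable_sample_mean K]
    by (rule borel_measurable_times_ennreal)
  have H: "(\<lambda>z. G (center_extend n z)) \<in> borel_measurable ?P"
  proof -
    have "center_extend n \<in> ?P \<rightarrow>\<^sub>M restrict_space (Pi\<^sub>M {1..n} (\<lambda>_. borel :: 'a measure)) (centered_configs n)"
      by (rule measurable_restrict_space2[OF _ center_extend_measurable]) (use center_extend_centered[OF n] in auto)
    then have "center_extend n \<in> ?P \<rightarrow>\<^sub>M lebesgue_centered n"
      using measurable_cong_sets[OF refl sets_lebesgue_centered] by blast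
    then show ?thesis using G by (rule measurable_compose)
  qed
  define H where "H z = G (center_extend n z)" for z
  have Hm[measurable]: "H \<in> borel_measurable ?P" unfolding H_def by (rule H)
  have tr: "(\<lambda>x. \<lambda>i\<in>{1..<n}. x i - m) \<in> ?P \<rightarrow>\<^sub>M ?P" for m by (rule measurable_restrict) measurable
  have "(\<integral>\<^sup>+ y. G (recenter n y) * K (sample_mean n y) \<partial>Pi\<^sub>M {1..n} (\<lambda>_. lborel))
      = (\<integral>\<^sup>+ x. (\<integral>\<^sup>+ t. G (recenter n (x(n := t))) * K (sample_mean n (x(n := t))) \<partial>lborel) \<partial>?P)"
    using f unfolding split by (intro product_nn_integral_insert) auto
  also have "\<dots> = (\<integral>\<^sup>+ x. ennreal (real n ^ DIM('a)) * (\<integral>\<^sup>+ m. H (\<lambda>i\<in>{1..<n}. x i - m) * K m \<partial>lborel) \<partial>?P)"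
  proof (rule nn_integral_cong)
    fix x assume x: "x \<in> space ?P"
    have up: "(\<lambda>t. x(n := t)) \<in> lborel \<rightarrow>\<^sub>M Pi\<^sub>M (insert n {1..<n}) (\<lambda>_. lborel :: 'a measure)"
      using measurable_component_update[OF x, of n] by simp
    have "(\<lambda>t. G (recenter n (x(n := t))) * K (sample_mean n (x(n := t)))) \<in> borel_measurable lborel"
      using measurable_compose[OF up f[unfolded split]] unfolding split[symmetric] .
    then have "(\<integral>\<^sup>+ t. G (recenter n (x(n := t))) * K (sample_mean n (x(n := t))) \<partial>lborel)
      = ennreal (real n ^ DIM('a)) * (\<integral>\<^sup>+ m. G (recenter n (x(n := - (\<Sum>i=1..<n. x i) + real n *\<^sub>R m)))
          * K (sample_mean n (x(n := - (\<Sum>i=1..<n. x i) + real n *\<^sub>R m))) \<partial>lborel)"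
      using n by (intro nn_integral_lborel_affine) auto
    then show "(\<integral>\<^sup>+ t. G (recenter n (x(n := t))) * K (sample_mean n (x(n := t))) \<partial>lborel)
      = ennreal (real n ^ DIM('a)) * (\<integral>\<^sup>+ m. H (\<lambda>i\<in>{1..<n}. x i - m) * K m \<partial>lborel)"
      unfolding sample_mean_update[OF n] recenter_update[OF n] H_def .
  qed
  also have "\<dots> = ennreal (real n ^ DIM('a)) * (\<integral>\<^sup>+ x. (\<integral>\<^sup>+ m. H (\<lambda>i\<in>{1..<n}. x i - m) * K m \<partial>lborel) \<partial>?P)"
  proof (rule nn_integral_cmult)
    have "(\<lambda>w. \<lambda>i\<in>{1..<n}. fst w i - snd w) \<in> ?P \<Otimes>\<^sub>M (lborel :: 'a measure) \<rightarrow>\<^sub>M ?P"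
      by (rule measurable_restrict) measurable
    then have "(\<lambda>w. H (\<lambda>i\<in>{1..<n}. fst w i - snd w)) \<in> borel_measurable (?P \<Otimes>\<^sub>M (lborel :: 'a measure))"
      by (rule measurable_compose[OF _ Hm])
    then have jm: "(\<lambda>(x, m). H (\<lambda>i\<in>{1..<n}. x i - m) * K m) \<in> borel_measurable (?P \<Otimes>\<^sub>M (lborel :: 'a measure))"
      by (simp add: case_prod_unfold)
    then show "(\<lambda>x. \<integral>\<^sup>+ m. H (\<lambda>i\<in>{1..<n}. x i - m) * K m \<partial>lborel) \<in> borel_measurable ?P"
      using lborel.borel_measurable_nn_integral_fst[of "\<lambda>(x, m). H (\<lambda>i\<in>{1..<n}. x i - m) * K m" ?P] by simp
  qed
  also have "(\<integral>\<^sup>+ x. (\<integral>\<^sup>+ m. H (\<lambda>i\<in>{1..<n}. x i - m) * K m \<partial>lborel) \<partial>?P)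
      = (\<integral>\<^sup>+ m. (\<integral>\<^sup>+ x. H (\<lambda>i\<in>{1..<n}. x i - m) * K m \<partial>?P) \<partial>lborel)"
  proof (rule PL.Fubini'[symmetric])
    have "(\<lambda>w. \<lambda>i\<in>{1..<n}. fst w i - snd w) \<in> ?P \<Otimes>\<^sub>M (lborel :: 'a measure) \<rightarrow>\<^sub>M ?P"
      by (rule measurable_restrict) measurable
    then have "(\<lambda>w. H (\<lambda>i\<in>{1..<n}. fst w i - snd w)) \<in> borel_measurable (?P \<Otimes>\<^sub>M (lborel :: 'a measure))"
      by (rule measurable_compose[OF _ Hm])
    then show "case_prod (\<lambda>x m. H (\<lambda>i\<in>{1..<n}. x i - m) * K m) \<in> borel_measurable (?P \<Otimes>\<^sub>M (lborel :: 'a measure))"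
      by (simp add: case_prod_unfold)
  qed
  also have "\<dots> = (\<integral>\<^sup>+ m. (\<integral>\<^sup>+ z. H z \<partial>?P) * K m \<partial>lborel)"
  proof (rule nn_integral_cong)
    fix m :: 'a
    have "(\<integral>\<^sup>+ x. H (\<lambda>i\<in>{1..<n}. x i - m) * K m \<partial>?P) = (\<integral>\<^sup>+ x. H (\<lambda>i\<in>{1..<n}. x i - m) \<partial>?P) * K m"
      using measurable_compose[OF tr Hm] by (intro nn_integral_multc)
    also have "(\<integral>\<^sup>+ x. H (\<lambda>i\<in>{1..<n}. x i - m) \<partial>?P) = (\<integral>\<^sup>+ x. H x \<partial>distr ?P ?P (\<lambda>x. \<lambda>i\<in>{1..<n}. x i - m))"
      by (rule nn_integral_distr[symmetric, OF tr]) (subst measurable_distr_eq1, rule Hm)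
    also have "\<dots> = (\<integral>\<^sup>+ z. H z \<partial>?P)" by (simp add: PiM_lborel_translate)
    finally show "(\<integral>\<^sup>+ x. H (\<lambda>i\<in>{1..<n}. x i - m) * K m \<partial>?P) = (\<integral>\<^sup>+ z. H z \<partial>?P) * K m" .
  qed
  also have "\<dots> = (\<integral>\<^sup>+ m. K m \<partial>lborel) * (\<integral>\<^sup>+ z. H z \<partial>?P)"
    by (subst nn_integral_cmult) (auto simp: mult.commute)
  finally show ?thesis unfolding H_def .
qed

lemma PiM_density_lborel:
  fixes q :: "'a::euclidean_space \<Rightarrow> real"
  assumes I: "finite I" and q[measurable]: "q \<in> borel_measurable borel"
    and mu: "density lborel (\<lambda>x. ennreal (q x)) \<in> prob_measures"
  shows "Pi\<^sub>M I (\<lambda>_. density lborel (\<lambda>x. ennreal (q x))) = density (Pi\<^sub>M I (\<lambda>_. lborel)) (\<lambda>x. \<Prod>i\<in>I. ennreal (q (x i)))"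
proof -
  let ?\<mu> = "density lborel (\<lambda>x. ennreal (q x))"
  interpret mu: prob_space ?\<mu> by (rule prob_measuresD[OF mu])
  interpret M: product_sigma_finite "\<lambda>_. ?\<mu>" by standard
  interpret L: product_sigma_finite "\<lambda>_. lborel :: 'a measure" by standard
  have pm: "(\<lambda>x. \<Prod>i\<in>I. ennreal (q (x i))) \<in> borel_measurable (Pi\<^sub>M I (\<lambda>_. lborel))"
  proof (rule borel_measurable_prod_ennreal)
    fix i assume i: "i \<in> I"
    have "(\<lambda>x. ennreal (q x)) \<in> borel_measurable lborel" by simp
    from measurable_compose[OF measurable_component_singleton[OF i] this]
    show "(\<lambda>z. ennreal (q (z i))) \<in> borel_measurable (Pi\<^sub>M I (\<lambda>_. lborel))" .
  qed
  show ?thesis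
  proof (rule M.PiM_eqI[OF I, symmetric])
    show "sets (density (Pi\<^sub>M I (\<lambda>_. lborel)) (\<lambda>x. \<Prod>i\<in>I. ennreal (q (x i)))) = sets (Pi\<^sub>M I (\<lambda>_. ?\<mu>))"
      by (simp cong: sets_PiM_cong)
    fix A assume A: "\<And>i. i \<in> I \<Longrightarrow> A i \<in> sets ?\<mu>"
    have As: "Pi\<^sub>E I A \<in> sets (Pi\<^sub>M I (\<lambda>_. lborel))" using A I by (intro sets_PiM_I_finite) auto
    have "emeasure (density (Pi\<^sub>M I (\<lambda>_. lborel)) (\<lambda>x. \<Prod>i\<in>I. ennreal (q (x i)))) (Pi\<^sub>E I A)
      = (\<integral>\<^sup>+ x. (\<Prod>i\<in>I. ennreal (q (x i))) * indicator (Pi\<^sub>E I A) x \<partial>Pi\<^sub>M I (\<lambda>_. lborel))"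
      using As pm by (intro emeasure_density)
    also have "\<dots> = (\<integral>\<^sup>+ x. (\<Prod>i\<in>I. ennreal (q (x i)) * indicator (A i) (x i)) \<partial>Pi\<^sub>M I (\<lambda>_. lborel))"
    proof (rule nn_integral_cong)
      fix x assume x: "x \<in> space (Pi\<^sub>M I (\<lambda>_. lborel :: 'a measure))"
      have "indicator (Pi\<^sub>E I A) x = (\<Prod>i\<in>I. indicator (A i) (x i) :: ennreal)"
        using x I by (auto simp: indicator_def space_PiM PiE_iff prod_eq_1_iff intro: prod_zero)
      then show "(\<Prod>i\<in>I. ennreal (q (x i))) * indicator (Pi\<^sub>E I A) x = (\<Prod>i\<in>I. ennreal (q (x i)) * indicator (A i) (x i))"
        by (simp add: prod.distrib)
    qed
    also have "\<dots> = (\<Prod>i\<in>I. \<integral>\<^sup>+ x. ennreal (q x) * indicator (A i) x \<partial>lborel)"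
      using A I by (intro L.product_nn_integral_prod) auto
    also have "\<dots> = (\<Prod>i\<in>I. emeasure ?\<mu> (A i))"
      using A by (intro prod.cong refl emeasure_density[symmetric]) auto
    finally show "emeasure (density (Pi\<^sub>M I (\<lambda>_. lborel)) (\<lambda>x. \<Prod>i\<in>I. ennreal (q (x i)))) (Pi\<^sub>E I A) = (\<Prod>i\<in>I. emeasure ?\<mu> (A i))" .
  qed
qed

section \<open>The lower bound for the Gibbs measure\<close>

lemma translate_centered:
  assumes p: "1 \<le> p" and mu: "\<mu> \<in> prob_measures_moment p"
  shows "translate_measure (- (\<integral>x. x \<partial>\<mu>)) \<mu> \<in> centered_prob_measures p"
proof -
  define m where "m = (\<integral>x. x \<partial>\<mu>)"
  note M = prob_measures_momentD[OF mu]
  interpret prob_space \<mu> by (rule M)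
  have tm: "(\<lambda>x. x - m) \<in> borel_measurable \<mu>"
    unfolding measurable_prob_measures[OF M(1)] by measurable
  have tm': "(\<lambda>x. x + - m) \<in> borel_measurable \<mu>" using tm by simp
  have nm: "(\<lambda>x. ennreal (norm x powr p)) \<in> borel_measurable borel" by measurable
  have nm': "(\<lambda>x. ennreal (norm x powr p)) \<in> borel_measurable \<mu>"
    unfolding measurable_prob_measures[OF M(1)] by (rule nm)
  have P: "translate_measure (- m) \<mu> \<in> prob_measures"
    unfolding translate_measure_def by (rule distr_in_prob_measures) (auto intro: prob_space_axioms tm)
  have "(\<integral>\<^sup>+ x. ennreal (norm x powr p) \<partial>translate_measure (- m) \<mu>) = (\<integral>\<^sup>+ x. ennreal (norm (x + - m) powr p) \<partial>\<mu>)"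
    unfolding translate_measure_def by (rule nn_integral_distr[OF tm']) (simp add: nm)
  also have "\<dots> \<le> (\<integral>\<^sup>+ x. ennreal (2 powr p) * (ennreal (norm x powr p) + ennreal (norm (- m) powr p)) \<partial>\<mu>)"
  proof (rule nn_integral_mono)
    fix x
    have "ennreal (norm (x + - m) powr p) \<le> ennreal (2 powr p * (norm x powr p + norm (- m) powr p))"
      by (rule ennreal_leI, rule norm_add_powr_le) (use p in simp)
    also have "\<dots> = ennreal (2 powr p) * (ennreal (norm x powr p) + ennreal (norm (- m) powr p))"
      by (subst ennreal_mult) (simp_all only: ennreal_plus powr_ge_zero add_nonneg_nonneg)
    finally show "ennreal (norm (x + - m) powr p) \<le> ennreal (2 powr p) * (ennreal (norm x powr p) + ennreal (norm (- m) powr p))" .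
  qed
  also have "\<dots> = ennreal (2 powr p) * ((\<integral>\<^sup>+ x. ennreal (norm x powr p) \<partial>\<mu>) + ennreal (norm (- m) powr p))"
  proof -
    have "(\<integral>\<^sup>+ x. (ennreal (norm x powr p) + ennreal (norm (- m) powr p)) \<partial>\<mu>)
        = (\<integral>\<^sup>+ x. ennreal (norm x powr p) \<partial>\<mu>) + (\<integral>\<^sup>+ x. ennreal (norm (- m) powr p) \<partial>\<mu>)"
      by (rule nn_integral_add[OF nm' borel_measurable_const])
    moreover have "(\<integral>\<^sup>+ x. ennreal (norm (- m) powr p) \<partial>\<mu>) = ennreal (norm (- m) powr p)"
      unfolding nn_integral_const emeasure_space_1 by (rule mult_1_right)
    moreover have "(\<lambda>x. ennreal (norm x powr p) + ennreal (norm (- m) powr p)) \<in> borel_measurable \<mu>"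
      by (intro borel_measurable_add nm' borel_measurable_const)
    ultimately show ?thesis by (simp only: nn_integral_cmult)
  qed
  also have "\<dots> < \<infinity>" using M(5) by (auto simp: ennreal_mult_less_top)
  finally have mom: "translate_measure (- m) \<mu> \<in> prob_measures_moment p"
    using P by (simp add: prob_measures_moment_def)
  have "(\<integral>x. x \<partial>translate_measure (- m) \<mu>) = (\<integral>x. x + - m \<partial>\<mu>)"
    unfolding translate_measure_def by (rule integral_distr[OF tm']) simp
  also have "\<dots> = 0"
    using first_moment_integrable[OF mu p] by (simp add: m_def prob_space)
  finally show ?thesis using mom unfolding m_def by (simp add: centered_prob_measures_def)
qed

lemma translate_zero:
  assumes "\<mu> \<in> prob_measures"
  shows "translate_measure 0 \<mu> = \<mu>"
  unfolding translate_measure_def by (simp, rule distr_id2) (simp add: prob_measuresD[OF assms])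

section \<open>Recentered samples and their likely behaviour\<close>

lemma empirical_measure_recenter:
  "empirical_measure n (recenter n y) = translate_measure (- sample_mean n y) (empirical_measure n y)"
proof -
  have "empirical_measure n (recenter n y) = distr (uniform_count_measure {1..n}) borel (\<lambda>i. y i + - sample_mean n y)"
    unfolding empirical_measure_def by (rule distr_cong) (auto simp: recenter_def space_uniform_count_measure)
  also have "\<dots> = translate_measure (- sample_mean n y) (empirical_measure n y)"
    unfolding empirical_measure_def by (rule distr_shift_eq_translate) simp
  finally show ?thesis .
qed

lemma sample_mean_restrict: "sample_mean n (restrict y {1..n}) = sample_mean n y"
  unfolding sample_mean_def by (intro arg_cong2[of _ _ _ _ "(*\<^sub>R)"] sum.cong) auto

lemma recenter_restrict: "recenter n (restrict y {1..n}) = recenter n y"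
  unfolding recenter_def sample_mean_restrict by auto

text \<open>Confining the sample mean to a ball makes the factor of the mean in the change of
  variables finite, namely the volume of a unit ball.\<close>

definition good_event :: "nat \<Rightarrow> 'a::euclidean_space \<Rightarrow> 'a measure set \<Rightarrow> (nat \<Rightarrow> 'a) set" where
  "good_event n m U = {\<omega>. sample_mean n \<omega> \<in> cball m 1 \<and> empirical_measure n (recenter n \<omega>) \<in> U}"

lemma restrict_iid_measurable:
  fixes \<mu> :: "'a::euclidean_space measure"
  assumes "\<mu> \<in> prob_measures"
  shows "(\<lambda>\<omega>. restrict \<omega> {1..n}) \<in> iid_measure \<mu> \<rightarrow>\<^sub>M Pi\<^sub>M {1..n} (\<lambda>_. lborel)"
proof (rule measurable_restrict)
  fix i
  show "(\<lambda>\<omega>. \<omega> i) \<in> iid_measure \<mu> \<rightarrow>\<^sub>M lborel" using iid_component_measurable[OF assms, of i] by simp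
qed

lemma recenter_iid_measurable:
  fixes \<mu> :: "'a::euclidean_space measure"
  assumes "\<mu> \<in> prob_measures" "1 \<le> n"
  shows "recenter n \<in> iid_measure \<mu> \<rightarrow>\<^sub>M lebesgue_centered n"
  using measurable_compose[OF restrict_iid_measurable[OF assms(1)] measurable_recenter[OF assms(2)]]
  unfolding recenter_restrict .

lemma sample_mean_iid_measurable:
  fixes \<mu> :: "'a::euclidean_space measure"
  assumes "\<mu> \<in> prob_measures"
  shows "sample_mean n \<in> borel_measurable (iid_measure \<mu>)"
  using measurable_compose[OF restrict_iid_measurable[OF assms] measurable_sample_mean]
  unfolding sample_mean_restrict .

lemma openin_borel_of: "openin X U \<Longrightarrow> U \<in> sets (borel_of X)"
  unfolding borel_of_def by (subst sets_measure_of) (auto dest: openin_subset intro: sigma_sets.Basic)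

lemma good_event_measurable:
  fixes \<mu> :: "'a::euclidean_space measure"
  assumes mu: "\<mu> \<in> prob_measures" and n: "1 \<le> n" and p: "1 \<le> p" and U: "openin (centered_wasserstein_topology p) U"
  shows "good_event n m U \<in> sets (iid_measure \<mu>)"
proof -
  note a = measurable_compose[OF recenter_iid_measurable[OF mu n] empirical_measure_measurable[OF p n]]
  have "(\<lambda>\<omega>. empirical_measure n (recenter n \<omega>)) -` U \<inter> space (iid_measure \<mu>) \<in> sets (iid_measure \<mu>)"
    by (rule measurable_sets[OF a openin_borel_of[OF U]])
  moreover have "sample_mean n -` cball m 1 \<inter> space (iid_measure \<mu>) \<in> sets (iid_measure \<mu>)"
    by (rule measurable_sets[OF sample_mean_iid_measurable[OF mu]]) simp
  moreover have "good_event n m U = ((\<lambda>\<omega>. empirical_measure n (recenter n \<omega>)) -` U \<inter> space (iid_measure \<mu>))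
      \<inter> (sample_mean n -` cball m 1 \<inter> space (iid_measure \<mu>))"
    unfolding good_event_def space_iid[OF mu] by auto
  ultimately show ?thesis by simp
qed

text \<open>The complement is covered by finitely many deviation events for averages: of the test
  functions, of the p-th power of the norm, and of the coordinates, which control the mean. The law
  of large numbers applies to each.\<close>

lemma good_event_prob:
  fixes \<mu> :: "'a::euclidean_space measure"
  assumes p: "1 \<le> p" and mu: "\<mu> \<in> prob_measures_moment p" and U: "openin (centered_wasserstein_topology p) U"
    and in_U: "translate_measure (- (\<integral>x. x \<partial>\<mu>)) \<mu> \<in> U"
  shows "(\<lambda>n. measure (iid_measure \<mu>) (- good_event n (\<integral>x. x \<partial>\<mu>) U)) \<longlonglongrightarrow> 0"
proof -
  note M = prob_measures_momentD[OF mu]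
  note mp = M(1)
  interpret prob_space "iid_measure \<mu>" by (rule prob_space_iid[OF mp])
  define m where "m = (\<integral>x. x \<partial>\<mu>)"
  obtain \<rho> where \<rho>: "0 < \<rho>"
    "\<And>\<nu>. \<nu> \<in> centered_prob_measures p \<Longrightarrow> wasserstein_dist p (translate_measure (- m) \<mu>) \<nu> < \<rho> \<Longrightarrow> \<nu> \<in> U"
    using openin_centered_wassersteinD[OF p U in_U] unfolding m_def by blast
  obtain f :: "nat \<Rightarrow> 'a \<Rightarrow> real" and N \<delta> where \<delta>: "0 < \<delta>" and fm: "\<And>j. f j \<in> borel_measurable borel"
    and fb: "\<And>j x. \<bar>f j x\<bar> \<le> 1"
    and test: "\<forall>\<nu>\<in>prob_measures_moment p. \<forall>y. (\<forall>j<N. \<bar>(\<integral>x. f j x \<partial>\<nu>) - (\<integral>x. f j x \<partial>\<mu>)\<bar> < \<delta>) \<longrightarrow>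
      \<bar>(\<integral>x. norm x powr p \<partial>\<nu>) - (\<integral>x. norm x powr p \<partial>\<mu>)\<bar> < \<delta> \<longrightarrow> norm (y - (- m)) < \<delta> \<longrightarrow>
      wasserstein_dist p (translate_measure (- m) \<mu>) (translate_measure y \<nu>) < \<rho>"
    using wasserstein_test_functions[OF p mu \<rho>(1), of "- m"] by blast
  \<comment> \<open>Divided by the dimension because the norm is bounded by the sum of the
    coordinates.\<close>
  define \<eta> where "\<eta> = min \<delta> 1 / real DIM('a)"
  have \<eta>: "0 < \<eta>" "\<eta> \<le> \<delta>"
  proof -
    show "0 < \<eta>" using \<delta> by (simp add: \<eta>_def)
    have "1 \<le> real DIM('a)" using DIM_ge_Suc0[where 'a='a] by simp
    then have "min \<delta> 1 / real DIM('a) \<le> min \<delta> 1 / 1" using \<delta> by (intro divide_left_mono) auto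
    then have "\<eta> \<le> min \<delta> 1" unfolding \<eta>_def by simp
    then show "\<eta> \<le> \<delta>" by simp
  qed
  define G where "G = f ` {..<N} \<union> {\<lambda>x. norm x powr p} \<union> (\<lambda>b x. x \<bullet> b) ` Basis"
  have finG: "finite G" by (simp add: G_def)
  have gm: "g \<in> borel_measurable borel" if "g \<in> G" for g using that fm by (auto simp: G_def)
  have gi: "integrable \<mu> g" if "g \<in> G" for g
  proof -
    have "integrable \<mu> (f j)" for j
    proof -
      interpret mu: prob_space \<mu> by (rule M(2))
      show ?thesis using fb fm by (intro mu.integrable_const_bound[where B=1]) (auto simp: measurable_prob_measures[OF mp])
    qed
    moreover have "integrable \<mu> (\<lambda>x. norm x powr p)" by (rule moment_integrable[OF mu])
    moreover have "integrable \<mu> (\<lambda>x. x \<bullet> b)" for b using first_moment_integrable[OF mu p] by simp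
    ultimately show ?thesis using that by (auto simp: G_def)
  qed
  define Bad where "Bad n g = {\<omega>\<in>space (iid_measure \<mu>). \<eta> \<le> \<bar>(\<Sum>i=1..n. g (\<omega> i)) / real n - (\<integral>x. g x \<partial>\<mu>)\<bar>}" for n g
  have Bad_meas: "Bad n g \<in> events" if "g \<in> G" for n g
  proof -
    note gm[OF that, measurable]
    have [measurable]: "(\<lambda>\<omega>. g (\<omega> i)) \<in> borel_measurable (iid_measure \<mu>)" for i
      by (rule measurable_compose[OF iid_component_measurable[OF mp] gm[OF that]])
    show ?thesis unfolding Bad_def by measurable
  qed
  have Bad0: "(\<lambda>n. prob (Bad n g)) \<longlonglongrightarrow> 0" if "g \<in> G" for g
    unfolding Bad_def
    by (rule weak_law_of_large_numbers[OF indep_iid[OF mp] distr_iid_component[OF mp] gm[OF that] gi[OF that] \<eta>(1)])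
  have sub: "- good_event n m U \<subseteq> (\<Union>g\<in>G. Bad n g)" if n: "1 \<le> n" for n
  proof (rule subsetI, rule ccontr)
    fix \<omega> assume w: "\<omega> \<in> - good_event n m U" and nb: "\<omega> \<notin> (\<Union>g\<in>G. Bad n g)"
    have av: "(\<integral>x. g x \<partial>empirical_measure n \<omega>) = (\<Sum>i=1..n. g (\<omega> i)) / real n" if "g \<in> G" for g
      using integral_empirical_measure[OF gm[OF that], of n \<omega>] by (simp add: divide_inverse mult.commute)
    have close: "\<bar>(\<integral>x. g x \<partial>empirical_measure n \<omega>) - (\<integral>x. g x \<partial>\<mu>)\<bar> < \<eta>" if "g \<in> G" for g
      using nb that unfolding av[OF that] Bad_def by (auto simp: space_iid[OF mp] not_le)
    have "norm (sample_mean n \<omega> - m) < min \<delta> 1"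
    proof -
      have "norm (sample_mean n \<omega> - m) \<le> (\<Sum>b\<in>Basis. \<bar>(sample_mean n \<omega> - m) \<bullet> b\<bar>)" by (rule norm_le_l1)
      also have "\<dots> < (\<Sum>b\<in>(Basis::'a set). \<eta>)"
      proof (rule sum_strict_mono)
        fix b :: 'a assume b: "b \<in> Basis"
        then have bG: "(\<lambda>x. x \<bullet> b) \<in> G" by (auto simp: G_def)
        have "(\<integral>x. x \<bullet> b \<partial>\<mu>) = m \<bullet> b" unfolding m_def by (rule integral_inner_left[OF first_moment_integrable[OF mu p]])
        moreover have "(\<integral>x. x \<bullet> b \<partial>empirical_measure n \<omega>) = sample_mean n \<omega> \<bullet> b"
          unfolding av[OF bG] by (simp add: sample_mean_def inner_sum_left divide_inverse mult.commute)
        ultimately show "\<bar>(sample_mean n \<omega> - m) \<bullet> b\<bar> < \<eta>" using close[OF bG] by (simp add: inner_diff_left)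
      qed auto
      also have "\<dots> = min \<delta> 1" by (simp add: \<eta>_def)
      finally show ?thesis .
    qed
    then have sm: "norm (sample_mean n \<omega> - m) < \<delta>" "sample_mean n \<omega> \<in> cball m 1"
      by (auto simp: dist_norm norm_minus_commute)
    have "norm (- sample_mean n \<omega> - (- m)) < \<delta>" using sm(1) by (simp add: norm_minus_commute)
    moreover have "\<forall>j<N. \<bar>(\<integral>x. f j x \<partial>empirical_measure n \<omega>) - (\<integral>x. f j x \<partial>\<mu>)\<bar> < \<delta>"
    proof (intro allI impI)
      fix j assume "j < N"
      then have "f j \<in> G" by (auto simp: G_def)
      from close[OF this] show "\<bar>(\<integral>x. f j x \<partial>empirical_measure n \<omega>) - (\<integral>x. f j x \<partial>\<mu>)\<bar> < \<delta>" using \<eta>(2) by linarith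
    qed
    moreover have "\<bar>(\<integral>x. norm x powr p \<partial>empirical_measure n \<omega>) - (\<integral>x. norm x powr p \<partial>\<mu>)\<bar> < \<delta>"
      using close[of "\<lambda>x. norm x powr p"] \<eta>(2) by (simp add: G_def)
    ultimately have "wasserstein_dist p (translate_measure (- m) \<mu>) (translate_measure (- sample_mean n \<omega>) (empirical_measure n \<omega>)) < \<rho>"
      using test empirical_measure_moment[OF n, of \<omega> p] by blast
    then have "empirical_measure n (recenter n \<omega>) \<in> U"
      unfolding empirical_measure_recenter[symmetric]
      by (intro \<rho>(2) empirical_measure_centered[OF n sum_recenter[OF n]])
    then show False using w sm(2) by (simp add: good_event_def)
  qed
  have "(\<lambda>n. prob (- good_event n m U)) \<longlonglongrightarrow> 0"
  proof (rule tendsto_sandwich[of "\<lambda>_. 0" _ _ "\<lambda>n. \<Sum>g\<in>G. prob (Bad n g)"])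
    show "\<forall>\<^sub>F n in sequentially. prob (- good_event n m U) \<le> (\<Sum>g\<in>G. prob (Bad n g))"
      using eventually_ge_at_top[of 1]
    proof eventually_elim
      case (elim n)
      have "prob (- good_event n m U) \<le> prob (\<Union>g\<in>G. Bad n g)"
        using Bad_meas finG by (intro finite_measure_mono sub[OF elim]) auto
      also have "\<dots> \<le> (\<Sum>g\<in>G. prob (Bad n g))"
        using Bad_meas finG by (intro finite_measure_subadditive_finite) auto
      finally show ?case .
    qed
    show "(\<lambda>n. \<Sum>g\<in>G. prob (Bad n g)) \<longlonglongrightarrow> 0"
      using tendsto_sum[of G "\<lambda>g n. prob (Bad n g)" "\<lambda>_. 0", OF Bad0] by simp
  qed (auto intro!: always_eventually)
  then show ?thesis unfolding m_def .
qed

lemma finite_free_energyD: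
  assumes gc: "growth_control W l" and \<sigma>: "0 < \<sigma>\<^sup>2" and mu: "\<mu> \<in> prob_measures" and F: "free_energy W \<sigma> \<mu> < \<infinity>"
  shows "W \<mu> < \<infinity>" "entropy_functional \<mu> < \<infinity>" "\<mu> \<in> prob_measures_moment l"
proof -
  have b: "0 < 2 / \<sigma>\<^sup>2" using \<sigma> by simp
  show W: "W \<mu> < \<infinity>"
  proof (rule ccontr)
    assume "\<not> W \<mu> < \<infinity>"
    then have "W \<mu> = \<infinity>" by (simp add: not_less top_unique)
    then have "free_energy W \<sigma> \<mu> = \<infinity>"
      using b entropy_functional_not_MInf[of \<mu>] unfolding free_energy_def by (cases "entropy_functional \<mu>") auto
    then show False using F by simp
  qed
  show "entropy_functional \<mu> < \<infinity>"
  proof (rule ccontr)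
    assume "\<not> entropy_functional \<mu> < \<infinity>"
    then have "free_energy W \<sigma> \<mu> = \<infinity>" using b W unfolding free_energy_def by (cases "W \<mu>") (auto simp: enn2ereal_ennreal)
    then show False using F by simp
  qed
  obtain \<kappa> where "\<And>\<mu>. \<mu> \<in> prob_measures \<Longrightarrow> \<mu> \<notin> prob_measures_moment l \<Longrightarrow> W \<mu> = \<infinity>"
    using growth_controlE[OF gc] by metis
  then show "\<mu> \<in> prob_measures_moment l" using W mu by fastforce
qed

text \<open>Tilting Lebesgue measure to the law of the sample; the inequality is strict only where the
  density vanishes.\<close>

lemma lborel_ge_tilted_iid:
  fixes H :: "(nat \<Rightarrow> 'a::euclidean_space) \<Rightarrow> ennreal" and q :: "'a \<Rightarrow> real"
  assumes q[measurable]: "q \<in> borel_measurable borel" "\<And>x. 0 \<le> q x" and \<mu>: "\<mu> = density lborel (\<lambda>x. ennreal (q x))"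
    and mu: "\<mu> \<in> prob_measures" and H: "H \<in> borel_measurable (Pi\<^sub>M {1..n} (\<lambda>_. lborel))"
  shows "(\<integral>\<^sup>+ \<omega>. H (restrict \<omega> {1..n}) * ennreal (exp (- (\<Sum>i=1..n. ln (q (\<omega> i))))) \<partial>iid_measure \<mu>)
    \<le> (\<integral>\<^sup>+ y. H y \<partial>Pi\<^sub>M {1..n} (\<lambda>_. lborel))"
proof -
  define g where "g y = (\<Sum>i=1..n. ln (q (y i)))" for y :: "nat \<Rightarrow> 'a"
  have gr: "g (restrict \<omega> {1..n}) = g \<omega>" for \<omega> unfolding g_def by (intro sum.cong) auto
  have comp: "(\<lambda>y. y i) \<in> Pi\<^sub>M {1..n} (\<lambda>_. lborel) \<rightarrow>\<^sub>M (borel :: 'a measure)" if "i \<in> {1..n}" for i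
    using measurable_component_singleton[OF that, of "\<lambda>_. lborel :: 'a measure"] by simp
  have lq: "(\<lambda>x. ln (q x)) \<in> borel_measurable borel" by measurable
  have gm: "g \<in> borel_measurable (Pi\<^sub>M {1..n} (\<lambda>_. lborel))"
    unfolding g_def by (intro borel_measurable_sum measurable_compose[OF comp lq])
  have pm: "(\<lambda>x. \<Prod>i\<in>{1..n}. ennreal (q (x i))) \<in> borel_measurable (Pi\<^sub>M {1..n} (\<lambda>_. lborel))"
    by (intro borel_measurable_prod_ennreal measurable_compose[OF comp]) auto
  define F where "F y = H y * ennreal (exp (- g y))" for y
  have Fm: "F \<in> borel_measurable (Pi\<^sub>M {1..n} (\<lambda>_. lborel))"
    unfolding F_def using H gm by measurable
  have ss: "sets (Pi\<^sub>M {1..n} (\<lambda>_. \<mu>)) = sets (Pi\<^sub>M {1..n} (\<lambda>_. lborel))"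
    by (intro sets_PiM_cong refl) (simp add: prob_measuresD[OF mu])
  have rm: "(\<lambda>\<omega>. restrict \<omega> {1..n}) \<in> iid_measure \<mu> \<rightarrow>\<^sub>M Pi\<^sub>M {1..n} (\<lambda>_. \<mu>)"
    using restrict_iid_measurable[OF mu] measurable_cong_sets[OF refl ss] by blast
  have Fm': "F \<in> borel_measurable (Pi\<^sub>M {1..n} (\<lambda>_. \<mu>))" using Fm measurable_cong_sets[OF ss refl] by blast
  have "(\<integral>\<^sup>+ \<omega>. H (restrict \<omega> {1..n}) * ennreal (exp (- g \<omega>)) \<partial>iid_measure \<mu>)
      = (\<integral>\<^sup>+ \<omega>. F (restrict \<omega> {1..n}) \<partial>iid_measure \<mu>)"
    unfolding F_def gr ..
  also have "\<dots> = (\<integral>\<^sup>+ y. F y \<partial>distr (iid_measure \<mu>) (Pi\<^sub>M {1..n} (\<lambda>_. \<mu>)) (\<lambda>\<omega>. restrict \<omega> {1..n}))"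
    by (rule nn_integral_distr[symmetric, OF rm]) (subst measurable_distr_eq1, rule Fm')
  also have "\<dots> = (\<integral>\<^sup>+ y. F y \<partial>Pi\<^sub>M {1..n} (\<lambda>_. \<mu>))"
    unfolding distr_iid_restrict[OF mu] ..
  also have "\<dots> = (\<integral>\<^sup>+ y. F y \<partial>density (Pi\<^sub>M {1..n} (\<lambda>_. lborel)) (\<lambda>x. \<Prod>i\<in>{1..n}. ennreal (q (x i))))"
    using PiM_density_lborel[OF finite_atLeastAtMost[of 1 n] q(1)] mu unfolding \<mu> by simp
  also have "\<dots> = (\<integral>\<^sup>+ y. (\<Prod>i\<in>{1..n}. ennreal (q (y i))) * F y \<partial>Pi\<^sub>M {1..n} (\<lambda>_. lborel))"
    by (rule nn_integral_density[OF pm Fm])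
  also have "\<dots> \<le> (\<integral>\<^sup>+ y. H y \<partial>Pi\<^sub>M {1..n} (\<lambda>_. lborel))"
  proof (rule nn_integral_mono)
    fix y :: "nat \<Rightarrow> 'a"
    show "(\<Prod>i\<in>{1..n}. ennreal (q (y i))) * F y \<le> H y"
    \<comment> \<open>Where some factor of the density vanishes the left side is 0, whatever value
      \<open>ln 0\<close> contributes to \<open>g\<close>; elsewhere density and tilt cancel
      exactly.\<close>
    proof (cases "\<exists>i\<in>{1..n}. q (y i) = 0")
      case True
      then obtain i where "i \<in> {1..n}" "q (y i) = 0" by blast
      then have "(\<Prod>i\<in>{1..n}. ennreal (q (y i))) = 0" by (intro prod_zero bexI[of _ i]) auto
      then show ?thesis by (simp only: mult_zero_left zero_le)
    next
      case False
      then have pos: "0 < q (y i)" if "i \<in> {1..n}" for i using q(2)[of "y i"] that by (auto simp: less_le)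
      have "exp (g y) = (\<Prod>i\<in>{1..n}. q (y i))"
        unfolding g_def exp_sum[OF finite_atLeastAtMost] using pos by (intro prod.cong) auto
      then have "(\<Prod>i\<in>{1..n}. ennreal (q (y i))) = ennreal (exp (g y))"
        using q(2) by (simp add: prod_ennreal)
      then have "(\<Prod>i\<in>{1..n}. ennreal (q (y i))) * F y = H y * (ennreal (exp (g y)) * ennreal (exp (- g y)))"
        by (simp add: F_def mult_ac)
      also have "ennreal (exp (g y)) * ennreal (exp (- g y)) = 1" by (simp flip: ennreal_mult exp_add)
      finally show ?thesis by simp
    qed
  qed
  finally show ?thesis unfolding g_def .
qed

section \<open>The mass of an open set seen from independent samples\<close>

lemma ennreal_integral_le_nn_integral:
  fixes f :: "'a \<Rightarrow> real"
  assumes "integrable M f"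
  shows "ennreal (\<integral>x. f x \<partial>M) \<le> (\<integral>\<^sup>+ x. ennreal (f x) \<partial>M)"
proof -
  have i: "integrable M (\<lambda>x. max 0 (f x))" using assms by (intro integrable_max) auto
  have "(\<integral>x. f x \<partial>M) \<le> (\<integral>x. max 0 (f x) \<partial>M)" using assms i by (intro integral_mono) auto
  then have "ennreal (\<integral>x. f x \<partial>M) \<le> ennreal (\<integral>x. max 0 (f x) \<partial>M)" by (rule ennreal_leI)
  also have "\<dots> = (\<integral>\<^sup>+ x. ennreal (max 0 (f x)) \<partial>M)" by (intro nn_integral_eq_integral[symmetric] i) auto
  also have "\<dots> = (\<integral>\<^sup>+ x. ennreal (f x) \<partial>M)" by (intro nn_integral_cong) (auto simp: max_def ennreal_neg)
  finally show ?thesis .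
qed

lemma gibbs_weight_recenter:
  assumes ti: "translation_invariant W" and sf: "sigma_finite_energy W" and n: "1 \<le> n"
  shows "gibbs_weight W \<sigma> n (recenter n y) = ennreal (exp (- (real n * (2 / \<sigma>\<^sup>2) * enn2real (energy_n W n y))))"
proof -
  have "energy_n W n (recenter n y) = energy_n W n y"
    using ti empirical_measure_prob[OF n, of y] unfolding energy_n_def empirical_measure_recenter translation_invariant_def by blast
  then show ?thesis
    unfolding gibbs_weight_def using energy_empirical_finite[OF sf n, of y] by (simp add: mult.commute)
qed

text \<open>Joins the tilting of Lebesgue measure with recentering: translation invariance lets the
  weight be evaluated at the sample itself, and integrating out the mean costs a power of
  \<open>n\<close> times the volume of the unit ball.\<close>

lemma gibbs_mass_ge_iid:
  fixes W :: "'a::euclidean_space measure \<Rightarrow> ennreal" and q :: "'a \<Rightarrow> real"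
  assumes ti: "translation_invariant W" and sf: "sigma_finite_energy W" and lsc: "lower_semicontinuous_energy W"
    and p: "1 \<le> p" and n: "1 \<le> n" and U: "openin (centered_wasserstein_topology p) U"
    and q: "q \<in> borel_measurable borel" "\<And>x. 0 \<le> q x" and \<mu>: "\<mu> = density lborel (\<lambda>x. ennreal (q x))"
    and mu: "\<mu> \<in> prob_measures"
  shows "(\<integral>\<^sup>+ \<omega>. indicator (good_event n m U) \<omega> * ennreal (exp (- (real n * (2 / \<sigma>\<^sup>2) * enn2real (energy_n W n \<omega>) + (\<Sum>i=1..n. ln (q (\<omega> i)))))) \<partial>iid_measure \<mu>)
    \<le> ennreal (real n ^ DIM('a) * unit_ball_vol (real DIM('a))) * gibbs_mass W \<sigma> n U"
proof -
  define G where "G x = gibbs_weight W \<sigma> n x * indicator U (empirical_measure n x)" for x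
  have Gm: "G \<in> borel_measurable (lebesgue_centered n)"
  proof -
    have [measurable]: "U \<in> sets (borel_of (centered_wasserstein_topology p))" by (rule openin_borel_of[OF U])
    note [measurable] = empirical_measure_measurable[OF p n, where 'a='a] measurable_lebesgue_centered[OF gibbs_weight_measurable[OF lsc n, of \<sigma>]]
    show ?thesis unfolding G_def by measurable
  qed
  define K where "K = (indicator (cball m 1) :: 'a \<Rightarrow> ennreal)"
  have Km: "K \<in> borel_measurable borel" unfolding K_def by (intro borel_measurable_indicator) simp
  define I where "I = (\<integral>\<^sup>+ z. G (center_extend n z) \<partial>Pi\<^sub>M {1..<n} (\<lambda>_. lborel))"
  define H where "H y = G (recenter n y) * K (sample_mean n y)" for y
  have Hm: "H \<in> borel_measurable (Pi\<^sub>M {1..n} (\<lambda>_. lborel))"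
    unfolding H_def using measurable_compose[OF measurable_recenter[OF n] Gm] measurable_compose[OF measurable_sample_mean Km]
    by (rule borel_measurable_times_ennreal)
  have V: "(\<integral>\<^sup>+ m. K m \<partial>lborel) = ennreal (unit_ball_vol (real DIM('a)))"
    unfolding K_def by (simp add: emeasure_cball)
  have HI: "(\<integral>\<^sup>+ y. H y \<partial>Pi\<^sub>M {1..n} (\<lambda>_. lborel)) = ennreal (real n ^ DIM('a)) * (ennreal (unit_ball_vol (real DIM('a))) * I)"
    unfolding H_def nn_integral_recenter[OF n Gm Km] V I_def ..
  have gI: "gibbs_mass W \<sigma> n U = ennreal (sqrt (real n) ^ DIM('a)) * I"
    unfolding gibbs_mass_def I_def G_def[symmetric] by (rule nn_integral_lebesgue_centered[OF n Gm])
  have "1 \<le> sqrt (real n) ^ DIM('a)" using n by (intro one_le_power) simp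
  then have "I \<le> gibbs_mass W \<sigma> n U"
    unfolding gI using mult_right_mono[of 1 "ennreal (sqrt (real n) ^ DIM('a))" I] by simp
  have Hr: "H (restrict \<omega> {1..n}) = indicator (good_event n m U) \<omega> * ennreal (exp (- (real n * (2 / \<sigma>\<^sup>2) * enn2real (energy_n W n \<omega>))))" for \<omega>
    unfolding H_def G_def K_def recenter_restrict sample_mean_restrict gibbs_weight_recenter[OF ti sf n]
    by (auto simp: good_event_def indicator_def)
  have "(\<integral>\<^sup>+ \<omega>. indicator (good_event n m U) \<omega> * ennreal (exp (- (real n * (2 / \<sigma>\<^sup>2) * enn2real (energy_n W n \<omega>) + (\<Sum>i=1..n. ln (q (\<omega> i)))))) \<partial>iid_measure \<mu>)
      = (\<integral>\<^sup>+ \<omega>. H (restrict \<omega> {1..n}) * ennreal (exp (- (\<Sum>i=1..n. ln (q (\<omega> i))))) \<partial>iid_measure \<mu>)"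
    unfolding Hr by (intro nn_integral_cong) (simp add: indicator_def exp_diff exp_minus divide_inverse flip: ennreal_mult)
  also have "\<dots> \<le> (\<integral>\<^sup>+ y. H y \<partial>Pi\<^sub>M {1..n} (\<lambda>_. lborel))"
    by (rule lborel_ge_tilted_iid[OF q \<mu> mu Hm])
  also have "\<dots> = ennreal (real n ^ DIM('a) * unit_ball_vol (real DIM('a))) * I"
    unfolding HI by (simp add: ennreal_mult mult.assoc)
  also have "\<dots> \<le> ennreal (real n ^ DIM('a) * unit_ball_vol (real DIM('a))) * gibbs_mass W \<sigma> n U"
    by (intro mult_left_mono \<open>I \<le> gibbs_mass W \<sigma> n U\<close>) simp
  finally show ?thesis .
qed

text \<open>Only the translate of \<open>\<mu>\<close> has to be centered, so near-minimizers of the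
  free energy over all probability measures are admissible. This is needed to bound the
  normalization from below by \<open>min_free_energy\<close>.\<close>

lemma gibbs_lower_bound:
  fixes W :: "'a::euclidean_space measure \<Rightarrow> ennreal"
  assumes \<sigma>: "0 < \<sigma>\<^sup>2" and ti: "translation_invariant W" and sf: "sigma_finite_energy W"
    and lsc: "lower_semicontinuous_energy W" and gc: "growth_control W l" and ch: "chaos_compatible W"
    and p: "1 \<le> p" "p < l" and mu: "\<mu> \<in> prob_measures" and Fa: "free_energy W \<sigma> \<mu> < ereal a"
    and U: "openin (centered_wasserstein_topology p) U" and in_U: "translate_measure (- (\<integral>x. x \<partial>\<mu>)) \<mu> \<in> U"
  shows "\<forall>\<^sub>F n in sequentially. ennreal (exp (- (real n * a))) \<le> gibbs_mass W \<sigma> n U"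
proof -
  interpret prob_space "iid_measure \<mu>" by (rule prob_space_iid[OF mu])
  have "free_energy W \<sigma> \<mu> < \<infinity>" using Fa by (rule less_trans) simp
  note fin = finite_free_energyD[OF gc \<sigma> mu this]
  have mup: "\<mu> \<in> prob_measures_moment p" by (rule prob_measures_moment_mono[OF fin(3)]) (use p in auto)
  define b where "b = 2 / \<sigma>\<^sup>2"
  have b: "0 < b" using \<sigma> by (simp add: b_def)
  obtain q where q: "q \<in> borel_measurable borel" "\<And>x. 0 \<le> q x" and \<mu>: "\<mu> = density lborel (\<lambda>x. ennreal (q x))"
    and Li: "integrable \<mu> (\<lambda>x. ln (q x))" and S: "entropy_functional \<mu> = ereal (\<integral>x. ln (q x) \<partial>\<mu>)"
    using finite_entropy_log_density[OF fin(2)] by blast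
  define L where "L x = ln (q x)" for x
  have Lm[measurable]: "L \<in> borel_measurable borel" unfolding L_def using q(1) by measurable
  have Li: "integrable \<mu> L" using Li unfolding L_def .
  define S' where "S' = (\<integral>x. L x \<partial>\<mu>)"
  define W' where "W' = enn2real (W \<mu>)"
  have W': "W \<mu> = ennreal W'" "0 \<le> W'" unfolding W'_def using fin(1) by (auto simp: less_top)
  define J where "J = S' + b * W'"
  have "free_energy W \<sigma> \<mu> = ereal J"
    using S unfolding free_energy_def W'(1) J_def S'_def L_def b_def by (simp add: enn2ereal_ennreal W'(2))
  then have Ja: "J < a" using Fa by simp
  \<comment> \<open>The gap from \<open>J\<close> to \<open>a\<close> is four units: three are spent
    by the choice of \<open>c\<close> below, the fourth absorbs the polynomial factor.\<close>
  define \<delta> where "\<delta> = (a - J) / 4"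
  have \<delta>: "0 < \<delta>" using Ja by (simp add: \<delta>_def)
  define m where "m = (\<integral>x. x \<partial>\<mu>)"
  define A where "A n = good_event n m U" for n
  have Am: "A n \<in> events" if "1 \<le> n" for n unfolding A_def by (rule good_event_measurable[OF mu that p(1) U])
  have A0: "(\<lambda>n. prob (- A n)) \<longlonglongrightarrow> 0"
    unfolding A_def m_def by (rule good_event_prob[OF p(1) mup U in_U])
  \<comment> \<open>The tail of the log-density beyond \<open>k\<close> is small in mean; it
    controls what is lost when the expectation is restricted to the likely event.\<close>
  have "(\<lambda>k. \<integral>x. max 0 (\<bar>L x\<bar> - real k) \<partial>\<mu>) \<longlonglongrightarrow> (\<integral>x. 0 \<partial>\<mu>)"
  proof (rule integral_dominated_convergence[where w="\<lambda>x. \<bar>L x\<bar>"])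
    show "AE x in \<mu>. (\<lambda>k. max 0 (\<bar>L x\<bar> - real k)) \<longlonglongrightarrow> 0"
    proof (rule AE_I2)
      fix x
      have "max 0 (\<bar>L x\<bar> - real k) = 0" if "nat \<lceil>\<bar>L x\<bar>\<rceil> \<le> k" for k
      proof -
        have "\<bar>L x\<bar> \<le> real k" using that by linarith
        then show ?thesis by simp
      qed
      then show "(\<lambda>k. max 0 (\<bar>L x\<bar> - real k)) \<longlonglongrightarrow> 0"
        by (intro tendsto_eventually eventually_sequentiallyI)
    qed
  qed (use Li Lm in \<open>auto simp: measurable_prob_measures[OF mu]\<close>)
  then have "\<forall>\<^sub>F k in sequentially. (\<integral>x. max 0 (\<bar>L x\<bar> - real k) \<partial>\<mu>) < \<delta> / 4"
    using \<delta> by (intro order_tendstoD) auto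
  then obtain k where k: "(\<integral>x. max 0 (\<bar>L x\<bar> - real k) \<partial>\<mu>) < \<delta> / 4" by (auto simp: eventually_sequentially)
  have comp: "(\<lambda>\<omega>. h (\<omega> i)) \<in> borel_measurable (iid_measure \<mu>)" if "h \<in> borel_measurable borel" for h :: "'a \<Rightarrow> real" and i
    by (rule measurable_compose[OF iid_component_measurable[OF mu] that])
  have ci: "integrable (iid_measure \<mu>) (\<lambda>\<omega>. h (\<omega> i)) \<longleftrightarrow> integrable \<mu> h"
    and ce: "(\<integral>\<omega>. h (\<omega> i) \<partial>iid_measure \<mu>) = (\<integral>x. h x \<partial>\<mu>)" if "h \<in> borel_measurable borel" for h :: "'a \<Rightarrow> real" and i
    using integrable_distr_eq[OF iid_component_measurable[OF mu] that, of i]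
      integral_distr[OF iid_component_measurable[OF mu] that, of i]
    unfolding distr_iid_component[OF mu] by auto
  have chl: "(\<lambda>n. \<integral>\<^sup>+ \<omega>. energy_n W n \<omega> \<partial>iid_measure \<mu>) \<longlonglongrightarrow> W \<mu>"
  proof -
    have "(\<lambda>n. \<integral>\<^sup>+ \<omega>. energy_n W n (\<lambda>i. (\<lambda>i \<omega>. \<omega> i) i \<omega>) \<partial>iid_measure \<mu>) \<longlonglongrightarrow> W \<mu>"
      using ch[unfolded chaos_compatible_def, rule_format, OF mu, of "iid_measure \<mu>" "\<lambda>i \<omega>. \<omega> i"]
        prob_space_iid[OF mu] indep_iid[OF mu] distr_iid_component[OF mu] by blast
    then show ?thesis by simp
  qed
  have "W \<mu> < ennreal (W' + \<delta> / (4 * b))" unfolding W'(1) using \<delta> b W'(2) by (intro ennreal_lessI) (auto intro!: add_nonneg_pos)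
  then have ev1: "\<forall>\<^sub>F n in sequentially. (\<integral>\<^sup>+ \<omega>. energy_n W n \<omega> \<partial>iid_measure \<mu>) < ennreal (W' + \<delta> / (4 * b))"
    by (rule order_tendstoD(2)[OF chl])
  have ev2: "\<forall>\<^sub>F n in sequentially. prob (- A n) < \<delta> / (4 * (real k + 1))"
    using \<delta> by (intro order_tendstoD(2)[OF A0]) auto
  have ev3: "\<forall>\<^sub>F n in sequentially. prob (- A n) < \<delta> / (4 * (\<bar>J\<bar> + 3 * \<delta> + 1))"
    using \<delta> by (intro order_tendstoD(2)[OF A0]) (auto intro!: divide_pos_pos add_nonneg_pos)
  \<comment> \<open>The exponent is twice the dimension because the cost is a power of
    \<open>n\<close> and the estimate is phrased with its square root.\<close>
  have ev4: "\<forall>\<^sub>F n in sequentially. sqrt (real n) ^ (2 * DIM('a)) * (unit_ball_vol (real DIM('a)) * exp (- (real n * a))) \<le> exp (- (real n * (J + 3 * \<delta>)))"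
    using \<delta> Ja by (intro eventually_poly_exp_le) (simp add: \<delta>_def field_simps)
  \<comment> \<open>Ensures that the slack of \<open>2 * \<delta>\<close> per particle amounts to at
    least 1 in total.\<close>
  have ev5: "\<forall>\<^sub>F n in sequentially. 1 / (2 * \<delta>) \<le> real n"
    using filterlim_real_sequentially by (simp add: filterlim_at_top)
  show ?thesis
    using ev1 ev2 ev3 ev4 ev5 eventually_ge_at_top[of 1]
  proof eventually_elim
    case (elim n)
    note n = elim(6)
    define E where "E \<omega> = enn2real (energy_n W n \<omega>)" for \<omega>
    have Em[measurable]: "E \<in> borel_measurable (iid_measure \<mu>)"
      unfolding E_def using energy_n_borel[OF lsc n] measurable_cong_sets[OF sets_iid[OF mu] refl]
      by (intro borel_measurable_enn2real) blast
    have Ee: "ennreal (E \<omega>) = energy_n W n \<omega>" for \<omega>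
      unfolding E_def using energy_empirical_finite[OF sf n, of \<omega>] by (simp add: less_top)
    have E0: "0 \<le> E \<omega>" for \<omega> by (simp add: E_def)
    have El: "(\<integral>\<^sup>+ \<omega>. ennreal (E \<omega>) \<partial>iid_measure \<mu>) < ennreal (W' + \<delta> / (4 * b))" unfolding Ee by (rule elim(1))
    have Ei: "integrable (iid_measure \<mu>) E"
      using less_trans[OF El ennreal_less_top] E0 by (intro integrableI_bounded) auto
    define w1 where "w1 = W' + \<delta> / (4 * b)"
    have w1: "0 \<le> w1" unfolding w1_def using W'(2) \<delta> b by simp
    have "ennreal (expectation E) \<le> ennreal w1"
      using El E0 nn_integral_eq_integral[OF Ei] unfolding w1_def[symmetric] by simp
    then have EE: "expectation E \<le> W' + \<delta> / (4 * b)"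
      using w1 unfolding w1_def[symmetric] by simp
    define T where "T \<omega> = (\<Sum>i=1..n. L (\<omega> i))" for \<omega>
    define Z where "Z \<omega> = real n * b * E \<omega> + T \<omega>" for \<omega>
    have LiM: "integrable (iid_measure \<mu>) (\<lambda>\<omega>. L (\<omega> i))" for i using ci[OF Lm] Li by blast
    have Ti: "integrable (iid_measure \<mu>) T" unfolding T_def by (intro Bochner_Integration.integrable_sum LiM)
    have Zi: "integrable (iid_measure \<mu>) Z" unfolding Z_def using Ei Ti by auto
    note AM = Am[OF n]
    have compl: "- A n \<in> events" using sets.compl_sets[OF AM] space_iid[OF mu] by (simp add: Compl_eq_Diff_UNIV)
    have pA: "prob (A n) = 1 - prob (- A n)"
      using prob_compl[OF AM] space_iid[OF mu] by (simp add: Compl_eq_Diff_UNIV)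
    have iL: "integrable (iid_measure \<mu>) (\<lambda>\<omega>. indicator (A n) \<omega> * L (\<omega> i))" for i
      using integrable_real_mult_indicator[OF AM LiM] by (simp add: mult.commute)
    have LA: "expectation (\<lambda>\<omega>. indicator (A n) \<omega> * L (\<omega> i)) \<le> S' + \<delta> / 2" for i
    proof -
      have mx: "(\<lambda>x. max 0 (\<bar>L x\<bar> - real k)) \<in> borel_measurable borel" by measurable
      have mi: "integrable \<mu> (\<lambda>x. max 0 (\<bar>L x\<bar> - real k))"
      proof (rule Bochner_Integration.integrable_bound[OF Li])
        show "(\<lambda>x. max 0 (\<bar>L x\<bar> - real k)) \<in> borel_measurable \<mu>"
          using mx by (simp add: measurable_prob_measures[OF mu])
      qed auto
      have iR: "integrable (iid_measure \<mu>) (\<lambda>\<omega>. L (\<omega> i) + max 0 (\<bar>L (\<omega> i)\<bar> - real k) + real k * indicator (- A n) \<omega>)"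
      proof (intro Bochner_Integration.integrable_add)
        show "integrable (iid_measure \<mu>) (\<lambda>\<omega>. max 0 (\<bar>L (\<omega> i)\<bar> - real k))"
          using ci[OF mx] mi by simp
        show "integrable (iid_measure \<mu>) (\<lambda>\<omega>. real k * indicator (- A n) \<omega>)"
          using compl by (simp add: emeasure_eq_measure)
      qed (rule LiM)
      have "expectation (\<lambda>\<omega>. indicator (A n) \<omega> * L (\<omega> i))
          \<le> expectation (\<lambda>\<omega>. L (\<omega> i) + max 0 (\<bar>L (\<omega> i)\<bar> - real k) + real k * indicator (- A n) \<omega>)"
      proof (rule integral_mono[OF iL iR])
        fix \<omega>
        \<comment> \<open>On the event the added terms are nonnegative; off it a negative
          \<open>L\<close> is outweighed, since its absolute value is at most \<open>k\<close> plus
          the excess over \<open>k\<close>.\<close>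
        show "indicator (A n) \<omega> * L (\<omega> i) \<le> L (\<omega> i) + max 0 (\<bar>L (\<omega> i)\<bar> - real k) + real k * indicator (- A n) \<omega>"
          by (auto simp: indicator_def)
      qed
      also have "\<dots> = S' + (\<integral>x. max 0 (\<bar>L x\<bar> - real k) \<partial>\<mu>) + real k * prob (- A n)"
      proof -
        have i1: "integrable (iid_measure \<mu>) (\<lambda>\<omega>. max 0 (\<bar>L (\<omega> i)\<bar> - real k))"
          using ci[OF mx] mi by simp
        have i2: "integrable (iid_measure \<mu>) (\<lambda>\<omega>. real k * indicator (- A n) \<omega>)"
          using compl by (simp add: emeasure_eq_measure)
        have i3: "expectation (\<lambda>\<omega>. real k * indicator (- A n) \<omega>) = real k * prob (- A n)"
          using compl by simp
        show ?thesis
          unfolding Bochner_Integration.integral_add[OF Bochner_Integration.integrable_add[OF LiM i1] i2]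
            Bochner_Integration.integral_add[OF LiM i1] i3 ce[OF Lm] ce[OF mx] S'_def ..
      qed
      also have "\<dots> \<le> S' + \<delta> / 4 + \<delta> / 4"
      proof -
        have "real k * prob (- A n) \<le> (real k + 1) * (\<delta> / (4 * (real k + 1)))"
          using elim(2) by (intro mult_mono) auto
        also have "\<dots> = \<delta> / 4" by (simp add: field_simps)
        finally show ?thesis using k by linarith
      qed
      finally show ?thesis by simp
    qed
    have iE: "integrable (iid_measure \<mu>) (\<lambda>\<omega>. indicator (A n) \<omega> * E \<omega>)"
      using integrable_real_mult_indicator[OF AM Ei] by (simp add: mult.commute)
    have EA: "expectation (\<lambda>\<omega>. indicator (A n) \<omega> * E \<omega>) \<le> W' + \<delta> / (4 * b)"
    proof -
      have "expectation (\<lambda>\<omega>. indicator (A n) \<omega> * E \<omega>) \<le> expectation E"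
        using E0 by (intro integral_mono iE Ei) (auto simp: indicator_def)
      then show ?thesis using EE by linarith
    qed
    have iZ: "integrable (iid_measure \<mu>) (\<lambda>\<omega>. indicator (A n) \<omega> * Z \<omega>)"
      using integrable_real_mult_indicator[OF AM Zi] by (simp add: mult.commute)
    have ZA: "expectation (\<lambda>\<omega>. indicator (A n) \<omega> * Z \<omega>) \<le> real n * (J + 3 * \<delta> / 4)"
    proof -
      have "(\<lambda>\<omega>. indicator (A n) \<omega> * Z \<omega>) = (\<lambda>\<omega>. real n * b * (indicator (A n) \<omega> * E \<omega>) + (\<Sum>i=1..n. indicator (A n) \<omega> * L (\<omega> i)))"
        by (rule ext) (simp add: Z_def T_def distrib_left sum_distrib_left mult_ac)
      then have "expectation (\<lambda>\<omega>. indicator (A n) \<omega> * Z \<omega>)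
          = real n * b * expectation (\<lambda>\<omega>. indicator (A n) \<omega> * E \<omega>) + (\<Sum>i=1..n. expectation (\<lambda>\<omega>. indicator (A n) \<omega> * L (\<omega> i)))"
      proof -
        have iE': "integrable (iid_measure \<mu>) (\<lambda>\<omega>. real n * b * (indicator (A n) \<omega> * E \<omega>))"
          by (rule integrable_mult_right) (rule iE)
        have iL': "integrable (iid_measure \<mu>) (\<lambda>\<omega>. \<Sum>i=1..n. indicator (A n) \<omega> * L (\<omega> i))"
          by (intro Bochner_Integration.integrable_sum iL)
        have sL: "expectation (\<lambda>\<omega>. \<Sum>i=1..n. indicator (A n) \<omega> * L (\<omega> i)) = (\<Sum>i=1..n. expectation (\<lambda>\<omega>. indicator (A n) \<omega> * L (\<omega> i)))"
          by (rule Bochner_Integration.integral_sum) (rule iL)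
        show ?thesis if "(\<lambda>\<omega>. indicator (A n) \<omega> * Z \<omega>) = (\<lambda>\<omega>. real n * b * (indicator (A n) \<omega> * E \<omega>) + (\<Sum>i=1..n. indicator (A n) \<omega> * L (\<omega> i)))"
          unfolding that Bochner_Integration.integral_add[OF iE' iL'] sL by simp
      qed
      also have "\<dots> \<le> real n * b * (W' + \<delta> / (4 * b)) + (\<Sum>i=1..n. S' + \<delta> / 2)"
        using b by (intro add_mono mult_left_mono EA sum_mono LA) auto
      also have "\<dots> = real n * (J + 3 * \<delta> / 4)"
      proof -
        have "b * (\<delta> / (4 * b)) = \<delta> / 4" using b by simp
        then have "real n * b * (\<delta> / (4 * b)) = real n * (\<delta> / 4)" by (simp only: mult.assoc)
        then show ?thesis by (simp add: J_def algebra_simps)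
      qed
      finally show ?thesis .
    qed
    define c where "c = real n * (J + 3 * \<delta>)"
    have iA: "integrable (iid_measure \<mu>) (\<lambda>\<omega>. (1 + c) * indicator (A n) \<omega>)"
      by (intro integrable_mult_right) (simp add: AM emeasure_eq_measure)
    \<comment> \<open>The tangent line of the exponential at \<open>- c\<close>, evaluated at
      \<open>- Z\<close> and restricted to the event.\<close>
    define f where "f \<omega> = exp (- c) * ((1 + c) * indicator (A n) \<omega> - indicator (A n) \<omega> * Z \<omega>)" for \<omega>
    have fi: "integrable (iid_measure \<mu>) f"
      unfolding f_def by (intro integrable_mult_right Bochner_Integration.integrable_diff iZ iA)
    have "expectation (\<lambda>\<omega>. (1 + c) * indicator (A n) \<omega>) = (1 + c) * prob (A n)"
      using AM by simp
    then have "expectation f = exp (- c) * ((1 + c) * prob (A n) - expectation (\<lambda>\<omega>. indicator (A n) \<omega> * Z \<omega>))"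
      unfolding f_def by (simp add: Bochner_Integration.integral_diff[OF iA iZ])
    \<comment> \<open>Per particle, \<open>c\<close> provides \<open>J + 3 * \<delta>\<close>; the
      complement of the event takes at most \<open>\<delta> / 4\<close> and the expectation of
      \<open>Z\<close> at most \<open>J + 3 * \<delta> / 4\<close>. What remains is
      \<open>2 * \<delta>\<close>.\<close>
    moreover have "1 \<le> (1 + c) * prob (A n) - expectation (\<lambda>\<omega>. indicator (A n) \<omega> * Z \<omega>)"
    proof -
      define B where "B = \<bar>J\<bar> + 3 * \<delta>"
      have B: "0 \<le> B" using \<delta> by (simp add: B_def)
      have "B * prob (- A n) \<le> (B + 1) * (\<delta> / (4 * (B + 1)))"
        using elim(3) B unfolding B_def[symmetric] by (intro mult_mono) auto
      also have "\<dots> = \<delta> / 4" using B by (simp add: field_simps)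
      finally have Bp: "B * prob (- A n) \<le> \<delta> / 4" .
      have "c * prob (- A n) \<le> real n * B * prob (- A n)"
        unfolding c_def B_def using \<delta> by (intro mult_right_mono mult_left_mono) auto
      also have "\<dots> \<le> real n * (\<delta> / 4)" using mult_left_mono[OF Bp, of "real n"] by (simp add: mult.assoc)
      finally have "c * prob (- A n) \<le> real n * (\<delta> / 4)" .
      then have "c - real n * (\<delta> / 4) \<le> c * prob (A n)" unfolding pA by (simp add: algebra_simps)
      also have "\<dots> \<le> (1 + c) * prob (A n)" by (simp add: distrib_right)
      finally have "c - real n * (\<delta> / 4) - real n * (J + 3 * \<delta> / 4) \<le> (1 + c) * prob (A n) - expectation (\<lambda>\<omega>. indicator (A n) \<omega> * Z \<omega>)"
        using ZA by linarith
      moreover have "c - real n * (\<delta> / 4) - real n * (J + 3 * \<delta> / 4) = real n * (2 * \<delta>)"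
        unfolding c_def by (simp add: algebra_simps)
      moreover have "1 \<le> real n * (2 * \<delta>)" using elim(5) \<delta> by (simp add: field_simps)
      ultimately show ?thesis by linarith
    qed
    ultimately have "exp (- c) \<le> expectation f"
      using mult_left_mono[of 1 _ "exp (- c)"] by simp
    then have "ennreal (exp (- c)) \<le> ennreal (expectation f)" by (rule ennreal_leI)
    also have "\<dots> \<le> (\<integral>\<^sup>+ \<omega>. ennreal (f \<omega>) \<partial>iid_measure \<mu>)" by (rule ennreal_integral_le_nn_integral[OF fi])
    also have "\<dots> \<le> (\<integral>\<^sup>+ \<omega>. indicator (A n) \<omega> * ennreal (exp (- Z \<omega>)) \<partial>iid_measure \<mu>)"
    proof (rule nn_integral_mono)
      fix \<omega>
      have "exp (- c) * (1 + (c - Z \<omega>)) \<le> exp (- c) * exp (c - Z \<omega>)"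
        by (intro mult_left_mono exp_ge_add_one_self) auto
      also have "\<dots> = exp (- Z \<omega>)" by (simp add: mult_exp_exp)
      finally have "exp (- c) * (1 + c - Z \<omega>) \<le> exp (- Z \<omega>)" by (simp add: add_diff_eq)
      then show "ennreal (f \<omega>) \<le> indicator (A n) \<omega> * ennreal (exp (- Z \<omega>))"
        by (cases "\<omega> \<in> A n") (auto simp: f_def intro: ennreal_leI)
    qed
    also have "\<dots> \<le> ennreal (real n ^ DIM('a) * unit_ball_vol (real DIM('a))) * gibbs_mass W \<sigma> n U"
      using gibbs_mass_ge_iid[OF ti sf lsc p(1) n U q \<mu> mu, of m \<sigma>]
      unfolding A_def Z_def T_def E_def L_def b_def .
    finally have main: "ennreal (exp (- c)) \<le> ennreal (real n ^ DIM('a) * unit_ball_vol (real DIM('a))) * gibbs_mass W \<sigma> n U" .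
    define D where "D = real n ^ DIM('a) * unit_ball_vol (real DIM('a))"
    have D: "0 < D" unfolding D_def using n by (intro mult_pos_pos) auto
    have "sqrt (real n) ^ (2 * DIM('a)) = real n ^ DIM('a)" by (simp add: power_mult)
    then have De: "D * exp (- (real n * a)) \<le> exp (- c)" using elim(4) by (simp add: D_def c_def mult.assoc)
    show ?case
    proof (cases "gibbs_mass W \<sigma> n U" rule: ennreal_cases)
      case (real g)
      have "ennreal (exp (- c)) \<le> ennreal (D * g)" using main real D unfolding D_def[symmetric] by (simp add: ennreal_mult)
      then have "exp (- c) \<le> D * g" using real D by simp
      then have "D * exp (- (real n * a)) \<le> D * g" using De by linarith
      then have "exp (- (real n * a)) \<le> g" using D by simp
      then show ?thesis using real by (simp add: ennreal_leI)
    qed simp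
  qed
qed

section \<open>From local bounds to the large deviation principle\<close>

text \<open>The hypotheses bound the unnormalized masses \<open>c\<^sub>n P\<^sub>n\<close> below and above near each point, with
  exponential tightness; the value \<open>m\<close> is then forced to be the infimum of \<open>J\<close> and to give the growth
  rate of the normalization.\<close>

locale local_ldp_bounds =
  fixes X :: "'b topology" and P :: "nat \<Rightarrow> 'b measure" and c :: "nat \<Rightarrow> real" and J :: "'b \<Rightarrow> ereal"
    and m :: ereal and n0 :: nat
  assumes prob: "\<And>n. n0 \<le> n \<Longrightarrow> prob_space (P n)" and sets_P: "\<And>n. n0 \<le> n \<Longrightarrow> sets (P n) = sets (borel_of X)"
    and c_pos: "\<And>n. n0 \<le> n \<Longrightarrow> 0 < c n"
    and lower: "\<And>U x a. openin X U \<Longrightarrow> x \<in> U \<Longrightarrow> J x < ereal a \<Longrightarrow>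
      \<forall>\<^sub>F n in sequentially. exp (- (real n * a)) \<le> c n * measure (P n) U"
    and upper: "\<And>x a. x \<in> topspace X \<Longrightarrow> ereal a < J x \<Longrightarrow>
      \<exists>U. openin X U \<and> x \<in> U \<and> (\<forall>\<^sub>F n in sequentially. c n * measure (P n) U \<le> exp (- (real n * a)))"
    and tight: "\<And>a. \<exists>K. compactin X K \<and> closedin X K \<and>
      (\<forall>\<^sub>F n in sequentially. c n * measure (P n) (topspace X - K) \<le> exp (- (real n * a)))"
    and m_le: "\<And>x. x \<in> topspace X \<Longrightarrow> m \<le> J x"
    and c_lower: "\<And>a. m < ereal a \<Longrightarrow> \<forall>\<^sub>F n in sequentially. exp (- (real n * a)) \<le> c n"
    and c_crude: "\<exists>C. \<forall>\<^sub>F n in sequentially. c n \<le> exp (real n * C)"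
    and m_less_top: "m < \<infinity>"
begin

lemma exp_rate_compare:
  assumes "\<forall>\<^sub>F n in sequentially. exp (- (real n * a)) \<le> exp (- (real n * b))"
  shows "b \<le> a"
proof -
  have "\<forall>\<^sub>F n in sequentially. exp (- (real n * a)) \<le> exp (- (real n * b)) \<and> 1 \<le> n"
    using assms eventually_ge_at_top[of "1::nat"] by eventually_elim auto
  then obtain n where "exp (- (real n * a)) \<le> exp (- (real n * b))" "1 \<le> n"
    by (auto simp: eventually_sequentially)
  then show ?thesis by simp
qed

text \<open>A value of minus infinity would force \<open>c n\<close> above every exponential,
  against the crude bound.\<close>

lemma m_finite: "\<bar>m\<bar> \<noteq> \<infinity>"
proof -
  have "m \<noteq> \<infinity>" using m_less_top by simp
  moreover have "m \<noteq> - \<infinity>"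
  proof
    assume "m = - \<infinity>"
    obtain C where C: "\<forall>\<^sub>F n in sequentially. c n \<le> exp (real n * C)" using c_crude by blast
    have "m < ereal (- C - 1)" using \<open>m = - \<infinity>\<close> by simp
    from c_lower[OF this] C have "\<forall>\<^sub>F n in sequentially. exp (- (real n * (- C - 1))) \<le> exp (- (real n * (- C)))"
      by eventually_elim (use order_trans in fastforce)
    then have "- C \<le> - C - 1" by (rule exp_rate_compare)
    then show False by simp
  qed
  ultimately show ?thesis by auto
qed

lemma borel_set_space:
  assumes "n0 \<le> n" "B \<in> sets (borel_of X)"
  shows "B \<in> sets (P n)"
  using assms sets_P by simp

lemma sets_open: "openin X U \<Longrightarrow> U \<in> sets (borel_of X)"
  by (rule openin_borel_of)

lemma sets_closed:
  assumes "closedin X C" shows "C \<in> sets (borel_of X)"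
proof -
  have "topspace X - C \<in> sets (borel_of X)" using assms by (intro sets_open) auto
  moreover have "space (borel_of X) = topspace X"
    unfolding borel_of_def by (rule space_measure_of) (auto dest: openin_subset)
  ultimately have "topspace X - (topspace X - C) \<in> sets (borel_of X)"
    using sets.compl_sets by metis
  then show ?thesis using closedin_subset[OF assms] by (simp add: double_diff)
qed

text \<open>The part of the closed set inside the compact set of \<open>tight\<close> is covered by
  finitely many neighbourhoods from \<open>upper\<close>, the part outside by the complement. The
  number of sets is absorbed in passing from \<open>a\<close> to \<open>b\<close>.\<close>

lemma closed_upper:
  assumes C: "closedin X C" and a: "\<And>x. x \<in> C \<Longrightarrow> ereal a < J x" and b: "b < a"
  shows "\<forall>\<^sub>F n in sequentially. c n * measure (P n) C \<le> exp (- (real n * b))"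
proof -
  obtain K where K: "compactin X K" "closedin X K"
    "\<forall>\<^sub>F n in sequentially. c n * measure (P n) (topspace X - K) \<le> exp (- (real n * a))"
    using tight by blast
  have CX: "C \<subseteq> topspace X" by (rule closedin_subset[OF C])
  define U where "U x = (SOME U. openin X U \<and> x \<in> U \<and> (\<forall>\<^sub>F n in sequentially. c n * measure (P n) U \<le> exp (- (real n * a))))" for x
  have U: "openin X (U x) \<and> x \<in> U x \<and> (\<forall>\<^sub>F n in sequentially. c n * measure (P n) (U x) \<le> exp (- (real n * a)))"
    if "x \<in> C" for x
    unfolding U_def by (rule someI_ex, rule upper) (use that CX a in auto)
  have "compactin X (C \<inter> K)" by (rule closed_Int_compactin[OF C K(1)])
  then obtain F where F: "finite F" "F \<subseteq> U ` (C \<inter> K)" "C \<inter> K \<subseteq> \<Union>F"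
    unfolding compactin_def using U by (smt (verit) IntD1 UN_I imageE subsetI)
  have Fev: "\<forall>\<^sub>F n in sequentially. \<forall>V\<in>F. c n * measure (P n) V \<le> exp (- (real n * a))"
    using F U by (intro eventually_ball_finite) auto
  have ev: "\<forall>\<^sub>F n in sequentially. (real (card F) + 1) * exp (- (real n * a)) \<le> exp (- (real n * b))"
    using eventually_poly_exp_le[OF b, of 0 "real (card F) + 1"] by simp
  show ?thesis
    using Fev K(3) ev eventually_ge_at_top[of n0]
  proof eventually_elim
    case (elim n)
    interpret prob_space "P n" by (rule prob[OF elim(4)])
    have FS: "V \<in> events" if "V \<in> F" for V
      using that F(2) U by (intro borel_set_space[OF elim(4)] sets_open) auto
    have KS: "topspace X - K \<in> events" using K(2) by (intro borel_set_space[OF elim(4)] sets_open) auto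
    have "prob C \<le> prob (\<Union>F \<union> (topspace X - K))"
    proof (rule finite_measure_mono)
      have "\<Union>F \<in> events" using F(1) FS by (intro sets.finite_Union) auto
      then show "\<Union>F \<union> (topspace X - K) \<in> events" using KS by (rule sets.Un)
    qed (use F CX in blast)
    also have "\<dots> \<le> prob (\<Union>F) + prob (topspace X - K)"
      using F FS KS by (intro measure_Un_le) auto
    also have "prob (\<Union>F) \<le> (\<Sum>V\<in>F. prob V)"
      using F FS finite_measure_subadditive_finite[of F "\<lambda>V. V"] by auto
    finally have "c n * prob C \<le> c n * ((\<Sum>V\<in>F. prob V) + prob (topspace X - K))"
      using c_pos[OF elim(4)] by (intro mult_left_mono) auto
    also have "\<dots> = (\<Sum>V\<in>F. c n * prob V) + c n * prob (topspace X - K)"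
      by (simp add: distrib_left sum_distrib_left)
    also have "\<dots> \<le> (\<Sum>V\<in>F. exp (- (real n * a))) + exp (- (real n * a))"
      using elim by (intro add_mono sum_mono) auto
    also have "\<dots> = (real (card F) + 1) * exp (- (real n * a))" by (simp add: distrib_right)
    finally show ?case using elim(3) by linarith
  qed
qed

lemma mass_upper:
  assumes J: "\<And>x. x \<in> topspace X \<Longrightarrow> ereal a' < J x" and a: "a < a'"
  shows "\<forall>\<^sub>F n in sequentially. c n \<le> exp (- (real n * a))"
proof -
  have "\<forall>\<^sub>F n in sequentially. c n * measure (P n) (topspace X) \<le> exp (- (real n * a))"
    by (rule closed_upper[OF closedin_topspace J a])
  then show ?thesis
    using eventually_ge_at_top[of n0]
  proof eventually_elim
    case (elim n)
    interpret prob_space "P n" by (rule prob[OF elim(2)])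
    have "space (P n) = space (borel_of X)" using sets_P[OF elim(2)] by (rule sets_eq_imp_space_eq)
    also have "\<dots> = topspace X"
      unfolding borel_of_def by (rule space_measure_of) (auto dest: openin_subset)
    finally show ?case using elim(1) prob_space by simp
  qed
qed

lemma c_upper:
  assumes "ereal a < m"
  shows "\<forall>\<^sub>F n in sequentially. c n \<le> exp (- (real n * a))"
proof -
  obtain a' where a': "ereal a < ereal a'" "ereal a' < m"
    using ereal_dense2[OF assms] by blast
  show ?thesis
  proof (rule mass_upper)
    show "ereal a' < J x" if "x \<in> topspace X" for x
      using a'(2) m_le[OF that] by (rule less_le_trans)
  qed (use a' in simp)
qed

text \<open>If \<open>J\<close> were infinite everywhere, the upper bound with the whole space as
  closed set would make \<open>c n\<close> decay faster than the rate that \<open>c_lower\<close>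
  permits.\<close>

lemma proper: "\<exists>x\<in>topspace X. J x < \<infinity>"
proof (rule ccontr)
  assume "\<not> ?thesis"
  then have J: "J x = \<infinity>" if "x \<in> topspace X" for x using that by auto
  obtain r where r: "m = ereal r" using m_finite by auto
  have "\<forall>\<^sub>F n in sequentially. c n \<le> exp (- (real n * (r + 2)))"
    by (rule mass_upper[of "r + 3"]) (use J in auto)
  moreover have "\<forall>\<^sub>F n in sequentially. exp (- (real n * (r + 1))) \<le> c n"
    by (rule c_lower) (simp add: r)
  ultimately have "\<forall>\<^sub>F n in sequentially. exp (- (real n * (r + 1))) \<le> exp (- (real n * (r + 2)))"
    by eventually_elim linarith
  then have "r + 2 \<le> r + 1" by (rule exp_rate_compare)
  then show False by simp
qed

text \<open>An upper mass bound on an open set, confronted with the lower bound near a point of it,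
  bounds \<open>J\<close> from below there. This yields lower semicontinuity of \<open>J\<close>
  from the mass bounds alone.\<close>

lemma rate_superlevel_nbhd:
  assumes "\<forall>\<^sub>F n in sequentially. c n * measure (P n) U \<le> exp (- (real n * a))" "openin X U" "y \<in> U"
  shows "ereal a \<le> J y"
proof (rule ccontr)
  assume "\<not> ?thesis"
  then have "J y < ereal a" by simp
  then obtain a' where a': "J y < ereal a'" "ereal a' < ereal a" using ereal_dense2 by blast
  from lower[OF assms(2,3) a'(1)] assms(1)
  have "\<forall>\<^sub>F n in sequentially. exp (- (real n * a')) \<le> exp (- (real n * a))"
    by eventually_elim linarith
  then have "a \<le> a'" by (rule exp_rate_compare)
  then show False using a'(2) by simp
qed

text \<open>Sublevel sets are closed by lower semicontinuity. They lie in a compact set of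
  \<open>tight\<close>, because its complement is open with mass too small for points of low
  rate.\<close>

lemma good_rate: "good_rate_function X (\<lambda>x. J x - m)"
  unfolding good_rate_function_def
proof (intro conjI ballI allI)
  obtain r where r: "m = ereal r" using m_finite by auto
  show "0 \<le> J x - m" if "x \<in> topspace X" for x
    using m_le[OF that] unfolding r by (cases "J x") auto
  show "\<exists>x\<in>topspace X. J x - m < \<infinity>"
  proof -
    obtain x where "x \<in> topspace X" "J x < \<infinity>" using proper by blast
    then show ?thesis unfolding r by (intro bexI[of _ x]) (cases "J x", auto)
  qed
  fix a :: real
  define L where "L = {x \<in> topspace X. J x - m \<le> ereal a}"
  have L: "L = {x \<in> topspace X. J x \<le> ereal (a + r)}"
  proof -
    have "J x - ereal r \<le> ereal a \<longleftrightarrow> J x \<le> ereal (a + r)" for x by (cases "J x") auto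
    then show ?thesis unfolding L_def r by auto
  qed
  have "openin X (topspace X - L)"
  proof (subst openin_subopen, rule ballI)
    fix x assume x: "x \<in> topspace X - L"
    then have "ereal (a + r) < J x" by (auto simp: L)
    then obtain b where b: "ereal (a + r) < ereal b" "ereal b < J x" using ereal_dense2 by blast
    then obtain U where U: "openin X U" "x \<in> U" "\<forall>\<^sub>F n in sequentially. c n * measure (P n) U \<le> exp (- (real n * b))"
      using upper[of x b] x by blast
    have "U \<subseteq> topspace X - L"
    proof
      fix y assume y: "y \<in> U"
      have "ereal b \<le> J y" by (rule rate_superlevel_nbhd[OF U(3,1) y])
      then have "ereal (a + r) < J y" using b(1) by (rule less_le_trans[rotated])
      then show "y \<in> topspace X - L" using y openin_subset[OF U(1)] by (auto simp: L)
    qed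
    then show "\<exists>T. openin X T \<and> x \<in> T \<and> T \<subseteq> topspace X - L" using U by blast
  qed
  then have Lc: "closedin X L" unfolding closedin_def by (simp add: L)
  obtain K where K: "compactin X K" "closedin X K"
    "\<forall>\<^sub>F n in sequentially. c n * measure (P n) (topspace X - K) \<le> exp (- (real n * (a + r + 1)))"
    using tight by blast
  have "L \<subseteq> K"
  proof (rule subsetI, rule ccontr)
    fix y assume y: "y \<in> L" "y \<notin> K"
    then have "y \<in> topspace X - K" by (simp add: L)
    from rate_superlevel_nbhd[OF K(3) openin_diff[OF openin_topspace K(2)] this]
    have "ereal (a + r + 1) \<le> J y" .
    also have "J y \<le> ereal (a + r)" using y(1) by (simp add: L)
    finally show False by simp
  qed
  then show "compactin X {x \<in> topspace X. J x - m \<le> ereal a}"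
    using closed_compactin[OF K(1) _ Lc] unfolding L_def by simp
qed

lemma log_rate_lower:
  assumes "0 < n" "exp (- (real n * a)) \<le> t"
  shows "ereal (- a) \<le> ereal (1 / real n) * ereal_log t"
proof -
  have t: "0 < t" using assms(2) exp_gt_zero less_le_trans by blast
  have "ln (exp (- (real n * a))) \<le> ln t" using assms(2) t by (subst ln_le_cancel_iff) auto
  then have "- a \<le> 1 / real n * ln t" using assms(1) by (simp add: field_simps)
  then show ?thesis using t by (simp add: ereal_log_def)
qed

lemma log_rate_upper:
  assumes "0 < n" "0 \<le> t" "t \<le> exp (- (real n * a))"
  shows "ereal (1 / real n) * ereal_log t \<le> ereal (- a)"
proof (cases "t = 0")
  case True
  then show ?thesis using assms(1) by (simp add: ereal_log_def)
next
  case False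
  then have t: "0 < t" using assms by simp
  have "ln t \<le> ln (exp (- (real n * a)))" using assms(3) t by (subst ln_le_cancel_iff) auto
  then have "1 / real n * ln t \<le> - a" using assms(1) by (simp add: field_simps)
  then show ?thesis using t by (simp add: ereal_log_def)
qed

lemma open_lower_rate:
  assumes U: "openin X U" "U \<subseteq> B" "B \<in> sets (borel_of X)" and x: "x \<in> U"
  shows "- (J x - m) \<le> liminf (\<lambda>n. ereal (1 / real n) * ereal_log (measure (P n) B))"
proof -
  obtain r where r: "m = ereal r" using m_finite by auto
  show ?thesis
  proof (cases "J x = \<infinity>")
    case True
    then show ?thesis unfolding r by simp
  next
    case False
    have "J x \<noteq> - \<infinity>" using m_le[of x] U(1) x openin_subset[OF U(1)] unfolding r by auto
    then obtain j where j: "J x = ereal j" using False by (cases "J x") auto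
    have "ereal (- (j - r) - e) \<le> liminf (\<lambda>n. ereal (1 / real n) * ereal_log (measure (P n) B))" if e: "0 < e" for e
    proof (rule Liminf_bounded)
      \<comment> \<open>Half of the error \<open>e\<close> is allotted to the mass of the
        neighbourhood and half to the normalization.\<close>
      have "J x < ereal (j + e / 2)" using j e by simp
      from lower[OF U(1) x this]
      have ev1: "\<forall>\<^sub>F n in sequentially. exp (- (real n * (j + e / 2))) \<le> c n * measure (P n) U" .
      have ev2: "\<forall>\<^sub>F n in sequentially. c n \<le> exp (- (real n * (r - e / 2)))"
        by (rule c_upper) (use r e in simp)
      show "\<forall>\<^sub>F n in sequentially. ereal (- (j - r) - e) \<le> ereal (1 / real n) * ereal_log (measure (P n) B)"
        using ev1 ev2 eventually_ge_at_top[of "max n0 1"]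
      proof eventually_elim
        case (elim n)
        then have n: "n0 \<le> n" "0 < n" by auto
        interpret prob_space "P n" by (rule prob[OF n(1)])
        have "exp (- (real n * (j + e / 2))) \<le> c n * prob U" by (rule elim(1))
        also have "\<dots> \<le> exp (- (real n * (r - e / 2))) * prob B"
          using elim(2) c_pos[OF n(1)] finite_measure_mono[OF U(2) borel_set_space[OF n(1) U(3)]]
          by (intro mult_mono) auto
        finally have le: "exp (- (real n * (j + e / 2))) \<le> exp (- (real n * (r - e / 2))) * prob B" .
        have eq: "- (real n * (j + e / 2)) = - (real n * (r - e / 2)) + - (real n * - (- (j - r) - e))"
          by (simp add: algebra_simps)
        have "exp (- (real n * - (- (j - r) - e))) \<le> prob B"
          using le unfolding eq exp_add by (rule mult_left_le_imp_le) simp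
        from log_rate_lower[OF n(2) this] show ?case unfolding minus_minus .
      qed
    qed
    note low = this
    have "ereal (- (j - r)) \<le> liminf (\<lambda>n. ereal (1 / real n) * ereal_log (measure (P n) B))"
    proof (rule ereal_le_epsilon2)
      fix e :: real assume "0 < e"
      from low[OF this]
      show "ereal (- (j - r)) \<le> liminf (\<lambda>n. ereal (1 / real n) * ereal_log (measure (P n) B)) + ereal e"
        by (cases "liminf (\<lambda>n. ereal (1 / real n) * ereal_log (measure (P n) B))") auto
    qed
    then show ?thesis unfolding j r by simp
  qed
qed

text \<open>Arguing with every real number below the infimum treats an infinite infimum, in
  particular an empty set, on the same footing.\<close>

lemma closed_upper_rate:
  assumes C: "closedin X C" "B \<subseteq> C" "B \<in> sets (borel_of X)"
  shows "limsup (\<lambda>n. ereal (1 / real n) * ereal_log (measure (P n) B)) \<le> - (INF x\<in>C. J x - m)"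
proof -
  obtain r where r: "m = ereal r" using m_finite by auto
  have bound: "limsup (\<lambda>n. ereal (1 / real n) * ereal_log (measure (P n) B)) \<le> ereal (- s)"
    if s: "ereal s < (INF x\<in>C. J x - m)" for s
  proof -
    obtain s' where s': "ereal s < ereal s'" "ereal s' < (INF x\<in>C. J x - m)" using ereal_dense2[OF s] by blast
    \<comment> \<open>The excess of \<open>s'\<close> over \<open>s\<close> is spent in two halves:
      on the strict loss in the mass bound and on the normalization.\<close>
    define e where "e = (s' - s) / 2"
    have e: "0 < e" using s'(1) by (simp add: e_def)
    have J: "ereal (s' + r) < J x" if "x \<in> C" for x
    proof -
      have "ereal s' < J x - m" using s'(2) INF_lower[OF that, of "\<lambda>x. J x - m"] by (rule less_le_trans)
      then show ?thesis unfolding r by (cases "J x") auto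
    qed
    have ev1: "\<forall>\<^sub>F n in sequentially. c n * measure (P n) C \<le> exp (- (real n * (s' + r - e)))"
      by (rule closed_upper[OF C(1) J]) (use e in auto)
    have ev2: "\<forall>\<^sub>F n in sequentially. exp (- (real n * (r + e))) \<le> c n"
      by (rule c_lower) (use r e in simp)
    show ?thesis
    proof (rule Limsup_bounded)
      show "\<forall>\<^sub>F n in sequentially. ereal (1 / real n) * ereal_log (measure (P n) B) \<le> ereal (- s)"
        using ev1 ev2 eventually_ge_at_top[of "max n0 1"]
      proof eventually_elim
        case (elim n)
        then have n: "n0 \<le> n" "0 < n" by auto
        interpret prob_space "P n" by (rule prob[OF n(1)])
        have "exp (- (real n * (r + e))) * prob B \<le> c n * prob C"
          using elim(2) c_pos[OF n(1)] finite_measure_mono[OF C(2) borel_set_space[OF n(1) sets_closed[OF C(1)]]]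
          by (intro mult_mono) auto
        also have "\<dots> \<le> exp (- (real n * (s' + r - e)))" by (rule elim(1))
        finally have le: "exp (- (real n * (r + e))) * prob B \<le> exp (- (real n * (s' + r - e)))" .
        have eq: "- (real n * (s' + r - e)) = - (real n * (r + e)) + - (real n * s)"
          by (simp add: e_def algebra_simps)
        have "prob B \<le> exp (- (real n * s))"
          using le unfolding eq exp_add by (rule mult_left_le_imp_le) simp
        then show ?case by (intro log_rate_upper[OF n(2)]) auto
      qed
    qed
  qed
  show ?thesis
  proof (rule ccontr)
    assume "\<not> ?thesis"
    then have "- (INF x\<in>C. J x - m) < limsup (\<lambda>n. ereal (1 / real n) * ereal_log (measure (P n) B))" by simp
    then obtain t where t: "- (INF x\<in>C. J x - m) < ereal t" "ereal t < limsup (\<lambda>n. ereal (1 / real n) * ereal_log (measure (P n) B))"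
      using ereal_dense2 by blast
    have "ereal (- t) < (INF x\<in>C. J x - m)" using t(1) by (metis ereal_uminus_less_reorder uminus_ereal.simps(1))
    from bound[OF this] t(2) show False by simp
  qed
qed

theorem ldp: "large_deviation_principle X n0 P (\<lambda>x. J x - m)"
  unfolding large_deviation_principle_def
proof (intro conjI allI impI ballI)
  show "prob_space (P n)" "sets (P n) = sets (borel_of X)" if "n0 \<le> n" for n
    using prob sets_P that by auto
  fix B assume B: "B \<in> sets (borel_of X)"
  have BX: "B \<subseteq> topspace X"
  proof -
    have "space (borel_of X) = topspace X"
      unfolding borel_of_def by (rule space_measure_of) (auto dest: openin_subset)
    then show ?thesis using sets.sets_into_space[OF B] by simp
  qed
  show "- (INF x\<in>X interior_of B. J x - m) \<le> liminf (\<lambda>n. ereal (1 / real n) * ereal_log (measure (P n) B))"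
  proof (subst ereal_uminus_le_reorder, rule INF_greatest)
    fix x assume "x \<in> X interior_of B"
    from open_lower_rate[OF openin_interior_of interior_of_subset B this]
    show "- liminf (\<lambda>n. ereal (1 / real n) * ereal_log (measure (P n) B)) \<le> J x - m"
      by (simp add: ereal_uminus_le_reorder)
  qed
  show "limsup (\<lambda>n. ereal (1 / real n) * ereal_log (measure (P n) B)) \<le> - (INF x\<in>X closure_of B. J x - m)"
    by (rule closed_upper_rate[OF closedin_closure_of closure_of_subset[OF BX] B])
qed

end

section \<open>The large deviation principle for the Gibbs measures\<close>

text \<open>The uniform law on the unit ball: compact support makes its energy finite, a bounded
  density its entropy.\<close>

lemma exists_finite_free_energy:
  fixes W :: "'a::euclidean_space measure \<Rightarrow> ennreal"
  assumes sf: "sigma_finite_energy W"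
  shows "\<exists>\<mu>\<in>prob_measures. free_energy W \<sigma> \<mu> < \<infinity>"
proof -
  define B where "B = cball (0::'a) 1"
  have Bm: "B \<in> sets lborel" by (simp add: B_def)
  have Bfin: "emeasure lborel B < \<infinity>" unfolding B_def by (rule emeasure_lborel_cball_finite)
  define v where "v = measure lborel B"
  have ev: "emeasure lborel B = ennreal v"
    unfolding v_def using Bfin by (simp add: emeasure_eq_ennreal_measure)
  have v: "0 < v" unfolding v_def B_def by (simp add: content_cball)
  define f where "f x = (indicator B x / v :: real)" for x
  have fm: "f \<in> borel_measurable borel" unfolding f_def using Bm by measurable
  have f_out: "f x = 0" if "x \<notin> B" for x using that by (simp add: f_def)
  define \<mu> where "\<mu> = density lborel (\<lambda>x. ennreal (f x))"
  have em: "emeasure \<mu> A = (\<integral>\<^sup>+ x. ennreal (f x) * indicator A x \<partial>lborel)" if "A \<in> sets borel" for A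
    unfolding \<mu>_def using fm that by (intro emeasure_density) auto
  have "emeasure \<mu> (space \<mu>) = (\<integral>\<^sup>+ x. ennreal (1 / v) * indicator B x \<partial>lborel)"
  proof -
    have "space \<mu> = UNIV" by (simp add: \<mu>_def)
    then have "emeasure \<mu> (space \<mu>) = (\<integral>\<^sup>+ x. ennreal (f x) * indicator UNIV x \<partial>lborel)"
      using em[of UNIV] by simp
    also have "\<dots> = (\<integral>\<^sup>+ x. ennreal (1 / v) * indicator B x \<partial>lborel)"
      by (intro nn_integral_cong) (simp add: f_def indicator_def)
    finally show ?thesis .
  qed
  also have "\<dots> = ennreal (1 / v) * ennreal v"
    using Bm by (simp add: nn_integral_cmult_indicator ev)
  also have "\<dots> = 1" using v by (simp flip: ennreal_mult)
  finally have "prob_space \<mu>" by (rule prob_spaceI)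
  then interpret prob_space \<mu> .
  have mu: "\<mu> \<in> prob_measures" using prob_space_axioms by (simp add: prob_measures_def \<mu>_def)
  have out: "emeasure \<mu> (- B) = 0"
  proof -
    have "emeasure \<mu> (- B) = (\<integral>\<^sup>+ x. ennreal (f x) * indicator (- B) x \<partial>lborel)"
      using Bm by (intro em) auto
    also have "\<dots> = (\<integral>\<^sup>+ x. 0 \<partial>(lborel :: 'a measure))"
      by (intro nn_integral_cong) (auto simp: f_def indicator_def)
    finally show ?thesis by simp
  qed
  have "measure_support \<mu> \<subseteq> B"
  proof (rule subsetI, rule ccontr)
    fix x assume x: "x \<in> measure_support \<mu>" "x \<notin> B"
    have "open (- B)" by (simp add: B_def open_Compl)
    then have "emeasure \<mu> (- B) > 0" using x unfolding measure_support_def by blast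
    then show False using out by simp
  qed
  moreover have "closed (measure_support \<mu>)"
    unfolding closed_def open_subopen[of "- measure_support \<mu>"]
    unfolding measure_support_def by blast
  ultimately have "compact (measure_support \<mu>)"
    unfolding B_def by (meson bounded_cball bounded_subset compact_eq_bounded_closed)
  then have W: "W \<mu> < \<infinity>" using sf mu unfolding sigma_finite_energy_def by blast
  have "(\<integral>\<^sup>+ x. ennreal (norm x powr 1) \<partial>\<mu>) \<le> (\<integral>\<^sup>+ x. 1 \<partial>\<mu>)"
  proof (rule nn_integral_mono_AE)
    have "- B \<in> null_sets \<mu>" using out Bm by (intro null_setsI) (auto simp: \<mu>_def)
    then have "AE x in \<mu>. x \<notin> - B" by (rule AE_not_in)
    then show "AE x in \<mu>. ennreal (norm x powr 1) \<le> 1"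
      by eventually_elim (simp add: B_def ennreal_le_1)
  qed
  also have "\<dots> < \<infinity>" by (simp add: emeasure_space_1)
  finally have mom: "\<mu> \<in> prob_measures_moment 1" using mu by (simp add: prob_measures_moment_def)
  have "entropy_functional \<mu> < \<infinity>"
  proof (cases rule: entropy_functional_cases[OF mom, case_names singular density])
    case singular
    have "absolutely_continuous lborel \<mu>"
      unfolding \<mu>_def using fm by (intro absolutely_continuousI_density) auto
    then show ?thesis using singular by simp
  next
    case (density q)
    \<comment> \<open>The entropy is expressed through some density \<open>q\<close>; uniqueness of
      densities replaces it by the explicit one almost everywhere.\<close>
    have "AE x in lborel. ennreal (q x) = ennreal (f x)"
      using density(1,3) fm unfolding \<mu>_def by (intro sigma_finite_measure.density_unique[OF sigma_finite_lborel]) auto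
    then have "AE x in lborel. q x = f x"
      by eventually_elim (use density(2) v in \<open>simp add: f_def\<close>)
    then have "(\<integral>\<^sup>+ x. ennreal (q x * ln (q x)) \<partial>lborel) = (\<integral>\<^sup>+ x. ennreal (f x * ln (f x)) \<partial>lborel)"
      by (intro nn_integral_cong_AE) (auto elim: eventually_mono)
    also have "\<dots> = (\<integral>\<^sup>+ x. ennreal (1 / v * ln (1 / v)) * indicator B x \<partial>lborel)"
      by (intro nn_integral_cong) (simp add: f_def indicator_def)
    also have "\<dots> < \<infinity>" using Bm by (simp add: nn_integral_cmult_indicator ev ennreal_mult_less_top)
    finally have "(\<integral>\<^sup>+ x. ennreal (q x * ln (q x)) \<partial>lborel) < \<infinity>" .
    then have "enn2ereal (\<integral>\<^sup>+ x. ennreal (q x * ln (q x)) \<partial>lborel) \<noteq> \<infinity>"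
      by (simp add: less_top enn2ereal_eq_top_iff flip: infinity_ereal_def)
    then show ?thesis
      unfolding density(5) using enn2ereal_nonneg[of "\<integral>\<^sup>+ x. ennreal (- (q x * ln (q x))) \<partial>lborel"]
      by (cases "enn2ereal (\<integral>\<^sup>+ x. ennreal (q x * ln (q x)) \<partial>lborel)";
          cases "enn2ereal (\<integral>\<^sup>+ x. ennreal (- (q x * ln (q x))) \<partial>lborel)") auto
  qed
  moreover have "ereal (2 / \<sigma>\<^sup>2) * enn2ereal (W \<mu>) < \<infinity>"
    using W by (cases "W \<mu>") (auto simp: enn2ereal_ennreal)
  ultimately have "free_energy W \<sigma> \<mu> < \<infinity>"
    unfolding free_energy_def by (auto simp: less_top ereal_plus_eq_PInfty simp flip: infinity_ereal_def)
  then show ?thesis using mu by blast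
qed

lemma local_ldp_bounds_gibbs:
  fixes W :: "'a::euclidean_space measure \<Rightarrow> ennreal"
  assumes \<sigma>: "0 < \<sigma>\<^sup>2" and ti: "translation_invariant W" and sf: "sigma_finite_energy W"
    and lsc: "lower_semicontinuous_energy W" and gc: "growth_control W l" and ch: "chaos_compatible W"
    and p: "1 \<le> p" "p < l"
  shows "local_ldp_bounds (centered_wasserstein_topology p) (gibbs_empirical_law W \<sigma> p)
    (\<lambda>n. enn2real (partition_function W \<sigma> n)) (free_energy W \<sigma>) (min_free_energy W \<sigma>) 1"
proof -
  let ?X = "centered_wasserstein_topology p :: 'a measure topology"
  let ?G = "gibbs_mass W \<sigma>"
  note props = gibbs_law_properties[OF \<sigma> sf lsc gc p]
  note top = topspace_centered_wasserstein[OF p(1), where 'a='a]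
  have mono: "?G n A \<le> ?G n B" if "A \<subseteq> B" for n A B
    unfolding gibbs_mass_def using that by (intro nn_integral_mono) (auto simp: indicator_def)
  obtain C where C: "\<And>n. 1 \<le> n \<Longrightarrow> ?G n UNIV \<le> ennreal (sqrt (real n) ^ DIM('a) * exp (real n * C))"
    using gibbs_exponential_tightness(2)[OF \<sigma> sf gc p] by blast
  have fin: "?G n A < \<infinity>" if "1 \<le> n" for n A
    using le_less_trans[OF order_trans[OF mono[OF subset_UNIV] C[OF that]] ennreal_less_top] by simp
  have lower_real: "exp r \<le> enn2real (?G n A)" if "ennreal (exp r) \<le> ?G n A" "1 \<le> n" for r n A
    using enn2real_mono[OF that(1) fin[OF that(2), unfolded infinity_ennreal_def]] by simp
  have upper_real: "enn2real (?G n A) \<le> exp r" if "?G n A \<le> ennreal (exp r)" for r n A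
    using that by (intro enn2real_leI) auto
  have lower: "\<forall>\<^sub>F n in sequentially. exp (- (real n * a)) \<le> enn2real (?G n U)"
    if "\<mu> \<in> prob_measures" "free_energy W \<sigma> \<mu> < ereal a" "openin ?X U" "translate_measure (- (\<integral>x. x \<partial>\<mu>)) \<mu> \<in> U" for U \<mu> a
    using gibbs_lower_bound[OF \<sigma> ti sf lsc gc ch p that] eventually_ge_at_top[of "1::nat"]
    by eventually_elim (rule lower_real)
  show ?thesis
  proof (rule local_ldp_bounds.intro)
    show "prob_space (gibbs_empirical_law W \<sigma> p n)" "0 < enn2real (partition_function W \<sigma> n)" if "1 \<le> n" for n
      using props[OF that] by auto
    show "sets (gibbs_empirical_law W \<sigma> p n) = sets (borel_of ?X)" for n
      by (simp add: gibbs_empirical_law_def)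
    show "\<forall>\<^sub>F n in sequentially. exp (- (real n * a))
        \<le> enn2real (partition_function W \<sigma> n) * measure (gibbs_empirical_law W \<sigma> p n) U"
      if "openin ?X U" "\<mu> \<in> U" "free_energy W \<sigma> \<mu> < ereal a" for U \<mu> a
    proof -
      have "\<mu> \<in> centered_prob_measures p" using that openin_subset[OF that(1)] unfolding top by blast
      then have mu: "\<mu> \<in> prob_measures" and m: "(\<integral>x. x \<partial>\<mu>) = 0"
        by (auto simp: centered_prob_measures_def prob_measures_moment_def)
      have "translate_measure (- (\<integral>x. x \<partial>\<mu>)) \<mu> \<in> U" unfolding m using translate_zero[OF mu] that(2) by simp
      from lower[OF mu that(3,1) this] eventually_ge_at_top[of "1::nat"] show ?thesis
        by eventually_elim (simp only: props(3)[OF _ openin_borel_of[OF that(1)]])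
    qed
    show "\<exists>U. openin ?X U \<and> \<mu> \<in> U \<and> (\<forall>\<^sub>F n in sequentially.
        enn2real (partition_function W \<sigma> n) * measure (gibbs_empirical_law W \<sigma> p n) U \<le> exp (- (real n * a)))"
      if mu: "\<mu> \<in> topspace ?X" and a: "ereal a < free_energy W \<sigma> \<mu>" for \<mu> a
    proof -
      obtain U where U: "openin ?X U" "\<mu> \<in> U" "\<forall>\<^sub>F n in sequentially. ?G n U \<le> ennreal (exp (- (real n * a)))"
        using gibbs_local_upper_bound[OF \<sigma> sf lsc gc p _ a] mu unfolding top by blast
      from U(3) eventually_ge_at_top[of "1::nat"]
      have "\<forall>\<^sub>F n in sequentially. enn2real (partition_function W \<sigma> n) * measure (gibbs_empirical_law W \<sigma> p n) U \<le> exp (- (real n * a))"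
        by eventually_elim (simp only: props(3)[OF _ openin_borel_of[OF U(1)]] upper_real)
      then show ?thesis using U(1,2) by blast
    qed
    show "\<exists>K. compactin ?X K \<and> closedin ?X K \<and> (\<forall>\<^sub>F n in sequentially.
        enn2real (partition_function W \<sigma> n) * measure (gibbs_empirical_law W \<sigma> p n) (topspace ?X - K) \<le> exp (- (real n * a)))" for a
    proof -
      obtain R where R: "0 \<le> R" "\<forall>\<^sub>F n in sequentially.
          ?G n {\<mu>. \<not> (\<integral>\<^sup>+ x. ennreal (norm x powr l) \<partial>\<mu>) \<le> ennreal R} \<le> ennreal (exp (- (real n * a)))"
        using gibbs_exponential_tightness(1)[OF \<sigma> sf gc p] by blast
      define K :: "'a measure set" where "K = {\<mu> \<in> centered_prob_measures p. (\<integral>\<^sup>+ x. ennreal (norm x powr l) \<partial>\<mu>) \<le> ennreal R}"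
      note cK = compactin_moment_ball[OF p R(1), where 'a='a, folded K_def]
      have sub: "topspace ?X - K \<subseteq> {\<mu>. \<not> (\<integral>\<^sup>+ x. ennreal (norm x powr l) \<partial>\<mu>) \<le> ennreal R}"
        unfolding top K_def by blast
      note ob = openin_borel_of[OF openin_diff[OF openin_topspace cK(2)]]
      from R(2) eventually_ge_at_top[of "1::nat"]
      have "\<forall>\<^sub>F n in sequentially. enn2real (partition_function W \<sigma> n) * measure (gibbs_empirical_law W \<sigma> p n) (topspace ?X - K) \<le> exp (- (real n * a))"
      proof eventually_elim
        case (elim n)
        show ?case unfolding props(3)[OF elim(2) ob]
          by (rule upper_real, rule order_trans[OF mono[OF sub] elim(1)])
      qed
      then show ?thesis using cK by blast
    qed
    show "min_free_energy W \<sigma> \<le> free_energy W \<sigma> \<mu>" if "\<mu> \<in> topspace ?X" for \<mu>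
    proof -
      have "\<mu> \<in> prob_measures"
        using that unfolding top by (simp add: centered_prob_measures_def prob_measures_moment_def)
      then show ?thesis unfolding min_free_energy_def by (rule INF_lower)
    qed
    show "\<forall>\<^sub>F n in sequentially. exp (- (real n * a)) \<le> enn2real (partition_function W \<sigma> n)"
      if a: "min_free_energy W \<sigma> < ereal a" for a
    proof -
      obtain \<mu> where mu: "\<mu> \<in> prob_measures" "free_energy W \<sigma> \<mu> < ereal a"
        using a unfolding min_free_energy_def INF_less_iff by blast
      have "free_energy W \<sigma> \<mu> < \<infinity>" using mu(2) by auto
      \<comment> \<open>A near-minimizer need not be centered. Its finite moment allows recentering,
        and the whole space serves as the open neighbourhood of the translate.\<close>
      have "\<mu> \<in> prob_measures_moment p"
        by (rule prob_measures_moment_mono[OF finite_free_energyD(3)[OF gc \<sigma> mu(1) \<open>free_energy W \<sigma> \<mu> < \<infinity>\<close>]]) (use p in auto)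
      then have "translate_measure (- (\<integral>x. x \<partial>\<mu>)) \<mu> \<in> topspace ?X" unfolding top by (rule translate_centered[OF p(1)])
      from lower[OF mu openin_topspace this] eventually_ge_at_top[of "1::nat"] show ?thesis
      proof eventually_elim
        case (elim n)
        have "enn2real (?G n (topspace ?X)) \<le> enn2real (?G n UNIV)"
          using mono[OF subset_UNIV] fin[OF elim(2)] by (intro enn2real_mono) auto
        then show ?case using elim(1) unfolding partition_function_eq by linarith
      qed
    qed
    show "\<exists>C. \<forall>\<^sub>F n in sequentially. enn2real (partition_function W \<sigma> n) \<le> exp (real n * C)"
    proof (rule exI[of _ "C + 1"])
      have "- (C + 1) < - C" by simp
      from eventually_poly_exp_le[OF this, of "DIM('a)" 1] eventually_ge_at_top[of "1::nat"]
      show "\<forall>\<^sub>F n in sequentially. enn2real (partition_function W \<sigma> n) \<le> exp (real n * (C + 1))"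
      proof eventually_elim
        case (elim n)
        have "enn2real (partition_function W \<sigma> n) \<le> sqrt (real n) ^ DIM('a) * exp (real n * C)"
          unfolding partition_function_eq using C[OF elim(2)] by (intro enn2real_leI) auto
        also have "\<dots> \<le> exp (- (real n * - (C + 1)))" using elim(1) by simp
        also have "\<dots> = exp (real n * (C + 1))" unfolding mult_minus_right minus_minus ..
        finally show ?case .
      qed
    qed
    show "min_free_energy W \<sigma> < \<infinity>"
      using exists_finite_free_energy[OF sf, of \<sigma>] unfolding min_free_energy_def INF_less_iff .
  qed
qed

theorem theorem2p14:
  fixes W :: "'a::euclidean_space measure \<Rightarrow> ennreal" and \<sigma> l :: real
  assumes "\<sigma>\<^sup>2 > 0"
    and "translation_invariant W"
    and "sigma_finite_energy W"
    and "lower_semicontinuous_energy W"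
    and "l \<ge> 1" and "growth_control W l"
    and "subhomogeneous W"
    and "chaos_compatible W"
    and "l > 1"
  shows "\<forall>p\<in>{1..<l}.
    good_rate_function (centered_wasserstein_topology p)
      (\<lambda>\<mu>. free_energy W \<sigma> \<mu> - min_free_energy W \<sigma>) \<and>
    large_deviation_principle (centered_wasserstein_topology p) 2 (gibbs_empirical_law W \<sigma> p)
      (\<lambda>\<mu>. free_energy W \<sigma> \<mu> - min_free_energy W \<sigma>)"
proof
  fix p assume "p \<in> {1..<l}"
  then have p: "1 \<le> p" "p < l" by auto
  \<comment> \<open>The local bounds hold from \<open>n = 1\<close> on; the statement for
    \<open>n\<close> at least 2 is a restriction of the resulting principle.\<close>
  interpret local_ldp_bounds "centered_wasserstein_topology p" "gibbs_empirical_law W \<sigma> p"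
    "\<lambda>n. enn2real (partition_function W \<sigma> n)" "free_energy W \<sigma>" "min_free_energy W \<sigma>" 1
    by (rule local_ldp_bounds_gibbs[OF assms(1-4,6,8) p])
  show "good_rate_function (centered_wasserstein_topology p)
      (\<lambda>\<mu>. free_energy W \<sigma> \<mu> - min_free_energy W \<sigma>) \<and>
    large_deviation_principle (centered_wasserstein_topology p) 2 (gibbs_empirical_law W \<sigma> p)
      (\<lambda>\<mu>. free_energy W \<sigma> \<mu> - min_free_energy W \<sigma>)"
    using good_rate ldp unfolding large_deviation_principle_def by simp
qed

end
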